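(* Let $F$ be a field of characteristic zero equipped with an automorphism $\sigma$ and a derivation $\partial$ such that $\sigma\partial=\partial\sigma$. Suppose that $K=F^\sigma$ is algebraically closed, that $F=K(x_1,\dots,x_n)$ is a purely transcendental extension of $K$ with transcendence basis $x_1,\dots,x_n$, and that $\sigma$ induces an automorphism of $K(x_i)$ for every $i=1,\dots,n$. Let $\widetilde K$ be a $\partial$-closure of $K$. Let $\sigma(Y)=AY$, $A\in GL_\nu(F)$, be a $\sigma$-difference system with coefficients in $F$ and let $G_A$ be its $\partial$-group scheme over $K$. The following statements are equivalent: (1) $G_A$ is conjugate over $\widetilde K$ to a constant $\partial$-group. (2) There exists $B\in M_\nu(F)$ such that $\sigma(B)=ABA^{-1}+\partial(A)A^{-1}$, i.e. such that the system $\sigma(Y)=AY$, $\partial Y=BY$ is integrable.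
   Context: $F^\sigma$ denotes the subfield of $\sigma$-invariant elements. The $\partial$-group scheme $G_A$: let $X=(X_{i,j})_{1\le i,j\le\nu}$, $\mathcal{S}=F\{X,\frac{1}{\det X}\}_\partial$ the ring of differential polynomials over $F$ localized at $\det X$, made into a $(\sigma,\partial)$-ring by $\sigma(\partial^kX)=\partial^k(AX)$, and for $k\ge0$ let $\mathcal{S}_k=F[X,\partial X,\dots,\partial^kX,\frac1{\det X}]$. There is a sequence of ideals $\mathfrak{I}_k\subset\mathcal{S}_k$, each maximal among proper $\sigma$-stable ideals of $\mathcal{S}_k$, with $\mathfrak{I}_{k+1}\cap\mathcal{S}_k=\mathfrak{I}_k$ and such that $\mathfrak{I}=\bigcup_k\mathfrak{I}_k$ is $\partial$-stable; set $\mathcal{R}^\#=\mathcal{S}/\mathfrak{I}$, generated over $F$ as a $\partial$-ring by the image $Z$ of $X$ (which satisfies $\sigma(Z)=AZ$) and $\frac1{\det Z}$. As $K$ is algebraically closed, the functor sending a $K$-$\partial$-algebra $S$ (with $\sigma$ acting trivially) to the group $Aut^{\sigma,\partial}(\mathcal{R}^\#\otimes_KS/F\otimes_KS)$ of $F\otimes_KS$-algebra automorphisms commuting with $\sigma$ and $\partial$ is represented by a linear algebraic $\partial$-group scheme $G_A$ over $K$; via $\varphi\mapsto Z^{-1}\varphi(Z)$ it is viewed as a $\partial$-subgroup scheme of $GL_\nu$. A linear $\partial$-group $G\subset GL_\nu$ over $\widetilde K$ is a constant $\partial$-group if all $\partial(X_{i,j})$ belong to its defining ideal in $\widetilde K\{X,\frac1{\det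 X}\}_\partial$. "Conjugate over $\widetilde K$" means that, after extension of scalars to $\widetilde K$, conjugating by some $P\in GL_\nu(\widetilde K)$ gives such a group. *)

theory Defs
  imports
    "HOL-Analysis.Analysis"
    "HOL-Library.Poly_Mapping"
    "HOL-Algebra.Algebra"
begin

section \<open>Differential and difference-differential rings\<close>

record 'a dring = "'a ring" +
  der :: "'a \<Rightarrow> 'a"

record 'a sdring = "'a dring" +
  shift :: "'a \<Rightarrow> 'a"

definition diff_ring :: "('a, 'm) dring_scheme \<Rightarrow> bool" where
  "diff_ring R \<longleftrightarrow> cring R \<and> der R \<in> carrier R \<rightarrow> carrier R \<and>
     (\<forall>a\<in>carrier R. \<forall>b\<in>carrier R.
        der R (a \<oplus>\<^bsub>R\<^esub> b) = der R a \<oplus>\<^bsub>R\<^esub> der R b \<and>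
        der R (a \<otimes>\<^bsub>R\<^esub> b) = (der R a \<otimes>\<^bsub>R\<^esub> b) \<oplus>\<^bsub>R\<^esub> (a \<otimes>\<^bsub>R\<^esub> der R b))"

definition diff_field :: "('a, 'm) dring_scheme \<Rightarrow> bool" where
  "diff_field R \<longleftrightarrow> field R \<and> diff_ring R"

definition dring_hom :: "('a, 'm) dring_scheme \<Rightarrow> ('b, 'n) dring_scheme \<Rightarrow> ('a \<Rightarrow> 'b) set" where
  "dring_hom R S = {h \<in> ring_hom R S. \<forall>a\<in>carrier R. h (der R a) = der S (h a)}"

definition dring_on :: "'a::comm_ring_1 set \<Rightarrow> ('a \<Rightarrow> 'a) \<Rightarrow> 'a dring" where
  "dring_on C d = \<lparr>carrier = C, mult = (*), one = 1, ring.zero = 0, add = (+), der = d\<rparr>"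

text \<open>The map \<open>R Quot I \<rightarrow> S Quot J\<close> induced by an additive map \<open>f : R \<rightarrow> S\<close> with \<open>f ` I \<subseteq> J\<close>.\<close>

definition quot_map ::
    "('b, 'm) ring_scheme \<Rightarrow> 'b set \<Rightarrow> ('a \<Rightarrow> 'b) \<Rightarrow> 'a set \<Rightarrow> 'b set" where
  "quot_map S J f c = (\<Union>x\<in>c. J +>\<^bsub>S\<^esub> f x)"

definition d_quot :: "('a, 'm) dring_scheme \<Rightarrow> 'a set \<Rightarrow> 'a set dring" where
  "d_quot R I = ring.extend (R Quot I) (dring.fields (quot_map R I (der R)))"

definition sd_quot :: "('a, 'm) sdring_scheme \<Rightarrow> 'a set \<Rightarrow> 'a set sdring" where
  "sd_quot R I = dring.extend (d_quot R I) (sdring.fields (quot_map R I (shift R)))"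

definition fixed_field :: "('a \<Rightarrow> 'a) \<Rightarrow> 'a set" where
  "fixed_field \<sigma> = {a. \<sigma> a = a}"

section \<open>Differentially closed fields and differential closures\<close>

text \<open>Differential polynomials over \<open>M\<close> in the differential indeterminates
  \<open>y\<^sub>0, \<dots>, y\<^bsub>m-1\<^esub>\<close>, as finitely supported families of coefficients; the pair \<open>(v, k)\<close> in a
  monomial stands for the \<open>k\<close>-th derivative of \<open>y\<^sub>v\<close>.\<close>

definition dpolys ::
    "('a, 'm) dring_scheme \<Rightarrow> nat \<Rightarrow> ((nat \<times> nat \<Rightarrow>\<^sub>0 nat) \<Rightarrow> 'a) set" where
  "dpolys M m = {p. range p \<subseteq> carrier M \<and> finite {\<alpha>. p \<alpha> \<noteq> \<zero>\<^bsub>M\<^esub>} \<and>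
     (\<forall>\<alpha>. p \<alpha> \<noteq> \<zero>\<^bsub>M\<^esub> \<longrightarrow> Poly_Mapping.keys \<alpha> \<subseteq> {..<m} \<times> UNIV)}"

text \<open>The value at \<open>y\<close> in \<open>L\<close> of a differential polynomial over \<open>M\<close>, the coefficients being
  mapped to \<open>L\<close> by \<open>h\<close>.\<close>

definition dpoly_eval ::
    "('a, 'm) dring_scheme \<Rightarrow> ('b, 'n) dring_scheme \<Rightarrow> ('a \<Rightarrow> 'b) \<Rightarrow> (nat \<Rightarrow> 'b) \<Rightarrow>
     ((nat \<times> nat \<Rightarrow>\<^sub>0 nat) \<Rightarrow> 'a) \<Rightarrow> 'b" where
  "dpoly_eval M L h y p =
     (\<Oplus>\<^bsub>L\<^esub>\<alpha>\<in>{\<alpha>. p \<alpha> \<noteq> \<zero>\<^bsub>M\<^esub>}.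
        h (p \<alpha>) \<otimes>\<^bsub>L\<^esub>
        (\<Otimes>\<^bsub>L\<^esub>w\<in>Poly_Mapping.keys \<alpha>.
           ((der L ^^ snd w) (y (fst w))) [^]\<^bsub>L\<^esub> (Poly_Mapping.lookup \<alpha> w)))"

text \<open>A differential field \<open>M\<close> is differentially closed if every finite system of differential
  equations and one inequation over \<open>M\<close> that is solvable in some differential field extension is
  solvable in \<open>M\<close>. The extensions \<open>L\<close> range over fields carried by subsets of the type of \<open>M\<close>.
  For infinite \<open>M\<close> this is no restriction: the differential subfield generated by \<open>M\<close> and a
  solution has the cardinality of \<open>M\<close>.\<close>

definition diff_closed :: "'a dring \<Rightarrow> bool" where
  "diff_closed M \<longleftrightarrow> diff_field M \<and>
     (\<forall>m E Q. finite E \<longrightarrow> E \<subseteq> dpolys M m \<longrightarrow> Q \<in> dpolys M m \<longrightarrow>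
        (\<exists>(L :: 'a dring) h y. diff_field L \<and> h \<in> dring_hom M L \<and> y \<in> {..<m} \<rightarrow> carrier L \<and>
            (\<forall>p\<in>E. dpoly_eval M L h y p = \<zero>\<^bsub>L\<^esub>) \<and> dpoly_eval M L h y Q \<noteq> \<zero>\<^bsub>L\<^esub>) \<longrightarrow>
        (\<exists>y. y \<in> {..<m} \<rightarrow> carrier M \<and>
            (\<forall>p\<in>E. dpoly_eval M M id y p = \<zero>\<^bsub>M\<^esub>) \<and> dpoly_eval M M id y Q \<noteq> \<zero>\<^bsub>M\<^esub>))"

text \<open>A differential closure \<open>\<iota> : K \<rightarrow> M\<close> is a differentially closed extension that embeds over \<open>K\<close>
  into every differentially closed extension \<open>L\<close> of \<open>K\<close>. Taking only \<open>L\<close> carried by subsets of the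
  type of \<open>M\<close> is again no restriction: a genuine closure of \<open>K\<close> has the cardinality of \<open>K\<close>, so it
  occurs among these \<open>L\<close>, and \<open>M\<close> embeds into any other \<open>L\<close> through it.\<close>

definition diff_closure :: "('a, 'm) dring_scheme \<Rightarrow> ('a \<Rightarrow> 'b) \<Rightarrow> 'b dring \<Rightarrow> bool" where
  "diff_closure K \<iota> M \<longleftrightarrow> diff_closed M \<and> \<iota> \<in> dring_hom K M \<and>
     (\<forall>(L :: 'b dring) j. diff_closed L \<longrightarrow> j \<in> dring_hom K L \<longrightarrow>
        (\<exists>e\<in>dring_hom M L. \<forall>a\<in>carrier K. e (\<iota> a) = j a))"

section \<open>Multivariate polynomials\<close>

text \<open>Polynomials in the variables \<open>'v\<close> with coefficients in \<open>'a\<close>; the product is the convolution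
  product of \<^type>\<open>poly_mapping\<close>.\<close>

type_synonym ('v, 'a) mpol = "('v \<Rightarrow>\<^sub>0 nat) \<Rightarrow>\<^sub>0 'a"

definition mpol_const :: "'a::comm_ring_1 \<Rightarrow> ('v, 'a) mpol" where
  "mpol_const a = Poly_Mapping.single 0 a"

definition mpol_var :: "'v \<Rightarrow> ('v, 'a::comm_ring_1) mpol" where
  "mpol_var v = Poly_Mapping.single (Poly_Mapping.single v 1) 1"

definition mpol_subst ::
    "('a::comm_ring_1 \<Rightarrow> 'b::comm_ring_1) \<Rightarrow> ('v \<Rightarrow> 'b) \<Rightarrow> ('v, 'a) mpol \<Rightarrow> 'b" where
  "mpol_subst h f p = (\<Sum>\<alpha>\<in>Poly_Mapping.keys p.
     h (Poly_Mapping.lookup p \<alpha>) * (\<Prod>v\<in>Poly_Mapping.keys \<alpha>. f v ^ Poly_Mapping.lookup \<alpha> v))"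

text \<open>The derivation extending \<open>d\<close> on the coefficients and mapping each variable \<open>v\<close> to \<open>dv v\<close>.\<close>

definition mpol_deriv ::
    "('a::comm_ring_1 \<Rightarrow> 'a) \<Rightarrow> ('v \<Rightarrow> ('v, 'a) mpol) \<Rightarrow> ('v, 'a) mpol \<Rightarrow> ('v, 'a) mpol" where
  "mpol_deriv d dv p = (\<Sum>\<alpha>\<in>Poly_Mapping.keys p.
     Poly_Mapping.single \<alpha> (d (Poly_Mapping.lookup p \<alpha>)) +
     (\<Sum>v\<in>Poly_Mapping.keys \<alpha>.
        Poly_Mapping.single (\<alpha> - Poly_Mapping.single v 1)
          (of_nat (Poly_Mapping.lookup \<alpha> v) * Poly_Mapping.lookup p \<alpha>) * dv v))"

definition mpols_over :: "'a::zero set \<Rightarrow> ('v, 'a) mpol set" where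
  "mpols_over C = {p. \<forall>\<alpha>. Poly_Mapping.lookup p \<alpha> \<in> C}"

definition algebraically_independent_over :: "'a::field set \<Rightarrow> nat \<Rightarrow> (nat \<Rightarrow> 'a) \<Rightarrow> bool" where
  "algebraically_independent_over K n x \<longleftrightarrow>
     (\<forall>p\<in>mpols_over K. (\<forall>\<alpha>\<in>Poly_Mapping.keys p. Poly_Mapping.keys \<alpha> \<subseteq> {..<n}) \<longrightarrow>
        mpol_subst id x p = 0 \<longrightarrow> p = 0)"

definition adjoin :: "'a::field set \<Rightarrow> 'a set \<Rightarrow> 'a set" where
  "adjoin K E = generate_field (dring_on UNIV (\<lambda>_. 0)) (K \<union> E)"

section \<open>The differential ring generated by a generic invertible matrix\<close>

text \<open>\<open>Entry i j k\<close> is the \<open>k\<close>-th derivative of the entry \<open>(i, j)\<close> of the generic matrix \<open>X\<close>, and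
  \<open>InvDet\<close> is the inverse of \<open>det X\<close>: the localization is the polynomial ring in all these
  variables modulo \<open>InvDet * det X - 1\<close>.\<close>

datatype 'n gl_var = Entry 'n 'n nat | InvDet

type_synonym ('a, 'n) gl_pol = "('n gl_var, 'a) mpol"

definition gen_mat :: "('a::comm_ring_1, 'n::finite) gl_pol ^ 'n ^ 'n" where
  "gen_mat = (\<chi> i j. mpol_var (Entry i j 0))"

primrec entry_deriv :: "'n gl_var \<Rightarrow> ('a::comm_ring_1, 'n) gl_pol" where
  "entry_deriv (Entry i j k) = mpol_var (Entry i j (Suc k))"
| "entry_deriv InvDet = 0"

text \<open>The value at \<open>InvDet\<close> is forced by the Leibniz rule in the localization.\<close>

definition gl_deriv ::
    "('a::comm_ring_1 \<Rightarrow> 'a) \<Rightarrow> ('a, 'n::finite) gl_pol \<Rightarrow> ('a, 'n) gl_pol" where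
  "gl_deriv d = mpol_deriv d (\<lambda>v. case v of
       Entry i j k \<Rightarrow> entry_deriv (Entry i j k)
     | InvDet \<Rightarrow> - (mpol_var InvDet)\<^sup>2 * mpol_deriv d entry_deriv (det gen_mat))"

definition gl_pol_dring ::
    "'a::comm_ring_1 set \<Rightarrow> ('a \<Rightarrow> 'a) \<Rightarrow> ('a, 'n::finite) gl_pol dring" where
  "gl_pol_dring C d = dring_on (mpols_over C) (gl_deriv d)"

definition gl_rel ::
    "'a::comm_ring_1 set \<Rightarrow> ('a \<Rightarrow> 'a) \<Rightarrow> ('a, 'n::finite) gl_pol set" where
  "gl_rel C d = PIdl\<^bsub>gl_pol_dring C d\<^esub> (mpol_var InvDet * det gen_mat - 1)"

text \<open>For a differential subfield \<open>C\<close>, this is the localized ring of differential polynomials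
  \<open>C{X, 1/det X}\<close>, and \<open>gl_class C d p\<close> is the element of it represented by \<open>p\<close>.\<close>

definition gl_dring ::
    "'a::comm_ring_1 set \<Rightarrow> ('a \<Rightarrow> 'a) \<Rightarrow> ('a, 'n::finite) gl_pol set dring" where
  "gl_dring C d = d_quot (gl_pol_dring C d) (gl_rel C d)"

definition gl_class ::
    "'a::comm_ring_1 set \<Rightarrow> ('a \<Rightarrow> 'a) \<Rightarrow> ('a, 'n::finite) gl_pol \<Rightarrow> ('a, 'n) gl_pol set" where
  "gl_class C d p = gl_rel C d +>\<^bsub>gl_pol_dring C d\<^esub> p"

section \<open>The Picard-Vessiot ring of a difference system\<close>

text \<open>The endomorphism \<open>\<partial>\<^sup>k X \<mapsto> \<partial>\<^sup>k (A X)\<close>, hence \<open>1/det X \<mapsto> 1/det A * 1/det X\<close>, extending \<open>\<sigma>\<close>.\<close>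

definition gl_shift ::
    "('a::field \<Rightarrow> 'a) \<Rightarrow> ('a \<Rightarrow> 'a) \<Rightarrow> 'a ^ 'n ^ 'n \<Rightarrow>
     ('a, 'n::finite) gl_pol \<Rightarrow> ('a, 'n) gl_pol" where
  "gl_shift \<sigma> d A = mpol_subst (\<lambda>a. mpol_const (\<sigma> a)) (\<lambda>v. case v of
       Entry i j k \<Rightarrow> (gl_deriv d ^^ k) ((map_matrix mpol_const A ** gen_mat) $ i $ j)
     | InvDet \<Rightarrow> mpol_const (inverse (det A)) * mpol_var InvDet)"

definition sol_sdring ::
    "('a::field \<Rightarrow> 'a) \<Rightarrow> ('a \<Rightarrow> 'a) \<Rightarrow> 'a ^ 'n ^ 'n \<Rightarrow> ('a, 'n::finite) gl_pol set sdring" where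
  "sol_sdring \<sigma> d A = dring.extend (gl_dring UNIV d)
     (sdring.fields (quot_map (gl_pol_dring UNIV d) (gl_rel UNIV d) (gl_shift \<sigma> d A)))"

definition sol_level ::
    "('a::field \<Rightarrow> 'a) \<Rightarrow> ('a \<Rightarrow> 'a) \<Rightarrow> 'a ^ 'n ^ 'n \<Rightarrow> nat \<Rightarrow> ('a, 'n::finite) gl_pol set set" where
  "sol_level \<sigma> d A k = generate_ring (sol_sdring \<sigma> d A)
     (gl_class UNIV d ` (range mpol_const \<union> {mpol_var (Entry i j l) | i j l. l \<le> k} \<union>
        {mpol_var InvDet}))"

definition proper_shift_ideal :: "('a, 'm) sdring_scheme \<Rightarrow> 'a set \<Rightarrow> bool" where
  "proper_shift_ideal R I \<longleftrightarrow> ideal I R \<and> I \<noteq> carrier R \<and> shift R ` I \<subseteq> I"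

definition maximal_shift_ideal :: "('a, 'm) sdring_scheme \<Rightarrow> 'a set \<Rightarrow> bool" where
  "maximal_shift_ideal R I \<longleftrightarrow> proper_shift_ideal R I \<and>
     (\<forall>J. proper_shift_ideal R J \<longrightarrow> I \<subseteq> J \<longrightarrow> J = I)"

definition pv_ideals ::
    "('a::field \<Rightarrow> 'a) \<Rightarrow> ('a \<Rightarrow> 'a) \<Rightarrow> 'a ^ 'n ^ 'n \<Rightarrow>
     (nat \<Rightarrow> ('a, 'n::finite) gl_pol set set) \<Rightarrow> bool" where
  "pv_ideals \<sigma> d A I \<longleftrightarrow>
     (\<forall>k. maximal_shift_ideal (sol_sdring \<sigma> d A \<lparr>carrier := sol_level \<sigma> d A k\<rparr>) (I k)) \<and>
     (\<forall>k. I (Suc k) \<inter> sol_level \<sigma> d A k = I k) \<and>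
     der (sol_sdring \<sigma> d A) ` (\<Union>k. I k) \<subseteq> (\<Union>k. I k)"

definition pv_ring ::
    "('a::field \<Rightarrow> 'a) \<Rightarrow> ('a \<Rightarrow> 'a) \<Rightarrow> 'a ^ 'n ^ 'n \<Rightarrow>
     (nat \<Rightarrow> ('a, 'n::finite) gl_pol set set) \<Rightarrow> ('a, 'n) gl_pol set set sdring" where
  "pv_ring \<sigma> d A I = sd_quot (sol_sdring \<sigma> d A) (\<Union>k. I k)"

definition pv_class ::
    "('a::field \<Rightarrow> 'a) \<Rightarrow> ('a \<Rightarrow> 'a) \<Rightarrow> 'a ^ 'n ^ 'n \<Rightarrow>
     (nat \<Rightarrow> ('a, 'n::finite) gl_pol set set) \<Rightarrow> ('a, 'n) gl_pol \<Rightarrow> ('a, 'n) gl_pol set set" where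
  "pv_class \<sigma> d A I p = (\<Union>k. I k) +>\<^bsub>sol_sdring \<sigma> d A\<^esub> gl_class UNIV d p"

section \<open>Tensor products\<close>

text \<open>The tensor product over \<open>K\<close> of the algebras \<open>c : K \<rightarrow> R\<close> and \<open>u : K \<rightarrow> S\<close> is the free abelian
  group on the pairs \<open>(r, s)\<close>, with the componentwise product extended bilinearly, modulo the
  usual relations. The operator \<open>\<sigma>\<close> acts through \<open>R\<close> only.\<close>

definition pre_tensor ::
    "('r, 'm) sdring_scheme \<Rightarrow> ('s, 'n) dring_scheme \<Rightarrow> ('r \<times> 's \<Rightarrow>\<^sub>0 int) sdring" where
  "pre_tensor R S =
     \<lparr>carrier = {p. Poly_Mapping.keys p \<subseteq> carrier R \<times> carrier S},
      mult = (\<lambda>p q. frag_extend (\<lambda>(r, s). frag_extend (\<lambda>(r', s').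
                frag_of (r \<otimes>\<^bsub>R\<^esub> r', s \<otimes>\<^bsub>S\<^esub> s')) q) p),
      one = frag_of (\<one>\<^bsub>R\<^esub>, \<one>\<^bsub>S\<^esub>), ring.zero = 0, add = (+),
      der = frag_extend (\<lambda>(r, s). frag_of (der R r, s) + frag_of (r, der S s)),
      shift = frag_extend (\<lambda>(r, s). frag_of (shift R r, s))\<rparr>"

definition tensor_rel ::
    "'k set \<Rightarrow> ('r, 'm) sdring_scheme \<Rightarrow> ('k \<Rightarrow> 'r) \<Rightarrow> ('s, 'n) dring_scheme \<Rightarrow> ('k \<Rightarrow> 's) \<Rightarrow>
     ('r \<times> 's \<Rightarrow>\<^sub>0 int) set" where
  "tensor_rel K R c S u = Idl\<^bsub>pre_tensor R S\<^esub>
     ({frag_of (r \<oplus>\<^bsub>R\<^esub> r', s) - frag_of (r, s) - frag_of (r', s) | r r' s.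
         r \<in> carrier R \<and> r' \<in> carrier R \<and> s \<in> carrier S} \<union>
      {frag_of (r, s \<oplus>\<^bsub>S\<^esub> s') - frag_of (r, s) - frag_of (r, s') | r s s'.
         r \<in> carrier R \<and> s \<in> carrier S \<and> s' \<in> carrier S} \<union>
      {frag_of (c a \<otimes>\<^bsub>R\<^esub> r, s) - frag_of (r, u a \<otimes>\<^bsub>S\<^esub> s) | a r s.
         a \<in> K \<and> r \<in> carrier R \<and> s \<in> carrier S})"

definition tensor ::
    "'k set \<Rightarrow> ('r, 'm) sdring_scheme \<Rightarrow> ('k \<Rightarrow> 'r) \<Rightarrow> ('s, 'n) dring_scheme \<Rightarrow> ('k \<Rightarrow> 's) \<Rightarrow>
     ('r \<times> 's \<Rightarrow>\<^sub>0 int) set sdring" where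
  "tensor K R c S u = sd_quot (pre_tensor R S) (tensor_rel K R c S u)"

definition pure_tensor ::
    "'k set \<Rightarrow> ('r, 'm) sdring_scheme \<Rightarrow> ('k \<Rightarrow> 'r) \<Rightarrow> ('s, 'n) dring_scheme \<Rightarrow> ('k \<Rightarrow> 's) \<Rightarrow>
     'r \<Rightarrow> 's \<Rightarrow> ('r \<times> 's \<Rightarrow>\<^sub>0 int) set" where
  "pure_tensor K R c S u r s = tensor_rel K R c S u +>\<^bsub>pre_tensor R S\<^esub> frag_of (r, s)"

section \<open>The Galois \<open>\<partial>\<close>-group scheme\<close>

definition d_algebra ::
    "('k, 'm) dring_scheme \<Rightarrow> ('s, 'n) dring_scheme \<Rightarrow> ('k \<Rightarrow> 's) \<Rightarrow> bool" where
  "d_algebra K S u \<longleftrightarrow> diff_ring S \<and> u \<in> dring_hom K S"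

text \<open>\<open>Aut\<^sup>\<sigma>\<^sup>,\<^sup>\<partial>(\<R>\<^sup># \<otimes> S / F \<otimes> S)\<close>: an automorphism is linear over \<open>F \<otimes> S\<close> iff it fixes the image of
  \<open>F \<otimes> S\<close>, which is generated by the pure tensors. Being extensional makes automorphisms equal
  as functions when they agree on the carrier.\<close>

definition pv_aut ::
    "('f::field \<Rightarrow> 'f) \<Rightarrow> ('f \<Rightarrow> 'f) \<Rightarrow> 'f ^ 'n ^ 'n \<Rightarrow> (nat \<Rightarrow> ('f, 'n::finite) gl_pol set set) \<Rightarrow>
     's dring \<Rightarrow> ('f \<Rightarrow> 's) \<Rightarrow>
     ((('f, 'n) gl_pol set set \<times> 's \<Rightarrow>\<^sub>0 int) set \<Rightarrow>
      (('f, 'n) gl_pol set set \<times> 's \<Rightarrow>\<^sub>0 int) set) set" where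
  "pv_aut \<sigma> d A I S u =
     (let c = (\<lambda>a. pv_class \<sigma> d A I (mpol_const a));
          T = tensor (fixed_field \<sigma>) (pv_ring \<sigma> d A I) c S u;
          t = pure_tensor (fixed_field \<sigma>) (pv_ring \<sigma> d A I) c S u
      in {\<phi> \<in> ring_iso T T \<inter> extensional (carrier T).
            (\<forall>a\<in>carrier T. \<phi> (der T a) = der T (\<phi> a) \<and> \<phi> (shift T a) = shift T (\<phi> a)) \<and>
            (\<forall>a. \<forall>s\<in>carrier S. \<phi> (t (c a) s) = t (c a) s)})"

text \<open>The \<open>S\<close>-points of the closed subscheme of \<open>GL\<close> over \<open>C\<close> with defining ideal \<open>J\<close>: the matrices
  \<open>h(X)\<close>, for \<open>h\<close> a \<open>C\<close>-\<open>\<partial>\<close>-algebra homomorphism from \<open>C{X, 1/det X}\<close> to \<open>S\<close> vanishing on \<open>J\<close>.\<close>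

definition gl_points ::
    "'f::comm_ring_1 set \<Rightarrow> ('f \<Rightarrow> 'f) \<Rightarrow> ('f, 'n::finite) gl_pol set set \<Rightarrow>
     's dring \<Rightarrow> ('f \<Rightarrow> 's) \<Rightarrow> ('s ^ 'n ^ 'n) set" where
  "gl_points C d J S u = {(\<chi> i j. h (gl_class C d (mpol_var (Entry i j 0)))) | h.
     h \<in> dring_hom (gl_dring C d) S \<and> (\<forall>a\<in>C. h (gl_class C d (mpol_const a)) = u a) \<and>
     (\<forall>a\<in>J. h a = \<zero>\<^bsub>S\<^esub>)}"

text \<open>The relation \<open>g = Z\<^sup>-\<^sup>1 \<phi>(Z)\<close>, that is \<open>\<phi>(Z) = Z g\<close>, in the tensor product.\<close>

definition pv_matrix ::
    "('f::field \<Rightarrow> 'f) \<Rightarrow> ('f \<Rightarrow> 'f) \<Rightarrow> 'f ^ 'n ^ 'n \<Rightarrow> (nat \<Rightarrow> ('f, 'n::finite) gl_pol set set) \<Rightarrow>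
     's dring \<Rightarrow> ('f \<Rightarrow> 's) \<Rightarrow>
     ((('f, 'n) gl_pol set set \<times> 's \<Rightarrow>\<^sub>0 int) set \<Rightarrow>
      (('f, 'n) gl_pol set set \<times> 's \<Rightarrow>\<^sub>0 int) set) \<Rightarrow> 's ^ 'n ^ 'n \<Rightarrow> bool" where
  "pv_matrix \<sigma> d A I S u \<phi> g \<longleftrightarrow>
     (let R = pv_ring \<sigma> d A I;
          c = (\<lambda>a. pv_class \<sigma> d A I (mpol_const a));
          T = tensor (fixed_field \<sigma>) R c S u;
          t = pure_tensor (fixed_field \<sigma>) R c S u;
          Z = (\<lambda>i j. pv_class \<sigma> d A I (mpol_var (Entry i j 0)))
      in \<forall>i j. \<phi> (t (Z i j) \<one>\<^bsub>S\<^esub>) =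
           (\<Oplus>\<^bsub>T\<^esub>k\<in>UNIV. t (Z i k) \<one>\<^bsub>S\<^esub> \<otimes>\<^bsub>T\<^esub> t \<one>\<^bsub>R\<^esub> (g $ k $ j)))"

text \<open>\<open>J\<close> is the defining ideal, in \<open>K{X, 1/det X}\<close>, of the \<open>\<partial>\<close>-subgroup scheme of \<open>GL\<close> that
  represents \<open>S \<mapsto> Aut\<^sup>\<sigma>\<^sup>,\<^sup>\<partial>(\<R>\<^sup># \<otimes> S / F \<otimes> S)\<close> through \<open>\<phi> \<mapsto> Z\<^sup>-\<^sup>1 \<phi>(Z)\<close>. This map is compatible with
  composition and natural in \<open>S\<close>, so only its bijectivity has to be required. The algebras \<open>S\<close>
  are carried by subsets of the type that carries the coordinate ring
  \<open>K{X, 1/det X} / J\<close>; by the Yoneda argument this already determines \<open>J\<close>.\<close>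

definition galois_group_ideal ::
    "('f::field \<Rightarrow> 'f) \<Rightarrow> ('f \<Rightarrow> 'f) \<Rightarrow> 'f ^ 'n ^ 'n \<Rightarrow> (nat \<Rightarrow> ('f, 'n::finite) gl_pol set set) \<Rightarrow>
     ('f, 'n) gl_pol set set \<Rightarrow> bool" where
  "galois_group_ideal \<sigma> d A I J \<longleftrightarrow>
     (let K = fixed_field \<sigma> in
      ideal J (gl_dring K d) \<and> der (gl_dring K d) ` J \<subseteq> J \<and>
      (\<forall>(S :: ('f, 'n) gl_pol set set dring) u. d_algebra (dring_on K d) S u \<longrightarrow>
         (\<forall>\<phi>\<in>pv_aut \<sigma> d A I S u. \<exists>!g. g \<in> gl_points K d J S u \<and> pv_matrix \<sigma> d A I S u \<phi> g) \<and>
         (\<forall>g\<in>gl_points K d J S u. \<exists>!\<phi>. \<phi> \<in> pv_aut \<sigma> d A I S u \<and> pv_matrix \<sigma> d A I S u \<phi> g)))"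

section \<open>Extension of scalars, conjugation and constant groups\<close>

definition extend_scalars ::
    "('k::comm_ring_1 \<Rightarrow> 'k) \<Rightarrow> ('f::comm_ring_1 \<Rightarrow> 'k) \<Rightarrow> ('f, 'n::finite) gl_pol set set \<Rightarrow>
     ('k, 'n) gl_pol set set" where
  "extend_scalars d \<iota> J = Idl\<^bsub>gl_dring UNIV d\<^esub>
     (quot_map (gl_pol_dring UNIV d) (gl_rel UNIV d) (Poly_Mapping.map \<iota>) ` J)"

text \<open>The differential endomorphism \<open>X \<mapsto> P X P\<^sup>-\<^sup>1\<close>; it fixes \<open>1/det X\<close>.\<close>

definition gl_conj ::
    "('k::field \<Rightarrow> 'k) \<Rightarrow> 'k ^ 'n ^ 'n \<Rightarrow> ('k, 'n::finite) gl_pol \<Rightarrow> ('k, 'n) gl_pol" where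
  "gl_conj d P = mpol_subst mpol_const (\<lambda>v. case v of
       Entry i j k \<Rightarrow> (gl_deriv d ^^ k)
         ((map_matrix mpol_const P ** gen_mat ** map_matrix mpol_const (matrix_inv P)) $ i $ j)
     | InvDet \<Rightarrow> mpol_var InvDet)"

text \<open>The defining ideal of \<open>P G P\<^sup>-\<^sup>1\<close>, where \<open>J\<close> is the defining ideal of \<open>G\<close>: an element \<open>f\<close>
  vanishes on \<open>P G P\<^sup>-\<^sup>1\<close> iff \<open>f(P X P\<^sup>-\<^sup>1)\<close> vanishes on \<open>G\<close>.\<close>

definition conj_ideal ::
    "('k::field \<Rightarrow> 'k) \<Rightarrow> 'k ^ 'n ^ 'n \<Rightarrow> ('k, 'n::finite) gl_pol set set \<Rightarrow>
     ('k, 'n) gl_pol set set" where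
  "conj_ideal d P J = {f \<in> carrier (gl_dring UNIV d).
     quot_map (gl_pol_dring UNIV d) (gl_rel UNIV d) (gl_conj d P) f \<in> J}"

definition constant_dgroup ::
    "('k::field \<Rightarrow> 'k) \<Rightarrow> ('k, 'n::finite) gl_pol set set \<Rightarrow> bool" where
  "constant_dgroup d J \<longleftrightarrow>
     (\<forall>i j. der (gl_dring UNIV d) (gl_class UNIV d (mpol_var (Entry i j 0))) \<in> J)"

end

theory Submission
  imports Defs "HOL-Algebra.Free_Abelian_Groups" "HOL-Computational_Algebra.Fraction_Field"
begin

text \<open>
Write \<open>F\<close> for the base field, \<open>K\<close> for its shift constants, \<open>R\<close> for the Picard-Vessiot ring with its
  fundamental matrix \<open>Z\<close>, and \<open>x'\<close> for the derivative of \<open>x\<close>. Conjugacy to a constant group and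
  integrability are both equivalent to the existence of a matrix \<open>C\<close> over \<open>K\<close> such that the entries of
  \<open>X' + C X - X C\<close> (the matrix \<open>gauge_rel\<close>) lie in the defining ideal \<open>J\<close> of the Galois group.

  Conjugacy. The derivative of \<open>P X P\<^sup>-\<^sup>1\<close> is \<open>P (X' + C X - X C) P\<^sup>-\<^sup>1\<close> with \<open>C = P\<^sup>-\<^sup>1 P'\<close>, so \<open>P\<close> conjugates
  the group to a constant one iff the relation for this \<open>C\<close> lies in the extended ideal
  (\<open>conj_constant_iff\<close>). The matrix \<open>C\<close> then has entries in the differential closure; a \<open>K\<close>-linear
  retraction of the closure onto \<open>K\<close>, applied to coefficients, sends the extended ideal to \<open>J\<close> and
  replaces \<open>C\<close> by a matrix over \<open>K\<close> (\<open>descend\<close>). Conversely every \<open>C\<close> over \<open>K\<close> has the form \<open>P\<^sup>-\<^sup>1 P'\<close>,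
  because the linear system \<open>P' = P C\<close> is solvable in a differentially closed field
  (\<open>linear_system_solvable\<close>).

  From integrability to \<open>C\<close>. If \<open>B\<close> is given, \<open>C = Z\<^sup>-\<^sup>1 (Z' - B Z)\<close> is shift invariant, hence has entries
  in \<open>K\<close>. The universal point \<open>g\<close> of the group comes from an automorphism \<open>Z \<mapsto> Z g\<close> which fixes \<open>B\<close> and
  \<open>C\<close>; differentiating \<open>Z g\<close> in two ways gives \<open>g' + C g = g C\<close> (\<open>gauge_constant_if_integrable\<close>).

  From \<open>C\<close> to integrability. With \<open>b = (Z' - Z C) Z\<^sup>-\<^sup>1\<close> one has \<open>Z' = b Z + Z C\<close>, and it remains to see
  that \<open>b\<close> has entries in \<open>F\<close>: applying the shift then gives integrability (\<open>shift_relation\<close>). Let \<open>S\<close>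
  be the ring of shift constants of \<open>R \<otimes>\<^sub>F R\<close>. Since \<open>R\<close> is linearly disjoint from shift constants
  (\<open>hom_injective\<close>), each of the two embeddings of \<open>R\<close> into \<open>R \<otimes>\<^sub>F R\<close> induces an isomorphism from
  \<open>R \<otimes>\<^sub>K S\<close> to \<open>R \<otimes>\<^sub>F R\<close> (\<open>psi_bij\<close>); composing one with the inverse of the other gives an automorphism
  over \<open>S\<close> that carries the first copy of \<open>Z\<close> to the second (\<open>pv_aut_exists\<close>). Its matrix is a point of the group,
  so it satisfies the relation for \<open>C\<close>, and this says \<open>1 \<otimes> b = b \<otimes> 1\<close>; a linear functional shows that
  such elements come from \<open>F\<close> (\<open>equal_in_both_factors\<close>).

  Constants of \<open>R\<close>. The argument uses that \<open>R\<close> has no shift ideals besides \<open>0\<close> and \<open>R\<close> and that its shift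
  constants are \<open>K\<close>. The first holds level by level (\<open>Pv_maximal\<close>). For the second, let \<open>c\<close> be a
  constant in a level, which is a finitely generated \<open>F\<close>-algebra. If \<open>c\<close> differed from all \<open>a\<close> in \<open>K\<close>,
  all \<open>c - a\<close> would be units; a Nullstellensatz argument (\<open>algebraic_if_translates_units\<close>) then makes
  \<open>c\<close> algebraic over \<open>F\<close>, its minimal polynomial has coefficients in \<open>K\<close>, and a root of it in the
  algebraically closed field \<open>K\<close> contradicts minimality (\<open>constants_mod_simple_ideal\<close>).
\<close>

section \<open>Subrings and finitely generated extensions\<close>

definition subring_set :: "'a::comm_ring_1 set \<Rightarrow> bool" where
  "subring_set A \<longleftrightarrow> 1 \<in> A \<and> (\<forall>a\<in>A. \<forall>b\<in>A. a - b \<in> A \<and> a * b \<in> A)"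

text \<open>Rings that are subsets of a type are treated without quotients: \<open>Q\<close> stands for the ideal \<open>Q \<inter> B\<close> of
  \<open>B\<close>, so that the same \<open>Q\<close> can be used for all subrings of \<open>B\<close>, and statements about \<open>B/Q\<close> are congruences.\<close>
definition ideal_on :: "'a::comm_ring_1 set \<Rightarrow> 'a set \<Rightarrow> bool" where
  "ideal_on Q B \<longleftrightarrow> 0 \<in> Q \<and> (\<forall>a\<in>Q \<inter> B. \<forall>b\<in>Q \<inter> B. a + b \<in> Q) \<and> (\<forall>a\<in>Q \<inter> B. \<forall>b\<in>B. a * b \<in> Q)"

definition prime_on :: "'a::comm_ring_1 set \<Rightarrow> 'a set \<Rightarrow> bool" where
  "prime_on Q B \<longleftrightarrow> ideal_on Q B \<and> 1 \<notin> Q \<and> (\<forall>a\<in>B. \<forall>b\<in>B. a * b \<in> Q \<longrightarrow> a \<in> Q \<or> b \<in> Q)"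

lemma subring_setD:
  assumes "subring_set A"
  shows "1 \<in> A" "0 \<in> A" "a \<in> A \<Longrightarrow> b \<in> A \<Longrightarrow> a - b \<in> A" "a \<in> A \<Longrightarrow> b \<in> A \<Longrightarrow> a * b \<in> A"
    "a \<in> A \<Longrightarrow> - a \<in> A" "a \<in> A \<Longrightarrow> b \<in> A \<Longrightarrow> a + b \<in> A" "a \<in> A \<Longrightarrow> a ^ k \<in> A"
proof -
  show 1: "1 \<in> A" using assms by (auto simp: subring_set_def)
  have m: "a \<in> A \<Longrightarrow> b \<in> A \<Longrightarrow> a - b \<in> A" for a b using assms by (auto simp: subring_set_def)
  have t: "a \<in> A \<Longrightarrow> b \<in> A \<Longrightarrow> a * b \<in> A" for a b using assms by (auto simp: subring_set_def)
  show "a \<in> A \<Longrightarrow> b \<in> A \<Longrightarrow> a - b \<in> A" "a \<in> A \<Longrightarrow> b \<in> A \<Longrightarrow> a * b \<in> A" using m t by auto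
  show z: "0 \<in> A" using m[OF 1 1] by simp
  have u: "a \<in> A \<Longrightarrow> - a \<in> A" for a using m[OF z, of a] by simp
  then show "a \<in> A \<Longrightarrow> - a \<in> A" .
  show "a \<in> A \<Longrightarrow> b \<in> A \<Longrightarrow> a + b \<in> A" using m[OF _ u, of a b] by simp
  show "a \<in> A \<Longrightarrow> a ^ k \<in> A" by (induction k) (auto intro: 1 t)
qed

lemma subring_set_sum:
  assumes "subring_set A" "\<And>i. i \<in> I \<Longrightarrow> f i \<in> A"
  shows "sum f I \<in> A"
  using assms(2) by (induction I rule: infinite_finite_induct) (auto intro: subring_setD[OF assms(1)])

lemma subring_set_prod:
  assumes "subring_set A" "\<And>i. i \<in> I \<Longrightarrow> f i \<in> A"
  shows "prod f I \<in> A"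
  using assms(2) by (induction I rule: infinite_finite_induct) (auto intro: subring_setD[OF assms(1)])

lemma ideal_on_subset: "ideal_on Q B \<Longrightarrow> A \<subseteq> B \<Longrightarrow> ideal_on Q A"
  unfolding ideal_on_def by (auto 4 3)

lemma prime_on_subset: "prime_on Q B \<Longrightarrow> A \<subseteq> B \<Longrightarrow> prime_on Q A"
  unfolding prime_on_def using ideal_on_subset by blast

definition polys_over :: "'a::comm_ring_1 set \<Rightarrow> 'a poly set" where
  "polys_over A = {p. \<forall>i. poly.coeff p i \<in> A}"

definition adjoin1 :: "'a::comm_ring_1 set \<Rightarrow> 'a \<Rightarrow> 'a set" where
  "adjoin1 A x = (\<lambda>p. poly p x) ` polys_over A"

fun adjoins :: "'a::comm_ring_1 set \<Rightarrow> 'a list \<Rightarrow> 'a set" where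
  "adjoins A [] = A"
| "adjoins A (x # xs) = adjoins (adjoin1 A x) xs"

lemma polys_over_closed:
  assumes A: "subring_set A"
  shows "p \<in> polys_over A \<Longrightarrow> q \<in> polys_over A \<Longrightarrow> p - q \<in> polys_over A"
    "p \<in> polys_over A \<Longrightarrow> q \<in> polys_over A \<Longrightarrow> p + q \<in> polys_over A"
    "p \<in> polys_over A \<Longrightarrow> q \<in> polys_over A \<Longrightarrow> p * q \<in> polys_over A"
    "a \<in> A \<Longrightarrow> Polynomial.monom a n \<in> polys_over A" "a \<in> A \<Longrightarrow> p \<in> polys_over A \<Longrightarrow> Polynomial.smult a p \<in> polys_over A"
    "0 \<in> polys_over A" "1 \<in> polys_over A" "a \<in> A \<Longrightarrow> [:a:] \<in> polys_over A"
    "p \<in> polys_over A \<Longrightarrow> poly_cutoff n p \<in> polys_over A" "p \<in> polys_over A \<Longrightarrow> p ^ n \<in> polys_over A"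
proof -
  note S = subring_setD[OF A]
  show t: "p \<in> polys_over A \<Longrightarrow> q \<in> polys_over A \<Longrightarrow> p * q \<in> polys_over A" for p q
    by (auto simp: polys_over_def coeff_mult intro!: subring_set_sum[OF A] S)
  show o: "1 \<in> polys_over A" by (auto simp: polys_over_def coeff_1 intro: S)
  show "p \<in> polys_over A \<Longrightarrow> p ^ n \<in> polys_over A" by (induction n) (auto intro: o t)
qed (auto simp: polys_over_def coeff_monom coeff_poly_cutoff coeff_pCons split: nat.split intro: subring_setD[OF A])

lemma subring_adjoin1:
  assumes A: "subring_set A"
  shows "subring_set (adjoin1 A x)" "A \<subseteq> adjoin1 A x" "x \<in> adjoin1 A x"
proof -
  note P = polys_over_closed[OF A]
  show "subring_set (adjoin1 A x)"
    unfolding subring_set_def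
  proof (intro conjI ballI)
    show "1 \<in> adjoin1 A x" unfolding adjoin1_def using P(7) by (metis image_eqI poly_1)
  next
    fix a b assume "a \<in> adjoin1 A x" "b \<in> adjoin1 A x"
    then obtain p q where "p \<in> polys_over A" "q \<in> polys_over A" "a = poly p x" "b = poly q x"
      by (auto simp: adjoin1_def)
    then show "a - b \<in> adjoin1 A x" "a * b \<in> adjoin1 A x"
      unfolding adjoin1_def using P(1,3) by (metis image_eqI poly_diff, metis image_eqI poly_mult)
  qed
  show "A \<subseteq> adjoin1 A x"
  proof
    fix a assume "a \<in> A"
    then show "a \<in> adjoin1 A x" unfolding adjoin1_def
      by (intro image_eqI[of _ _ "[:a:]"]) (auto intro: P)
  qed
  have "Polynomial.monom 1 1 \<in> polys_over A" by (intro P subring_setD[OF A])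
  then show "x \<in> adjoin1 A x" unfolding adjoin1_def
    by (intro image_eqI[of _ _ "Polynomial.monom 1 1"]) (auto simp: poly_monom)
qed

lemma adjoin1_minimal:
  assumes B: "subring_set B" and "A \<subseteq> B" "x \<in> B"
  shows "adjoin1 A x \<subseteq> B"
proof
  fix y assume "y \<in> adjoin1 A x"
  then obtain p where "p \<in> polys_over A" and y: "y = poly p x" by (auto simp: adjoin1_def)
  then have "\<And>i. poly.coeff p i \<in> B" using assms by (auto simp: polys_over_def)
  then show "y \<in> B" unfolding y poly_altdef
    by (intro subring_set_sum[OF B] subring_setD[OF B] \<open>x \<in> B\<close>)
qed

lemma subring_adjoins:
  assumes "subring_set A"
  shows "subring_set (adjoins A xs)" "A \<subseteq> adjoins A xs" "set xs \<subseteq> adjoins A xs"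
  using assms
proof (induction xs arbitrary: A)
  case (Cons x xs)
  { case 1 then show ?case using Cons.IH(1) subring_adjoin1(1) by auto }
  { case 2 then show ?case using Cons.IH(2) subring_adjoin1(1,2) by fastforce }
  { case 3 then show ?case using Cons.IH(2,3)[OF subring_adjoin1(1)[OF 3], of x] subring_adjoin1(3)[OF 3, of x] by auto }
qed auto

lemma adjoins_minimal:
  assumes "subring_set B" "A \<subseteq> B" "set xs \<subseteq> B"
  shows "adjoins A xs \<subseteq> B"
  using assms(2,3) by (induction xs arbitrary: A) (auto simp: adjoin1_minimal[OF assms(1)])

section \<open>Units in finitely generated extensions\<close>

text \<open>Modulo \<open>Q\<close>: every nonzero \<open>b\<close> in \<open>B\<close> has a nonzero \<open>f\<close> in \<open>A\<close> such that an element of \<open>A\<close> which becomes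
  a unit in \<open>B[1/b]\<close> is already a unit in \<open>A[1/f]\<close> (it divides a power of \<open>f\<close>). Put this way the property
  composes along towers, which is all that is needed of generic freeness or of Chevalley's theorem.\<close>
definition unit_spread :: "'a::comm_ring_1 set \<Rightarrow> 'a set \<Rightarrow> 'a set \<Rightarrow> bool" where
  "unit_spread A B Q \<longleftrightarrow> (\<forall>b\<in>B - Q. \<exists>f\<in>A - Q. \<forall>a\<in>A.
     (\<exists>N. \<exists>y\<in>B. b ^ N - a * y \<in> Q) \<longrightarrow> (\<exists>M. \<exists>y\<in>A. f ^ M - a * y \<in> Q))"

text \<open>Division with remainder by a polynomial whose leading coefficient need not be a unit. The vanishing
  conditions replace degrees, because \<open>poly.coeff q e\<close> is only assumed to be nonzero modulo an ideal later.\<close>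
lemma pseudo_division:
  fixes q :: "'a::comm_ring_1 poly"
  assumes A: "subring_set A" and q: "q \<in> polys_over A" and qe: "\<And>i. i > e \<Longrightarrow> poly.coeff q i = 0"
    and "f \<in> polys_over A" "\<And>i. i \<ge> n \<Longrightarrow> poly.coeff f i = 0"
  shows "\<exists>k h r. h \<in> polys_over A \<and> r \<in> polys_over A \<and> Polynomial.smult (poly.coeff q e ^ k) f = q * h + r \<and>
    (\<forall>i\<ge>e. poly.coeff r i = 0) \<and> (\<forall>i. i + e \<ge> n \<longrightarrow> poly.coeff h i = 0)"
  using assms(4,5)
proof (induction n arbitrary: f)
  case 0
  then have "f = 0" by (auto intro: poly_eqI)
  then show ?case using polys_over_closed(6)[OF A] by (intro exI[of _ 0]) auto
next
  case (Suc n)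
  note P = polys_over_closed[OF A]
  show ?case
  proof (cases "Suc n \<le> e")
    case True
    then show ?thesis using Suc.prems P(6)
      by (intro exI[of _ 0] exI[of _ "0::'a poly"] exI[of _ f]) auto
  next
    case False
    then have ne: "e \<le> n" by simp
    define m where "m = poly.coeff q e"
    define c where "c = poly.coeff f n"
    have mc: "m \<in> A" "c \<in> A" using q Suc.prems(1) by (auto simp: m_def c_def polys_over_def)
    define f' where "f' = Polynomial.smult m f - Polynomial.monom c (n - e) * q"
    have f': "f' \<in> polys_over A" unfolding f'_def by (intro P mc q Suc.prems(1))
    have z: "poly.coeff f' i = 0" if "i \<ge> n" for i
    proof (cases "i = n")
      case True
      then show ?thesis using ne by (simp add: f'_def coeff_monom_mult m_def c_def mult.commute[of "poly.coeff q e"])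
    next
      case False
      then have "poly.coeff f i = 0" "poly.coeff q (i - (n - e)) = 0" using that ne Suc.prems(2)[of i] qe by auto
      then show ?thesis by (simp add: f'_def coeff_monom_mult)
    qed
    obtain k h r where *: "h \<in> polys_over A" "r \<in> polys_over A" "Polynomial.smult (m ^ k) f' = q * h + r"
      "\<forall>i\<ge>e. poly.coeff r i = 0" "\<forall>i. i + e \<ge> n \<longrightarrow> poly.coeff h i = 0"
      using Suc.IH[OF f' z] unfolding m_def by blast
    have "Polynomial.smult (m ^ Suc k) f = q * (h + Polynomial.monom (m ^ k * c) (n - e)) + r"
    proof -
      have "Polynomial.smult (m ^ Suc k) f = Polynomial.smult (m ^ k) f' + Polynomial.smult (m ^ k) (Polynomial.monom c (n - e) * q)"
        by (simp add: f'_def algebra_simps smult_diff_right)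
      also have "\<dots> = q * h + r + Polynomial.monom (m ^ k * c) (n - e) * q"
        using *(3) by (simp add: smult_monom flip: mult_smult_left)
      finally show ?thesis by (simp add: algebra_simps)
    qed
    moreover have "h + Polynomial.monom (m ^ k * c) (n - e) \<in> polys_over A"
      by (intro P * subring_setD[OF A] mc)
    moreover have "poly.coeff (h + Polynomial.monom (m ^ k * c) (n - e)) i = 0" if "i + e \<ge> Suc n" for i
      using that *(5) ne by (auto simp: coeff_monom)
    ultimately show ?thesis using *(2,4) unfolding m_def by blast
  qed
qed

context
  fixes A Q :: "'a::comm_ring_1 set" and x :: 'a
  assumes A: "subring_set A" and Q: "prime_on Q (adjoin1 A x)"
begin

private lemma B: "subring_set (adjoin1 A x)" "a \<in> A \<Longrightarrow> a \<in> adjoin1 A x" "x \<in> adjoin1 A x"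
  "p \<in> polys_over A \<Longrightarrow> poly p x \<in> adjoin1 A x"
  using subring_adjoin1[OF A] by (auto simp: adjoin1_def)

private lemmas Bc = subring_setD[OF B(1)] and Ac = subring_setD[OF A]

private lemmas memB = Bc Ac B(2-4)

private lemma Qz: "0 \<in> Q" and Q1: "1 \<notin> Q"
  and Qadd: "a \<in> Q \<Longrightarrow> b \<in> Q \<Longrightarrow> a \<in> adjoin1 A x \<Longrightarrow> b \<in> adjoin1 A x \<Longrightarrow> a + b \<in> Q"
  and Qmul: "a \<in> Q \<Longrightarrow> a \<in> adjoin1 A x \<Longrightarrow> b \<in> adjoin1 A x \<Longrightarrow> a * b \<in> Q"
  and Qprime: "a * b \<in> Q \<Longrightarrow> a \<in> adjoin1 A x \<Longrightarrow> b \<in> adjoin1 A x \<Longrightarrow> a \<in> Q \<or> b \<in> Q"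
  using Q unfolding prime_on_def ideal_on_def by auto

private lemma Qmul2: "b \<in> Q \<Longrightarrow> a \<in> adjoin1 A x \<Longrightarrow> b \<in> adjoin1 A x \<Longrightarrow> a * b \<in> Q"
  using Qmul[of b a] by (simp add: mult.commute)

private lemma Qdiff: "a \<in> Q \<Longrightarrow> b \<in> Q \<Longrightarrow> a \<in> adjoin1 A x \<Longrightarrow> b \<in> adjoin1 A x \<Longrightarrow> a - b \<in> Q"
  using Qadd[of a "(-1) * b"] Qmul2[of b "-1"] Bc by auto

private lemma Qsub: "a - b \<in> Q \<Longrightarrow> b \<in> Q \<Longrightarrow> a \<in> adjoin1 A x \<Longrightarrow> b \<in> adjoin1 A x \<Longrightarrow> a \<in> Q"
  using Qadd[of "a - b" b] Bc by auto

private lemma Qpow: "a \<in> adjoin1 A x \<Longrightarrow> a ^ k \<in> Q \<Longrightarrow> a \<in> Q"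
proof (induction k)
  case (Suc k)
  then show ?case using Qprime[of a "a ^ k"] Bc(7)[of a k] by auto
qed (use Q1 in auto)

private lemma Qpoly:
  assumes "p \<in> polys_over A" "\<And>i. poly.coeff p i \<in> Q" shows "poly p x \<in> Q"
proof -
  have S: "sum f I \<in> Q \<and> sum f I \<in> adjoin1 A x" if "\<And>i. i \<in> I \<Longrightarrow> f i \<in> Q \<and> f i \<in> adjoin1 A x" for f :: "nat \<Rightarrow> 'a" and I
    using that by (induction I rule: infinite_finite_induct) (auto intro: Qz Bc Qadd)
  have "poly.coeff p i * x ^ i \<in> Q \<and> poly.coeff p i * x ^ i \<in> adjoin1 A x" for i
    using assms by (auto simp: polys_over_def memB Qmul)
  then show ?thesis unfolding poly_altdef by (intro S[THEN conjunct1]) auto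
qed

private lemma truncate:
  assumes p: "p \<in> polys_over A" and i: "poly.coeff p i \<notin> Q" and n: "\<And>i. i \<ge> n \<Longrightarrow> poly.coeff p i = 0"
  shows "\<exists>q e. q \<in> polys_over A \<and> e < n \<and> (\<forall>i>e. poly.coeff q i = 0) \<and> poly.coeff q e \<notin> Q \<and>
     poly q x - poly p x \<in> Q"
proof -
  let ?S = "{i. poly.coeff p i \<notin> Q}"
  have "?S \<subseteq> {..<n}" using n Qz by (metis (mono_tags, lifting) lessThan_iff mem_Collect_eq not_le_imp_less subsetI)
  then have f: "finite ?S" by (rule finite_subset) auto
  define e where "e = Max ?S"
  have e: "e \<in> ?S" unfolding e_def using f i by (intro Max_in) auto
  have ge: "poly.coeff p i \<in> Q" if "i > e" for i
    using Max_ge[OF f, of i] that unfolding e_def by fastforce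
  define q where "q = poly_cutoff (Suc e) p"
  have q: "q \<in> polys_over A" unfolding q_def by (intro polys_over_closed[OF A] p)
  have "poly (q - p) x \<in> Q"
  proof (rule Qpoly)
    show "q - p \<in> polys_over A" by (intro polys_over_closed[OF A] p q)
    fix i
    have "0 - poly.coeff p i \<in> Q" if "i > e" using ge[OF that] p
      by (intro Qdiff Qz B(2)) (auto simp: polys_over_def Ac)
    then show "poly.coeff (q - p) i \<in> Q" using Qz by (auto simp: q_def coeff_poly_cutoff)
  qed
  moreover have "e < n" using e \<open>?S \<subseteq> {..<n}\<close> by auto
  ultimately show ?thesis using q e by (intro exI[of _ q] exI[of _ e]) (auto simp: q_def coeff_poly_cutoff)
qed

private lemma coeff_power_top:
  fixes q :: "'a poly"
  assumes "\<And>i. i > e \<Longrightarrow> poly.coeff q i = 0"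
  shows "poly.coeff (q ^ N) (e * N) = poly.coeff q e ^ N \<and> (\<forall>i > e * N. poly.coeff (q ^ N) i = 0)"
proof (induction N)
  case (Suc N)
  have c: "poly.coeff (q ^ Suc N) i = poly.coeff q e * poly.coeff (q ^ N) (i - e)" if "i \<ge> e * Suc N" for i
  proof -
    have "poly.coeff (q ^ Suc N) i = (\<Sum>j\<le>i. poly.coeff q j * poly.coeff (q ^ N) (i - j))"
      by (simp add: coeff_mult)
    also have "\<dots> = (\<Sum>j\<in>{e}. poly.coeff q j * poly.coeff (q ^ N) (i - j))"
    proof (rule sum.mono_neutral_right)
      show "\<forall>j\<in>{..i} - {e}. poly.coeff q j * poly.coeff (q ^ N) (i - j) = 0"
      proof
        fix j assume "j \<in> {..i} - {e}"
        then consider "j > e" | "j < e" by fastforce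
        moreover have "i - j > e * N" if "j < e" using \<open>i \<ge> e * Suc N\<close> that by simp
        ultimately show "poly.coeff q j * poly.coeff (q ^ N) (i - j) = 0"
          using assms Suc by cases auto
      qed
    qed (use that in auto)
    finally show ?thesis by simp
  qed
  show ?case
  proof (intro conjI allI impI)
    show "poly.coeff (q ^ Suc N) (e * Suc N) = poly.coeff q e ^ Suc N"
      using c[of "e * Suc N"] Suc by simp
    fix i assume i: "i > e * Suc N"
    then have "i - e > e * N" by simp
    then show "poly.coeff (q ^ Suc N) i = 0" using c[of i] i Suc by simp
  qed
qed auto

text \<open>If \<open>x\<close> is transcendental modulo \<open>Q\<close>, the leading coefficient of \<open>b\<close> as a polynomial in \<open>x\<close> works:
  compare top coefficients in \<open>b^N = a y\<close>. If \<open>x\<close> is algebraic, let \<open>l\<close> be the leading coefficient of a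
  relation of least degree and \<open>m\<close> an element of \<open>A\<close> that \<open>b\<close> divides (a norm of \<open>b\<close>); then \<open>l m\<close> works,
  because after inverting \<open>l\<close> the powers of \<open>x\<close> below the degree form a basis, and the constant
  coefficients of a relation \<open>m^N = a y\<close> can be compared.\<close>
lemma unit_spread_adjoin1: "unit_spread A (adjoin1 A x) Q"
proof (cases "\<exists>p\<in>polys_over A. poly p x \<in> Q \<and> (\<exists>i. poly.coeff p i \<notin> Q)")
  case False
  then have indep: "poly.coeff p i \<in> Q" if "p \<in> polys_over A" "poly p x \<in> Q" for p i using that by blast
  show ?thesis unfolding unit_spread_def
  proof (intro ballI)
    fix b assume b: "b \<in> adjoin1 A x - Q"
    then obtain \<beta> where \<beta>: "\<beta> \<in> polys_over A" "b = poly \<beta> x" by (auto simp: adjoin1_def)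
    then obtain i where "poly.coeff \<beta> i \<notin> Q" using Qpoly b by blast
    then obtain q e where q: "q \<in> polys_over A" "\<forall>i>e. poly.coeff q i = 0" "poly.coeff q e \<notin> Q" "poly q x - b \<in> Q"
      using truncate[OF \<beta>(1), of i "Suc (Polynomial.degree \<beta>)"] \<beta>(2) by (auto simp: coeff_eq_0)
    let ?f = "poly.coeff q e"
    show "\<exists>f\<in>A - Q. \<forall>a\<in>A. (\<exists>N. \<exists>y\<in>adjoin1 A x. b ^ N - a * y \<in> Q) \<longrightarrow> (\<exists>M. \<exists>y\<in>A. f ^ M - a * y \<in> Q)"
    proof (intro bexI[of _ ?f] ballI impI)
      show "?f \<in> A - Q" using q by (auto simp: polys_over_def)
      fix a assume a: "a \<in> A" and "\<exists>N. \<exists>y\<in>adjoin1 A x. b ^ N - a * y \<in> Q"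
      then obtain N \<eta> where \<eta>: "\<eta> \<in> polys_over A" "b ^ N - a * poly \<eta> x \<in> Q" by (auto simp: adjoin1_def)
      have qx: "poly q x \<in> adjoin1 A x" using B q by blast
      obtain w where w: "poly q x ^ N - b ^ N = (poly q x - b) * w" "w \<in> adjoin1 A x"
      proof
        show "poly q x ^ N - b ^ N = (poly q x - b) * (\<Sum>i<N. b ^ (N - Suc i) * poly q x ^ i)"
          by (rule power_diff_sumr2)
        show "(\<Sum>i<N. b ^ (N - Suc i) * poly q x ^ i) \<in> adjoin1 A x"
          using b qx by (intro subring_set_sum[OF B(1)]) (simp add: memB)
      qed
      have "poly q x ^ N - b ^ N \<in> Q" unfolding w using q(4) w(2) b qx by - (rule Qmul; simp add: memB)
      then have "(poly q x ^ N - b ^ N) + (b ^ N - a * poly \<eta> x) \<in> Q"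
        using \<eta> b qx a by - (rule Qadd; simp add: memB)
      then have "poly (q ^ N - Polynomial.smult a \<eta>) x \<in> Q" by (simp add: poly_power)
      moreover have "q ^ N - Polynomial.smult a \<eta> \<in> polys_over A" by (intro polys_over_closed[OF A] q \<eta> a)
      ultimately have "poly.coeff (q ^ N - Polynomial.smult a \<eta>) (e * N) \<in> Q" using indep by blast
      then have "?f ^ N - a * poly.coeff \<eta> (e * N) \<in> Q"
        using coeff_power_top[of e q N] q(2) by simp
      then show "\<exists>M. \<exists>y\<in>A. ?f ^ M - a * y \<in> Q" using \<eta>(1) by (auto simp: polys_over_def)
    qed
  qed
next
  case True
  define D where "D d p \<longleftrightarrow> p \<in> polys_over A \<and> (\<forall>i>d. poly.coeff p i = 0) \<and> poly.coeff p d \<notin> Q \<and> poly p x \<in> Q" for d p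
  obtain p0 i0 where p0: "p0 \<in> polys_over A" "poly p0 x \<in> Q" "poly.coeff p0 i0 \<notin> Q" using True by blast
  have trunc0: "\<exists>e q. D e q \<and> e < n" if t: "p \<in> polys_over A" "poly p x \<in> Q" "poly.coeff p i \<notin> Q"
    "\<And>i. i \<ge> n \<Longrightarrow> poly.coeff p i = 0" for p i n
  proof -
    obtain q e where q: "q \<in> polys_over A" "e < n" "\<forall>i>e. poly.coeff q i = 0" "poly.coeff q e \<notin> Q" "poly q x - poly p x \<in> Q"
      using truncate[where n=n, OF t(1,3,4)] by blast
    then have "poly q x \<in> Q" using Qsub[OF q(5) t(2)] q(1) t(1) by (simp add: memB)
    then show ?thesis using q unfolding D_def by blast
  qed
  have ex: "\<exists>d. \<exists>p. D d p"
    using trunc0[where n="Suc (Polynomial.degree p0)", OF p0] by (auto simp: coeff_eq_0)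
  define d where "d = (LEAST d. \<exists>p. D d p)"
  obtain p where "D d p" using LeastI_ex[OF ex] unfolding d_def by blast
  then have p: "p \<in> polys_over A" "\<And>i. i > d \<Longrightarrow> poly.coeff p i = 0" "poly.coeff p d \<notin> Q" "poly p x \<in> Q"
    unfolding D_def by auto
  have indep: "poly.coeff q i \<in> Q" if t: "q \<in> polys_over A" "\<And>i. i \<ge> d \<Longrightarrow> poly.coeff q i = 0" "poly q x \<in> Q" for q i
  proof (rule ccontr)
    assume "poly.coeff q i \<notin> Q"
    then obtain e q' where "D e q'" "e < d" using trunc0[where n=d, OF t(1,3) _ t(2)] by blast
    then show False using not_less_Least[of e "\<lambda>d. \<exists>p. D d p"] unfolding d_def by blast
  qed
  define l where "l = poly.coeff p d"
  have l: "l \<in> A" "l \<notin> Q" using p by (auto simp: l_def polys_over_def)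
  have d: "d > 0"
  proof (rule ccontr)
    assume "\<not> d > 0"
    then have "p = [:poly.coeff p 0:]" using p(2) by (intro poly_eqI) (auto simp: coeff_pCons split: nat.split)
    then have "poly p x = poly.coeff p 0" by (metis poly_0 poly_pCons mult_zero_right add.right_neutral)
    then show False using p(3,4) \<open>\<not> d > 0\<close> by auto
  qed
  show ?thesis unfolding unit_spread_def
  proof (intro ballI)
    fix b assume b': "b \<in> adjoin1 A x - Q"
    then have b: "b \<in> adjoin1 A x" "b \<notin> Q" by auto
    obtain \<beta> where \<beta>: "\<beta> \<in> polys_over A" "b = poly \<beta> x" using b by (auto simp: adjoin1_def)
    \<comment> \<open>Polynomials in \<open>x\<close> that are multiples of \<open>b\<close> modulo \<open>Q\<close>. Dividing the minimal relation \<open>p\<close> by one of least degree shows that this degree is zero.\<close>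
    define M where "M e q \<longleftrightarrow> q \<in> polys_over A \<and> (\<forall>i>e. poly.coeff q i = 0) \<and> poly.coeff q e \<notin> Q \<and>
       (\<exists>y\<in>adjoin1 A x. poly q x - b * y \<in> Q)" for e q
    have truncM: "\<exists>e q'. M e q' \<and> e < n" if t: "q \<in> polys_over A" "y \<in> adjoin1 A x" "poly q x - b * y \<in> Q"
       "poly.coeff q i \<notin> Q" "\<And>i. i \<ge> n \<Longrightarrow> poly.coeff q i = 0" for q y i n
    proof -
      obtain q' e where q': "q' \<in> polys_over A" "e < n" "\<forall>i>e. poly.coeff q' i = 0" "poly.coeff q' e \<notin> Q" "poly q' x - poly q x \<in> Q"
        using truncate[where n=n, OF t(1,4,5)] by blast
      have "(poly q' x - poly q x) + (poly q x - b * y) \<in> Q"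
        using q' t b by - (rule Qadd; simp add: memB)
      then have "poly q' x - b * y \<in> Q" by simp
      then show ?thesis using q' t(2) unfolding M_def by blast
    qed
    obtain k h r where kr: "h \<in> polys_over A" "r \<in> polys_over A" "Polynomial.smult (l ^ k) \<beta> = p * h + r"
       "\<forall>i\<ge>d. poly.coeff r i = 0"
      using pseudo_division[where e=d and n="Suc (Polynomial.degree \<beta>)", OF A p(1,2) \<beta>(1)] unfolding l_def by (auto simp: coeff_eq_0)
    have rx: "poly r x - b * l ^ k \<in> Q"
    proof -
      have "b * l ^ k = poly p x * poly h x + poly r x"
        using arg_cong[OF kr(3), of "\<lambda>p. poly p x"] \<beta>(2) by (simp add: mult.commute)
      then have "poly r x - b * l ^ k = poly p x * (- poly h x)" by (simp add: algebra_simps)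
      also have "\<dots> \<in> Q" using p kr by - (rule Qmul; simp add: memB)
      finally show ?thesis .
    qed
    have "\<exists>i. poly.coeff r i \<notin> Q"
    proof (rule ccontr)
      assume "\<not> ?thesis"
      then have "poly r x \<in> Q" using Qpoly kr by blast
      then have "poly r x - (poly r x - b * l ^ k) \<in> Q" using rx kr l b by - (rule Qdiff; simp add: memB)
      then have "b * l ^ k \<in> Q" by simp
      then have "b \<in> Q \<or> l ^ k \<in> Q" using Qprime[of b "l ^ k"] b l by (simp add: memB)
      then show False using b Qpow[of l k] l by (simp add: memB)
    qed
    then obtain e0 q0 where e0: "M e0 q0" "e0 < d"
      using truncM[OF kr(2) _ rx] kr(4) Bc(7)[OF B(2)[OF l(1)], of k] by blast
    define e where "e = (LEAST e. \<exists>q. M e q)"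
    obtain q where Mq: "M e q" using LeastI_ex[of "\<lambda>e. \<exists>q. M e q"] e0 unfolding e_def by blast
    have ed: "e < d" using e0 Least_le[of "\<lambda>e. \<exists>q. M e q" e0] unfolding e_def by fastforce
    obtain y0 where q: "q \<in> polys_over A" "\<And>i. i > e \<Longrightarrow> poly.coeff q i = 0" "poly.coeff q e \<notin> Q"
       and y0: "y0 \<in> adjoin1 A x" "poly q x - b * y0 \<in> Q" using Mq unfolding M_def by blast
    have qx: "poly q x \<notin> Q" using indep[OF q(1), of e] q(2,3) ed by auto
    define m where "m = poly.coeff q e"
    have m: "m \<in> A" "m \<notin> Q" using q by (auto simp: m_def polys_over_def)
    \<comment> \<open>Otherwise divide \<open>p\<close> by \<open>q\<close>. Modulo \<open>Q\<close> the remainder vanishes by minimality of \<open>e\<close>, and then so does \<open>h\<close>, whose degree is below \<open>d\<close>; hence \<open>m ^ k * l\<close> lies in the prime \<open>Q\<close>.\<close>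
    have e: "e = 0"
    proof (rule ccontr)
      assume "e \<noteq> 0"
      obtain k h r where k: "h \<in> polys_over A" "r \<in> polys_over A" "Polynomial.smult (m ^ k) p = q * h + r"
         "\<forall>i\<ge>e. poly.coeff r i = 0" "\<forall>i. i + e \<ge> Suc d \<longrightarrow> poly.coeff h i = 0"
        using pseudo_division[where e=e and n="Suc d", OF A q(1,2) p(1)] p(2) unfolding m_def by auto
      have eq: "m ^ k * poly p x = poly q x * poly h x + poly r x"
        using arg_cong[OF k(3), of "\<lambda>p. poly p x"] by simp
      have "poly r x - b * (- y0 * poly h x) = m ^ k * poly p x - (poly q x - b * y0) * poly h x"
        using eq by (simp add: algebra_simps)
      also have "\<dots> \<in> Q" using k m p q y0 b by - (rule Qdiff[OF Qmul2[of "poly p x"] Qmul[of "poly q x - b * y0"]]; simp add: memB)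
      finally have rM: "poly r x - b * (- y0 * poly h x) \<in> Q" .
      have "poly.coeff r i \<in> Q" for i
      proof (rule ccontr)
        assume ri: "poly.coeff r i \<notin> Q"
        have "- y0 * poly h x \<in> adjoin1 A x" using y0(1) k(1) by (simp add: memB)
        then obtain e' q' where "M e' q'" "e' < e"
          using truncM[where n=e, OF k(2) _ rM ri] k(4) by blast
        then show False using not_less_Least[of e' "\<lambda>e. \<exists>q. M e q"] unfolding e_def by blast
      qed note rQ = this
      then have "poly r x \<in> Q" using Qpoly k by blast
      then have "m ^ k * poly p x - poly r x \<in> Q" using k m p by - (rule Qdiff, rule Qmul2; simp add: memB)
      then have "poly q x * poly h x \<in> Q" using eq by simp
      then have hx: "poly h x \<in> Q" using Qprime[of "poly q x"] qx q k by (auto simp: memB)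
      have hQ: "poly.coeff h i \<in> Q" for i
        using indep[OF k(1) _ hx] k(5) \<open>e \<noteq> 0\<close> by auto
      have "poly.coeff (q * h) d \<in> Q \<and> poly.coeff (q * h) d \<in> adjoin1 A x" unfolding coeff_mult
      proof -
        have "sum f I \<in> Q \<and> sum f I \<in> adjoin1 A x" if "\<And>i. i \<in> I \<Longrightarrow> f i \<in> Q \<and> f i \<in> adjoin1 A x" for f :: "nat \<Rightarrow> 'a" and I
          using that by (induction I rule: infinite_finite_induct) (auto intro: Qz Bc Qadd)
        then show "(\<Sum>i\<le>d. poly.coeff q i * poly.coeff h (d - i)) \<in> Q \<and> (\<Sum>i\<le>d. poly.coeff q i * poly.coeff h (d - i)) \<in> adjoin1 A x"
          using q k hQ by (auto simp: polys_over_def memB Qmul2)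
      qed
      then have "poly.coeff (q * h) d + poly.coeff r d \<in> Q" using rQ k by (intro Qadd) (auto simp: polys_over_def memB)
      then have "m ^ k * l \<in> Q" using arg_cong[OF k(3), of "\<lambda>p. poly.coeff p d"] by (simp add: l_def)
      then show False using Qprime[of "m ^ k" l] Qpow[of m k] m l by (auto simp: memB)
    qed
    have "q = [:m:]" using q(2) e by (intro poly_eqI) (auto simp: coeff_pCons m_def split: nat.split)
    then have y0': "m - b * y0 \<in> Q" using y0 by simp
    show "\<exists>f\<in>A - Q. \<forall>a\<in>A. (\<exists>N. \<exists>y\<in>adjoin1 A x. b ^ N - a * y \<in> Q) \<longrightarrow> (\<exists>M. \<exists>y\<in>A. f ^ M - a * y \<in> Q)"
    proof (intro bexI[of _ "l * m"] ballI impI)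
      show "l * m \<in> A - Q" using l m Qprime[of l m] by (auto simp: memB)
      fix a assume a: "a \<in> A" and "\<exists>N. \<exists>y\<in>adjoin1 A x. b ^ N - a * y \<in> Q"
      then obtain N y where y: "y \<in> adjoin1 A x" "b ^ N - a * y \<in> Q" by blast
      obtain w where w: "m ^ N - (b * y0) ^ N = (m - b * y0) * w" "w \<in> adjoin1 A x"
      proof
        show "m ^ N - (b * y0) ^ N = (m - b * y0) * (\<Sum>i<N. (b * y0) ^ (N - Suc i) * m ^ i)"
          by (rule power_diff_sumr2)
        show "(\<Sum>i<N. (b * y0) ^ (N - Suc i) * m ^ i) \<in> adjoin1 A x"
          using b m y0 by (intro subring_set_sum[OF B(1)]) (simp add: memB)
      qed
      obtain \<eta> where \<eta>: "\<eta> \<in> polys_over A" "y * y0 ^ N = poly \<eta> x"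
        using Bc(4)[OF y(1) Bc(7)[OF y0(1), of N]] by (auto simp: adjoin1_def)
      obtain k h r where k: "h \<in> polys_over A" "r \<in> polys_over A" "Polynomial.smult (l ^ k) \<eta> = p * h + r"
         "\<forall>i\<ge>d. poly.coeff r i = 0"
        using pseudo_division[where e=d and n="Suc (Polynomial.degree \<eta>)", OF A p(1,2) \<eta>(1)] unfolding l_def by (auto simp: coeff_eq_0)
      have eq: "l ^ k * (y * y0 ^ N) = poly p x * poly h x + poly r x"
        using arg_cong[OF k(3), of "\<lambda>p. poly p x"] \<eta>(2) by simp
      \<comment> \<open>Reduce \<open>y y0^N\<close> modulo \<open>p\<close>; the difference \<open>?s\<close> has degree below \<open>d\<close> and lies in \<open>Q\<close> when evaluated at \<open>x\<close>, so its coefficients lie in \<open>Q\<close>.\<close>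
      let ?s = "Polynomial.smult a r - [:l ^ k * m ^ N:]"
      have "poly ?s x = - (poly p x * (a * poly h x) + (m - b * y0) * (l ^ k * w) + (b ^ N - a * y) * (l ^ k * y0 ^ N))"
      proof -
        have T1: "poly p x * (a * poly h x) = a * (l ^ k * (y * y0 ^ N)) - a * poly r x" using eq by (simp add: algebra_simps)
        have T2: "(m - b * y0) * (l ^ k * w) = l ^ k * (m ^ N - b ^ N * y0 ^ N)" using w(1)
          by (simp add: power_mult_distrib mult.left_commute)
        show ?thesis unfolding T1 T2 by (simp add: algebra_simps)
      qed
      also have "\<dots> = 0 - (poly p x * (a * poly h x) + (m - b * y0) * (l ^ k * w) + (b ^ N - a * y) * (l ^ k * y0 ^ N))" by simp
      also have "\<dots> \<in> Q" using p k a m b y0 y0' w l y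
        by - (rule Qdiff[OF Qz Qadd[OF Qadd[OF Qmul[of "poly p x"] Qmul[of "m - b * y0"]] Qmul[of "b ^ N - a * y"]]];
          simp add: memB)
      finally have "poly ?s x \<in> Q" .
      moreover have "?s \<in> polys_over A" using k a m l by (intro polys_over_closed[OF A] Ac) auto
      moreover have "poly.coeff ?s i = 0" if "i \<ge> d" for i using that d k(4) by (auto simp: coeff_pCons split: nat.split)
      ultimately have "poly.coeff ?s 0 \<in> Q" by (intro indep[of ?s 0])
      then have c0: "a * poly.coeff r 0 - l ^ k * m ^ N \<in> Q" by simp
      have r0: "poly.coeff r 0 \<in> A" using k by (auto simp: polys_over_def)
      have "(l * m) ^ (k + N) - a * (poly.coeff r 0 * (l ^ N * m ^ k)) = (a * poly.coeff r 0 - l ^ k * m ^ N) * (- (l ^ N * m ^ k))"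
        by (simp add: algebra_simps power_add power_mult_distrib)
      also have "\<dots> \<in> Q" using c0 a r0 l m by - (rule Qmul; simp add: memB)
      finally show "\<exists>M. \<exists>y\<in>A. (l * m) ^ M - a * y \<in> Q" using r0 l m
        by (intro exI[of _ "k + N"] bexI[of _ "poly.coeff r 0 * (l ^ N * m ^ k)"]) (simp_all add: memB)
    qed
  qed
qed

end

lemma unit_spread_trans:
  assumes AC: "unit_spread A C Q" and CB: "unit_spread C B Q" and "A \<subseteq> C"
  shows "unit_spread A B Q"
  unfolding unit_spread_def
proof
  fix b assume "b \<in> B - Q"
  then obtain f where f: "f \<in> C - Q" and
    fC: "\<forall>a\<in>C. (\<exists>N. \<exists>y\<in>B. b ^ N - a * y \<in> Q) \<longrightarrow> (\<exists>M. \<exists>y\<in>C. f ^ M - a * y \<in> Q)"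
    using CB[unfolded unit_spread_def, rule_format, of b] by blast
  from f obtain g where g: "g \<in> A - Q" and
    gA: "\<forall>a\<in>A. (\<exists>N. \<exists>y\<in>C. f ^ N - a * y \<in> Q) \<longrightarrow> (\<exists>M. \<exists>y\<in>A. g ^ M - a * y \<in> Q)"
    using AC[unfolded unit_spread_def, rule_format, of f] by blast
  show "\<exists>f\<in>A - Q. \<forall>a\<in>A. (\<exists>N. \<exists>y\<in>B. b ^ N - a * y \<in> Q) \<longrightarrow> (\<exists>M. \<exists>y\<in>A. f ^ M - a * y \<in> Q)"
  proof (intro bexI[of _ g] ballI impI)
    fix a assume a: "a \<in> A" and "\<exists>N. \<exists>y\<in>B. b ^ N - a * y \<in> Q"
    then have "\<exists>M. \<exists>y\<in>C. f ^ M - a * y \<in> Q" using fC[rule_format, of a] \<open>A \<subseteq> C\<close> by auto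
    then show "\<exists>M. \<exists>y\<in>A. g ^ M - a * y \<in> Q" using gA[rule_format, OF a] by simp
  qed (rule g)
qed

lemma unit_spread_adjoins:
  assumes "subring_set A" "prime_on Q (adjoins A xs)"
  shows "unit_spread A (adjoins A xs) Q"
  using assms
proof (induction xs arbitrary: A)
  case Nil
  then show ?case by (auto simp: unit_spread_def)
next
  case (Cons x xs)
  have "prime_on Q (adjoin1 A x)"
    using Cons.prems subring_adjoins(2)[OF subring_adjoin1(1)[OF Cons.prems(1)]] by (auto intro: prime_on_subset)
  then have "unit_spread A (adjoin1 A x) Q" by (rule unit_spread_adjoin1[OF Cons.prems(1)])
  moreover have "unit_spread (adjoin1 A x) (adjoins A (x # xs)) Q"
    using Cons.IH[OF subring_adjoin1(1)[OF Cons.prems(1)]] Cons.prems by simp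
  ultimately show ?case by (rule unit_spread_trans) (rule subring_adjoin1(2)[OF Cons.prems(1)])
qed

section \<open>Constants modulo a shift ideal\<close>

definition eval_at :: "('f::field \<Rightarrow> 'a::comm_ring_1) \<Rightarrow> 'a \<Rightarrow> 'f poly \<Rightarrow> 'a" where
  "eval_at \<kappa> c p = poly (map_poly \<kappa> p) c"

locale ring_map =
  fixes \<kappa> :: "'f::comm_ring_1 \<Rightarrow> 'a::comm_ring_1"
  assumes add: "\<kappa> (a + b) = \<kappa> a + \<kappa> b" and mult: "\<kappa> (a * b) = \<kappa> a * \<kappa> b" and one: "\<kappa> 1 = 1"
begin

lemma zero: "\<kappa> 0 = 0" using add[of 0 0] by simp
lemma uminus: "\<kappa> (- a) = - \<kappa> a" using add[of a "- a"] zero by (simp add: eq_neg_iff_add_eq_0 add.commute)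
lemma diff: "\<kappa> (a - b) = \<kappa> a - \<kappa> b" using add[of a "- b"] uminus[of b] by simp
lemma power: "\<kappa> (a ^ k) = \<kappa> a ^ k" by (induction k) (auto simp: one mult)
lemma sum: "\<kappa> (sum f I) = (\<Sum>i\<in>I. \<kappa> (f i))" by (induction I rule: infinite_finite_induct) (auto simp: zero add)
lemma prod: "\<kappa> (prod f I) = (\<Prod>i\<in>I. \<kappa> (f i))" by (induction I rule: infinite_finite_induct) (auto simp: one mult)

lemma subring_range: "subring_set (range \<kappa>)"
  unfolding subring_set_def by (metis (no_types, lifting) diff mult one rangeE rangeI)

end

locale field_map = ring_map \<kappa> for \<kappa> :: "'f::field \<Rightarrow> 'a::comm_ring_1"
begin

lemma eval_pCons: "eval_at \<kappa> c (pCons a p) = \<kappa> a + c * eval_at \<kappa> c p"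
  by (simp add: eval_at_def map_poly_pCons zero)

lemma eval_0: "eval_at \<kappa> c 0 = 0" by (simp add: eval_at_def)

lemma eval_1: "eval_at \<kappa> c 1 = 1" unfolding one_pCons by (simp add: eval_pCons eval_0 one)

lemma eval_add: "eval_at \<kappa> c (p + q) = eval_at \<kappa> c p + eval_at \<kappa> c q"
  by (induction p q rule: poly_induct2) (auto simp: eval_pCons eval_0 add algebra_simps)

lemma eval_smult: "eval_at \<kappa> c (Polynomial.smult a p) = \<kappa> a * eval_at \<kappa> c p"
  by (induction p) (auto simp: eval_pCons eval_0 mult algebra_simps)

lemma eval_mult: "eval_at \<kappa> c (p * q) = eval_at \<kappa> c p * eval_at \<kappa> c q"
  by (induction p) (auto simp: eval_pCons eval_0 eval_add eval_smult zero algebra_simps)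

lemma eval_diff: "eval_at \<kappa> c (p - q) = eval_at \<kappa> c p - eval_at \<kappa> c q"
  using eval_add[of c "p - q" q] by simp

lemma eval_power: "eval_at \<kappa> c (p ^ k) = eval_at \<kappa> c p ^ k"
  by (induction k) (auto simp: eval_1 eval_mult)

lemma adjoin1_range: "adjoin1 (range \<kappa>) c = range (eval_at \<kappa> c)"
proof
  show "range (eval_at \<kappa> c) \<subseteq> adjoin1 (range \<kappa>) c"
    unfolding adjoin1_def eval_at_def polys_over_def by (auto simp: coeff_map_poly zero)
  have "\<exists>q. p = map_poly \<kappa> q" if "p \<in> polys_over (range \<kappa>)" for p
    using that
  proof (induction p)
    case 0
    then show ?case by (intro exI[of _ 0]) simp
  next
    case (pCons a p)
    have "p \<in> polys_over (range \<kappa>)" unfolding polys_over_def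
    proof safe
      fix i show "poly.coeff p i \<in> range \<kappa>" using pCons.prems[unfolded polys_over_def, simplified, rule_format, of "Suc i"] by simp
    qed
    then obtain q where "p = map_poly \<kappa> q" using pCons.IH by blast
    moreover obtain b where "a = \<kappa> b" using pCons.prems[unfolded polys_over_def, simplified, rule_format, of 0] by auto
    ultimately show ?case by (intro exI[of _ "pCons b q"]) (simp add: map_poly_pCons zero)
  qed
  then show "adjoin1 (range \<kappa>) c \<subseteq> range (eval_at \<kappa> c)"
    unfolding adjoin1_def eval_at_def by fastforce
qed

end

text \<open>Krull's theorem: an ideal maximal among those avoiding a multiplicative set is prime.\<close>
lemma exists_prime_avoiding:
  assumes B: "subring_set B" and Q: "ideal_on Q B" "Q \<subseteq> B"
    and M: "1 \<in> M" "\<And>a b. a \<in> M \<Longrightarrow> b \<in> M \<Longrightarrow> a * b \<in> M" "M \<subseteq> B" "Q \<inter> M = {}"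
  obtains P where "Q \<subseteq> P" "P \<subseteq> B" "prime_on P B" "P \<inter> M = {}"
proof -
  define C where "C = {P. ideal_on P B \<and> P \<subseteq> B \<and> Q \<subseteq> P \<and> P \<inter> M = {}}"
  have "\<exists>P\<in>C. (\<forall>V\<in>C. P \<subseteq> V \<longrightarrow> V = P)"
  proof (rule subset_Zorn_nonempty)
    show "C \<noteq> {}" using assms by (auto simp: C_def)
    fix \<C> assume ne: "\<C> \<noteq> {}" and ch: "subset.chain C \<C>"
    have sub: "\<C> \<subseteq> C" using ch by (auto simp: subset.chain_def)
    have "ideal_on (\<Union>\<C>) B" unfolding ideal_on_def
    proof (intro conjI ballI)
      show "0 \<in> \<Union>\<C>" using ne sub by (auto simp: C_def ideal_on_def)
    next
      fix a b assume "a \<in> \<Union>\<C> \<inter> B" "b \<in> \<Union>\<C> \<inter> B"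
      then obtain V Y where XY: "V \<in> \<C>" "Y \<in> \<C>" "a \<in> V" "b \<in> Y" and ab: "a \<in> B" "b \<in> B" by auto
      then have "V \<subseteq> Y \<or> Y \<subseteq> V" using ch by (auto simp: subset.chain_def)
      then obtain Z where "Z \<in> \<C>" "a \<in> Z" "b \<in> Z" using XY by blast
      then show "a + b \<in> \<Union>\<C>" using sub ab unfolding C_def ideal_on_def by fastforce
    next
      fix a b assume "a \<in> \<Union>\<C> \<inter> B" "b \<in> B"
      then show "a * b \<in> \<Union>\<C>" using sub unfolding C_def ideal_on_def by fastforce
    qed
    then show "\<Union>\<C> \<in> C" using ne sub by (auto simp: C_def)
  qed
  then obtain P where PC: "P \<in> C" and mx: "\<forall>V\<in>C. P \<subseteq> V \<longrightarrow> V = P" by blast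
  then have P: "ideal_on P B" "P \<subseteq> B" "Q \<subseteq> P" "P \<inter> M = {}" by (auto simp: C_def)
  have max: "V = P" if "ideal_on V B" "V \<subseteq> B" "P \<subseteq> V" "V \<inter> M = {}" for V
    using mx[rule_format, of V] that P(3) by (auto simp: C_def)
  note Bc = subring_setD[OF B]
  have Padd: "u \<in> P \<Longrightarrow> v \<in> P \<Longrightarrow> u + v \<in> P" and Pmul: "u \<in> P \<Longrightarrow> v \<in> B \<Longrightarrow> u * v \<in> P" and P0: "0 \<in> P" for u v
    using P(1) Int_absorb2[OF P(2)] unfolding ideal_on_def by auto
  have ext: "\<exists>m\<in>M. \<exists>u\<in>P. \<exists>v\<in>B. m = u + a * v" if a: "a \<in> B" "a \<notin> P" for a
  proof (rule ccontr)
    assume no: "\<not> ?thesis"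
    define V where "V = {u + a * v | u v. u \<in> P \<and> v \<in> B}"
    have V0: "P \<subseteq> V" unfolding V_def using Bc(2) by force
    have aV: "a \<in> V" unfolding V_def using P0 Bc(1) by force
    have "ideal_on V B" unfolding ideal_on_def
    proof (intro conjI ballI)
      show "0 \<in> V" using V0 P0 by auto
    next
      fix x y assume "x \<in> V \<inter> B" "y \<in> V \<inter> B"
      then obtain u v u' v' where e: "x = u + a * v" "y = u' + a * v'" and m: "u \<in> P" "v \<in> B" "u' \<in> P" "v' \<in> B"
        unfolding V_def by blast
      have "x + y = (u + u') + a * (v + v')" by (simp add: e algebra_simps)
      then show "x + y \<in> V" unfolding V_def using Padd Bc(6) m by blast
    next
      fix x y assume "x \<in> V \<inter> B" "y \<in> B"
      then obtain u v where e: "x = u + a * v" and m: "u \<in> P" "v \<in> B" "y \<in> B"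
        unfolding V_def by blast
      have "x * y = (u * y) + a * (v * y)" by (simp add: e algebra_simps)
      then show "x * y \<in> V" unfolding V_def using Pmul Bc(4) m by blast
    qed
    moreover have "V \<subseteq> B" unfolding V_def using P(2) a by (auto intro!: Bc)
    moreover have "V \<inter> M = {}" using no unfolding V_def by blast
    ultimately have "V = P" using max V0 by blast
    then show False using aV a by blast
  qed
  have "a \<in> P \<or> b \<in> P" if ab: "a \<in> B" "b \<in> B" "a * b \<in> P" for a b
  proof (rule ccontr)
    assume "\<not> ?thesis"
    then obtain m u v m' u' v' where m: "m \<in> M" "u \<in> P" "v \<in> B" "m = u + a * v"
      and m': "m' \<in> M" "u' \<in> P" "v' \<in> B" "m' = u' + b * v'" using ext ab by meson
    have "m * m' = u * (u' + b * v') + (u' * (a * v) + (a * b) * (v * v'))" unfolding m m' by (simp add: algebra_simps)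
    also have "\<dots> \<in> P" by (intro Padd Pmul[OF m(2)] Pmul[OF m'(2)] Pmul[OF ab(3)] Bc) (use m m' ab P(2) in auto)
    finally show False using M(2)[OF m(1) m'(1)] P(4) by blast
  qed
  then have "prime_on P B" using P M(1) unfolding prime_on_def by blast
  then show ?thesis using that P by blast
qed

context field_map
begin

text \<open>Otherwise a prime over \<open>Q\<close> avoids all nonzero values at \<open>c\<close>, so \<open>F[c]\<close> is a polynomial ring modulo this
  prime. Spreading units from \<open>B\<close> down to \<open>F[c]\<close> produces one nonzero polynomial with a power
  divisible by all \<open>c - a\<close>, \<open>a \<in> K\<close>; it would have infinitely many roots.\<close>
theorem algebraic_if_translates_units:
  assumes Q: "ideal_on Q B" "1 \<notin> Q" and B: "B = adjoins (range \<kappa>) xs" and c: "c \<in> B"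
    and K: "infinite K" and unit: "\<And>a. a \<in> K \<Longrightarrow> \<exists>y\<in>B. (c - \<kappa> a) * y - 1 \<in> Q"
  shows "\<exists>p. p \<noteq> 0 \<and> eval_at \<kappa> c p \<in> Q"
proof (rule ccontr)
  assume no: "\<not> ?thesis"
  have rB: "subring_set B" unfolding B by (rule subring_adjoins(1)[OF subring_range])
  have kB: "range \<kappa> \<subseteq> B" unfolding B by (rule subring_adjoins(2)[OF subring_range])
  let ?A = "adjoin1 (range \<kappa>) c"
  let ?M = "eval_at \<kappa> c ` {p. p \<noteq> 0}"
  have AB: "?A \<subseteq> B" by (rule adjoin1_minimal[OF rB kB c])
  have m1: "ideal_on (Q \<inter> B) B" using Q(1) subring_setD[OF rB] unfolding ideal_on_def by auto
  have m2: "?M \<subseteq> B" using AB unfolding adjoin1_range by auto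
  have m3: "1 \<in> ?M" by (intro image_eqI[of _ _ 1]) (auto simp: eval_1)
  have m4: "a * b \<in> ?M" if "a \<in> ?M" "b \<in> ?M" for a b
  proof -
    obtain p q where "p \<noteq> 0" "q \<noteq> 0" "a = eval_at \<kappa> c p" "b = eval_at \<kappa> c q" using \<open>a \<in> ?M\<close> \<open>b \<in> ?M\<close> by auto
    then show ?thesis by (intro image_eqI[of _ _ "p * q"]) (auto simp: eval_mult)
  qed
  have m5: "(Q \<inter> B) \<inter> ?M = {}" using no by blast
  obtain P where P: "Q \<inter> B \<subseteq> P" "P \<subseteq> B" "prime_on P B" "P \<inter> ?M = {}"
    by (rule exists_prime_avoiding[OF rB m1 Int_lower2 m3 m4 m2 m5])
  have sub: "adjoins ?A xs = B"
  proof
    show "adjoins ?A xs \<subseteq> B" using AB subring_adjoins(3)[OF subring_range, of xs]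
      by (intro adjoins_minimal[OF rB]) (auto simp: B)
    have A: "subring_set ?A" by (rule subring_adjoin1(1)[OF subring_range])
    show "B \<subseteq> adjoins ?A xs" unfolding B
      using subring_adjoins[OF A, of xs] subring_adjoin1(2)[OF subring_range, of c]
      by (intro adjoins_minimal) auto
  qed
  have "unit_spread ?A B P"
    using unit_spread_adjoins[OF subring_adjoin1(1)[OF subring_range], of P c xs] P(3) by (simp add: sub)
  moreover have "1 \<in> B - P" using P(3) subring_setD(1)[OF rB] by (auto simp: prime_on_def)
  ultimately obtain f where f: "f \<in> ?A - P" and
    spread: "\<forall>a\<in>?A. (\<exists>N. \<exists>y\<in>B. 1 ^ N - a * y \<in> P) \<longrightarrow> (\<exists>M. \<exists>y\<in>?A. f ^ M - a * y \<in> P)"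
    unfolding unit_spread_def by blast
  obtain p where p: "f = eval_at \<kappa> c p" using f unfolding adjoin1_range by blast
  have zP: "q = 0" if "eval_at \<kappa> c q \<in> P" for q using P(4) that by blast
  have root: "poly p a = 0" if "a \<in> K" for a
  proof -
    have lin: "eval_at \<kappa> c [:- a, 1:] = c - \<kappa> a" by (simp add: eval_pCons eval_0 one uminus)
    then have cA: "c - \<kappa> a \<in> ?A" unfolding adjoin1_range by (metis rangeI)
    obtain y where y: "y \<in> B" "(c - \<kappa> a) * y - 1 \<in> Q" using unit \<open>a \<in> K\<close> by blast
    have "u * v \<in> P" if "u \<in> P" "v \<in> B" for u v
      using P(3) Int_absorb2[OF P(2)] that unfolding prime_on_def ideal_on_def by auto
    moreover have "(c - \<kappa> a) * y - 1 \<in> Q \<inter> B" using y cA AB subring_setD[OF rB] by auto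
    ultimately have "((c - \<kappa> a) * y - 1) * (-1) \<in> P"
      using P(1) subring_setD(5)[OF rB subring_setD(1)[OF rB]] by blast
    then have "1 ^ 0 - (c - \<kappa> a) * y \<in> P" by simp
    then obtain M z where z: "z \<in> ?A" "f ^ M - (c - \<kappa> a) * z \<in> P" using spread cA y(1) by blast
    then obtain q where q: "z = eval_at \<kappa> c q" unfolding adjoin1_range by blast
    have "eval_at \<kappa> c (p ^ M - [:- a, 1:] * q) \<in> P" using z(2) by (simp only: eval_diff eval_power eval_mult lin q p)
    then have "p ^ M - [:- a, 1:] * q = 0" by (rule zP)
    then have "poly (p ^ M - [:- a, 1:] * q) a = 0" by simp
    then have "poly p a ^ M = 0" by simp
    then show ?thesis by simp
  qed
  have "p = 0"
  proof (rule ccontr)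
    assume "p \<noteq> 0"
    then have "finite {a. poly p a = 0}" by (rule poly_roots_finite)
    then show False using K root by (meson finite_subset mem_Collect_eq subsetI)
  qed
  then have "f = 0" by (simp add: p eval_0)
  then show False using f P(3) by (auto simp: prime_on_def ideal_on_def)
qed

text \<open>The monic polynomial of least degree killing \<open>c\<close> modulo \<open>Q\<close> has invariant coefficients, since applying
  \<open>\<sigma>\<close> to the coefficients gives another one. It therefore has a root \<open>a\<close> among the constants, and since
  \<open>c - a\<close> is a unit the factor \<open>c - a\<close> can be cancelled, contradicting minimality.\<close>
theorem constants_mod_simple_ideal:
  fixes \<sigma> :: "'f \<Rightarrow> 'f" and \<Sigma> :: "'a \<Rightarrow> 'a"
  assumes Q: "ideal_on Q B" "1 \<notin> Q" and B: "B = adjoins (range \<kappa>) xs" and c: "c \<in> B"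
    and \<sigma>: "ring_map \<sigma>" and \<Sigma>: "ring_map \<Sigma>" "\<And>a. \<Sigma> (\<kappa> a) = \<kappa> (\<sigma> a)" "\<And>q. q \<in> Q \<Longrightarrow> q \<in> B \<Longrightarrow> \<Sigma> q \<in> Q"
    and \<Sigma>B: "\<And>q. q \<in> B \<Longrightarrow> \<Sigma> q \<in> B"
    and inf: "infinite (fixed_field \<sigma>)"
    and closed: "\<And>p. (\<forall>i. poly.coeff p i \<in> fixed_field \<sigma>) \<Longrightarrow> Polynomial.degree p > 0 \<Longrightarrow> \<exists>a\<in>fixed_field \<sigma>. poly p a = 0"
    and unit: "\<And>x. x \<in> B \<Longrightarrow> \<Sigma> x - x \<in> Q \<Longrightarrow> x \<notin> Q \<Longrightarrow> \<exists>y\<in>B. x * y - 1 \<in> Q"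
    and inv: "\<Sigma> c - c \<in> Q"
  shows "\<exists>a\<in>fixed_field \<sigma>. c - \<kappa> a \<in> Q"
proof (rule ccontr)
  assume no: "\<not> ?thesis"
  interpret s: ring_map \<sigma> by (rule \<sigma>)
  interpret S: ring_map \<Sigma> by (rule \<Sigma>(1))
  have rB: "subring_set B" unfolding B by (rule subring_adjoins(1)[OF subring_range])
  have kB: "\<kappa> a \<in> B" for a using subring_adjoins(2)[OF subring_range, of xs] unfolding B by auto
  note Bc = subring_setD[OF rB]
  have evB: "eval_at \<kappa> c p \<in> B" for p
    using adjoin1_minimal[OF rB _ c, of "range \<kappa>"] kB unfolding adjoin1_range by auto
  have Qadd: "u \<in> Q \<Longrightarrow> v \<in> Q \<Longrightarrow> u \<in> B \<Longrightarrow> v \<in> B \<Longrightarrow> u + v \<in> Q"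
    and Qmul: "u \<in> Q \<Longrightarrow> u \<in> B \<Longrightarrow> v \<in> B \<Longrightarrow> u * v \<in> Q" and Q0: "0 \<in> Q" for u v
    using Q(1) unfolding ideal_on_def by auto
  have Qdiff: "u \<in> Q \<Longrightarrow> v \<in> Q \<Longrightarrow> u \<in> B \<Longrightarrow> v \<in> B \<Longrightarrow> u - v \<in> Q" for u v
    using Qadd[of u "v * (-1)"] Qmul[of v "-1"] Bc by auto
  have u: "\<exists>y\<in>B. (c - \<kappa> a) * y - 1 \<in> Q" if "a \<in> fixed_field \<sigma>" for a
  proof (rule unit)
    show "c - \<kappa> a \<in> B" using c kB by (auto intro: Bc)
    show "\<Sigma> (c - \<kappa> a) - (c - \<kappa> a) \<in> Q" using inv that by (simp add: S.diff \<Sigma>(2) fixed_field_def)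
    show "c - \<kappa> a \<notin> Q" using no that by blast
  qed
  have ex: "\<exists>p. p \<noteq> 0 \<and> eval_at \<kappa> c p \<in> Q"
    by (rule algebraic_if_translates_units[OF Q B c inf u])
  define n where "n = (LEAST n. \<exists>p. p \<noteq> 0 \<and> eval_at \<kappa> c p \<in> Q \<and> Polynomial.degree p = n)"
  obtain p where p: "p \<noteq> 0" "eval_at \<kappa> c p \<in> Q" "Polynomial.degree p = n"
    using LeastI_ex[of "\<lambda>n. \<exists>p. p \<noteq> 0 \<and> eval_at \<kappa> c p \<in> Q \<and> Polynomial.degree p = n"] ex unfolding n_def by blast
  have min: "q = 0" if "eval_at \<kappa> c q \<in> Q" "Polynomial.degree q < n" for q
    using not_less_Least[of "Polynomial.degree q" "\<lambda>n. \<exists>p. p \<noteq> 0 \<and> eval_at \<kappa> c p \<in> Q \<and> Polynomial.degree p = n"] that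
    unfolding n_def by blast
  define m where "m = Polynomial.smult (inverse (poly.coeff p n)) p"
  have lc: "poly.coeff p n \<noteq> 0" using p by auto
  have m: "eval_at \<kappa> c m \<in> Q" "poly.coeff m n = 1" "Polynomial.degree m = n" "m \<noteq> 0"
    using p lc Qmul[OF p(2) evB kB] by (auto simp: m_def eval_smult mult.commute[of "\<kappa> _"])
  have n: "n > 0"
  proof (rule ccontr)
    assume "\<not> n > 0"
    then have "m = 1" using m by (metis degree_eq_zeroE coeff_pCons_0 gr0I one_pCons)
    then show False using m(1) Q(2) by (simp add: eval_1)
  qed
  \<comment> \<open>Applying \<open>\<sigma>\<close> to coefficients agrees with \<open>\<Sigma>\<close> up to a multiple of \<open>c - \<Sigma> c\<close>.\<close>
  have ev\<sigma>: "\<exists>w\<in>B. eval_at \<kappa> c (map_poly \<sigma> q) - \<Sigma> (eval_at \<kappa> c q) = (c - \<Sigma> c) * w" for q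
  proof (induction q)
    case 0
    then show ?case using Bc(2) by (intro bexI[of _ 0]) (auto simp: eval_0 S.zero)
  next
    case (pCons a q)
    then obtain w where w: "w \<in> B" "eval_at \<kappa> c (map_poly \<sigma> q) - \<Sigma> (eval_at \<kappa> c q) = (c - \<Sigma> c) * w" by blast
    have "eval_at \<kappa> c (map_poly \<sigma> (pCons a q)) - \<Sigma> (eval_at \<kappa> c (pCons a q))
       = c * eval_at \<kappa> c (map_poly \<sigma> q) - \<Sigma> c * \<Sigma> (eval_at \<kappa> c q)"
      by (simp add: eval_pCons map_poly_pCons s.zero S.add S.mult \<Sigma>(2))
    also have "\<dots> = c * (eval_at \<kappa> c (map_poly \<sigma> q) - \<Sigma> (eval_at \<kappa> c q)) + (c - \<Sigma> c) * \<Sigma> (eval_at \<kappa> c q)"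
      by (simp add: algebra_simps)
    also have "\<dots> = (c - \<Sigma> c) * (c * w + \<Sigma> (eval_at \<kappa> c q))" unfolding w(2) by (simp add: algebra_simps)
    finally show ?case using w(1) c \<Sigma>B[OF evB] by (intro bexI[of _ "c * w + \<Sigma> (eval_at \<kappa> c q)"]) (auto intro: Bc)
  qed
  have "eval_at \<kappa> c (map_poly \<sigma> m) \<in> Q"
  proof -
    obtain w where w: "w \<in> B" "eval_at \<kappa> c (map_poly \<sigma> m) - \<Sigma> (eval_at \<kappa> c m) = (c - \<Sigma> c) * w" using ev\<sigma> by blast
    have "eval_at \<kappa> c (map_poly \<sigma> m) = (\<Sigma> c - c) * (- w) + \<Sigma> (eval_at \<kappa> c m)" using w(2) by (simp add: algebra_simps)
    also have "\<dots> \<in> Q" using \<Sigma>(3)[OF m(1) evB] \<Sigma>B[OF evB, of m] \<Sigma>B[OF c] c w(1) inv Bc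
      by - (rule Qadd[OF Qmul]; simp)
    finally show ?thesis .
  qed
  then have "eval_at \<kappa> c (map_poly \<sigma> m - m) \<in> Q" unfolding eval_diff using m(1) evB by (intro Qdiff) auto
  moreover have "map_poly \<sigma> m - m = 0 \<or> Polynomial.degree (map_poly \<sigma> m - m) < n"
  proof (cases "map_poly \<sigma> m - m = 0")
    case False
    have c0: "poly.coeff (map_poly \<sigma> m - m) i = 0" if "i \<ge> n" for i
    proof (cases "i = n")
      case True then show ?thesis using m by (simp add: coeff_map_poly s.zero s.one)
    next
      case False then show ?thesis using that m by (simp add: coeff_map_poly s.zero coeff_eq_0)
    qed
    then show ?thesis using False by (meson leading_coeff_neq_0 not_le_imp_less)
  qed simp
  ultimately have fx: "map_poly \<sigma> m = m" using min by fastforce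
  have "poly.coeff m i \<in> fixed_field \<sigma>" for i
    using arg_cong[OF fx, of "\<lambda>p. poly.coeff p i"] by (simp add: coeff_map_poly s.zero fixed_field_def)
  then obtain a where a: "a \<in> fixed_field \<sigma>" "poly m a = 0" using closed[of m] n m by auto
  then obtain q where q: "m = [:- a, 1:] * q" using poly_eq_0_iff_dvd by (metis dvdE)
  have q0: "q \<noteq> 0" using q m(4) by auto
  have dq: "Polynomial.degree q < n" using m(3) q0 unfolding q by (subst (asm) degree_mult_eq) auto
  have lin: "eval_at \<kappa> c [:- a, 1:] = c - \<kappa> a" by (simp add: eval_pCons eval_0 one uminus)
  obtain y where y: "y \<in> B" "(c - \<kappa> a) * y - 1 \<in> Q" using u[OF a(1)] by blast
  let ?e = "eval_at \<kappa> c q"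
  have em: "(c - \<kappa> a) * ?e \<in> Q" using m(1) unfolding q eval_mult lin by simp
  have "?e = ((c - \<kappa> a) * ?e) * y - ((c - \<kappa> a) * y - 1) * ?e" by (simp add: algebra_simps)
  also have "\<dots> \<in> Q" using em y evB kB c Bc by - (rule Qdiff[OF Qmul Qmul]; simp)
  finally have "q = 0" using min dq by blast
  then show False using q0 by blast
qed

end

section \<open>Multivariate polynomials\<close>

text \<open>Homomorphisms defined on a subring only: the embedding of \<open>K\<close> into its differential closure has no
  meaning outside \<open>K\<close>.\<close>
locale ring_map_on =
  fixes C :: "'a::comm_ring_1 set" and h :: "'a \<Rightarrow> 'b::comm_ring_1"
  assumes C: "subring_set C"
    and add: "a \<in> C \<Longrightarrow> b \<in> C \<Longrightarrow> h (a + b) = h a + h b"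
    and mult: "a \<in> C \<Longrightarrow> b \<in> C \<Longrightarrow> h (a * b) = h a * h b"
    and one: "h 1 = 1"
begin

lemmas C_closed = subring_setD[OF C]

lemma zero: "h 0 = 0" using add[of 0 0] C_closed by simp
lemma uminus: "a \<in> C \<Longrightarrow> h (- a) = - h a"
  using add[of a "- a"] zero C_closed by (simp add: eq_neg_iff_add_eq_0 add.commute)
lemma diff: "a \<in> C \<Longrightarrow> b \<in> C \<Longrightarrow> h (a - b) = h a - h b"
  using add[of a "- b"] uminus[of b] C_closed by simp
lemma sum: "(\<And>i. i \<in> S \<Longrightarrow> f i \<in> C) \<Longrightarrow> h (sum f S) = (\<Sum>i\<in>S. h (f i))"
  by (induction S rule: infinite_finite_induct) (auto simp: zero add subring_set_sum[OF C])
lemma prod: "(\<And>i. i \<in> S \<Longrightarrow> f i \<in> C) \<Longrightarrow> h (prod f S) = (\<Prod>i\<in>S. h (f i))"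
  by (induction S rule: infinite_finite_induct) (auto simp: one mult subring_set_prod[OF C])
lemma of_nat: "h (of_nat k) = of_nat k"
proof (induction k)
  case (Suc k)
  have "of_nat k \<in> C" using C_closed by (induction k) auto
  then show ?case using Suc add C_closed one by simp
qed (simp add: zero)

lemma det:
  assumes "\<And>i j. M $ i $ j \<in> C"
  shows "h (det (M :: 'a^'n^'n::finite)) = det (map_matrix h M)"
proof -
  have s: "of_int (sign p) \<in> C \<and> h (of_int (sign p)) = of_int (sign p)" for p :: "'n \<Rightarrow> 'n"
    using C_closed one uminus[of 1] by (auto simp: sign_def)
  have m: "of_int (sign p) * (\<Prod>i\<in>UNIV. M $ i $ p i) \<in> C" for p
    using assms s by (intro C_closed subring_set_prod[OF C]) auto
  show ?thesis unfolding det_def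
    using assms s by (subst sum) (auto simp: m mult prod subring_set_prod[OF C])
qed

end

lemma subring_set_det:
  assumes "subring_set A" "\<And>i j. M $ i $ j \<in> A"
  shows "det (M :: 'a::comm_ring_1^'n^'n::finite) \<in> A"
proof -
  have "of_int (sign p) \<in> A" for p :: "'n \<Rightarrow> 'n"
    using subring_setD[OF assms(1)] by (auto simp: sign_def)
  then show ?thesis unfolding det_def using assms
    by (intro subring_set_sum subring_setD subring_set_prod) auto
qed

lemma subring_set_UNIV: "subring_set UNIV" by (simp add: subring_set_def)

locale derivation =
  fixes d :: "'a::comm_ring_1 \<Rightarrow> 'a"
  assumes add: "d (a + b) = d a + d b" and mult: "d (a * b) = d a * b + a * d b"
begin

lemma zero: "d 0 = 0" using add[of 0 0] by simp
lemma one: "d 1 = 0" using mult[of 1 1] by simp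
lemma uminus: "d (- a) = - d a" using add[of a "- a"] zero by (simp add: eq_neg_iff_add_eq_0 add.commute)
lemma diff: "d (a - b) = d a - d b" using add[of a "- b"] uminus[of b] by simp
lemma sum: "d (sum f S) = (\<Sum>i\<in>S. d (f i))" by (induction S rule: infinite_finite_induct) (auto simp: zero add)
lemma of_nat: "d (of_nat k) = 0" by (induction k) (auto simp: zero add one)

lemma matrix_mult:
  "map_matrix d (M ** N) = map_matrix d M ** N + M ** map_matrix d N"
  by (simp add: vec_eq_iff matrix_matrix_mult_def sum mult sum.distrib)

lemma matrix_one: "map_matrix d (mat 1) = 0"
  by (simp add: vec_eq_iff mat_def one zero)

end

lemma poly_mapping_sum_single: "p = (\<Sum>\<alpha>\<in>Poly_Mapping.keys p. Poly_Mapping.single \<alpha> (Poly_Mapping.lookup p \<alpha>))"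
  by (rule poly_mapping_eqI) (auto simp: lookup_sum lookup_single when_def in_keys_iff)

lemma mpols_over_UNIV: "mpols_over UNIV = UNIV" by (simp add: mpols_over_def)

lemma mpols_over_single: "0 \<in> C \<Longrightarrow> a \<in> C \<Longrightarrow> Poly_Mapping.single \<alpha> a \<in> mpols_over C"
  by (auto simp: mpols_over_def lookup_single when_def)

lemma mpols_over_add:
  assumes "subring_set C" "p \<in> mpols_over C" "q \<in> mpols_over C"
  shows "p + q \<in> mpols_over C" "p - q \<in> mpols_over C" "0 \<in> mpols_over C"
  using assms subring_setD[OF assms(1)] by (auto simp: mpols_over_def lookup_add lookup_minus)

lemma mpols_over_zero: "subring_set C \<Longrightarrow> 0 \<in> mpols_over C"
  using subring_setD(2) by (auto simp: mpols_over_def)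

lemma mpols_over_induct [consumes 2, case_names single add]:
  assumes p: "p \<in> mpols_over C" and C: "subring_set C"
    and s: "\<And>\<alpha> a. a \<in> C \<Longrightarrow> P (Poly_Mapping.single \<alpha> a)"
    and a: "\<And>p q. p \<in> mpols_over C \<Longrightarrow> q \<in> mpols_over C \<Longrightarrow> P p \<Longrightarrow> P q \<Longrightarrow> P (p + q)"
  shows "P p"
proof -
  have z: "P 0" using s[of 0 0] subring_setD(2)[OF C] by simp
  have pl: "Poly_Mapping.lookup p \<alpha> \<in> C" for \<alpha> using p by (auto simp: mpols_over_def)
  have "(\<Sum>\<alpha>\<in>S. Poly_Mapping.single \<alpha> (Poly_Mapping.lookup p \<alpha>)) \<in> mpols_over C \<and>
        P (\<Sum>\<alpha>\<in>S. Poly_Mapping.single \<alpha> (Poly_Mapping.lookup p \<alpha>))" for S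
    using subring_setD(2)[OF C]
    by (induction S rule: infinite_finite_induct)
       (auto intro!: s a mpols_over_single mpols_over_add(1)[OF C] z mpols_over_zero[OF C] pl)
  then show ?thesis using poly_mapping_sum_single[of p] by metis
qed

lemma mpols_over_mult:
  assumes C: "subring_set C" and p: "p \<in> mpols_over C" and q: "q \<in> mpols_over C"
  shows "p * q \<in> mpols_over C"
  using p C
proof (induction rule: mpols_over_induct)
  case (single \<alpha> a)
  show ?case using q C
  proof (induction rule: mpols_over_induct)
    case (single \<beta> b)
    then show ?case using \<open>a \<in> C\<close> subring_setD[OF C] by (auto simp: mult_single intro: mpols_over_single)
  qed (auto simp: distrib_left intro: mpols_over_add C)
qed (auto simp: distrib_right intro: mpols_over_add C)

lemma subring_mpols_over:
  assumes "subring_set C" shows "subring_set (mpols_over C)"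
  unfolding subring_set_def
proof (intro conjI ballI)
  show "1 \<in> mpols_over C" using assms subring_setD[OF assms] mpols_over_single[of C 1 0] by simp
qed (auto intro: mpols_over_add mpols_over_mult assms)

lemma mpol_const_closed: "subring_set C \<Longrightarrow> a \<in> C \<Longrightarrow> mpol_const a \<in> mpols_over C"
  unfolding mpol_const_def by (auto intro: mpols_over_single subring_setD)

lemma mpol_var_closed: "subring_set C \<Longrightarrow> mpol_var v \<in> mpols_over C"
  unfolding mpol_var_def by (auto intro: mpols_over_single subring_setD)

lemma mpol_const_map: "ring_map_on UNIV mpol_const"
  by unfold_locales (auto simp: mpol_const_def subring_set_UNIV single_add mult_single)

lemma mpol_const_eq_iff: "mpol_const a = mpol_const b \<longleftrightarrow> a = b"
  unfolding mpol_const_def by (metis lookup_single_eq)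

lemma mpol_var_power: "mpol_var v ^ k = Poly_Mapping.single (Poly_Mapping.single v k) 1"
  by (induction k) (auto simp: mpol_var_def mult_single simp flip: single_add)

lemma single_eq_const_times_vars:
  "Poly_Mapping.single \<alpha> a = mpol_const a * (\<Prod>v\<in>Poly_Mapping.keys \<alpha>. mpol_var v ^ Poly_Mapping.lookup \<alpha> v)"
proof -
  have "(\<Prod>v\<in>S. mpol_var v ^ g v) = Poly_Mapping.single (\<Sum>v\<in>S. Poly_Mapping.single v (g v)) (1::'b)" if "finite S" for S and g :: "'a \<Rightarrow> nat"
    using that by (induction S) (auto simp: mpol_var_power mult_single)
  from this[of "Poly_Mapping.keys \<alpha>" "Poly_Mapping.lookup \<alpha>"] show ?thesis
    by (simp add: mpol_const_def mult_single flip: poly_mapping_sum_single)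
qed

lemma mpol_induct [consumes 2, case_names const var add mult]:
  assumes p: "p \<in> mpols_over C" and C: "subring_set C"
    and c: "\<And>a. a \<in> C \<Longrightarrow> P (mpol_const a)" and v: "\<And>v. P (mpol_var v)"
    and a: "\<And>p q. p \<in> mpols_over C \<Longrightarrow> q \<in> mpols_over C \<Longrightarrow> P p \<Longrightarrow> P q \<Longrightarrow> P (p + q)"
    and m: "\<And>p q. p \<in> mpols_over C \<Longrightarrow> q \<in> mpols_over C \<Longrightarrow> P p \<Longrightarrow> P q \<Longrightarrow> P (p * q)"
  shows "P p"
  using p C
proof (induction rule: mpols_over_induct)
  case (single \<alpha> b)
  note R = subring_mpols_over[OF C]
  have one: "P 1" using c[of 1] subring_setD(1)[OF C] by (simp add: mpol_const_def)
  have pw: "mpol_var v ^ k \<in> mpols_over C \<and> P (mpol_var v ^ k)" for v k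
    using one by (induction k) (auto intro: v m subring_setD[OF R] mpol_var_closed[OF C])
  have "(\<Prod>v\<in>S. mpol_var v ^ g v) \<in> mpols_over C \<and> P (\<Prod>v\<in>S. mpol_var v ^ g v)" for S g
    using pw by (induction S rule: infinite_finite_induct) (auto intro: m subring_setD[OF R] one)
  then show ?case unfolding single_eq_const_times_vars using c[OF single] mpol_const_closed[OF C single] m by blast
qed (use a in blast)

subsection \<open>Substitution\<close>

definition monom_value :: "('v \<Rightarrow> 'b::comm_ring_1) \<Rightarrow> ('v \<Rightarrow>\<^sub>0 nat) \<Rightarrow> 'b" where
  "monom_value f \<alpha> = (\<Prod>v\<in>Poly_Mapping.keys \<alpha>. f v ^ Poly_Mapping.lookup \<alpha> v)"

lemma monom_value_superset:
  assumes "finite S" "Poly_Mapping.keys \<alpha> \<subseteq> S"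
  shows "monom_value f \<alpha> = (\<Prod>v\<in>S. f v ^ Poly_Mapping.lookup \<alpha> v)"
  unfolding monom_value_def using assms by (intro prod.mono_neutral_left) (auto simp: in_keys_iff)

lemma monom_value_add: "monom_value f (\<alpha> + \<beta>) = monom_value f \<alpha> * monom_value f \<beta>"
proof -
  let ?S = "Poly_Mapping.keys \<alpha> \<union> Poly_Mapping.keys \<beta>"
  have "Poly_Mapping.keys (\<alpha> + \<beta>) \<subseteq> ?S" by (rule keys_add)
  then show ?thesis
    by (simp add: monom_value_superset[of ?S] lookup_add power_add prod.distrib)
qed

text \<open>Both \<open>mpol_subst\<close> and \<open>mpol_deriv\<close> are sums over the support of terms additive in the coefficient; the
  only obstacle to additivity is that the support of a sum is not the union of the supports.\<close>
lemma keys_sum_additive: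
  fixes F :: "('v \<Rightarrow>\<^sub>0 nat) \<Rightarrow> 'a::comm_ring_1 \<Rightarrow> 'c::comm_monoid_add"
  assumes C: "0 \<in> C" and p: "p \<in> mpols_over C" "q \<in> mpols_over C"
    and z: "\<And>\<alpha>. F \<alpha> 0 = 0" and a: "\<And>\<alpha> a b. a \<in> C \<Longrightarrow> b \<in> C \<Longrightarrow> F \<alpha> (a + b) = F \<alpha> a + F \<alpha> b"
  shows "(\<Sum>\<alpha>\<in>Poly_Mapping.keys (p + q). F \<alpha> (Poly_Mapping.lookup (p + q) \<alpha>)) =
    (\<Sum>\<alpha>\<in>Poly_Mapping.keys p. F \<alpha> (Poly_Mapping.lookup p \<alpha>)) + (\<Sum>\<alpha>\<in>Poly_Mapping.keys q. F \<alpha> (Poly_Mapping.lookup q \<alpha>))"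
proof -
  let ?S = "Poly_Mapping.keys p \<union> Poly_Mapping.keys q"
  have e: "(\<Sum>\<alpha>\<in>Poly_Mapping.keys r. F \<alpha> (Poly_Mapping.lookup r \<alpha>)) = (\<Sum>\<alpha>\<in>?S. F \<alpha> (Poly_Mapping.lookup r \<alpha>))"
    if "Poly_Mapping.keys r \<subseteq> ?S" for r
    using that by (intro sum.mono_neutral_left) (auto simp: in_keys_iff z)
  have pl: "Poly_Mapping.lookup p \<alpha> \<in> C" "Poly_Mapping.lookup q \<alpha> \<in> C" for \<alpha>
    using p by (auto simp: mpols_over_def)
  show ?thesis unfolding e[OF keys_add] e[OF Un_upper1] e[OF Un_upper2] by (simp add: lookup_add a pl sum.distrib)
qed

context ring_map_on
begin

lemma subst_add:
  assumes "p \<in> mpols_over C" "q \<in> mpols_over C"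
  shows "mpol_subst h f (p + q) = mpol_subst h f p + mpol_subst h f q"
  unfolding mpol_subst_def
  by (rule keys_sum_additive[OF C_closed(2) assms]) (auto simp: zero add distrib_right)

lemma subst_single: "mpol_subst h f (Poly_Mapping.single \<alpha> a) = h a * monom_value f \<alpha>"
  by (cases "a = 0") (auto simp: mpol_subst_def monom_value_def zero)

lemma subst_const: "mpol_subst h f (mpol_const a) = h a"
  by (simp add: mpol_const_def subst_single monom_value_def)

lemma subst_var: "mpol_subst h f (mpol_var v) = f v"
  by (simp add: mpol_var_def subst_single monom_value_def one)

lemma subst_mult:
  assumes p: "p \<in> mpols_over C" and q: "q \<in> mpols_over C"
  shows "mpol_subst h f (p * q) = mpol_subst h f p * mpol_subst h f q"
  using p C
proof (induction rule: mpols_over_induct)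
  case (single \<alpha> a)
  show ?case using q C
  proof (induction rule: mpols_over_induct)
    case (single \<beta> b)
    then show ?case using \<open>a \<in> C\<close> by (simp add: mult_single subst_single mult monom_value_add ac_simps)
  next
    case (add p q)
    have m: "Poly_Mapping.single \<alpha> a * p \<in> mpols_over C" "Poly_Mapping.single \<alpha> a * q \<in> mpols_over C"
      using add \<open>a \<in> C\<close> C_closed(2) by (auto intro!: mpols_over_mult C mpols_over_single)
    show ?case using add by (simp add: distrib_left subst_add m)
  qed
next
  case (add p1 p2)
  have m: "p1 * q \<in> mpols_over C" "p2 * q \<in> mpols_over C"
    using add q by (auto intro!: mpols_over_mult C)
  show ?case using add by (simp add: distrib_right subst_add m)
qed

lemma subst_map: "ring_map_on (mpols_over C) (mpol_subst h f)"
proof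
  show "mpol_subst h f 1 = 1" using subst_const[of f 1] one by (simp add: mpol_const_def)
qed (auto simp: subring_mpols_over C subst_add subst_mult)

lemma map_eq_subst:
  assumes "p \<in> mpols_over C"
  shows "Poly_Mapping.map h p = mpol_subst (\<lambda>a. mpol_const (h a)) mpol_var p"
proof -
  have "Poly_Mapping.map h p = (\<Sum>\<alpha>\<in>Poly_Mapping.keys p. Poly_Mapping.single \<alpha> (h (Poly_Mapping.lookup p \<alpha>)))"
    by (rule poly_mapping_eqI) (auto simp: lookup_sum lookup_single when_def in_keys_iff Poly_Mapping.map.rep_eq)
  then show ?thesis unfolding mpol_subst_def single_eq_const_times_vars by simp
qed

lemma const_comp: "ring_map_on C (\<lambda>a. mpol_const (h a))"
  by unfold_locales (auto simp: C add mult one mpol_const_def single_add mult_single)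

lemma coeff_map: "ring_map_on (mpols_over C :: ('v, 'a) mpol set) (Poly_Mapping.map h)"
proof -
  interpret c: ring_map_on C "\<lambda>a. mpol_const (h a)" by (rule const_comp)
  interpret s: ring_map_on "mpols_over C :: ('v, 'a) mpol set" "mpol_subst (\<lambda>a. mpol_const (h a)) mpol_var" by (rule c.subst_map)
  show ?thesis
    by unfold_locales
      (use s.add s.mult s.one s.C_closed in \<open>auto simp: map_eq_subst intro: s.C\<close>)
qed

lemma map_const: "Poly_Mapping.map h (mpol_const a) = mpol_const (h a)"
  by (simp add: mpol_const_def zero)

lemma map_var: "Poly_Mapping.map h (mpol_var v) = mpol_var v"
  by (simp add: mpol_var_def zero one)

end

subsection \<open>Derivations\<close>

context derivation
begin

text \<open>The summand of \<open>mpol_deriv\<close> that belongs to the monomial \<open>\<alpha>\<close>.\<close>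
definition term_deriv :: "('v \<Rightarrow> ('v, 'a) mpol) \<Rightarrow> ('v \<Rightarrow>\<^sub>0 nat) \<Rightarrow> 'a \<Rightarrow> ('v, 'a) mpol" where
  "term_deriv dv \<alpha> a = Poly_Mapping.single \<alpha> (d a) +
     (\<Sum>v\<in>Poly_Mapping.keys \<alpha>. Poly_Mapping.single (\<alpha> - Poly_Mapping.single v 1) (of_nat (Poly_Mapping.lookup \<alpha> v) * a) * dv v)"

lemma mpol_deriv_alt: "mpol_deriv d dv p = (\<Sum>\<alpha>\<in>Poly_Mapping.keys p. term_deriv dv \<alpha> (Poly_Mapping.lookup p \<alpha>))"
  by (simp add: mpol_deriv_def term_deriv_def)

lemma mpol_deriv_add: "mpol_deriv d dv (p + q) = mpol_deriv d dv p + mpol_deriv d dv q"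
  unfolding mpol_deriv_alt
  by (rule keys_sum_additive[where C = UNIV])
    (auto simp: mpols_over_UNIV term_deriv_def zero add single_add distrib_left distrib_right sum.distrib algebra_simps)

lemma mpol_deriv_single: "mpol_deriv d dv (Poly_Mapping.single \<alpha> a) = term_deriv dv \<alpha> a"
  by (cases "a = 0") (auto simp: mpol_deriv_alt, simp add: term_deriv_def zero)

lemma mpol_deriv_const: "mpol_deriv d dv (mpol_const a) = mpol_const (d a)"
  by (simp add: mpol_const_def mpol_deriv_single term_deriv_def)

lemma mpol_deriv_var: "mpol_deriv d dv (mpol_var v) = dv v"
  by (simp add: mpol_var_def mpol_deriv_single term_deriv_def one)

lemma term_deriv_superset:
  assumes "finite S" "Poly_Mapping.keys \<alpha> \<subseteq> S"
  shows "term_deriv dv \<alpha> a = Poly_Mapping.single \<alpha> (d a) +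
     (\<Sum>v\<in>S. Poly_Mapping.single (\<alpha> - Poly_Mapping.single v 1) (of_nat (Poly_Mapping.lookup \<alpha> v) * a) * dv v)"
  unfolding term_deriv_def using assms
  by (intro arg_cong2[of _ _ _ _ "(+)"] refl sum.mono_neutral_left) (auto simp: in_keys_iff)

text \<open>The Leibniz rule on monomials, where the exponent of a variable in the product is the sum of the two
  exponents.\<close>
lemma term_deriv_mult:
  "term_deriv dv (\<alpha> + \<beta>) (a * b) = term_deriv dv \<alpha> a * Poly_Mapping.single \<beta> b + Poly_Mapping.single \<alpha> a * term_deriv dv \<beta> b"
proof -
  let ?S = "Poly_Mapping.keys \<alpha> \<union> Poly_Mapping.keys \<beta>"
  let ?e = "\<lambda>v. Poly_Mapping.single v (1::nat)"
  have S: "Poly_Mapping.keys (\<alpha> + \<beta>) \<subseteq> ?S" by (rule keys_add)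
  have t: "Poly_Mapping.single (\<alpha> + \<beta> - ?e v) (of_nat (Poly_Mapping.lookup \<alpha> v) * c) =
      Poly_Mapping.single ((\<alpha> - ?e v) + \<beta>) (of_nat (Poly_Mapping.lookup \<alpha> v) * c)" for \<alpha> \<beta> v and c :: 'a
  proof (cases "Poly_Mapping.lookup \<alpha> v = 0")
    case False
    then have "\<alpha> + \<beta> - ?e v = (\<alpha> - ?e v) + \<beta>"
      by (intro poly_mapping_eqI) (auto simp: lookup_add lookup_minus lookup_single when_def)
    then show ?thesis by simp
  qed simp
  define U where "U v = Poly_Mapping.single (\<alpha> - ?e v) (of_nat (Poly_Mapping.lookup \<alpha> v) * a)" for v
  define V where "V v = Poly_Mapping.single (\<beta> - ?e v) (of_nat (Poly_Mapping.lookup \<beta> v) * b)" for v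
  let ?a = "Poly_Mapping.single \<alpha> a" and ?b = "Poly_Mapping.single \<beta> b"
  have key: "Poly_Mapping.single (\<alpha> + \<beta> - ?e v) (of_nat (Poly_Mapping.lookup (\<alpha> + \<beta>) v) * (a * b)) = U v * ?b + ?a * V v" for v
    unfolding U_def V_def using t[of \<alpha> \<beta> v "a * b"] t[of \<beta> \<alpha> v "a * b"]
    by (simp add: lookup_add mult_single single_add distrib_right distrib_left ac_simps)
  have "term_deriv dv (\<alpha> + \<beta>) (a * b) = Poly_Mapping.single \<alpha> (d a) * ?b + ?a * Poly_Mapping.single \<beta> (d b)
      + (\<Sum>v\<in>?S. (U v * ?b + ?a * V v) * dv v)"
    unfolding term_deriv_superset[of ?S, OF finite_UnI[OF finite_keys finite_keys] S] key
    by (simp add: mult_single mult single_add)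
  moreover have "term_deriv dv \<alpha> a = Poly_Mapping.single \<alpha> (d a) + (\<Sum>v\<in>?S. U v * dv v)"
      "term_deriv dv \<beta> b = Poly_Mapping.single \<beta> (d b) + (\<Sum>v\<in>?S. V v * dv v)"
    unfolding U_def V_def by (auto intro!: term_deriv_superset simp del: One_nat_def)
  ultimately show ?thesis
    by (simp only: distrib_left distrib_right sum.distrib sum_distrib_left sum_distrib_right) (simp only: ac_simps)
qed

lemma mpol_deriv_mult: "mpol_deriv d dv (p * q) = mpol_deriv d dv p * q + p * mpol_deriv d dv q"
proof -
  have p: "p \<in> mpols_over UNIV" and q: "q \<in> mpols_over UNIV" by (auto simp: mpols_over_UNIV)
  show ?thesis using p subring_set_UNIV
  proof (induction rule: mpols_over_induct)
    case (single \<alpha> a)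
    show ?case using q subring_set_UNIV
    proof (induction rule: mpols_over_induct)
      case (single \<beta> b)
      then show ?case by (simp add: mult_single mpol_deriv_single term_deriv_mult)
    qed (simp add: distrib_left mpol_deriv_add algebra_simps)
  qed (simp add: distrib_right mpol_deriv_add algebra_simps)
qed

lemma mpol_derivation: "derivation (mpol_deriv d dv)"
  by unfold_locales (auto simp: mpol_deriv_add mpol_deriv_mult)

lemma mpol_deriv_closed:
  assumes C: "subring_set C" and dC: "\<And>a. a \<in> C \<Longrightarrow> d a \<in> C" and dv: "\<And>v. dv v \<in> mpols_over C" and p: "p \<in> mpols_over C"
  shows "mpol_deriv d dv p \<in> mpols_over C"
  using p C
  by (induction rule: mpol_induct)
    (auto simp: mpol_deriv_const mpol_deriv_var mpol_deriv_add mpol_deriv_mult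
      intro!: mpol_const_closed dC dv mpols_over_add mpols_over_mult C)

end

section \<open>Determinants and adjugates\<close>

text \<open>A determinant is a polynomial with integer coefficients in the entries, so a derivation of it is
  determined on the entries. This applies to the two derivations in \<open>gl_deriv\<close>, which differ on \<open>InvDet\<close>.\<close>
lemma derivations_agree_det:
  assumes "derivation D" "derivation D'" "\<And>i j. D (M $ i $ j) = D' (M $ i $ j)"
  shows "D (det (M :: 'a::comm_ring_1^'n^'n::finite)) = D' (det M)"
proof -
  interpret D: derivation D by fact
  interpret D': derivation D' by fact
  have s: "D (of_int (sign p)) = D' (of_int (sign p))" for p :: "'n \<Rightarrow> 'n"
    by (auto simp: sign_def D.one D'.one D.uminus D'.uminus)
  have p: "D (\<Prod>i\<in>S. M $ i $ p i) = D' (\<Prod>i\<in>S. M $ i $ p i)" for S and p :: "'n \<Rightarrow> 'n"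
    by (induction S rule: infinite_finite_induct) (auto simp: D.one D'.one D.mult D'.mult assms(3))
  show ?thesis unfolding det_def by (simp add: D.sum D'.sum D.mult D'.mult s p)
qed

text \<open>The inverse of the fundamental matrix must be written without division.\<close>
definition adjugate :: "'a::comm_ring_1^'n^'n \<Rightarrow> 'a^'n^'n" where
  "adjugate M = (\<chi> k j. det (\<chi> r. if r = j then axis k 1 else M $ r))"

lemma mult_adjugate: "(M ** adjugate M) $ i $ j = (if i = j then det M else 0)"
proof -
  have "(M ** adjugate M) $ i $ j = (\<Sum>k\<in>UNIV. det (\<chi> r. if r = j then M $ i $ k *s axis k 1 else M $ r))"
    by (simp add: matrix_matrix_mult_def adjugate_def flip: det_row_mul)
  also have "\<dots> = det (\<chi> r. if r = j then (\<Sum>k\<in>UNIV. M $ i $ k *s axis k 1) else M $ r)"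
    by (rule det_linear_row_sum[symmetric]) simp
  also have "(\<Sum>k\<in>UNIV. M $ i $ k *s axis k 1) = M $ i" by (rule basis_expansion)
  also have "det (\<chi> r. if r = j then M $ i else M $ r) = (if i = j then det M else 0)"
  proof (cases "i = j")
    case True
    then have "(\<chi> r. if r = j then M $ i else M $ r) = M" by (auto simp: vec_eq_iff)
    then show ?thesis using True by simp
  next
    case False
    then show ?thesis by (auto intro!: det_identical_rows[of i j] simp: row_def vec_eq_iff)
  qed
  finally show ?thesis .
qed

text \<open>The left inverse is obtained by transposing, which avoids proving that the two adjugates agree.\<close>
lemma adjugate_mult: "(transpose (adjugate (transpose M)) ** M) $ i $ j = (if i = j then det M else 0)"
proof -
  have "transpose (adjugate (transpose M)) ** M = transpose (transpose M ** adjugate (transpose M))"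
    by (simp add: matrix_transpose_mul)
  then show ?thesis by (simp add: transpose_def mult_adjugate[unfolded transpose_def] det_transpose[unfolded transpose_def])
qed

section \<open>Rings presented as quotients\<close>

lemma cring_of_surj:
  assumes R: "cring R" and carr: "carrier S = q ` carrier R"
    and m: "\<And>a b. a \<in> carrier R \<Longrightarrow> b \<in> carrier R \<Longrightarrow> q (a \<otimes>\<^bsub>R\<^esub> b) = q a \<otimes>\<^bsub>S\<^esub> q b"
    and p: "\<And>a b. a \<in> carrier R \<Longrightarrow> b \<in> carrier R \<Longrightarrow> q (a \<oplus>\<^bsub>R\<^esub> b) = q a \<oplus>\<^bsub>S\<^esub> q b"
    and o: "q \<one>\<^bsub>R\<^esub> = \<one>\<^bsub>S\<^esub>" and z: "q \<zero>\<^bsub>R\<^esub> = \<zero>\<^bsub>S\<^esub>"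
  shows "cring S"
proof -
  interpret R: cring R by fact
  have qc: "a \<in> carrier R \<Longrightarrow> q a \<in> carrier S" for a using carr by simp
  show ?thesis
  proof (rule cringI)
    show "abelian_group S"
    proof (rule abelian_groupI)
      fix x assume "x \<in> carrier S"
      then obtain a where a: "x = q a" "a \<in> carrier R" using carr by auto
      then have "q (\<ominus>\<^bsub>R\<^esub> a) \<oplus>\<^bsub>S\<^esub> x = \<zero>\<^bsub>S\<^esub>" by (simp add: R.l_neg z flip: p)
      then show "\<exists>y\<in>carrier S. y \<oplus>\<^bsub>S\<^esub> x = \<zero>\<^bsub>S\<^esub>" using qc a by blast
    qed (auto simp: carr R.a_ac simp flip: p z)
    show "comm_monoid S"
      by (rule comm_monoidI) (auto simp: carr R.m_ac simp flip: m o)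
  qed (auto simp: carr R.l_distr simp flip: m p)
qed

text \<open>All ring axioms are equational, so they pass to images under maps that preserve the operations.
  Quotients and transported structures are handled by this one lemma.\<close>
lemma diff_ring_of_surj:
  assumes R: "diff_ring R" and carr: "carrier S = q ` carrier R"
    and m: "\<And>a b. a \<in> carrier R \<Longrightarrow> b \<in> carrier R \<Longrightarrow> q (a \<otimes>\<^bsub>R\<^esub> b) = q a \<otimes>\<^bsub>S\<^esub> q b"
    and p: "\<And>a b. a \<in> carrier R \<Longrightarrow> b \<in> carrier R \<Longrightarrow> q (a \<oplus>\<^bsub>R\<^esub> b) = q a \<oplus>\<^bsub>S\<^esub> q b"
    and o: "q \<one>\<^bsub>R\<^esub> = \<one>\<^bsub>S\<^esub>" and z: "q \<zero>\<^bsub>R\<^esub> = \<zero>\<^bsub>S\<^esub>"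
    and d: "\<And>a. a \<in> carrier R \<Longrightarrow> q (der R a) = der S (q a)"
  shows "diff_ring S"
proof -
  interpret R: cring R using R by (simp add: diff_ring_def)
  have dR: "a \<in> carrier R \<Longrightarrow> der R a \<in> carrier R" for a using R by (auto simp: diff_ring_def)
  have dp: "der R (a \<oplus>\<^bsub>R\<^esub> b) = der R a \<oplus>\<^bsub>R\<^esub> der R b"
    "der R (a \<otimes>\<^bsub>R\<^esub> b) = (der R a \<otimes>\<^bsub>R\<^esub> b) \<oplus>\<^bsub>R\<^esub> (a \<otimes>\<^bsub>R\<^esub> der R b)" if "a \<in> carrier R" "b \<in> carrier R" for a b
    using R that by (auto simp: diff_ring_def)
  show ?thesis unfolding diff_ring_def
    using cring_of_surj[OF R.is_cring carr m p o z]
    by (auto simp: carr dR dp simp flip: d m p)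
qed

lemma cring_idealI:
  assumes "cring R" "I \<subseteq> carrier R" "\<zero>\<^bsub>R\<^esub> \<in> I" "\<And>a b. a \<in> I \<Longrightarrow> b \<in> I \<Longrightarrow> a \<oplus>\<^bsub>R\<^esub> b \<in> I"
    "\<And>a x. a \<in> I \<Longrightarrow> x \<in> carrier R \<Longrightarrow> x \<otimes>\<^bsub>R\<^esub> a \<in> I"
  shows "ideal I R"
proof -
  interpret cring R by fact
  have "\<ominus>\<^bsub>R\<^esub> a \<in> I" if "a \<in> I" for a
    using assms(5)[OF that, of "\<ominus>\<^bsub>R\<^esub> \<one>\<^bsub>R\<^esub>"] assms(2) that by (auto simp: l_minus)
  then have "subgroup I (add_monoid R)"
    using assms(2-4) by (intro add.subgroupI) (auto simp: a_inv_def)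
  moreover have "a \<otimes>\<^bsub>R\<^esub> x \<in> I" if "a \<in> I" "x \<in> carrier R" for a x
    using assms(5)[OF that] assms(2) that m_comm by auto
  ultimately show ?thesis by (intro idealI) (auto intro: assms ring_axioms)
qed

lemma quot_map_coset:
  assumes R: "ring R" and S: "ring S" and I: "ideal I R" and J: "ideal J S"
    and f: "f \<in> carrier R \<rightarrow> carrier S" "\<And>a b. a \<in> carrier R \<Longrightarrow> b \<in> carrier R \<Longrightarrow> f (a \<oplus>\<^bsub>R\<^esub> b) = f a \<oplus>\<^bsub>S\<^esub> f b"
    and fI: "f ` I \<subseteq> J" and a: "a \<in> carrier R"
  shows "quot_map S J f (I +>\<^bsub>R\<^esub> a) = J +>\<^bsub>S\<^esub> f a"
proof -
  interpret R: ring R by fact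
  interpret S: ring S by fact
  interpret I: ideal I R by fact
  interpret J: ideal J S by fact
  have "J +>\<^bsub>S\<^esub> f x = J +>\<^bsub>S\<^esub> f a" if x: "x \<in> I +>\<^bsub>R\<^esub> a" for x
  proof -
    obtain i where i: "i \<in> I" "x = i \<oplus>\<^bsub>R\<^esub> a" using x by (auto simp: a_r_coset_def')
    then have "f x = f i \<oplus>\<^bsub>S\<^esub> f a" using f a I.Icarr by auto
    moreover have "f i \<in> J" "f a \<in> carrier S" using fI i f a by auto
    ultimately have "f x \<in> J +>\<^bsub>S\<^esub> f a" by (auto simp: a_r_coset_def')
    then show ?thesis using J.a_repr_independence'[of "f x" "f a"] \<open>f a \<in> carrier S\<close> by simp
  qed
  moreover have "a \<in> I +>\<^bsub>R\<^esub> a" using a I.a_rcos_self by simp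
  ultimately show ?thesis unfolding quot_map_def by (intro SUP_eq_const) blast+
qed

lemma d_quot_simps:
  "carrier (d_quot R I) = carrier (R Quot I)" "monoid.mult (d_quot R I) = monoid.mult (R Quot I)"
  "monoid.one (d_quot R I) = monoid.one (R Quot I)" "ring.zero (d_quot R I) = ring.zero (R Quot I)" "ring.add (d_quot R I) = ring.add (R Quot I)"
  "der (d_quot R I) = quot_map R I (der R)"
  by (simp_all add: d_quot_def ring.defs dring.defs)

lemma sd_quot_simps:
  "carrier (sd_quot R I) = carrier (R Quot I)" "monoid.mult (sd_quot R I) = monoid.mult (R Quot I)"
  "monoid.one (sd_quot R I) = monoid.one (R Quot I)" "ring.zero (sd_quot R I) = ring.zero (R Quot I)" "ring.add (sd_quot R I) = ring.add (R Quot I)"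
  "der (sd_quot R I) = quot_map R I (der R)" "shift (sd_quot R I) = quot_map R I (shift R)"
  by (simp_all add: sd_quot_def d_quot_simps dring.defs sdring.defs)

lemma FactRing_facts:
  assumes R: "cring R" and I: "ideal I R"
  shows "carrier (R Quot I) = (+>\<^bsub>R\<^esub>) I ` carrier R"
    "\<And>a b. a \<in> carrier R \<Longrightarrow> b \<in> carrier R \<Longrightarrow> (I +>\<^bsub>R\<^esub> a) \<otimes>\<^bsub>R Quot I\<^esub> (I +>\<^bsub>R\<^esub> b) = I +>\<^bsub>R\<^esub> (a \<otimes>\<^bsub>R\<^esub> b)"
    "\<And>a b. a \<in> carrier R \<Longrightarrow> b \<in> carrier R \<Longrightarrow> (I +>\<^bsub>R\<^esub> a) \<oplus>\<^bsub>R Quot I\<^esub> (I +>\<^bsub>R\<^esub> b) = I +>\<^bsub>R\<^esub> (a \<oplus>\<^bsub>R\<^esub> b)"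
    "\<one>\<^bsub>R Quot I\<^esub> = I +>\<^bsub>R\<^esub> \<one>\<^bsub>R\<^esub>" "\<zero>\<^bsub>R Quot I\<^esub> = I +>\<^bsub>R\<^esub> \<zero>\<^bsub>R\<^esub>"
    "\<And>a b. a \<in> carrier R \<Longrightarrow> b \<in> carrier R \<Longrightarrow> (I +>\<^bsub>R\<^esub> a = I +>\<^bsub>R\<^esub> b) = (a \<ominus>\<^bsub>R\<^esub> b \<in> I)"
proof -
  interpret R: cring R by fact
  interpret I: ideal I R by fact
  show "carrier (R Quot I) = (+>\<^bsub>R\<^esub>) I ` carrier R"
    by (auto simp: FactRing_def A_RCOSETS_def')
  show "\<one>\<^bsub>R Quot I\<^esub> = I +>\<^bsub>R\<^esub> \<one>\<^bsub>R\<^esub>" by (simp add: FactRing_def)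
  have "I +>\<^bsub>R\<^esub> \<zero>\<^bsub>R\<^esub> = I" by (rule R.a_coset_join2) (auto simp: I.a_subgroup)
  then show "\<zero>\<^bsub>R Quot I\<^esub> = I +>\<^bsub>R\<^esub> \<zero>\<^bsub>R\<^esub>" by (simp add: FactRing_def)
qed (auto simp: FactRing_def ideal.rcoset_mult_add[OF I] ideal.a_rcos_sum[OF I] ring.quotient_eq_iff_same_a_r_cos[OF cring.axioms(1)[OF R] I])

text \<open>The map \<open>q\<close> presents the record \<open>S\<close> as the quotient of \<open>R\<close> by \<open>I\<close>. Computing with \<open>q\<close> replaces computing
  with cosets in \<open>d_quot\<close>, \<open>sd_quot\<close> and \<open>gl_dring\<close>.\<close>
locale quot_hom =
  fixes R :: "('a, 'm) ring_scheme" and S :: "('b, 'n) ring_scheme" and q :: "'a \<Rightarrow> 'b" and I :: "'a set"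
  assumes R: "cring R"
    and carr: "carrier S = q ` carrier R"
    and q_mult: "a \<in> carrier R \<Longrightarrow> b \<in> carrier R \<Longrightarrow> q (a \<otimes>\<^bsub>R\<^esub> b) = q a \<otimes>\<^bsub>S\<^esub> q b"
    and q_add: "a \<in> carrier R \<Longrightarrow> b \<in> carrier R \<Longrightarrow> q (a \<oplus>\<^bsub>R\<^esub> b) = q a \<oplus>\<^bsub>S\<^esub> q b"
    and q_one: "q \<one>\<^bsub>R\<^esub> = \<one>\<^bsub>S\<^esub>" and q_zero: "q \<zero>\<^bsub>R\<^esub> = \<zero>\<^bsub>S\<^esub>"
    and q_eq: "a \<in> carrier R \<Longrightarrow> b \<in> carrier R \<Longrightarrow> q a = q b \<longleftrightarrow> a \<ominus>\<^bsub>R\<^esub> b \<in> I"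

lemma (in quot_hom) S: "cring S"
  by (rule cring_of_surj[OF R carr q_mult q_add q_one q_zero])

lemma (in quot_hom) q_closed: "a \<in> carrier R \<Longrightarrow> q a \<in> carrier S" using carr by simp

lemma (in quot_hom) q_eq_zero: "a \<in> carrier R \<Longrightarrow> q a = \<zero>\<^bsub>S\<^esub> \<longleftrightarrow> a \<in> I"
proof -
  interpret R: cring R by (rule R)
  assume "a \<in> carrier R"
  then show ?thesis using q_eq[of a "\<zero>\<^bsub>R\<^esub>"] q_zero by (simp add: R.minus_eq)
qed

lemma quot_hom_d_quot:
  assumes "cring R" "ideal I R" shows "quot_hom R (d_quot R I) (\<lambda>a. I +>\<^bsub>R\<^esub> a) I"
  using FactRing_facts[OF assms] assms by (intro quot_hom.intro) (auto simp: d_quot_simps)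

lemma quot_hom_sd_quot:
  assumes "cring R" "ideal I R" shows "quot_hom R (sd_quot R I) (\<lambda>a. I +>\<^bsub>R\<^esub> a) I"
  using FactRing_facts[OF assms] assms by (intro quot_hom.intro) (auto simp: sd_quot_simps)

lemma der_d_quot:
  assumes "diff_ring R" "ideal I R" "der R ` I \<subseteq> I" "a \<in> carrier R"
  shows "der (d_quot R I) (I +>\<^bsub>R\<^esub> a) = I +>\<^bsub>R\<^esub> der R a"
proof -
  interpret cring R using assms by (simp add: diff_ring_def)
  show ?thesis unfolding d_quot_simps
    using assms by (intro quot_map_coset) (auto simp: diff_ring_def ring_axioms)
qed

lemma der_sd_quot:
  assumes "cring R" "der R \<in> carrier R \<rightarrow> carrier R"
    "\<And>a b. a \<in> carrier R \<Longrightarrow> b \<in> carrier R \<Longrightarrow> der R (a \<oplus>\<^bsub>R\<^esub> b) = der R a \<oplus>\<^bsub>R\<^esub> der R b"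
    "ideal I R" "der R ` I \<subseteq> I" "a \<in> carrier R"
  shows "der (sd_quot R I) (I +>\<^bsub>R\<^esub> a) = I +>\<^bsub>R\<^esub> der R a"
  unfolding sd_quot_simps
  using assms cring.axioms(1)[OF assms(1)] by (intro quot_map_coset) auto

lemma shift_sd_quot:
  assumes "cring R" "shift R \<in> carrier R \<rightarrow> carrier R"
    "\<And>a b. a \<in> carrier R \<Longrightarrow> b \<in> carrier R \<Longrightarrow> shift R (a \<oplus>\<^bsub>R\<^esub> b) = shift R a \<oplus>\<^bsub>R\<^esub> shift R b"
    "ideal I R" "shift R ` I \<subseteq> I" "a \<in> carrier R"
  shows "shift (sd_quot R I) (I +>\<^bsub>R\<^esub> a) = I +>\<^bsub>R\<^esub> shift R a"
  unfolding sd_quot_simps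
  using assms cring.axioms(1)[OF assms(1)] by (intro quot_map_coset) auto

section \<open>Tensor products\<close>

text \<open>The last assumption makes the relation ideal stable under the derivation of \<open>R \<otimes> S\<close>. It is weaker than
  a derivation on \<open>K\<close> commuting with both structure maps.\<close>
locale tensor_prod =
  fixes R :: "('r, 'm) sdring_scheme" and S :: "('s, 'n) dring_scheme"
    and K :: "'k set" and c :: "'k \<Rightarrow> 'r" and u :: "'k \<Rightarrow> 's"
  assumes R: "diff_ring R" and S: "diff_ring S"
    and c: "a \<in> K \<Longrightarrow> c a \<in> carrier R" and u: "a \<in> K \<Longrightarrow> u a \<in> carrier S"
    and dcu: "a \<in> K \<Longrightarrow> \<exists>a'\<in>K. der R (c a) = c a' \<and> der S (u a) = u a'"
begin

sublocale R: cring R using R by (simp add: diff_ring_def)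
sublocale S: cring S using S by (simp add: diff_ring_def)

lemma der_closed: "r \<in> carrier R \<Longrightarrow> der R r \<in> carrier R" "s \<in> carrier S \<Longrightarrow> der S s \<in> carrier S"
  using R S by (auto simp: diff_ring_def)

lemma der_R:
  "r \<in> carrier R \<Longrightarrow> r' \<in> carrier R \<Longrightarrow> der R (r \<oplus>\<^bsub>R\<^esub> r') = der R r \<oplus>\<^bsub>R\<^esub> der R r'"
  "r \<in> carrier R \<Longrightarrow> r' \<in> carrier R \<Longrightarrow> der R (r \<otimes>\<^bsub>R\<^esub> r') = (der R r \<otimes>\<^bsub>R\<^esub> r') \<oplus>\<^bsub>R\<^esub> (r \<otimes>\<^bsub>R\<^esub> der R r')"
  using R by (auto simp: diff_ring_def)

lemma der_S:
  "r \<in> carrier S \<Longrightarrow> r' \<in> carrier S \<Longrightarrow> der S (r \<oplus>\<^bsub>S\<^esub> r') = der S r \<oplus>\<^bsub>S\<^esub> der S r'"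
  "r \<in> carrier S \<Longrightarrow> r' \<in> carrier S \<Longrightarrow> der S (r \<otimes>\<^bsub>S\<^esub> r') = (der S r \<otimes>\<^bsub>S\<^esub> r') \<oplus>\<^bsub>S\<^esub> (r \<otimes>\<^bsub>S\<^esub> der S r')"
  using S by (auto simp: diff_ring_def)

abbreviation Pre where "Pre \<equiv> pre_tensor R S"
abbreviation Rel where "Rel \<equiv> tensor_rel K R c S u"
abbreviation T where "T \<equiv> tensor K R c S u"
abbreviation t where "t \<equiv> pure_tensor K R c S u"

lemma pre_simps:
  "carrier Pre = {p. Poly_Mapping.keys p \<subseteq> carrier R \<times> carrier S}"
  "monoid.one Pre = frag_of (\<one>\<^bsub>R\<^esub>, \<one>\<^bsub>S\<^esub>)" "ring.zero Pre = 0" "ring.add Pre = (+)"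
  "der Pre = frag_extend (\<lambda>(r, s). frag_of (der R r, s) + frag_of (r, der S s))"
  "shift Pre = frag_extend (\<lambda>(r, s). frag_of (shift R r, s))"
  by (simp_all add: pre_tensor_def)

lemma pre_mult: "p \<otimes>\<^bsub>Pre\<^esub> q = frag_extend (\<lambda>(r, s). frag_extend (\<lambda>(r', s').
                frag_of (r \<otimes>\<^bsub>R\<^esub> r', s \<otimes>\<^bsub>S\<^esub> s')) q) p"
  by (simp add: pre_tensor_def)

lemma pre_mult_diff: "(p - p') \<otimes>\<^bsub>Pre\<^esub> q = p \<otimes>\<^bsub>Pre\<^esub> q - p' \<otimes>\<^bsub>Pre\<^esub> q"
    "q \<otimes>\<^bsub>Pre\<^esub> (p - p') = q \<otimes>\<^bsub>Pre\<^esub> p - q \<otimes>\<^bsub>Pre\<^esub> p'"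
    "0 \<otimes>\<^bsub>Pre\<^esub> q = 0" "q \<otimes>\<^bsub>Pre\<^esub> 0 = 0"
    "frag_of (r, s) \<otimes>\<^bsub>Pre\<^esub> frag_of (r', s') = frag_of (r \<otimes>\<^bsub>R\<^esub> r', s \<otimes>\<^bsub>S\<^esub> s')"
proof -
  show "(p - p') \<otimes>\<^bsub>Pre\<^esub> q = p \<otimes>\<^bsub>Pre\<^esub> q - p' \<otimes>\<^bsub>Pre\<^esub> q" for p p' q by (simp add: pre_mult frag_extend_diff)
  show "q \<otimes>\<^bsub>Pre\<^esub> (p - p') = q \<otimes>\<^bsub>Pre\<^esub> p - q \<otimes>\<^bsub>Pre\<^esub> p'"
    using subset_UNIV[of "Poly_Mapping.keys q"]
    by (induction q rule: frag_induction) (auto simp: pre_mult frag_extend_diff)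
  show "q \<otimes>\<^bsub>Pre\<^esub> 0 = 0"
    using subset_UNIV[of "Poly_Mapping.keys q"]
    by (induction q rule: frag_induction) (auto simp: pre_mult frag_extend_diff)
qed (auto simp: pre_mult)

text \<open>The additive group of the pre-tensor product is free on pure elements; differences suffice because
  they produce sums and negatives.\<close>
lemma pre_induct [consumes 1, case_names pure diff]:
  assumes "p \<in> carrier Pre" and "\<And>r s. r \<in> carrier R \<Longrightarrow> s \<in> carrier S \<Longrightarrow> Q (frag_of (r, s))"
    and d: "\<And>a b. a \<in> carrier Pre \<Longrightarrow> b \<in> carrier Pre \<Longrightarrow> Q a \<Longrightarrow> Q b \<Longrightarrow> Q (a - b)"
  shows "Q p"
proof -
  have k: "Poly_Mapping.keys p \<subseteq> carrier R \<times> carrier S" using assms(1) by (simp add: pre_simps)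
  have z: "Q 0" using d[of "frag_of (\<one>\<^bsub>R\<^esub>, \<one>\<^bsub>S\<^esub>)" "frag_of (\<one>\<^bsub>R\<^esub>, \<one>\<^bsub>S\<^esub>)"] assms(2) by (simp add: pre_simps)
  have "p \<in> carrier Pre \<and> Q p" using k
  proof (induction p rule: frag_induction)
    case (diff a b)
    then show ?case using d[of a b] keys_diff[of a b] by (auto simp: pre_simps)
  qed (use z assms(2) in \<open>auto simp: pre_simps\<close>)
  then show ?thesis by simp
qed

lemma pre_diff_closed: "a \<in> carrier Pre \<Longrightarrow> b \<in> carrier Pre \<Longrightarrow> a - b \<in> carrier Pre"
  using keys_diff[of a b] by (auto simp: pre_simps)

lemma pre_add_closed: "a \<in> carrier Pre \<Longrightarrow> b \<in> carrier Pre \<Longrightarrow> a + b \<in> carrier Pre"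
  using keys_add[of a b] by (auto simp: pre_simps)

lemma pre_zero_closed: "0 \<in> carrier Pre" by (simp add: pre_simps)

lemma pre_pure_closed: "r \<in> carrier R \<Longrightarrow> s \<in> carrier S \<Longrightarrow> frag_of (r, s) \<in> carrier Pre"
  by (simp add: pre_simps)

lemma pre_mult_closed:
  assumes "p \<in> carrier Pre" "q \<in> carrier Pre" shows "p \<otimes>\<^bsub>Pre\<^esub> q \<in> carrier Pre"
  using assms(1)
proof (induction rule: pre_induct)
  case (pure r s)
  show ?case using assms(2)
    by (induction rule: pre_induct) (use pure in \<open>auto simp: pre_mult_diff intro: pre_diff_closed pre_pure_closed\<close>)
qed (auto simp: pre_mult_diff intro: pre_diff_closed)

lemma pre_cring: "cring Pre"
proof (rule cringI)
  show "abelian_group Pre"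
  proof (rule abelian_groupI)
    fix x assume "x \<in> carrier Pre"
    then show "\<exists>y\<in>carrier Pre. y \<oplus>\<^bsub>Pre\<^esub> x = \<zero>\<^bsub>Pre\<^esub>"
      by (intro bexI[of _ "- x"]) (auto simp: pre_simps)
  qed (auto simp: pre_simps(3,4) pre_add_closed pre_zero_closed ac_simps)
  have comm: "p \<otimes>\<^bsub>Pre\<^esub> q = q \<otimes>\<^bsub>Pre\<^esub> p" if "p \<in> carrier Pre" and q: "q \<in> carrier Pre" for p q
    using that(1)
  proof (induction rule: pre_induct)
    case (pure r s)
    show ?case using q
      by (induction rule: pre_induct) (use pure in \<open>auto simp: pre_mult_diff R.m_comm S.m_comm\<close>)
  qed (auto simp: pre_mult_diff)
  show "comm_monoid Pre"
  proof (rule comm_monoidI)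
    fix x y z assume "x \<in> carrier Pre" and y: "y \<in> carrier Pre" and z: "z \<in> carrier Pre"
    then show "x \<otimes>\<^bsub>Pre\<^esub> y \<otimes>\<^bsub>Pre\<^esub> z = x \<otimes>\<^bsub>Pre\<^esub> (y \<otimes>\<^bsub>Pre\<^esub> z)"
    proof (induction rule: pre_induct)
      case (pure r s)
      show ?case using y
      proof (induction rule: pre_induct)
        case (pure r' s')
        show ?case using z
          by (induction rule: pre_induct)
            (use pure \<open>r \<in> carrier R\<close> \<open>s \<in> carrier S\<close> in \<open>auto simp: pre_mult_diff R.m_assoc S.m_assoc\<close>)
      qed (auto simp: pre_mult_diff)
    qed (auto simp: pre_mult_diff)
  next
    fix x assume "x \<in> carrier Pre"
    then show "\<one>\<^bsub>Pre\<^esub> \<otimes>\<^bsub>Pre\<^esub> x = x"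
      by (induction rule: pre_induct) (auto simp: pre_mult_diff pre_simps(2))
  qed (auto simp: comm pre_mult_closed pre_simps(2) pre_pure_closed)
  fix x y z assume "x \<in> carrier Pre" "y \<in> carrier Pre" "z \<in> carrier Pre"
  have "(x + y) \<otimes>\<^bsub>Pre\<^esub> z = x \<otimes>\<^bsub>Pre\<^esub> z + y \<otimes>\<^bsub>Pre\<^esub> z"
    using pre_mult_diff(1)[of "x + y" y z] by simp
  then show "(x \<oplus>\<^bsub>Pre\<^esub> y) \<otimes>\<^bsub>Pre\<^esub> z = x \<otimes>\<^bsub>Pre\<^esub> z \<oplus>\<^bsub>Pre\<^esub> y \<otimes>\<^bsub>Pre\<^esub> z" by (simp add: pre_simps)
qed

sublocale Pre: cring Pre by (rule pre_cring)

lemma pre_minus: "a \<in> carrier Pre \<Longrightarrow> b \<in> carrier Pre \<Longrightarrow> a \<ominus>\<^bsub>Pre\<^esub> b = a - b"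
proof -
  assume a: "a \<in> carrier Pre" "b \<in> carrier Pre"
  have "\<ominus>\<^bsub>Pre\<^esub> b = - b"
    by (rule Pre.minus_equality) (use a in \<open>auto simp: pre_simps\<close>)
  then show ?thesis by (simp add: Pre.minus_eq pre_simps)
qed

definition gens :: "('r \<times> 's \<Rightarrow>\<^sub>0 int) set" where
  "gens = ({frag_of (r \<oplus>\<^bsub>R\<^esub> r', s) - frag_of (r, s) - frag_of (r', s) | r r' s.
         r \<in> carrier R \<and> r' \<in> carrier R \<and> s \<in> carrier S} \<union>
      {frag_of (r, s \<oplus>\<^bsub>S\<^esub> s') - frag_of (r, s) - frag_of (r, s') | r s s'.
         r \<in> carrier R \<and> s \<in> carrier S \<and> s' \<in> carrier S} \<union>
      {frag_of (c a \<otimes>\<^bsub>R\<^esub> r, s) - frag_of (r, u a \<otimes>\<^bsub>S\<^esub> s) | a r s.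
         a \<in> K \<and> r \<in> carrier R \<and> s \<in> carrier S})"

lemma gens_cases:
  assumes "x \<in> gens"
  obtains r r' s where "r \<in> carrier R" "r' \<in> carrier R" "s \<in> carrier S"
      "x = frag_of (r \<oplus>\<^bsub>R\<^esub> r', s) - frag_of (r, s) - frag_of (r', s)"
    | r s s' where "r \<in> carrier R" "s \<in> carrier S" "s' \<in> carrier S"
      "x = frag_of (r, s \<oplus>\<^bsub>S\<^esub> s') - frag_of (r, s) - frag_of (r, s')"
    | a r s where "a \<in> K" "r \<in> carrier R" "s \<in> carrier S"
      "x = frag_of (c a \<otimes>\<^bsub>R\<^esub> r, s) - frag_of (r, u a \<otimes>\<^bsub>S\<^esub> s)"
  using assms unfolding gens_def
  by (elim UnE CollectE exE conjE) (rule that(1) that(2) that(3); assumption)+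

lemma gens_carrier: "gens \<subseteq> carrier Pre"
  by (auto elim!: gens_cases simp: c u intro!: pre_diff_closed pre_pure_closed)

lemma Rel_eq: "Rel = Idl\<^bsub>Pre\<^esub> gens" unfolding tensor_rel_def gens_def ..

lemma Rel_ideal: "ideal Rel Pre" unfolding Rel_eq by (rule Pre.genideal_ideal[OF gens_carrier])

lemma gens_Rel: "gens \<subseteq> Rel" unfolding Rel_eq by (rule Pre.genideal_self[OF gens_carrier])

definition cl :: "('r \<times> 's \<Rightarrow>\<^sub>0 int) \<Rightarrow> ('r \<times> 's \<Rightarrow>\<^sub>0 int) set" where "cl p = Rel +>\<^bsub>Pre\<^esub> p"

lemma t_cl: "t r s = cl (frag_of (r, s))" by (simp add: pure_tensor_def cl_def)

sublocale Q: quot_hom Pre T cl Rel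
  unfolding cl_def tensor_def by (rule quot_hom_sd_quot[OF pre_cring Rel_ideal])

sublocale T: cring T by (rule Q.S)

lemma cl_diff: "a \<in> carrier Pre \<Longrightarrow> b \<in> carrier Pre \<Longrightarrow> cl (a - b) = cl a \<ominus>\<^bsub>T\<^esub> cl b"
proof -
  assume a: "a \<in> carrier Pre" "b \<in> carrier Pre"
  have "cl a = cl (a - b) \<oplus>\<^bsub>T\<^esub> cl b"
    using Q.q_add[of "a - b" b] a pre_diff_closed by (simp add: pre_simps)
  then show ?thesis using a pre_diff_closed Q.q_closed by (simp add: T.minus_eq T.a_assoc T.r_neg)
qed

lemma t_closed: "r \<in> carrier R \<Longrightarrow> s \<in> carrier S \<Longrightarrow> t r s \<in> carrier T"
  by (simp add: t_cl Q.q_closed pre_pure_closed)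

lemma cl_diff_zero: "a \<in> carrier Pre \<Longrightarrow> b \<in> carrier Pre \<Longrightarrow> a - b \<in> gens \<Longrightarrow> cl a = cl b"
  using Q.q_eq[of a b] gens_Rel by (auto simp: pre_minus)

lemma t_add1: "r \<in> carrier R \<Longrightarrow> r' \<in> carrier R \<Longrightarrow> s \<in> carrier S \<Longrightarrow> t (r \<oplus>\<^bsub>R\<^esub> r') s = t r s \<oplus>\<^bsub>T\<^esub> t r' s"
proof -
  assume a: "r \<in> carrier R" "r' \<in> carrier R" "s \<in> carrier S"
  have "cl (frag_of (r \<oplus>\<^bsub>R\<^esub> r', s)) = cl (frag_of (r, s) \<oplus>\<^bsub>Pre\<^esub> frag_of (r', s))"
    by (rule cl_diff_zero) (use a in \<open>auto simp: pre_pure_closed gens_def pre_simps(4) diff_diff_eq intro: Pre.a_closed[unfolded pre_simps(4)]\<close>)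
  then show ?thesis using a by (simp add: t_cl Q.q_add pre_pure_closed)
qed

lemma t_add2: "r \<in> carrier R \<Longrightarrow> s \<in> carrier S \<Longrightarrow> s' \<in> carrier S \<Longrightarrow> t r (s \<oplus>\<^bsub>S\<^esub> s') = t r s \<oplus>\<^bsub>T\<^esub> t r s'"
proof -
  assume a: "r \<in> carrier R" "s' \<in> carrier S" "s \<in> carrier S"
  have "cl (frag_of (r, s \<oplus>\<^bsub>S\<^esub> s')) = cl (frag_of (r, s) \<oplus>\<^bsub>Pre\<^esub> frag_of (r, s'))"
    by (rule cl_diff_zero) (use a in \<open>auto simp: pre_pure_closed gens_def pre_simps(4) diff_diff_eq intro: Pre.a_closed[unfolded pre_simps(4)]\<close>)
  then show ?thesis using a by (simp add: t_cl Q.q_add pre_pure_closed)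
qed

lemma t_balanced: "a \<in> K \<Longrightarrow> r \<in> carrier R \<Longrightarrow> s \<in> carrier S \<Longrightarrow> t (c a \<otimes>\<^bsub>R\<^esub> r) s = t r (u a \<otimes>\<^bsub>S\<^esub> s)"
  unfolding t_cl by (rule cl_diff_zero) (auto simp: pre_pure_closed gens_def c u)

lemma t_mult: "r \<in> carrier R \<Longrightarrow> s \<in> carrier S \<Longrightarrow> r' \<in> carrier R \<Longrightarrow> s' \<in> carrier S \<Longrightarrow>
    t r s \<otimes>\<^bsub>T\<^esub> t r' s' = t (r \<otimes>\<^bsub>R\<^esub> r') (s \<otimes>\<^bsub>S\<^esub> s')"
  using Q.q_mult[of "frag_of (r, s)" "frag_of (r', s')"] by (simp add: t_cl pre_pure_closed pre_mult_diff(5))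

lemma t_one: "t \<one>\<^bsub>R\<^esub> \<one>\<^bsub>S\<^esub> = \<one>\<^bsub>T\<^esub>" using Q.q_one by (simp add: t_cl pre_simps)

lemma t_zero1: "s \<in> carrier S \<Longrightarrow> t \<zero>\<^bsub>R\<^esub> s = \<zero>\<^bsub>T\<^esub>"
  using t_add1[of "\<zero>\<^bsub>R\<^esub>" "\<zero>\<^bsub>R\<^esub>" s] t_closed[of "\<zero>\<^bsub>R\<^esub>" s] by (simp add: T.add.l_cancel_one')

lemma t_zero2: "r \<in> carrier R \<Longrightarrow> t r \<zero>\<^bsub>S\<^esub> = \<zero>\<^bsub>T\<^esub>"
  using t_add2[of r "\<zero>\<^bsub>S\<^esub>" "\<zero>\<^bsub>S\<^esub>"] t_closed[of r "\<zero>\<^bsub>S\<^esub>"] by (simp add: T.add.l_cancel_one')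

lemma t_uminus1: "r \<in> carrier R \<Longrightarrow> s \<in> carrier S \<Longrightarrow> \<ominus>\<^bsub>T\<^esub> t r s = t (\<ominus>\<^bsub>R\<^esub> r) s"
  using t_add1[of "\<ominus>\<^bsub>R\<^esub> r" r s] t_zero1[of s] t_closed[of r s] t_closed[of "\<ominus>\<^bsub>R\<^esub> r" s]
  by (intro T.minus_equality) (auto simp: R.l_neg)

lemma T_induct [consumes 1, case_names pure add]:
  assumes x: "x \<in> carrier T" and p: "\<And>r s. r \<in> carrier R \<Longrightarrow> s \<in> carrier S \<Longrightarrow> A (t r s)"
    and a: "\<And>x y. x \<in> carrier T \<Longrightarrow> y \<in> carrier T \<Longrightarrow> A x \<Longrightarrow> A y \<Longrightarrow> A (x \<oplus>\<^bsub>T\<^esub> y)"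
  shows "A x"
proof -
  obtain q where q: "q \<in> carrier Pre" "x = cl q" using x Q.carr by auto
  have "A (cl q) \<and> A (\<ominus>\<^bsub>T\<^esub> cl q)" using q(1)
  proof (induction rule: pre_induct)
    case (pure r s)
    then show ?case using p t_uminus1 by (simp flip: t_cl)
  next
    case (diff b b')
    then have b: "cl b \<in> carrier T" "cl b' \<in> carrier T" using Q.q_closed by auto
    have e: "cl (b - b') = cl b \<oplus>\<^bsub>T\<^esub> \<ominus>\<^bsub>T\<^esub> cl b'" using cl_diff diff by (simp add: T.minus_eq)
    then have "\<ominus>\<^bsub>T\<^esub> cl (b - b') = \<ominus>\<^bsub>T\<^esub> cl b \<oplus>\<^bsub>T\<^esub> cl b'" using b by (simp add: T.minus_add)
    then show ?case using e a b diff by simp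
  qed
  then show ?thesis using q by simp
qed

text \<open>A balanced biadditive map into an abelian group is enough, since the relation ideal is spanned
  additively by multiples of its generators with pure elements, which again have the shape of generators.
  The additive version is what linear functionals are applied to.\<close>
lemma universal_additive:
  fixes G :: "('g, 'x) ring_scheme"
  assumes G: "abelian_group G"
    and \<beta>: "\<And>r s. r \<in> carrier R \<Longrightarrow> s \<in> carrier S \<Longrightarrow> \<beta> r s \<in> carrier G"
    and a1: "\<And>r r' s. r \<in> carrier R \<Longrightarrow> r' \<in> carrier R \<Longrightarrow> s \<in> carrier S \<Longrightarrow> \<beta> (r \<oplus>\<^bsub>R\<^esub> r') s = \<beta> r s \<oplus>\<^bsub>G\<^esub> \<beta> r' s"
    and a2: "\<And>r s s'. r \<in> carrier R \<Longrightarrow> s \<in> carrier S \<Longrightarrow> s' \<in> carrier S \<Longrightarrow> \<beta> r (s \<oplus>\<^bsub>S\<^esub> s') = \<beta> r s \<oplus>\<^bsub>G\<^esub> \<beta> r s'"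
    and b: "\<And>a r s. a \<in> K \<Longrightarrow> r \<in> carrier R \<Longrightarrow> s \<in> carrier S \<Longrightarrow> \<beta> (c a \<otimes>\<^bsub>R\<^esub> r) s = \<beta> r (u a \<otimes>\<^bsub>S\<^esub> s)"
  obtains \<Phi> where "\<And>x. x \<in> carrier T \<Longrightarrow> \<Phi> x \<in> carrier G"
    "\<And>x y. x \<in> carrier T \<Longrightarrow> y \<in> carrier T \<Longrightarrow> \<Phi> (x \<oplus>\<^bsub>T\<^esub> y) = \<Phi> x \<oplus>\<^bsub>G\<^esub> \<Phi> y"
    "\<And>r s. r \<in> carrier R \<Longrightarrow> s \<in> carrier S \<Longrightarrow> \<Phi> (t r s) = \<beta> r s"
proof -
  interpret G: abelian_group G by fact
  obtain f where f: "f \<in> hom (free_Abelian_group (carrier R \<times> carrier S)) (add_monoid G)"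
    and f_of: "\<And>x. x \<in> carrier R \<times> carrier S \<Longrightarrow> f (frag_of x) = (\<lambda>(r, s). \<beta> r s) x"
    by (rule comm_group.free_Abelian_group_universal[OF G.a_comm_group, of "\<lambda>(r, s). \<beta> r s" "carrier R \<times> carrier S"]) (use \<beta> in auto)
  have fc: "f p \<in> carrier G" if "p \<in> carrier Pre" for p
    using f that by (auto simp: hom_def pre_simps Pi_def)
  have fa: "f (p + q) = f p \<oplus>\<^bsub>G\<^esub> f q" if "p \<in> carrier Pre" "q \<in> carrier Pre" for p q
    using f that by (auto simp: hom_def pre_simps)
  have fd: "f (p - q) = f p \<ominus>\<^bsub>G\<^esub> f q" if "p \<in> carrier Pre" "q \<in> carrier Pre" for p q
    using fa[of "p - q" q] that pre_diff_closed[of p q] fc by (simp add: G.minus_eq G.a_assoc G.r_neg)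
  have ft: "f (frag_of (r, s)) = \<beta> r s" if "r \<in> carrier R" "s \<in> carrier S" for r s using f_of that by simp
  have f0: "f 0 = \<zero>\<^bsub>G\<^esub>" using fd[of 0 0] fc[of 0] by (simp add: pre_simps G.minus_eq G.r_neg)
  define N where "N = {x \<in> carrier Pre. \<forall>y\<in>carrier Pre. f (x \<otimes>\<^bsub>Pre\<^esub> y) = \<zero>\<^bsub>G\<^esub>}"
  have "ideal N Pre"
  proof (rule cring_idealI[OF pre_cring])
    show "\<zero>\<^bsub>Pre\<^esub> \<in> N" by (auto simp: N_def f0 pre_simps(3)[symmetric]) (simp add: pre_simps f0)
    show "a \<oplus>\<^bsub>Pre\<^esub> b \<in> N" if "a \<in> N" "b \<in> N" for a b
      using that fa[of "a \<otimes>\<^bsub>Pre\<^esub> _" "b \<otimes>\<^bsub>Pre\<^esub> _"] by (auto simp: N_def Pre.l_distr pre_simps(4)[symmetric])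
    show "x \<otimes>\<^bsub>Pre\<^esub> a \<in> N" if "a \<in> N" "x \<in> carrier Pre" for a x
    proof -
      have "f (x \<otimes>\<^bsub>Pre\<^esub> a \<otimes>\<^bsub>Pre\<^esub> y) = \<zero>\<^bsub>G\<^esub>" if "y \<in> carrier Pre" for y
      proof -
        have "x \<otimes>\<^bsub>Pre\<^esub> a \<otimes>\<^bsub>Pre\<^esub> y = a \<otimes>\<^bsub>Pre\<^esub> (x \<otimes>\<^bsub>Pre\<^esub> y)"
          using \<open>a \<in> N\<close> \<open>x \<in> carrier Pre\<close> that by (simp add: N_def Pre.m_ac)
        then show ?thesis using \<open>a \<in> N\<close> \<open>x \<in> carrier Pre\<close> that by (auto simp: N_def)
      qed
      then show ?thesis using that by (simp add: N_def)
    qed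
  qed (auto simp: N_def)
  moreover have "gens \<subseteq> N"
  proof
    fix x assume x: "x \<in> gens"
    have "f (x \<otimes>\<^bsub>Pre\<^esub> y) = \<zero>\<^bsub>G\<^esub>" if "y \<in> carrier Pre" for y
      using that
    proof (induction rule: pre_induct)
      case (pure r0 s0)
      from x show ?case
      proof (cases rule: gens_cases)
        case (1 r r' s)
        then have "f (x \<otimes>\<^bsub>Pre\<^esub> frag_of (r0, s0)) = \<beta> (r \<otimes>\<^bsub>R\<^esub> r0 \<oplus>\<^bsub>R\<^esub> r' \<otimes>\<^bsub>R\<^esub> r0) (s \<otimes>\<^bsub>S\<^esub> s0)
          \<ominus>\<^bsub>G\<^esub> \<beta> (r \<otimes>\<^bsub>R\<^esub> r0) (s \<otimes>\<^bsub>S\<^esub> s0) \<ominus>\<^bsub>G\<^esub> \<beta> (r' \<otimes>\<^bsub>R\<^esub> r0) (s \<otimes>\<^bsub>S\<^esub> s0)"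
          using pure by (simp add: pre_mult_diff fd ft pre_diff_closed pre_pure_closed R.l_distr)
        also have "\<dots> = \<zero>\<^bsub>G\<^esub>" using 1 pure by (simp add: a1 \<beta> G.minus_eq G.a_ac G.r_neg G.r_neg1 G.r_neg2)
        finally show ?thesis .
      next
        case (2 r s s')
        then have "f (x \<otimes>\<^bsub>Pre\<^esub> frag_of (r0, s0)) = \<beta> (r \<otimes>\<^bsub>R\<^esub> r0) (s \<otimes>\<^bsub>S\<^esub> s0 \<oplus>\<^bsub>S\<^esub> s' \<otimes>\<^bsub>S\<^esub> s0)
          \<ominus>\<^bsub>G\<^esub> \<beta> (r \<otimes>\<^bsub>R\<^esub> r0) (s \<otimes>\<^bsub>S\<^esub> s0) \<ominus>\<^bsub>G\<^esub> \<beta> (r \<otimes>\<^bsub>R\<^esub> r0) (s' \<otimes>\<^bsub>S\<^esub> s0)"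
          using pure by (simp add: pre_mult_diff fd ft pre_diff_closed pre_pure_closed S.l_distr)
        also have "\<dots> = \<zero>\<^bsub>G\<^esub>" using 2 pure by (simp add: a2 \<beta> G.minus_eq G.a_ac G.r_neg G.r_neg1 G.r_neg2)
        finally show ?thesis .
      next
        case (3 a r s)
        then show ?thesis using pure b[of a "r \<otimes>\<^bsub>R\<^esub> r0" "s \<otimes>\<^bsub>S\<^esub> s0"]
          by (simp add: pre_mult_diff fd ft pre_pure_closed R.m_assoc S.m_assoc c u \<beta> G.minus_eq G.r_neg)
      qed
    next
      case (diff y y')
      then show ?case using x gens_carrier fd[of "x \<otimes>\<^bsub>Pre\<^esub> y" "x \<otimes>\<^bsub>Pre\<^esub> y'"]
        by (auto simp: pre_mult_diff pre_mult_closed G.minus_eq)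
    qed
    then show "x \<in> N" using x gens_carrier by (auto simp: N_def)
  qed
  ultimately have N: "Rel \<subseteq> N" unfolding Rel_eq by (rule Pre.genideal_minimal)
  have kill: "f x = \<zero>\<^bsub>G\<^esub>" if "x \<in> Rel" for x
  proof -
    have "x \<in> carrier Pre" "f (x \<otimes>\<^bsub>Pre\<^esub> \<one>\<^bsub>Pre\<^esub>) = \<zero>\<^bsub>G\<^esub>" using N that by (auto simp: N_def)
    then show ?thesis by simp
  qed
  define \<Phi> where "\<Phi> x = f (SOME p. p \<in> carrier Pre \<and> cl p = x)" for x
  have \<Phi>: "\<Phi> (cl p) = f p" if p: "p \<in> carrier Pre" for p
  proof -
    define q where "q = (SOME q. q \<in> carrier Pre \<and> cl q = cl p)"
    have q: "q \<in> carrier Pre \<and> cl q = cl p" unfolding q_def by (rule someI[of _ p]) (use p in simp)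
    then have "q - p \<in> Rel" using Q.q_eq[of q p] p by (simp add: pre_minus)
    then have "f q \<ominus>\<^bsub>G\<^esub> f p = \<zero>\<^bsub>G\<^esub>" using kill fd[of q p] q p by simp
    then have "f q = f p" using fc q p by (metis G.add.inv_closed G.add.inv_equality G.minus_eq G.minus_minus)
    then show ?thesis unfolding \<Phi>_def q_def .
  qed
  show ?thesis
  proof (rule that[of \<Phi>])
    fix x assume "x \<in> carrier T"
    then show "\<Phi> x \<in> carrier G" using Q.carr \<Phi> fc by auto
  next
    fix x y assume "x \<in> carrier T" "y \<in> carrier T"
    then obtain p q where "p \<in> carrier Pre" "q \<in> carrier Pre" "x = cl p" "y = cl q" using Q.carr by auto
    then show "\<Phi> (x \<oplus>\<^bsub>T\<^esub> y) = \<Phi> x \<oplus>\<^bsub>G\<^esub> \<Phi> y"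
      using \<Phi> fa Pre.a_closed[of p q] by (simp add: pre_simps(4) flip: Q.q_add)
  next
    fix r s assume "r \<in> carrier R" "s \<in> carrier S"
    then show "\<Phi> (t r s) = \<beta> r s" by (simp add: t_cl \<Phi> pre_pure_closed ft)
  qed
qed

lemma universal_ring:
  assumes A: "cring A" and f: "f \<in> ring_hom R A" and h: "h \<in> ring_hom S A" and fh: "\<And>a. a \<in> K \<Longrightarrow> f (c a) = h (u a)"
  obtains \<Phi> where "\<Phi> \<in> ring_hom T A" "\<And>r s. r \<in> carrier R \<Longrightarrow> s \<in> carrier S \<Longrightarrow> \<Phi> (t r s) = f r \<otimes>\<^bsub>A\<^esub> h s"
proof -
  interpret A: cring A by fact
  note F = ring_hom_memE[OF f] and H = ring_hom_memE[OF h]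
  obtain \<Phi> where \<Phi>: "\<And>x. x \<in> carrier T \<Longrightarrow> \<Phi> x \<in> carrier A"
    "\<And>x y. x \<in> carrier T \<Longrightarrow> y \<in> carrier T \<Longrightarrow> \<Phi> (x \<oplus>\<^bsub>T\<^esub> y) = \<Phi> x \<oplus>\<^bsub>A\<^esub> \<Phi> y"
    "\<And>r s. r \<in> carrier R \<Longrightarrow> s \<in> carrier S \<Longrightarrow> \<Phi> (t r s) = f r \<otimes>\<^bsub>A\<^esub> h s"
  proof (rule universal_additive[OF A.abelian_group_axioms, where \<beta> = "\<lambda>r s. f r \<otimes>\<^bsub>A\<^esub> h s"])
    fix a r s assume "a \<in> K" "r \<in> carrier R" "s \<in> carrier S"
    then show "f (c a \<otimes>\<^bsub>R\<^esub> r) \<otimes>\<^bsub>A\<^esub> h s = f r \<otimes>\<^bsub>A\<^esub> h (u a \<otimes>\<^bsub>S\<^esub> s)"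
      using c u by (simp add: F H fh A.m_ac)
  qed (auto simp: F H A.l_distr A.r_distr)
  have mult: "\<Phi> (x \<otimes>\<^bsub>T\<^esub> y) = \<Phi> x \<otimes>\<^bsub>A\<^esub> \<Phi> y" if x: "x \<in> carrier T" and y: "y \<in> carrier T" for x y
    using x
  proof (induction rule: T_induct)
    case (pure r s)
    show ?case using y
    proof (induction rule: T_induct)
      case (pure r' s')
      then show ?case using \<open>r \<in> carrier R\<close> \<open>s \<in> carrier S\<close> by (simp add: t_mult \<Phi>(3) F H A.m_ac)
    next
      case (add x y)
      then show ?case using pure t_closed by (simp add: T.r_distr \<Phi>(1,2) A.r_distr)
    qed
  next
    case (add x x')
    then show ?case using y by (simp add: T.l_distr \<Phi>(1,2) A.l_distr)
  qed
  have "\<Phi> \<one>\<^bsub>T\<^esub> = \<one>\<^bsub>A\<^esub>" using \<Phi>(3)[of "\<one>\<^bsub>R\<^esub>" "\<one>\<^bsub>S\<^esub>"] F(4) H(4) by (simp add: t_one)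
  then have "\<Phi> \<in> ring_hom T A" using \<Phi> mult by (intro ring_hom_memI) auto
  then show ?thesis using that[of \<Phi>] \<Phi>(3) by blast
qed

lemma pre_der_closed: "p \<in> carrier Pre \<Longrightarrow> der Pre p \<in> carrier Pre"
proof (induction rule: pre_induct)
  case (pure r s)
  then have "frag_of (der R r, s) \<oplus>\<^bsub>Pre\<^esub> frag_of (r, der S s) \<in> carrier Pre"
    by (intro Pre.a_closed pre_pure_closed der_closed)
  then show ?case by (simp add: pre_simps(4,5))
qed (simp add: pre_simps(5) frag_extend_diff pre_diff_closed)

lemma cl_eq_additive:
  assumes \<Phi>: "\<And>x y. x \<in> carrier T \<Longrightarrow> y \<in> carrier T \<Longrightarrow> \<Phi> (x \<oplus>\<^bsub>T\<^esub> y) = \<Phi> x \<oplus>\<^bsub>T\<^esub> \<Phi> y"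
      "\<And>x. x \<in> carrier T \<Longrightarrow> \<Phi> x \<in> carrier T"
    and f: "\<And>p q. f (p - q) = f p - f q" "\<And>p. p \<in> carrier Pre \<Longrightarrow> f p \<in> carrier Pre"
    and pure: "\<And>r s. r \<in> carrier R \<Longrightarrow> s \<in> carrier S \<Longrightarrow> cl (f (frag_of (r, s))) = \<Phi> (t r s)"
    and p: "p \<in> carrier Pre"
  shows "cl (f p) = \<Phi> (cl p)"
  using p
proof (induction rule: pre_induct)
  case (pure r s)
  then show ?case using assms(5) by (simp add: t_cl)
next
  case (diff a b)
  have "\<Phi> (cl a) = \<Phi> (cl (a - b) \<oplus>\<^bsub>T\<^esub> cl b)"
    using Q.q_add[of "a - b" b] diff pre_diff_closed by (simp add: pre_simps)
  also have "\<dots> = \<Phi> (cl (a - b)) \<oplus>\<^bsub>T\<^esub> \<Phi> (cl b)" using diff \<Phi> Q.q_closed pre_diff_closed by simp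
  finally have "\<Phi> (cl (a - b)) = \<Phi> (cl a) \<ominus>\<^bsub>T\<^esub> \<Phi> (cl b)"
    using diff \<Phi>(2) Q.q_closed pre_diff_closed by (simp add: T.minus_eq T.a_assoc T.r_neg)
  then show ?case using diff f by (simp add: cl_diff)
qed

lemma der_T:
  assumes "p \<in> carrier Pre" shows "der T (cl p) = cl (der Pre p)"
proof -
  obtain \<Phi> where \<Phi>: "\<And>x. x \<in> carrier T \<Longrightarrow> \<Phi> x \<in> carrier T"
    "\<And>x y. x \<in> carrier T \<Longrightarrow> y \<in> carrier T \<Longrightarrow> \<Phi> (x \<oplus>\<^bsub>T\<^esub> y) = \<Phi> x \<oplus>\<^bsub>T\<^esub> \<Phi> y"
    "\<And>r s. r \<in> carrier R \<Longrightarrow> s \<in> carrier S \<Longrightarrow> \<Phi> (t r s) = t (der R r) s \<oplus>\<^bsub>T\<^esub> t r (der S s)"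
  proof (rule universal_additive[OF T.abelian_group_axioms, where \<beta> = "\<lambda>r s. t (der R r) s \<oplus>\<^bsub>T\<^esub> t r (der S s)"])
    fix a r s assume a: "a \<in> K" "r \<in> carrier R" "s \<in> carrier S"
    obtain a' where a': "a' \<in> K" "der R (c a) = c a'" "der S (u a) = u a'" using dcu a by blast
    show "t (der R (c a \<otimes>\<^bsub>R\<^esub> r)) s \<oplus>\<^bsub>T\<^esub> t (c a \<otimes>\<^bsub>R\<^esub> r) (der S s) = t (der R r) (u a \<otimes>\<^bsub>S\<^esub> s) \<oplus>\<^bsub>T\<^esub> t r (der S (u a \<otimes>\<^bsub>S\<^esub> s))"
      using a a' c u by (simp add: der_R der_S t_add1 t_add2 t_balanced der_closed t_closed T.a_ac)
  qed (auto simp: t_closed der_closed der_R der_S t_add1 t_add2 T.a_ac)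
  have eq: "cl (der Pre p) = \<Phi> (cl p)" if "p \<in> carrier Pre" for p
  proof (rule cl_eq_additive[OF \<Phi>(2,1) _ _ _ that])
    fix r s assume "r \<in> carrier R" "s \<in> carrier S"
    then show "cl (der Pre (frag_of (r, s))) = \<Phi> (t r s)"
      using Q.q_add[of "frag_of (der R r, s)" "frag_of (r, der S s)"] pre_pure_closed der_closed
      by (simp add: pre_simps(4,5) \<Phi>(3)) (simp add: t_cl)
  qed (auto simp: pre_simps(5) frag_extend_diff pre_der_closed[unfolded pre_simps(5)])
  have z: "\<Phi> \<zero>\<^bsub>T\<^esub> = \<zero>\<^bsub>T\<^esub>" using eq[of 0] Q.q_zero by (simp add: pre_simps)
  have "der Pre ` Rel \<subseteq> Rel"
  proof safe
    fix x assume x: "x \<in> Rel"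
    then have xc: "x \<in> carrier Pre" using ideal.Icarr[OF Rel_ideal] by blast
    then have "cl (der Pre x) = \<zero>\<^bsub>T\<^esub>" using eq[OF xc] Q.q_eq_zero[OF xc] x z by simp
    then show "der Pre x \<in> Rel" using Q.q_eq_zero[OF pre_der_closed[OF xc]] by simp
  qed
  then show ?thesis using assms unfolding tensor_def cl_def
    by (intro der_sd_quot pre_cring Rel_ideal) (auto simp: pre_der_closed, auto simp: pre_simps(4,5) frag_extend_add)
qed

lemma der_T_additive: "x \<in> carrier T \<Longrightarrow> der T x \<in> carrier T"
    "x \<in> carrier T \<Longrightarrow> y \<in> carrier T \<Longrightarrow> der T (x \<oplus>\<^bsub>T\<^esub> y) = der T x \<oplus>\<^bsub>T\<^esub> der T y"
proof -
  show "x \<in> carrier T \<Longrightarrow> der T x \<in> carrier T" using Q.carr der_T pre_der_closed by auto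
  assume "x \<in> carrier T" "y \<in> carrier T"
  then obtain p q where p: "p \<in> carrier Pre" "q \<in> carrier Pre" "x = cl p" "y = cl q" using Q.carr by auto
  then have "der T (x \<oplus>\<^bsub>T\<^esub> y) = cl (der Pre (p \<oplus>\<^bsub>Pre\<^esub> q))" by (simp add: der_T flip: Q.q_add)
  also have "der Pre (p \<oplus>\<^bsub>Pre\<^esub> q) = der Pre p \<oplus>\<^bsub>Pre\<^esub> der Pre q" by (simp add: pre_simps(4,5) frag_extend_add)
  finally show "der T (x \<oplus>\<^bsub>T\<^esub> y) = der T x \<oplus>\<^bsub>T\<^esub> der T y" using p by (simp add: Q.q_add pre_der_closed der_T)
qed

lemma der_t: "r \<in> carrier R \<Longrightarrow> s \<in> carrier S \<Longrightarrow> der T (t r s) = t (der R r) s \<oplus>\<^bsub>T\<^esub> t r (der S s)"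
  using Q.q_add[of "frag_of (der R r, s)" "frag_of (r, der S s)"]
  by (simp add: t_cl der_T pre_pure_closed der_closed pre_simps(4,5))

lemma T_diff_ring: "diff_ring T"
proof -
  have "der T (x \<otimes>\<^bsub>T\<^esub> y) = (der T x \<otimes>\<^bsub>T\<^esub> y) \<oplus>\<^bsub>T\<^esub> (x \<otimes>\<^bsub>T\<^esub> der T y)" if x: "x \<in> carrier T" and y: "y \<in> carrier T" for x y
    using x
  proof (induction rule: T_induct)
    case (pure r s)
    show ?case using y
    proof (induction rule: T_induct)
      case (pure r' s')
      then show ?case using \<open>r \<in> carrier R\<close> \<open>s \<in> carrier S\<close>
        by (simp add: t_mult der_t der_closed der_R der_S t_add1 t_add2 T.l_distr T.r_distr t_closed T.a_ac)
    next
      case (add x y)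
      then show ?case using pure t_closed[OF pure] by (simp add: T.r_distr der_T_additive T.a_ac)
    qed
  next
    case (add x x')
    then show ?case using y by (simp add: T.l_distr der_T_additive T.a_ac)
  qed
  then show ?thesis using der_T_additive T.is_cring by (auto simp: diff_ring_def)
qed

lemma shift_T:
  assumes s: "shift R \<in> ring_hom R R" "\<And>a. a \<in> K \<Longrightarrow> shift R (c a) = c a"
  shows "shift T \<in> ring_hom T T" "\<And>r s. r \<in> carrier R \<Longrightarrow> s \<in> carrier S \<Longrightarrow> shift T (t r s) = t (shift R r) s"
proof -
  note F = ring_hom_memE[OF s(1)]
  obtain \<Phi> where \<Phi>: "\<Phi> \<in> ring_hom T T" "\<And>r s. r \<in> carrier R \<Longrightarrow> s \<in> carrier S \<Longrightarrow> \<Phi> (t r s) = t (shift R r) s"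
  proof (rule universal_ring[OF T.is_cring, where f = "\<lambda>r. t (shift R r) \<one>\<^bsub>S\<^esub>" and h = "\<lambda>s. t \<one>\<^bsub>R\<^esub> s"])
    show "(\<lambda>r. t (shift R r) \<one>\<^bsub>S\<^esub>) \<in> ring_hom R T"
      by (rule ring_hom_memI) (auto simp: F t_closed t_add1 t_mult t_one)
    show "(\<lambda>s. t \<one>\<^bsub>R\<^esub> s) \<in> ring_hom S T"
      by (rule ring_hom_memI) (auto simp: t_closed t_add2 t_mult t_one)
    show "t (shift R (c a)) \<one>\<^bsub>S\<^esub> = t \<one>\<^bsub>R\<^esub> (u a)" if "a \<in> K" for a
      using t_balanced[OF that, of "\<one>\<^bsub>R\<^esub>" "\<one>\<^bsub>S\<^esub>"] s(2)[OF that] c[OF that] u[OF that] by simp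
  next
    fix \<Phi> assume "\<Phi> \<in> ring_hom T T" and e: "\<And>r s. r \<in> carrier R \<Longrightarrow> s \<in> carrier S \<Longrightarrow>
      \<Phi> (t r s) = t (shift R r) \<one>\<^bsub>S\<^esub> \<otimes>\<^bsub>T\<^esub> t \<one>\<^bsub>R\<^esub> s"
    moreover have "\<Phi> (t r s) = t (shift R r) s" if "r \<in> carrier R" "s \<in> carrier S" for r s
      using e[OF that] that F(1) by (simp add: t_mult)
    ultimately show ?thesis using that by blast
  qed
  note P = ring_hom_memE[OF \<Phi>(1)]
  have sc: "shift Pre p \<in> carrier Pre" if "p \<in> carrier Pre" for p
    using that by (induction rule: pre_induct) (auto simp: pre_simps(6) frag_extend_diff pre_diff_closed pre_pure_closed F)
  have eq: "cl (shift Pre p) = \<Phi> (cl p)" if "p \<in> carrier Pre" for p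
  proof (rule cl_eq_additive[OF P(3,1) _ sc _ that])
    fix r s assume "r \<in> carrier R" "s \<in> carrier S"
    then show "cl (shift Pre (frag_of (r, s))) = \<Phi> (t r s)"
      by (simp add: pre_simps(6) \<Phi>(2)) (simp add: t_cl)
  qed (auto simp: pre_simps(6) frag_extend_diff)
  have z: "\<Phi> \<zero>\<^bsub>T\<^esub> = \<zero>\<^bsub>T\<^esub>" using eq[of 0] Q.q_zero by (simp add: pre_simps)
  have "shift Pre ` Rel \<subseteq> Rel"
  proof safe
    fix x assume x: "x \<in> Rel"
    then have xc: "x \<in> carrier Pre" using ideal.Icarr[OF Rel_ideal] by blast
    then have "cl (shift Pre x) = \<zero>\<^bsub>T\<^esub>" using eq[OF xc] Q.q_eq_zero[OF xc] x z by simp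
    then show "shift Pre x \<in> Rel" using Q.q_eq_zero[OF sc[OF xc]] by simp
  qed
  then have shT: "shift T (cl p) = cl (shift Pre p)" if "p \<in> carrier Pre" for p
    using that unfolding tensor_def cl_def
    by (intro shift_sd_quot pre_cring Rel_ideal) (auto simp: sc, auto simp: pre_simps(4,6) frag_extend_add)
  have sP: "shift T x = \<Phi> x" if "x \<in> carrier T" for x
    using that Q.carr eq shT by auto
  show "shift T \<in> ring_hom T T"
    by (rule ring_hom_memI) (auto simp: sP P)
  show "shift T (t r s) = t (shift R r) s" if "r \<in> carrier R" "s \<in> carrier S" for r s
    using sP[OF t_closed[OF that]] \<Phi>(2)[OF that] by simp
qed

text \<open>A \<open>K\<close>-linear map from \<open>R\<close> to \<open>S\<close> induces \<open>r \<otimes> s \<mapsto> lam r * s\<close>. With \<open>lam \<one> = \<one>\<close> this retracts \<open>S \<rightarrow> R \<otimes> S\<close>.\<close>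
lemma inj_right:
  assumes lam: "\<And>r. r \<in> carrier R \<Longrightarrow> lam r \<in> carrier S"
     "\<And>r r'. r \<in> carrier R \<Longrightarrow> r' \<in> carrier R \<Longrightarrow> lam (r \<oplus>\<^bsub>R\<^esub> r') = lam r \<oplus>\<^bsub>S\<^esub> lam r'"
     "\<And>a r. a \<in> K \<Longrightarrow> r \<in> carrier R \<Longrightarrow> lam (c a \<otimes>\<^bsub>R\<^esub> r) = u a \<otimes>\<^bsub>S\<^esub> lam r"
    and s: "s \<in> carrier S" "s' \<in> carrier S" and r: "r \<in> carrier R" "r' \<in> carrier R" and eq: "t r s = t r' s'"
  shows "lam r \<otimes>\<^bsub>S\<^esub> s = lam r' \<otimes>\<^bsub>S\<^esub> s'"
proof (rule universal_additive[OF S.abelian_group_axioms, where \<beta> = "\<lambda>r s. lam r \<otimes>\<^bsub>S\<^esub> s"])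
  fix \<Phi> assume "\<And>r s. r \<in> carrier R \<Longrightarrow> s \<in> carrier S \<Longrightarrow> \<Phi> (t r s) = lam r \<otimes>\<^bsub>S\<^esub> s"
  then show ?thesis using eq r s by metis
next
  fix a r s assume "a \<in> K" "r \<in> carrier R" "s \<in> carrier S"
  then show "lam (c a \<otimes>\<^bsub>R\<^esub> r) \<otimes>\<^bsub>S\<^esub> s = lam r \<otimes>\<^bsub>S\<^esub> (u a \<otimes>\<^bsub>S\<^esub> s)" using lam u by (simp add: S.m_ac)
qed (auto simp: lam S.l_distr S.r_distr)

end

section \<open>Records carried by subsets of a ring type\<close>

lemma dring_on_simps [simp]:
  "carrier (dring_on C d) = C" "a \<otimes>\<^bsub>dring_on C d\<^esub> b = a * b" "a \<oplus>\<^bsub>dring_on C d\<^esub> b = a + b"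
  "\<one>\<^bsub>dring_on C d\<^esub> = 1" "\<zero>\<^bsub>dring_on C d\<^esub> = 0" "der (dring_on C d) = d"
  by (simp_all add: dring_on_def)

lemma cring_dring_on: "subring_set C \<Longrightarrow> cring (dring_on C d)"
  using subring_setD[of C]
  by (intro cringI abelian_groupI comm_monoidI) (auto simp: algebra_simps intro: bexI[of _ "- _"])

lemma minus_dring_on:
  assumes "subring_set C" "a \<in> C" "b \<in> C"
  shows "\<ominus>\<^bsub>dring_on C d\<^esub> b = - b" "a \<ominus>\<^bsub>dring_on C d\<^esub> b = a - b"
proof -
  interpret cring "dring_on C d" by (rule cring_dring_on) fact
  show m: "\<ominus>\<^bsub>dring_on C d\<^esub> b = - b"
    by (rule minus_equality) (use assms subring_setD[of C] in auto)
  show "a \<ominus>\<^bsub>dring_on C d\<^esub> b = a - b" by (simp add: minus_eq m)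
qed

lemma diff_ring_dring_on:
  assumes "subring_set C" "derivation d" "\<And>a. a \<in> C \<Longrightarrow> d a \<in> C"
  shows "diff_ring (dring_on C d)"
  using assms cring_dring_on[OF assms(1)] derivation.add[OF assms(2)] derivation.mult[OF assms(2)]
  by (auto simp: diff_ring_def)

lemma nat_pow_dring_on: "a [^]\<^bsub>dring_on C d\<^esub> (k::nat) = a ^ k"
  by (induction k) (auto simp: nat_pow_def mult.commute)

text \<open>Translates between the list polynomials in which algebraic closedness of a ring record is expressed
  and polynomials over the surrounding type.\<close>
lemma root_in_algebraically_closed_subfield:
  fixes p :: "'f::field poly"
  assumes ac: "algebraically_closed (dring_on K d)" and pK: "\<And>i. poly.coeff p i \<in> K" and deg: "Polynomial.degree p > 0"
  shows "\<exists>a\<in>K. poly p a = 0"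
proof -
  interpret L: algebraically_closed "dring_on K d" by (rule ac)
  define P where "P = rev (Polynomial.coeffs p)"
  have p0: "p \<noteq> 0" using deg by auto
  have dP: "Polynomials.degree P = Polynomial.degree p"
    by (auto simp: P_def degree_eq_length_coeffs)
  have "set P \<subseteq> K" unfolding P_def using pK by (auto simp: coeffs_def)
  then have cP: "P \<in> carrier (poly_ring (dring_on K d))"
    using p0 by (auto simp: univ_poly_def polynomial_def P_def hd_rev last_coeffs_eq_coeff_degree)
  then have "L.splitted P" using L.roots_over_carrier by blast
  then have "L.roots P \<noteq> {#}" unfolding L.splitted_def using dP deg by auto
  then obtain x where "x \<in># L.roots P" by blast
  then have x: "L.is_root P x" using L.roots_mem_iff_is_root[OF cP] by auto
  have "L.eval (rev xs) x = poly (Poly xs) x" for xs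
    by (induction xs rule: rev_induct) (auto simp: Poly_append poly_monom nat_pow_dring_on)
  from this[of "Polynomial.coeffs p"] have "L.eval P x = poly p x" by (simp add: P_def)
  then show ?thesis using x by (auto simp: L.is_root_def)
qed

lemma subring_fixed_field:
  assumes "ring_map \<sigma>" shows "subring_set (fixed_field \<sigma>)"
proof -
  interpret ring_map \<sigma> by fact
  show ?thesis by (auto simp: subring_set_def fixed_field_def one diff mult)
qed

section \<open>The differential ring of the generic matrix\<close>

definition gl_eq :: "('a::comm_ring_1, 'n::finite) gl_pol" where
  "gl_eq = mpol_var InvDet * det gen_mat - 1"

context derivation
begin

lemma gl_derivation: "derivation (gl_deriv d :: ('a, 'n::finite) gl_pol \<Rightarrow> _)"
  unfolding gl_deriv_def by (rule mpol_derivation)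

lemma gl_deriv_const: "gl_deriv d (mpol_const a) = mpol_const (d a)"
  by (simp add: gl_deriv_def mpol_deriv_const)

lemma gl_deriv_Entry: "gl_deriv d (mpol_var (Entry i j k)) = mpol_var (Entry i j (Suc k))"
  by (simp add: gl_deriv_def mpol_deriv_var)

lemma gl_deriv_InvDet: "gl_deriv d (mpol_var InvDet) = - (mpol_var InvDet)\<^sup>2 * gl_deriv d (det gen_mat)"
proof -
  have "mpol_deriv d entry_deriv (det gen_mat) = gl_deriv d (det gen_mat :: ('a, 'b) gl_pol)"
    by (rule derivations_agree_det[OF mpol_derivation gl_derivation])
      (simp add: gen_mat_def gl_deriv_Entry mpol_deriv_var)
  then show ?thesis by (simp add: gl_deriv_def mpol_deriv_var)
qed

lemma gl_deriv_gl_eq: "gl_deriv d gl_eq = - (mpol_var InvDet * gl_deriv d (det gen_mat)) * gl_eq"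
proof -
  interpret D: derivation "gl_deriv d :: ('a, 'b) gl_pol \<Rightarrow> _" by (rule gl_derivation)
  show ?thesis unfolding gl_eq_def D.diff D.mult gl_deriv_InvDet D.one
    by (simp add: algebra_simps power2_eq_square)
qed

end

lemma gen_mat_nth: "gen_mat $ i $ j = mpol_var (Entry i j 0)" by (simp add: gen_mat_def)

lemma gen_mat_closed: "subring_set C \<Longrightarrow> gen_mat $ i $ j \<in> mpols_over C"
  by (simp add: gen_mat_def mpol_var_closed)

lemma det_gen_mat_closed: "subring_set C \<Longrightarrow> det gen_mat \<in> mpols_over C"
  by (intro subring_set_det subring_mpols_over gen_mat_closed)

lemma gl_eq_closed: "subring_set C \<Longrightarrow> gl_eq \<in> mpols_over C"
  unfolding gl_eq_def using subring_mpols_over[of C] subring_setD[of "mpols_over C"]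
  by (auto intro!: subring_setD mpol_var_closed det_gen_mat_closed)

text \<open>Instantiated with all of \<open>F\<close>, with \<open>K\<close> inside \<open>F\<close>, and with all of the differential closure.\<close>
locale gl_setup = derivation d for d :: "'a::comm_ring_1 \<Rightarrow> 'a" +
  fixes C :: "'a set"
  assumes C: "subring_set C" and dC: "a \<in> C \<Longrightarrow> d a \<in> C"
begin

abbreviation polys :: "('a, 'n::finite) gl_pol set" where "polys \<equiv> mpols_over C"

lemmas polys_closed = subring_setD[OF subring_mpols_over[OF C]]

lemma gl_deriv_closed: "p \<in> polys \<Longrightarrow> gl_deriv d p \<in> (polys :: ('a, 'n::finite) gl_pol set)"
  unfolding gl_deriv_def
proof (rule mpol_deriv_closed[OF C dC])
  fix v :: "'n gl_var"
  have "mpol_deriv d entry_deriv (det gen_mat) \<in> (polys :: ('a, 'n) gl_pol set)"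
  proof (rule mpol_deriv_closed[OF C dC _ det_gen_mat_closed[OF C]])
    show "entry_deriv v \<in> (polys :: ('a, 'n) gl_pol set)" for v
      by (cases v) (auto intro: mpol_var_closed C polys_closed)
  qed
  then show "(case v of Entry i j k \<Rightarrow> entry_deriv (Entry i j k)
     | InvDet \<Rightarrow> - (mpol_var InvDet)\<^sup>2 * mpol_deriv d entry_deriv (det gen_mat)) \<in> (polys :: ('a, 'n) gl_pol set)"
    by (cases v) (auto intro!: mpol_var_closed C polys_closed simp: power2_eq_square)
qed

lemma pol_diff_ring: "diff_ring (gl_pol_dring C d :: ('a, 'n::finite) gl_pol dring)"
  unfolding gl_pol_dring_def by (rule diff_ring_dring_on[OF subring_mpols_over[OF C] gl_derivation gl_deriv_closed])

lemma pol_cring: "cring (gl_pol_dring C d :: ('a, 'n::finite) gl_pol dring)"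
  by (rule pol_diff_ring[unfolded diff_ring_def, THEN conjunct1])

lemma gl_rel_eq: "gl_rel C d = {x * gl_eq | x. x \<in> polys}"
  unfolding gl_rel_def cgenideal_def gl_pol_dring_def by (simp add: gl_eq_def)

lemma gl_rel_ideal: "ideal (gl_rel C d :: ('a, 'n::finite) gl_pol set) (gl_pol_dring C d)"
  unfolding gl_rel_def
  by (rule cring.cgenideal_ideal[OF pol_cring]) (use gl_eq_closed[OF C] in \<open>simp add: gl_pol_dring_def gl_eq_def\<close>)

lemma gl_rel_deriv: "gl_deriv d ` gl_rel C d \<subseteq> (gl_rel C d :: ('a, 'n::finite) gl_pol set)"
proof safe
  fix p :: "('a, 'n) gl_pol" assume "p \<in> gl_rel C d"
  then obtain x where x: "p = x * gl_eq" "x \<in> polys" unfolding gl_rel_eq by blast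
  have "gl_deriv d p = (gl_deriv d x - x * (mpol_var InvDet * gl_deriv d (det gen_mat))) * gl_eq"
    unfolding x derivation.mult[OF gl_derivation] gl_deriv_gl_eq by (simp add: algebra_simps)
  moreover have "gl_deriv d x - x * (mpol_var InvDet * gl_deriv d (det gen_mat)) \<in> polys"
    using x by (intro polys_closed gl_deriv_closed mpol_var_closed det_gen_mat_closed C)
  ultimately show "gl_deriv d p \<in> gl_rel C d" unfolding gl_rel_eq by blast
qed

sublocale Q: quot_hom "gl_pol_dring C d :: ('a, 'n::finite) gl_pol dring" "gl_dring C d" "gl_class C d" "gl_rel C d"
  unfolding gl_dring_def gl_class_def by (rule quot_hom_d_quot[OF pol_cring gl_rel_ideal])

lemma gl_class_simps:
  "carrier (gl_dring C d) = gl_class C d ` polys"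
  "p \<in> polys \<Longrightarrow> q \<in> polys \<Longrightarrow> gl_class C d p \<otimes>\<^bsub>gl_dring C d\<^esub> gl_class C d q = gl_class C d (p * q)"
  "p \<in> polys \<Longrightarrow> q \<in> polys \<Longrightarrow> gl_class C d p \<oplus>\<^bsub>gl_dring C d\<^esub> gl_class C d q = gl_class C d (p + q)"
  "\<one>\<^bsub>gl_dring C d\<^esub> = gl_class C d 1" "\<zero>\<^bsub>gl_dring C d\<^esub> = gl_class C d 0"
  "p \<in> polys \<Longrightarrow> q \<in> polys \<Longrightarrow> gl_class C d p = gl_class C d q \<longleftrightarrow> p - q \<in> gl_rel C d"
  for p q :: "('a, 'n::finite) gl_pol"
proof -
  show "\<one>\<^bsub>gl_dring C d\<^esub> = gl_class C d 1" "\<zero>\<^bsub>gl_dring C d\<^esub> = gl_class C d 0"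
    "carrier (gl_dring C d) = gl_class C d ` polys"
    by (rule Q.q_one[symmetric, unfolded gl_pol_dring_def dring_on_simps] Q.q_zero[symmetric, unfolded gl_pol_dring_def dring_on_simps]
      Q.carr[unfolded gl_pol_dring_def dring_on_simps])+
qed (use Q.q_mult[of p q] Q.q_add[of p q] Q.q_eq[of p q]
    minus_dring_on(2)[OF subring_mpols_over[OF C], of p q "gl_deriv d"] in \<open>simp_all add: gl_pol_dring_def\<close>)

lemma der_gl_class:
  "p \<in> polys \<Longrightarrow> der (gl_dring C d) (gl_class C d p) = gl_class C d (gl_deriv d p)"
  for p :: "('a, 'n::finite) gl_pol"
  using der_d_quot[OF pol_diff_ring gl_rel_ideal, of p] gl_rel_deriv
  unfolding gl_dring_def gl_class_def by (simp add: gl_pol_dring_def)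

lemma gl_diff_ring: "diff_ring (gl_dring C d :: ('a, 'n::finite) gl_pol set dring)"
  by (rule diff_ring_of_surj[OF pol_diff_ring Q.carr Q.q_mult Q.q_add Q.q_one Q.q_zero])
    (simp_all add: gl_pol_dring_def der_gl_class)

end

section \<open>The shift on the generic matrix\<close>

locale sd_field = derivation \<delta> + s: ring_map \<sigma> for \<sigma> \<delta> :: "'f::field_char_0 \<Rightarrow> 'f" +
  fixes A :: "'f ^ 'n::finite ^ 'n"
  assumes commute: "\<sigma> (\<delta> a) = \<delta> (\<sigma> a)" and detA: "det A \<noteq> 0"
begin

abbreviation K where "K \<equiv> fixed_field \<sigma>"
abbreviation \<Sigma> :: "('f, 'n) gl_pol \<Rightarrow> ('f, 'n) gl_pol" where "\<Sigma> \<equiv> gl_shift \<sigma> \<delta> A"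
abbreviation D :: "('f, 'n) gl_pol \<Rightarrow> ('f, 'n) gl_pol" where "D \<equiv> gl_deriv \<delta>"
abbreviation Ac :: "('f, 'n) gl_pol ^ 'n ^ 'n" where "Ac \<equiv> map_matrix mpol_const A"

sublocale F: gl_setup \<delta> UNIV by unfold_locales (auto simp: subring_set_UNIV)

sublocale Kg: gl_setup \<delta> K
proof unfold_locales
  show "subring_set K" by (rule subring_fixed_field) unfold_locales
  show "a \<in> K \<Longrightarrow> \<delta> a \<in> K" for a using commute by (simp add: fixed_field_def)
qed

declare mpols_over_UNIV [simp]

sublocale D: derivation D by (rule gl_derivation)

lemma const_shift: "ring_map_on UNIV (\<lambda>a. mpol_const (\<sigma> a))"
  by unfold_locales (auto simp: subring_set_UNIV s.add s.mult s.one mpol_const_def single_add mult_single)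

sublocale S: ring_map \<Sigma>
proof -
  interpret c: ring_map_on UNIV "\<lambda>a. mpol_const (\<sigma> a) :: ('f, 'n) gl_pol" by (rule const_shift)
  interpret m: ring_map_on UNIV \<Sigma> unfolding gl_shift_def using c.subst_map by simp
  show "ring_map \<Sigma>" using m.add m.mult m.one by unfold_locales auto
qed

lemma shift_const: "\<Sigma> (mpol_const a) = mpol_const (\<sigma> a)"
  unfolding gl_shift_def by (rule ring_map_on.subst_const[OF const_shift])

lemma shift_Entry: "\<Sigma> (mpol_var (Entry i j k)) = (D ^^ k) ((Ac ** gen_mat) $ i $ j)"
  unfolding gl_shift_def by (subst ring_map_on.subst_var[OF const_shift]) simp

lemma shift_InvDet: "\<Sigma> (mpol_var InvDet) = mpol_const (inverse (det A)) * mpol_var InvDet"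
  unfolding gl_shift_def by (subst ring_map_on.subst_var[OF const_shift]) simp

lemma ring_map_on_UNIV: "ring_map h \<Longrightarrow> ring_map_on UNIV h"
  by (simp add: ring_map_on_def ring_map_def subring_set_UNIV)

lemma det_Ac: "det Ac = mpol_const (det A)"
  by (rule ring_map_on.det[OF mpol_const_map, symmetric]) simp

lemma shift_det: "\<Sigma> (det gen_mat) = mpol_const (det A) * det gen_mat"
proof -
  have "\<Sigma> (det gen_mat) = det (map_matrix \<Sigma> gen_mat)"
    by (rule ring_map_on.det[OF ring_map_on_UNIV]) (unfold_locales, simp)
  also have "map_matrix \<Sigma> gen_mat = Ac ** gen_mat"
    by (simp add: vec_eq_iff gen_mat_nth shift_Entry)
  finally show ?thesis by (simp add: det_mul det_Ac)
qed

lemma const_mult: "mpol_const (a * b) = mpol_const a * mpol_const b" and const_one: "mpol_const 1 = 1"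
  and const_add: "mpol_const (a + b) = mpol_const a + mpol_const b" and const_zero: "mpol_const 0 = 0"
  by (simp_all add: mpol_const_def mult_single single_add)

lemma shift_gl_eq: "\<Sigma> gl_eq = gl_eq"
proof -
  have "mpol_const (inverse (det A)) * (mpol_const (det A) :: ('f, 'n) gl_pol) = 1"
    using detA by (simp add: const_one flip: const_mult)
  then show ?thesis
    unfolding gl_eq_def S.diff S.mult shift_InvDet shift_det S.one
    by (simp add: mult_ac)
qed

lemma gl_rel_mult: "p \<in> gl_rel UNIV \<delta> \<Longrightarrow> q * p \<in> gl_rel UNIV \<delta>" "p \<in> gl_rel UNIV \<delta> \<Longrightarrow> p * q \<in> gl_rel UNIV \<delta>"
  and gl_rel_add: "p \<in> gl_rel UNIV \<delta> \<Longrightarrow> q \<in> gl_rel UNIV \<delta> \<Longrightarrow> p + q \<in> gl_rel UNIV \<delta>"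
  and gl_rel_zero: "0 \<in> gl_rel UNIV \<delta>" for p q :: "('f, 'n) gl_pol"
  unfolding F.gl_rel_eq by (auto simp: mult.assoc[symmetric] distrib_right[symmetric]) (metis mult.assoc mult.commute, metis mult_zero_left)

lemma shift_gl_rel: "p \<in> gl_rel UNIV \<delta> \<Longrightarrow> \<Sigma> p \<in> gl_rel UNIV \<delta>"
  unfolding F.gl_rel_eq by (auto simp: S.mult shift_gl_eq)

lemma shift_deriv_commute: "\<Sigma> (D p) - D (\<Sigma> p) \<in> gl_rel UNIV \<delta>"
proof -
  have "p \<in> mpols_over UNIV" by simp
  then show ?thesis using subring_set_UNIV
  proof (induction rule: mpol_induct)
    case (const a)
    then show ?case using gl_rel_zero by (simp add: gl_deriv_const shift_const commute)
  next
    case (var v)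
    show ?case
    proof (cases v)
      case (Entry i j k)
      then show ?thesis using gl_rel_zero by (simp add: gl_deriv_Entry shift_Entry)
    next
      case InvDet
      let ?y = "mpol_var InvDet :: ('f, 'n) gl_pol" and ?a = "mpol_const (det A) :: ('f, 'n) gl_pol"
        and ?b = "mpol_const (inverse (det A)) :: ('f, 'n) gl_pol" and ?x = "det gen_mat :: ('f, 'n) gl_pol"
      have ab: "?b * ?a = 1" using detA by (simp add: const_one flip: const_mult)
      have dab: "D ?b * ?a + ?b * D ?a = 0" using D.mult[of ?b ?a] by (simp add: ab D.one)
      have sD: "\<Sigma> (D ?x) = D (\<Sigma> ?x)"
      proof -
        have pd: "\<Sigma> (D (\<Prod>i\<in>T. gen_mat $ i $ f i)) = D (\<Sigma> (\<Prod>i\<in>T. gen_mat $ i $ f i))" for T and f :: "'n \<Rightarrow> 'n"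
        proof (induction T rule: infinite_finite_induct)
          case (insert i T)
          have "\<Sigma> (D (gen_mat $ i $ f i)) = D (\<Sigma> (gen_mat $ i $ f i))"
            by (simp add: gen_mat_nth gl_deriv_Entry shift_Entry)
          then show ?case using insert by (simp add: D.mult S.mult S.add)
        qed (auto simp: D.one S.zero S.one)
        have "\<Sigma> (D (of_int (sign p) * (\<Prod>i\<in>UNIV. gen_mat $ i $ p i))) = D (\<Sigma> (of_int (sign p) * (\<Prod>i\<in>UNIV. gen_mat $ i $ p i)))" for p :: "'n \<Rightarrow> 'n"
          using pd[of p UNIV] by (auto simp: sign_def D.uminus S.uminus)
        then show ?thesis unfolding det_def by (simp add: D.sum S.sum)
      qed
      have "\<Sigma> (D ?y) = - (?b * ?y)\<^sup>2 * D (?a * ?x)"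
        unfolding gl_deriv_InvDet S.mult S.uminus S.power sD shift_InvDet shift_det ..
      moreover have "D (\<Sigma> ?y) = D ?b * ?y + ?b * (- ?y\<^sup>2 * D ?x)"
        unfolding shift_InvDet D.mult gl_deriv_InvDet ..
      moreover have "- (?b * ?y)\<^sup>2 * D (?a * ?x) = - (?b * ?b * D ?a) * (?y * ?y * ?x) - (?b * ?a) * (?b * ?y * ?y * D ?x)"
        by (simp add: D.mult algebra_simps power2_eq_square)
      moreover have "?b * ?b * D ?a = - D ?b"
      proof -
        have "?b * (D ?b * ?a + ?b * D ?a) = D ?b * (?b * ?a) + ?b * ?b * D ?a" by (simp add: algebra_simps)
        then show ?thesis unfolding ab dab by (simp add: eq_neg_iff_add_eq_0 add.commute)
      qed
      ultimately have "\<Sigma> (D ?y) - D (\<Sigma> ?y) = (D ?b * ?y) * gl_eq"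
        unfolding ab gl_eq_def by (simp add: algebra_simps power2_eq_square)
      then show ?thesis using InvDet unfolding F.gl_rel_eq by auto
    qed
  next
    case (add p q)
    then show ?case using gl_rel_add[of "\<Sigma> (D p) - D (\<Sigma> p)" "\<Sigma> (D q) - D (\<Sigma> q)"]
      by (simp add: D.add S.add algebra_simps)
  next
    case (mult p q)
    have "\<Sigma> (D (p * q)) - D (\<Sigma> (p * q)) = (\<Sigma> (D p) - D (\<Sigma> p)) * \<Sigma> q + \<Sigma> p * (\<Sigma> (D q) - D (\<Sigma> q))"
      by (simp add: D.mult S.mult S.add algebra_simps)
    then show ?case using gl_rel_add gl_rel_mult mult by simp
  qed
qed

lemma sol_simps:
  "carrier (sol_sdring \<sigma> \<delta> A) = carrier (gl_dring UNIV \<delta>)"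
  "monoid.mult (sol_sdring \<sigma> \<delta> A) = monoid.mult (gl_dring UNIV \<delta>)"
  "ring.add (sol_sdring \<sigma> \<delta> A) = ring.add (gl_dring UNIV \<delta>)"
  "\<one>\<^bsub>sol_sdring \<sigma> \<delta> A\<^esub> = \<one>\<^bsub>gl_dring UNIV \<delta>\<^esub>" "\<zero>\<^bsub>sol_sdring \<sigma> \<delta> A\<^esub> = \<zero>\<^bsub>gl_dring UNIV \<delta>\<^esub>"
  "der (sol_sdring \<sigma> \<delta> A) = der (gl_dring UNIV \<delta>)"
  "shift (sol_sdring \<sigma> \<delta> A) = quot_map (gl_pol_dring UNIV \<delta>) (gl_rel UNIV \<delta>) \<Sigma>"
  by (simp_all add: sol_sdring_def dring.defs sdring.defs)

abbreviation "Sol \<equiv> sol_sdring \<sigma> \<delta> A"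
abbreviation cls :: "('f, 'n) gl_pol \<Rightarrow> ('f, 'n) gl_pol set" where "cls \<equiv> gl_class UNIV \<delta>"

lemma cls_simps:
  "carrier Sol = range cls" "cls p \<otimes>\<^bsub>Sol\<^esub> cls q = cls (p * q)" "cls p \<oplus>\<^bsub>Sol\<^esub> cls q = cls (p + q)"
  "\<one>\<^bsub>Sol\<^esub> = cls 1" "\<zero>\<^bsub>Sol\<^esub> = cls 0" "cls p = cls q \<longleftrightarrow> p - q \<in> gl_rel UNIV \<delta>"
  "der Sol (cls p) = cls (D p)" "shift Sol (cls p) = cls (\<Sigma> p)"
proof -
  show "shift Sol (cls p) = cls (\<Sigma> p)"
    unfolding sol_simps gl_class_def using F.gl_rel_ideal shift_gl_rel F.pol_cring
    by (intro quot_map_coset cring.axioms(1)) (auto simp: gl_pol_dring_def S.add)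
qed (auto simp: sol_simps F.gl_class_simps F.der_gl_class)

lemma Sol_cring: "cring Sol"
  by (rule cring_of_surj[OF F.pol_cring, where q = cls]) (auto simp: cls_simps gl_pol_dring_def)

end

section \<open>Levels of the solution ring\<close>

context sd_field
begin

text \<open>Any list enumerating the finitely many generators; it only serves to express that a level is finitely
  generated.\<close>
definition gl_vars :: "nat \<Rightarrow> ('f, 'n) gl_pol list" where
  "gl_vars k = (SOME xs. set xs = mpol_var ` ({Entry i j l | i j l. l \<le> k} \<union> {InvDet}))"

lemma set_gl_vars: "set (gl_vars k) = mpol_var ` ({Entry i j l | i j l. l \<le> k} \<union> {InvDet})"
proof -
  have "{Entry (i::'n) j l | i j l. l \<le> k} \<subseteq> (\<Union>i. \<Union>j. Entry i j ` {..k})" by auto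
  then have "finite {Entry (i::'n) j l | i j l. l \<le> k}" by (rule finite_subset) simp
  then have "finite (mpol_var ` ({Entry i j l | i j l. l \<le> k} \<union> {InvDet}) :: ('f, 'n) gl_pol set)" by simp
  then show ?thesis unfolding gl_vars_def by (rule someI_ex[OF finite_list])
qed

text \<open>The polynomials of order at most \<open>k\<close>: representatives of the level \<open>\<S>\<^sub>k\<close> of the solution ring.\<close>
definition lev :: "nat \<Rightarrow> ('f, 'n) gl_pol set" where
  "lev k = adjoins (range mpol_const) (gl_vars k)"

lemma const_field_map: "field_map (mpol_const :: 'f \<Rightarrow> ('f, 'n) gl_pol)"
  by unfold_locales (auto simp: const_add const_mult const_one)

lemma const_subring: "subring_set (range (mpol_const :: 'f \<Rightarrow> ('f, 'n) gl_pol))"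
proof -
  interpret field_map "mpol_const :: 'f \<Rightarrow> ('f, 'n) gl_pol" by (rule const_field_map)
  show ?thesis by (rule subring_range)
qed

lemma lev_subring: "subring_set (lev k)" unfolding lev_def by (rule subring_adjoins(1)[OF const_subring])

lemmas lev_closed = subring_setD[OF lev_subring]

lemma lev_gens: "mpol_const a \<in> lev k" "l \<le> k \<Longrightarrow> mpol_var (Entry i j l) \<in> lev k" "mpol_var InvDet \<in> lev k"
  using subring_adjoins(2,3)[OF const_subring, of "gl_vars k"] unfolding lev_def set_gl_vars by auto

lemma lev_minimal:
  assumes "subring_set B" "\<And>a. mpol_const a \<in> B" "\<And>i j l. l \<le> k \<Longrightarrow> mpol_var (Entry i j l) \<in> B" "mpol_var InvDet \<in> B"
  shows "lev k \<subseteq> B"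
  unfolding lev_def by (rule adjoins_minimal[OF assms(1)]) (use assms in \<open>auto simp: set_gl_vars\<close>)

lemma lev_mono: "k \<le> m \<Longrightarrow> lev k \<subseteq> lev m"
  by (rule lev_minimal[OF lev_subring]) (auto intro: lev_gens)

lemma lev_union: "\<exists>k. p \<in> lev k"
proof -
  have "p \<in> mpols_over UNIV" by simp
  then show ?thesis using subring_set_UNIV
  proof (induction rule: mpol_induct)
    case (const a) then show ?case using lev_gens by blast
  next
    case (var v) then show ?case using lev_gens by (cases v) blast+
  next
    case (add p q)
    then obtain k m where "p \<in> lev k" "q \<in> lev m" by blast
    then have "p \<in> lev (max k m)" "q \<in> lev (max k m)" using lev_mono[of k "max k m"] lev_mono[of m "max k m"] by auto
    then show ?case by (intro exI[of _ "max k m"] lev_closed)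
  next
    case (mult p q)
    then obtain k m where "p \<in> lev k" "q \<in> lev m" by blast
    then have "p \<in> lev (max k m)" "q \<in> lev (max k m)" using lev_mono[of k "max k m"] lev_mono[of m "max k m"] by auto
    then show ?case by (intro exI[of _ "max k m"] lev_closed)
  qed
qed

lemma lev_deriv: "p \<in> lev k \<Longrightarrow> D p \<in> lev (Suc k)"
proof -
  let ?B = "{p \<in> lev k. D p \<in> lev (Suc k)}"
  have m: "lev k \<subseteq> lev (Suc k)" by (rule lev_mono) simp
  have B: "subring_set ?B"
    unfolding subring_set_def using m subring_setD[OF lev_subring[of "Suc k"]] subring_setD[OF lev_subring[of k]]
    by (auto simp: D.one D.diff D.mult subset_eq)
  have dd: "D (det gen_mat) \<in> lev (Suc k)"
  proof -
    have pr: "(\<Prod>i\<in>T. gen_mat $ i $ f i) \<in> ?B" for T and f :: "'n \<Rightarrow> 'n"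
      by (rule subring_set_prod[OF B]) (simp add: gen_mat_nth gl_deriv_Entry lev_gens)
    have "det gen_mat \<in> ?B"
      by (rule subring_set_det[OF B]) (simp add: gen_mat_nth gl_deriv_Entry lev_gens)
    then show ?thesis by simp
  qed
  have "lev k \<subseteq> ?B"
    by (rule lev_minimal[OF B])
      (auto simp: gl_deriv_const gl_deriv_Entry gl_deriv_InvDet power2_eq_square intro!: lev_gens lev_closed dd)
  then show "p \<in> lev k \<Longrightarrow> D p \<in> lev (Suc k)" by blast
qed

text \<open>Derivatives of \<open>A X\<close> of order at most \<open>k\<close> involve derivatives of \<open>X\<close> of order at most \<open>k\<close> only.\<close>
lemma lev_shift: "p \<in> lev k \<Longrightarrow> \<Sigma> p \<in> lev k"
proof -
  have B: "subring_set {p. \<Sigma> p \<in> lev k}"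
    unfolding subring_set_def using lev_closed by (auto simp: S.one S.diff S.mult)
  have e: "(D ^^ l) ((Ac ** gen_mat) $ i $ j) \<in> lev l" for i j l
  proof (induction l)
    case 0
    show ?case by (auto simp: matrix_matrix_mult_def gen_mat_nth intro!: subring_set_sum[OF lev_subring] lev_closed lev_gens)
  qed (simp add: lev_deriv)
  have "lev k \<subseteq> {p. \<Sigma> p \<in> lev k}"
  proof (rule lev_minimal[OF B])
    fix i j l assume "l \<le> k"
    then show "mpol_var (Entry i j l) \<in> {p. \<Sigma> p \<in> lev k}" using e[of l i j] lev_mono by (auto simp: shift_Entry)
  qed (auto simp: shift_const shift_InvDet intro!: lev_gens lev_closed)
  then show "p \<in> lev k \<Longrightarrow> \<Sigma> p \<in> lev k" by blast
qed

lemma sol_level_eq: "sol_level \<sigma> \<delta> A k = cls ` lev k"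
proof
  interpret cring Sol by (rule Sol_cring)
  let ?G = "cls ` (range mpol_const \<union> {mpol_var (Entry i j l) | i j l. l \<le> k} \<union> {mpol_var InvDet})"
  have neg: "\<ominus>\<^bsub>Sol\<^esub> cls p = cls (- p)" for p
    by (rule minus_equality) (auto simp: cls_simps gl_rel_zero)
  show "sol_level \<sigma> \<delta> A k \<subseteq> cls ` lev k"
  proof
    fix y assume "y \<in> sol_level \<sigma> \<delta> A k"
    then show "y \<in> cls ` lev k" unfolding sol_level_def
    proof (induction rule: generate_ring.induct)
      case one then show ?case unfolding cls_simps by (rule imageI[OF lev_closed(1)])
    next
      case (incl h) then show ?case using lev_gens by auto
    next
      case (a_inv h) then show ?case by (auto simp: neg intro!: imageI lev_closed)
    next
      case (eng_add h1 h2) then show ?case by (auto simp: cls_simps(3) intro!: imageI lev_closed)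
    next
      case (eng_mult h1 h2) then show ?case by (auto simp: cls_simps(2) intro!: imageI lev_closed)
    qed
  qed
  have B: "subring_set {p. cls p \<in> generate_ring Sol ?G}"
    unfolding subring_set_def
  proof (intro conjI ballI)
    show "1 \<in> {p. cls p \<in> generate_ring Sol ?G}" using generate_ring.one[of Sol ?G] by (simp add: cls_simps)
  next
    fix a b assume "a \<in> {p. cls p \<in> generate_ring Sol ?G}" "b \<in> {p. cls p \<in> generate_ring Sol ?G}"
    then have ab: "cls a \<in> generate_ring Sol ?G" "cls b \<in> generate_ring Sol ?G" by auto
    have "cls (a - b) = cls a \<oplus>\<^bsub>Sol\<^esub> \<ominus>\<^bsub>Sol\<^esub> cls b" by (simp add: neg cls_simps(3))
    moreover have "cls (a * b) = cls a \<otimes>\<^bsub>Sol\<^esub> cls b" by (simp add: cls_simps(2))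
    ultimately show "a - b \<in> {p. cls p \<in> generate_ring Sol ?G}" "a * b \<in> {p. cls p \<in> generate_ring Sol ?G}"
      using ab by (auto intro!: generate_ring.intros(3-5) simp del: sol_simps)
  qed
  have "lev k \<subseteq> {p. cls p \<in> generate_ring Sol ?G}"
    by (rule lev_minimal[OF B]) (auto intro!: generate_ring.incl)
  then show "cls ` lev k \<subseteq> sol_level \<sigma> \<delta> A k" unfolding sol_level_def by blast
qed

end

section \<open>Maximal shift ideals\<close>

locale pv_data = sd_field \<sigma> \<delta> A for \<sigma> \<delta> :: "'f::field_char_0 \<Rightarrow> 'f" and A :: "'f ^ 'n::finite ^ 'n" +
  fixes I :: "nat \<Rightarrow> ('f, 'n) gl_pol set set"
  assumes pv: "pv_ideals \<sigma> \<delta> A I"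
    and ac: "algebraically_closed (dring_on (fixed_field \<sigma>) \<delta>)"
begin

abbreviation "Lev k \<equiv> Sol\<lparr>carrier := cls ` lev k\<rparr>"

lemma I_max: "maximal_shift_ideal (Lev k) (I k)"
  and I_chain: "I (Suc k) \<inter> cls ` lev k = I k"
  and I_der: "der Sol ` (\<Union>k. I k) \<subseteq> (\<Union>k. I k)"
  using pv unfolding pv_ideals_def sol_level_eq by auto

lemma I_ideal: "ideal (I k) (Lev k)" "I k \<noteq> cls ` lev k" "x \<in> I k \<Longrightarrow> shift Sol x \<in> I k"
  using I_max[of k] by (auto simp: maximal_shift_ideal_def proper_shift_ideal_def)

lemma I_sub: "I k \<subseteq> cls ` lev k"
  using ideal.Icarr[OF I_ideal(1)[of k]] by auto

lemma I_mono: "k \<le> m \<Longrightarrow> I k \<subseteq> I m"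
proof -
  have "I k \<subseteq> I (Suc k)" for k using I_chain[of k] by (metis Int_lower1)
  then show "k \<le> m \<Longrightarrow> I k \<subseteq> I m" by (rule lift_Suc_mono_le)
qed

lemma I_level: "x \<in> I m \<Longrightarrow> x \<in> cls ` lev k \<Longrightarrow> x \<in> I k"
proof (cases "m \<le> k")
  case True
  then show "x \<in> I m \<Longrightarrow> x \<in> I k" using I_mono by blast
next
  case False
  then have "k \<le> m" by simp
  assume xl: "x \<in> cls ` lev k" and "x \<in> I m"
  with \<open>k \<le> m\<close> show "x \<in> I k"
  proof (induction m rule: dec_induct)
    case (step i)
    have "lev k \<subseteq> lev i" using lev_mono step by simp
    then have "x \<in> I (Suc i) \<inter> cls ` lev i" using step.prems xl by auto
    then show ?case using step.IH I_chain[of i] xl by auto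
  qed
qed

text \<open>Preimage in the polynomial ring of the ideal defining the Picard-Vessiot ring.\<close>
definition Pv :: "('f, 'n) gl_pol set" where "Pv = {p. cls p \<in> (\<Union>k. I k)}"

lemma Pv_lev: "p \<in> lev k \<Longrightarrow> p \<in> Pv \<longleftrightarrow> cls p \<in> I k"
  unfolding Pv_def using I_level by blast

lemma I_zero: "cls 0 \<in> I k"
  using additive_subgroup.zero_closed[OF ideal.axioms(1)[OF I_ideal(1)[of k]]] by (simp add: cls_simps)

lemma gl_rel_Pv: "p \<in> gl_rel UNIV \<delta> \<Longrightarrow> p \<in> Pv"
  unfolding Pv_def using I_zero cls_simps(6)[of p 0] by auto

lemma Pv_zero: "0 \<in> Pv" by (simp add: gl_rel_Pv gl_rel_zero)

lemma Pv_add: "p \<in> Pv \<Longrightarrow> q \<in> Pv \<Longrightarrow> p + q \<in> Pv"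
proof -
  obtain k m where "p \<in> lev k" "q \<in> lev m" using lev_union by blast
  then have l: "p \<in> lev (max k m)" "q \<in> lev (max k m)" using lev_mono[of k "max k m"] lev_mono[of m "max k m"] by auto
  assume "p \<in> Pv" "q \<in> Pv"
  then have "cls p \<oplus>\<^bsub>Lev (max k m)\<^esub> cls q \<in> I (max k m)"
    using Pv_lev l by (intro additive_subgroup.a_closed[OF ideal.axioms(1)[OF I_ideal(1)]]) auto
  then have "cls (p + q) \<in> I (max k m)" by (simp add: cls_simps(3))
  then show "p + q \<in> Pv" by (auto simp: Pv_def)
qed

lemma Pv_mult: "p \<in> Pv \<Longrightarrow> q * p \<in> Pv" "p \<in> Pv \<Longrightarrow> p * q \<in> Pv"
proof -
  obtain k m where "p \<in> lev k" "q \<in> lev m" using lev_union by blast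
  then have l: "p \<in> lev (max k m)" "q \<in> lev (max k m)" using lev_mono[of k "max k m"] lev_mono[of m "max k m"] by auto
  assume "p \<in> Pv"
  then have "cls q \<otimes>\<^bsub>Lev (max k m)\<^esub> cls p \<in> I (max k m)"
    using Pv_lev l by (intro ideal.I_l_closed[OF I_ideal(1)]) auto
  then have "cls (q * p) \<in> I (max k m)" by (simp add: cls_simps(2))
  then show "q * p \<in> Pv" by (auto simp: Pv_def)
  then show "p * q \<in> Pv" by (simp add: mult.commute)
qed

lemma Pv_uminus: "p \<in> Pv \<Longrightarrow> - p \<in> Pv" using Pv_mult(1)[of p "- 1"] by simp

lemma Lev_cring: "cring (Lev k)"
  by (rule cring_of_surj[OF cring_dring_on[OF lev_subring, where d = id], where q = cls]) (auto simp: cls_simps)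

lemma Pv_one: "1 \<notin> Pv"
proof
  assume "1 \<in> Pv"
  then have "\<one>\<^bsub>Lev 0\<^esub> \<in> I 0" using Pv_lev[of 1 0] lev_closed(1) by (simp add: cls_simps)
  then have "I 0 = carrier (Lev 0)" by (rule ideal.one_imp_carrier[OF I_ideal(1)])
  then show False using I_ideal(2)[of 0] by simp
qed

lemma Pv_shift: "p \<in> Pv \<Longrightarrow> \<Sigma> p \<in> Pv"
  using I_ideal(3) unfolding Pv_def by (auto simp flip: cls_simps(8))

text \<open>Maximality of the ideal of one level, expressed by representatives.\<close>
lemma level_maximal:
  assumes b: "b \<subseteq> lev k" "0 \<in> b" "\<And>p q. p \<in> b \<Longrightarrow> q \<in> b \<Longrightarrow> p + q \<in> b"
    "\<And>p q. p \<in> b \<Longrightarrow> q \<in> lev k \<Longrightarrow> q * p \<in> b" "\<And>p. p \<in> b \<Longrightarrow> \<Sigma> p \<in> b" and Pb: "Pv \<inter> lev k \<subseteq> b"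
  shows "(\<exists>q\<in>b. 1 - q \<in> Pv) \<or> b \<subseteq> Pv"
proof -
  let ?J = "cls ` b"
  have J1: "ideal ?J (Lev k)"
  proof (rule cring_idealI[OF Lev_cring])
    show "?J \<subseteq> carrier (Lev k)" using b(1) by auto
    show "\<zero>\<^bsub>Lev k\<^esub> \<in> ?J" using b(2) by (simp add: cls_simps(5))
    show "x \<oplus>\<^bsub>Lev k\<^esub> y \<in> ?J" if "x \<in> ?J" "y \<in> ?J" for x y
      using that b(3) by (auto simp: cls_simps(3))
    show "y \<otimes>\<^bsub>Lev k\<^esub> x \<in> ?J" if "x \<in> ?J" "y \<in> carrier (Lev k)" for x y
      using that b(4) by (auto simp: cls_simps(2))
  qed
  have J2: "shift (Lev k) ` ?J \<subseteq> ?J" using b(5) by (auto simp: cls_simps(8))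
  have J3: "I k \<subseteq> ?J"
  proof
    fix x assume x: "x \<in> I k"
    then obtain p where p: "x = cls p" "p \<in> lev k" using I_sub by blast
    then have "p \<in> Pv" using x Pv_lev by blast
    then show "x \<in> ?J" using p Pb by blast
  qed
  have alt: "?J = I k" if "?J \<noteq> cls ` lev k"
  proof -
    have "proper_shift_ideal (Lev k) ?J" unfolding proper_shift_ideal_def using J1 J2 that by simp
    then show ?thesis using I_max[of k] J3 unfolding maximal_shift_ideal_def by blast
  qed
  show ?thesis
  proof (cases "?J = cls ` lev k")
    case True
    then have "cls 1 \<in> ?J" using lev_closed(1) by blast
    then obtain q where "q \<in> b" "cls 1 = cls q" by auto
    then show ?thesis using cls_simps(6)[of 1 q] gl_rel_Pv by blast
  next
    case False
    then have "?J = I k" using alt by blast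
    then have "b \<subseteq> Pv" unfolding Pv_def by blast
    then show ?thesis ..
  qed
qed

text \<open>An element of a larger shift ideal lies in some level, and there the ideal is already maximal.\<close>
lemma Pv_maximal:
  assumes a: "Pv \<subseteq> \<aa>" "\<And>p q. p \<in> \<aa> \<Longrightarrow> q \<in> \<aa> \<Longrightarrow> p + q \<in> \<aa>" "\<And>p q. p \<in> \<aa> \<Longrightarrow> q * p \<in> \<aa>"
    "\<And>p. p \<in> \<aa> \<Longrightarrow> \<Sigma> p \<in> \<aa>" and one: "1 \<notin> \<aa>"
  shows "\<aa> = Pv"
proof -
  have "\<aa> \<inter> lev k \<subseteq> Pv" for k
  proof -
    have "(\<exists>q\<in>\<aa> \<inter> lev k. 1 - q \<in> Pv) \<or> \<aa> \<inter> lev k \<subseteq> Pv"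
      by (rule level_maximal) (use a Pv_zero in \<open>auto intro: lev_closed lev_shift\<close>)
    moreover have False if "q \<in> \<aa> \<inter> lev k" "1 - q \<in> Pv" for q
    proof -
      have "(1 - q) + q \<in> \<aa>" using that a(1) by (intro a(2)) auto
      then show False using one by simp
    qed
    ultimately show ?thesis by blast
  qed
  then show ?thesis using lev_union a(1) by blast
qed

lemma infinite_K: "infinite K"
proof -
  have "of_nat k \<in> K" for k using s.zero s.one s.add by (induction k) (auto simp: fixed_field_def)
  then have "range of_nat \<subseteq> K" by auto
  moreover have "infinite (range (of_nat :: nat \<Rightarrow> 'f))" by (rule range_inj_infinite) (rule inj_of_nat)
  ultimately show ?thesis using finite_subset by blast
qed

text \<open>In a shift-simple ring a nonzero constant generates a shift ideal, hence is a unit; as this unit lies in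
  the level of the constant, the level can be used as the finitely generated algebra.\<close>
theorem Pv_constants:
  assumes inv: "\<Sigma> p - p \<in> Pv"
  shows "\<exists>a\<in>K. p - mpol_const a \<in> Pv"
proof -
  interpret c: field_map "mpol_const :: 'f \<Rightarrow> ('f, 'n) gl_pol" by (rule const_field_map)
  obtain k where k: "p \<in> lev k" using lev_union by blast
  show ?thesis
  proof (rule c.constants_mod_simple_ideal[where B = "lev k" and xs = "gl_vars k" and \<sigma> = \<sigma> and \<Sigma> = \<Sigma>])
    show "ideal_on Pv (lev k)" unfolding ideal_on_def using Pv_zero Pv_add Pv_mult by auto
    show "\<exists>y\<in>lev k. x * y - 1 \<in> Pv" if x: "x \<in> lev k" "\<Sigma> x - x \<in> Pv" "x \<notin> Pv" for x
    proof -
      \<comment> \<open>The ideal generated by \<open>Pv\<close> and \<open>x\<close>; it is shift stable because \<open>\<Sigma> x - x\<close> lies in \<open>Pv\<close>.\<close>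
      let ?b = "{q + x * y | q y. q \<in> Pv \<inter> lev k \<and> y \<in> lev k}"
      have "(\<exists>q\<in>?b. 1 - q \<in> Pv) \<or> ?b \<subseteq> Pv"
      proof (rule level_maximal)
        show "?b \<subseteq> lev k" using x lev_closed by auto
        show "0 \<in> ?b" using Pv_zero lev_closed(2)[of k] by force
        show "Pv \<inter> lev k \<subseteq> ?b" using lev_closed(2)[of k] by force
      next
        fix u v assume "u \<in> ?b" "v \<in> ?b"
        then obtain q y q' y' where e: "u = q + x * y" "v = q' + x * y'" and
          m: "q \<in> Pv \<inter> lev k" "y \<in> lev k" "q' \<in> Pv \<inter> lev k" "y' \<in> lev k" by blast
        have "u + v = (q + q') + x * (y + y')" by (simp add: e algebra_simps)
        moreover have "q + q' \<in> Pv \<inter> lev k" "y + y' \<in> lev k" using m Pv_add lev_closed by auto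
        ultimately show "u + v \<in> ?b" by blast
      next
        fix u v assume "u \<in> ?b" "v \<in> lev k"
        then obtain q y where e: "u = q + x * y" and m: "q \<in> Pv \<inter> lev k" "y \<in> lev k" "v \<in> lev k" by blast
        have "v * u = v * q + x * (v * y)" by (simp add: e algebra_simps)
        moreover have "v * q \<in> Pv \<inter> lev k" "v * y \<in> lev k" using m Pv_mult lev_closed by auto
        ultimately show "v * u \<in> ?b" by blast
      next
        fix u assume "u \<in> ?b"
        then obtain q y where e: "u = q + x * y" and m: "q \<in> Pv \<inter> lev k" "y \<in> lev k" by blast
        have "\<Sigma> u = (\<Sigma> q + (\<Sigma> x - x) * \<Sigma> y) + x * \<Sigma> y" by (simp add: e S.add S.mult algebra_simps)
        moreover have "\<Sigma> q + (\<Sigma> x - x) * \<Sigma> y \<in> Pv \<inter> lev k"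
          using m x by (auto intro!: Pv_add Pv_mult(2) Pv_shift lev_closed lev_shift)
        ultimately show "\<Sigma> u \<in> ?b" using lev_shift[OF m(2)] by blast
      qed
      moreover have "x \<in> ?b" using Pv_zero lev_closed(1,2)[of k] by force
      ultimately obtain q y where "q \<in> Pv" "y \<in> lev k" and o: "1 - (q + x * y) \<in> Pv" using x(3) by blast
      then have "- ((1 - (q + x * y)) + q) \<in> Pv" by (intro Pv_uminus Pv_add)
      then show ?thesis using \<open>y \<in> lev k\<close> by (intro bexI[of _ y]) simp_all
    qed
    show "\<exists>a\<in>fixed_field \<sigma>. poly p a = 0" if "\<forall>i. poly.coeff p i \<in> fixed_field \<sigma>" "0 < Polynomial.degree p" for p
      using root_in_algebraically_closed_subfield[OF ac] that by blast
    show "1 \<notin> Pv" by (rule Pv_one)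
    show "lev k = adjoins (range mpol_const) (gl_vars k)" by (rule lev_def)
    show "p \<in> lev k" "\<Sigma> p - p \<in> Pv" using k inv by auto
    show "ring_map \<sigma>" "ring_map \<Sigma>" by unfold_locales
    show "\<Sigma> (mpol_const a) = mpol_const (\<sigma> a)" for a by (rule shift_const)
    show "\<Sigma> q \<in> Pv" if "q \<in> Pv" for q by (rule Pv_shift[OF that])
    show "\<Sigma> q \<in> lev k" if "q \<in> lev k" for q by (rule lev_shift[OF that])
    show "infinite K" by (rule infinite_K)
  qed
qed

section \<open>The Picard-Vessiot ring\<close>

definition R :: "('f, 'n) gl_pol set set sdring" where "R = pv_ring \<sigma> \<delta> A I"
definition pc :: "('f, 'n) gl_pol \<Rightarrow> ('f, 'n) gl_pol set set" where "pc = pv_class \<sigma> \<delta> A I"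

lemma UI_ideal: "ideal (\<Union>k. I k) Sol"
proof (rule cring_idealI[OF Sol_cring])
  show "(\<Union>k. I k) \<subseteq> carrier Sol" using I_sub unfolding cls_simps(1) by blast
  show "\<zero>\<^bsub>Sol\<^esub> \<in> (\<Union>k. I k)" using I_zero by (auto simp: cls_simps(5))
next
  fix x y assume xy: "x \<in> (\<Union>k. I k)" "y \<in> (\<Union>k. I k)"
  then obtain p q where "x = cls p" "y = cls q" using I_sub by blast
  then show "x \<oplus>\<^bsub>Sol\<^esub> y \<in> (\<Union>k. I k)" using Pv_add[of p q] xy by (simp add: Pv_def cls_simps(3))
next
  fix x y assume xy: "x \<in> (\<Union>k. I k)" "y \<in> carrier Sol"
  then obtain p q where "x = cls p" "y = cls q" using I_sub by (fastforce simp: cls_simps(1))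
  then show "y \<otimes>\<^bsub>Sol\<^esub> x \<in> (\<Union>k. I k)" using Pv_mult(1)[of p q] xy by (simp add: Pv_def cls_simps(2))
qed

lemma pc_simps:
  "carrier R = range pc" "pc p \<otimes>\<^bsub>R\<^esub> pc q = pc (p * q)" "pc p \<oplus>\<^bsub>R\<^esub> pc q = pc (p + q)"
  "\<one>\<^bsub>R\<^esub> = pc 1" "\<zero>\<^bsub>R\<^esub> = pc 0" "pc p = pc q \<longleftrightarrow> p - q \<in> Pv"
  "der R (pc p) = pc (D p)" "shift R (pc p) = pc (\<Sigma> p)"
proof -
  interpret Q: quot_hom Sol R "\<lambda>a. (\<Union>k. I k) +>\<^bsub>Sol\<^esub> a" "\<Union>k. I k"
    unfolding R_def pv_ring_def by (rule quot_hom_sd_quot[OF Sol_cring UI_ideal])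
  interpret Sc: cring Sol by (rule Sol_cring)
  have pc: "pc p = (\<Union>k. I k) +>\<^bsub>Sol\<^esub> cls p" for p by (simp add: pc_def pv_class_def)
  have c: "cls p \<in> carrier Sol" for p by (simp add: cls_simps(1))
  show "carrier R = range pc" unfolding Q.carr by (auto simp: cls_simps(1) pc)
  show "pc p \<otimes>\<^bsub>R\<^esub> pc q = pc (p * q)" "pc p \<oplus>\<^bsub>R\<^esub> pc q = pc (p + q)"
    using Q.q_mult[OF c c] Q.q_add[OF c c] by (simp_all add: pc cls_simps(2,3))
  show "\<one>\<^bsub>R\<^esub> = pc 1" "\<zero>\<^bsub>R\<^esub> = pc 0" using Q.q_one Q.q_zero by (simp_all add: pc cls_simps(4,5))
  have "\<ominus>\<^bsub>Sol\<^esub> cls q = cls (- q)" by (rule Sc.minus_equality) (auto simp: cls_simps gl_rel_zero)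
  then have "cls p \<ominus>\<^bsub>Sol\<^esub> cls q = cls (p - q)" by (simp add: Sc.minus_eq cls_simps(3))
  then show "pc p = pc q \<longleftrightarrow> p - q \<in> Pv" using Q.q_eq[OF c c, of p q] by (simp add: pc Pv_def)
  show "der R (pc p) = pc (D p)" unfolding R_def pv_ring_def pc
    by (subst der_sd_quot[OF Sol_cring]) (use I_der UI_ideal in \<open>auto simp: cls_simps(1,3,7) D.add\<close>)
  show "shift R (pc p) = pc (\<Sigma> p)" unfolding R_def pv_ring_def pc
    by (subst shift_sd_quot[OF Sol_cring]) (use I_ideal(3) UI_ideal in \<open>auto simp: cls_simps(1,3,8) S.add\<close>)
qed

end

section \<open>Matrices over a ring record\<close>

text \<open>Matrices with entries in a ring record as a ring record, so that matrix identities over tensor products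
  become computations in a noncommutative ring.\<close>
definition mring :: "('a, 'm) ring_scheme \<Rightarrow> ('n::finite \<Rightarrow> 'n \<Rightarrow> 'a) ring" where
  "mring R = \<lparr>carrier = {M. \<forall>i j. M i j \<in> carrier R},
     mult = (\<lambda>M N i j. \<Oplus>\<^bsub>R\<^esub>k\<in>UNIV. M i k \<otimes>\<^bsub>R\<^esub> N k j),
     one = (\<lambda>i j. if i = j then \<one>\<^bsub>R\<^esub> else \<zero>\<^bsub>R\<^esub>), ring.zero = (\<lambda>i j. \<zero>\<^bsub>R\<^esub>),
     add = (\<lambda>M N i j. M i j \<oplus>\<^bsub>R\<^esub> N i j)\<rparr>"

lemma mring_simps:
  "carrier (mring R) = {M. \<forall>i j. M i j \<in> carrier R}"
  "(M \<otimes>\<^bsub>mring R\<^esub> N) i j = (\<Oplus>\<^bsub>R\<^esub>k\<in>UNIV. M i k \<otimes>\<^bsub>R\<^esub> N k j)"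
  "(M \<oplus>\<^bsub>mring R\<^esub> N) i j = M i j \<oplus>\<^bsub>R\<^esub> N i j"
  "\<one>\<^bsub>mring R\<^esub> i j = (if i = j then \<one>\<^bsub>R\<^esub> else \<zero>\<^bsub>R\<^esub>)" "\<zero>\<^bsub>mring R\<^esub> i j = \<zero>\<^bsub>R\<^esub>"
  by (simp_all add: mring_def)

lemma finsum_swap:
  assumes "cring R" "finite A" "finite B" "\<And>i j. i \<in> A \<Longrightarrow> j \<in> B \<Longrightarrow> f i j \<in> carrier R"
  shows "(\<Oplus>\<^bsub>R\<^esub>i\<in>A. \<Oplus>\<^bsub>R\<^esub>j\<in>B. f i j) = (\<Oplus>\<^bsub>R\<^esub>j\<in>B. \<Oplus>\<^bsub>R\<^esub>i\<in>A. f i j)"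
proof -
  interpret cring R by fact
  show ?thesis using assms(2,4)
  proof (induction A rule: finite_induct)
    case empty
    then show ?case by (simp add: finsum_zero)
  next
    case (insert a A)
    then have "(\<Oplus>\<^bsub>R\<^esub>i\<in>insert a A. \<Oplus>\<^bsub>R\<^esub>j\<in>B. f i j) = (\<Oplus>\<^bsub>R\<^esub>j\<in>B. f a j) \<oplus>\<^bsub>R\<^esub> (\<Oplus>\<^bsub>R\<^esub>j\<in>B. \<Oplus>\<^bsub>R\<^esub>i\<in>A. f i j)"
      by (subst finsum_insert) (auto intro!: finsum_closed)
    also have "\<dots> = (\<Oplus>\<^bsub>R\<^esub>j\<in>B. f a j \<oplus>\<^bsub>R\<^esub> (\<Oplus>\<^bsub>R\<^esub>i\<in>A. f i j))"
      using insert by (subst finsum_addf) (auto intro!: finsum_closed)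
    also have "\<dots> = (\<Oplus>\<^bsub>R\<^esub>j\<in>B. \<Oplus>\<^bsub>R\<^esub>i\<in>insert a A. f i j)"
      using insert by (intro finsum_cong') (auto intro!: finsum_closed)
    finally show ?case .
  qed
qed

lemma ring_mring:
  assumes "cring R" shows "ring (mring R :: ('n::finite \<Rightarrow> 'n \<Rightarrow> 'a) ring)"
proof -
  interpret cring R by fact
  have pick: "(\<Oplus>\<^bsub>R\<^esub>k\<in>(UNIV::'n set). (if i = k then f k else \<zero>\<^bsub>R\<^esub>)) = f i" if "\<And>k. f k \<in> carrier R" for i and f :: "'n \<Rightarrow> 'a"
    using finsum_singleton[of i "UNIV :: 'n set" f] that by simp
  show ?thesis
  proof (rule ringI)
    show "abelian_group (mring R :: ('n \<Rightarrow> 'n \<Rightarrow> 'a) ring)"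
    proof (rule abelian_groupI)
      fix M :: "'n \<Rightarrow> 'n \<Rightarrow> 'a" assume M: "M \<in> carrier (mring R)"
      show "\<exists>N\<in>carrier (mring R). N \<oplus>\<^bsub>mring R\<^esub> M = \<zero>\<^bsub>mring R\<^esub>"
        by (intro bexI[of _ "\<lambda>i j. \<ominus>\<^bsub>R\<^esub> M i j"]) (use M in \<open>auto simp: mring_simps l_neg fun_eq_iff\<close>)
    qed (auto simp: mring_simps fun_eq_iff a_ac)
    show "Group.monoid (mring R :: ('n \<Rightarrow> 'n \<Rightarrow> 'a) ring)"
    proof (rule monoidI)
      fix M N P :: "'n \<Rightarrow> 'n \<Rightarrow> 'a"
      assume m: "M \<in> carrier (mring R)" "N \<in> carrier (mring R)" "P \<in> carrier (mring R)"
      show "M \<otimes>\<^bsub>mring R\<^esub> N \<otimes>\<^bsub>mring R\<^esub> P = M \<otimes>\<^bsub>mring R\<^esub> (N \<otimes>\<^bsub>mring R\<^esub> P)"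
      proof (intro ext)
        fix i j
        have "(\<Oplus>\<^bsub>R\<^esub>k\<in>UNIV. (\<Oplus>\<^bsub>R\<^esub>l\<in>UNIV. M i l \<otimes>\<^bsub>R\<^esub> N l k) \<otimes>\<^bsub>R\<^esub> P k j) = (\<Oplus>\<^bsub>R\<^esub>k\<in>UNIV. \<Oplus>\<^bsub>R\<^esub>l\<in>UNIV. M i l \<otimes>\<^bsub>R\<^esub> (N l k \<otimes>\<^bsub>R\<^esub> P k j))"
          using m by (intro finsum_cong') (auto simp: mring_simps finsum_ldistr m_assoc intro!: finsum_closed)
        also have "\<dots> = (\<Oplus>\<^bsub>R\<^esub>l\<in>UNIV. \<Oplus>\<^bsub>R\<^esub>k\<in>UNIV. M i l \<otimes>\<^bsub>R\<^esub> (N l k \<otimes>\<^bsub>R\<^esub> P k j))"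
          using m by (intro finsum_swap[OF assms]) (auto simp: mring_simps)
        also have "\<dots> = (\<Oplus>\<^bsub>R\<^esub>l\<in>UNIV. M i l \<otimes>\<^bsub>R\<^esub> (\<Oplus>\<^bsub>R\<^esub>k\<in>UNIV. N l k \<otimes>\<^bsub>R\<^esub> P k j))"
          using m by (intro finsum_cong') (auto simp: mring_simps finsum_rdistr intro!: finsum_closed)
        finally show "(M \<otimes>\<^bsub>mring R\<^esub> N \<otimes>\<^bsub>mring R\<^esub> P) i j = (M \<otimes>\<^bsub>mring R\<^esub> (N \<otimes>\<^bsub>mring R\<^esub> P)) i j"
          by (simp add: mring_simps)
      qed
    next
      fix M :: "'n \<Rightarrow> 'n \<Rightarrow> 'a" assume "M \<in> carrier (mring R)"
      then have M: "\<And>i j. M i j \<in> carrier R" by (simp add: mring_simps)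
      have "(\<Oplus>\<^bsub>R\<^esub>k\<in>UNIV. (if i = k then \<one>\<^bsub>R\<^esub> else \<zero>\<^bsub>R\<^esub>) \<otimes>\<^bsub>R\<^esub> M k j) = (\<Oplus>\<^bsub>R\<^esub>k\<in>UNIV. (if i = k then M k j else \<zero>\<^bsub>R\<^esub>))" for i j
        by (intro finsum_cong') (auto simp: M)
      then show "\<one>\<^bsub>mring R\<^esub> \<otimes>\<^bsub>mring R\<^esub> M = M" by (intro ext) (simp add: mring_simps pick M)
      have "(\<Oplus>\<^bsub>R\<^esub>k\<in>UNIV. M i k \<otimes>\<^bsub>R\<^esub> (if k = j then \<one>\<^bsub>R\<^esub> else \<zero>\<^bsub>R\<^esub>)) = (\<Oplus>\<^bsub>R\<^esub>k\<in>UNIV. (if j = k then M i k else \<zero>\<^bsub>R\<^esub>))" for i j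
        by (intro finsum_cong') (auto simp: M)
      then show "M \<otimes>\<^bsub>mring R\<^esub> \<one>\<^bsub>mring R\<^esub> = M" by (intro ext) (simp add: mring_simps pick M)
    qed (auto simp: mring_simps intro!: finsum_closed)
    fix M N P :: "'n \<Rightarrow> 'n \<Rightarrow> 'a"
    assume m: "M \<in> carrier (mring R)" "N \<in> carrier (mring R)" "P \<in> carrier (mring R)"
    show "(M \<oplus>\<^bsub>mring R\<^esub> N) \<otimes>\<^bsub>mring R\<^esub> P = M \<otimes>\<^bsub>mring R\<^esub> P \<oplus>\<^bsub>mring R\<^esub> N \<otimes>\<^bsub>mring R\<^esub> P"
    proof (intro ext)
      fix i j
      have "(\<Oplus>\<^bsub>R\<^esub>k\<in>UNIV. (M i k \<oplus>\<^bsub>R\<^esub> N i k) \<otimes>\<^bsub>R\<^esub> P k j) = (\<Oplus>\<^bsub>R\<^esub>k\<in>UNIV. M i k \<otimes>\<^bsub>R\<^esub> P k j \<oplus>\<^bsub>R\<^esub> N i k \<otimes>\<^bsub>R\<^esub> P k j)"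
        using m by (intro finsum_cong') (auto simp: mring_simps l_distr)
      then show "((M \<oplus>\<^bsub>mring R\<^esub> N) \<otimes>\<^bsub>mring R\<^esub> P) i j = (M \<otimes>\<^bsub>mring R\<^esub> P \<oplus>\<^bsub>mring R\<^esub> N \<otimes>\<^bsub>mring R\<^esub> P) i j"
        using m by (simp add: mring_simps finsum_addf)
    qed
    show "P \<otimes>\<^bsub>mring R\<^esub> (M \<oplus>\<^bsub>mring R\<^esub> N) = P \<otimes>\<^bsub>mring R\<^esub> M \<oplus>\<^bsub>mring R\<^esub> P \<otimes>\<^bsub>mring R\<^esub> N"
    proof (intro ext)
      fix i j
      have "(\<Oplus>\<^bsub>R\<^esub>k\<in>UNIV. P i k \<otimes>\<^bsub>R\<^esub> (M k j \<oplus>\<^bsub>R\<^esub> N k j)) = (\<Oplus>\<^bsub>R\<^esub>k\<in>UNIV. P i k \<otimes>\<^bsub>R\<^esub> M k j \<oplus>\<^bsub>R\<^esub> P i k \<otimes>\<^bsub>R\<^esub> N k j)"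
        using m by (intro finsum_cong') (auto simp: mring_simps r_distr)
      then show "(P \<otimes>\<^bsub>mring R\<^esub> (M \<oplus>\<^bsub>mring R\<^esub> N)) i j = (P \<otimes>\<^bsub>mring R\<^esub> M \<oplus>\<^bsub>mring R\<^esub> P \<otimes>\<^bsub>mring R\<^esub> N) i j"
        using m by (simp add: mring_simps finsum_addf)
    qed
  qed
qed

lemma hom_mring_mult:
  assumes "cring R" "cring S" "h \<in> ring_hom R S" "M \<in> carrier (mring R)" "N \<in> carrier (mring R)"
  shows "(\<lambda>i j. h ((M \<otimes>\<^bsub>mring R\<^esub> N) i j)) = (\<lambda>i j. h (M i j)) \<otimes>\<^bsub>mring S\<^esub> (\<lambda>i j. h (N i j))"
proof (intro ext)
  fix i j
  interpret R: cring R by fact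
  interpret S: cring S by fact
  interpret ring_hom_cring R S h by unfold_locales (rule assms)
  have "h (\<Oplus>\<^bsub>R\<^esub>k\<in>UNIV. M i k \<otimes>\<^bsub>R\<^esub> N k j) = (\<Oplus>\<^bsub>S\<^esub>k\<in>UNIV. (h \<circ> (\<lambda>k. M i k \<otimes>\<^bsub>R\<^esub> N k j)) k)"
    using assms by (subst hom_finsum) (auto simp: mring_simps)
  also have "\<dots> = (\<Oplus>\<^bsub>S\<^esub>k\<in>UNIV. h (M i k) \<otimes>\<^bsub>S\<^esub> h (N k j))"
    using assms by (intro S.finsum_cong') (auto simp: mring_simps)
  finally show "h ((M \<otimes>\<^bsub>mring R\<^esub> N) i j) = ((\<lambda>i j. h (M i j)) \<otimes>\<^bsub>mring S\<^esub> (\<lambda>i j. h (N i j))) i j"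
    by (simp add: mring_simps)
qed

lemma hom_mring_add:
  assumes "h \<in> ring_hom R S" "M \<in> carrier (mring R)" "N \<in> carrier (mring R)"
  shows "(\<lambda>i j. h ((M \<oplus>\<^bsub>mring R\<^esub> N) i j)) = (\<lambda>i j. h (M i j)) \<oplus>\<^bsub>mring S\<^esub> (\<lambda>i j. h (N i j))"
  using assms by (auto simp: mring_simps ring_hom_memE fun_eq_iff)

lemma hom_mring_one:
  assumes "cring R" "cring S" "h \<in> ring_hom R S"
  shows "(\<lambda>i j. h (\<one>\<^bsub>mring R\<^esub> i j)) = \<one>\<^bsub>mring S\<^esub>"
proof -
  interpret R: cring R by fact
  interpret S: cring S by fact
  interpret ring_hom_cring R S h by unfold_locales (rule assms)
  show ?thesis by (intro ext) (simp add: mring_simps)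
qed

lemma der_finsum:
  assumes "diff_ring R" "finite I" "\<And>i. i \<in> I \<Longrightarrow> f i \<in> carrier R"
  shows "der R (\<Oplus>\<^bsub>R\<^esub>i\<in>I. f i) = (\<Oplus>\<^bsub>R\<^esub>i\<in>I. der R (f i))"
proof -
  interpret cring R using assms by (simp add: diff_ring_def)
  have d: "der R a \<in> carrier R" if "a \<in> carrier R" for a using assms that by (auto simp: diff_ring_def)
  have da: "der R (a \<oplus>\<^bsub>R\<^esub> b) = der R a \<oplus>\<^bsub>R\<^esub> der R b" if "a \<in> carrier R" "b \<in> carrier R" for a b
    using assms that by (auto simp: diff_ring_def)
  have z: "der R \<zero>\<^bsub>R\<^esub> = \<zero>\<^bsub>R\<^esub>" using da[of "\<zero>\<^bsub>R\<^esub>" "\<zero>\<^bsub>R\<^esub>"] d[of "\<zero>\<^bsub>R\<^esub>"] by (simp add: add.l_cancel_one')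
  show ?thesis using assms(2,3)
    by (induction I rule: finite_induct) (auto simp: z da d finsum_insert Pi_def)
qed

lemma der_mring_mult:
  assumes "diff_ring R" "M \<in> carrier (mring R)" "N \<in> carrier (mring R)"
  shows "(\<lambda>i j. der R ((M \<otimes>\<^bsub>mring R\<^esub> N) i j)) =
    ((\<lambda>i j. der R (M i j)) \<otimes>\<^bsub>mring R\<^esub> N) \<oplus>\<^bsub>mring R\<^esub> (M \<otimes>\<^bsub>mring R\<^esub> (\<lambda>i j. der R (N i j)))"
proof (intro ext)
  fix i j
  interpret cring R using assms by (simp add: diff_ring_def)
  have d: "der R a \<in> carrier R" if "a \<in> carrier R" for a using assms that by (auto simp: diff_ring_def)
  have dm: "der R (a \<otimes>\<^bsub>R\<^esub> b) = (der R a \<otimes>\<^bsub>R\<^esub> b) \<oplus>\<^bsub>R\<^esub> (a \<otimes>\<^bsub>R\<^esub> der R b)" if "a \<in> carrier R" "b \<in> carrier R" for a b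
    using assms that by (auto simp: diff_ring_def)
  have m: "M i j \<in> carrier R" "N i j \<in> carrier R" for i j using assms by (auto simp: mring_simps)
  show "der R ((M \<otimes>\<^bsub>mring R\<^esub> N) i j) = (((\<lambda>i j. der R (M i j)) \<otimes>\<^bsub>mring R\<^esub> N) \<oplus>\<^bsub>mring R\<^esub> (M \<otimes>\<^bsub>mring R\<^esub> (\<lambda>i j. der R (N i j)))) i j"
    unfolding mring_simps by (subst der_finsum[OF assms(1)]) (simp_all add: m dm d finsum_addf)
qed

section \<open>Linear disjointness from the shift constants\<close>

fun lin_comb :: "('t, 'x) ring_scheme \<Rightarrow> ('r \<Rightarrow> 's \<Rightarrow> 't) \<Rightarrow> 'r list \<Rightarrow> 's list \<Rightarrow> 't" where
  "lin_comb T g (r # rs) (s # ss) = g r s \<oplus>\<^bsub>T\<^esub> lin_comb T g rs ss"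
| "lin_comb T g _ _ = \<zero>\<^bsub>T\<^esub>"

lemma lin_comb_Nil [simp]: "lin_comb T g rs [] = \<zero>\<^bsub>T\<^esub>" by (cases rs) auto

lemma lin_comb_closed:
  assumes "cring T" "\<And>r s. r \<in> A \<Longrightarrow> s \<in> B \<Longrightarrow> g r s \<in> carrier T" "set rs \<subseteq> A" "set ss \<subseteq> B"
  shows "lin_comb T g rs ss \<in> carrier T"
proof -
  interpret cring T by fact
  show ?thesis using assms(3,4)
  proof (induction rs arbitrary: ss)
    case (Cons r rs)
    then show ?case by (cases ss) (auto simp: assms(2))
  qed simp
qed

text \<open>Instantiated with the tensor square of \<open>R\<close> as \<open>T2\<close>, either of its two embeddings as \<open>f\<close>, the diagonal shift
  as \<open>sT\<close>, and the ring of shift constants as \<open>S\<close>.\<close>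
locale disjoint_tensor = tensor_prod R S K c u
  for R :: "('r, 'm) sdring_scheme" and S :: "('s, 'n) dring_scheme" and K :: "'k::field set" and c u +
  fixes T2 :: "('t, 'x) ring_scheme" and f h sT
  assumes T2: "cring T2" and f: "f \<in> ring_hom R T2" and h: "h \<in> ring_hom S T2" and inj_h: "inj_on h (carrier S)"
    and fh: "a \<in> K \<Longrightarrow> f (c a) = h (u a)"
    and sT: "sT \<in> ring_hom T2 T2" and sTf: "r \<in> carrier R \<Longrightarrow> sT (f r) = f (shift R r)"
    and sTh: "s \<in> carrier S \<Longrightarrow> sT (h s) = h s"
    and shR: "shift R \<in> ring_hom R R"
    and simple: "ideal J R \<Longrightarrow> shift R ` J \<subseteq> J \<Longrightarrow> J = {\<zero>\<^bsub>R\<^esub>} \<or> \<one>\<^bsub>R\<^esub> \<in> J"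
    and const: "r \<in> carrier R \<Longrightarrow> shift R r = r \<Longrightarrow> \<exists>a\<in>K. r = c a"
    and K: "0 \<in> K" "1 \<in> K" "a \<in> K \<Longrightarrow> b \<in> K \<Longrightarrow> a + b \<in> K" "a \<in> K \<Longrightarrow> b \<in> K \<Longrightarrow> a * b \<in> K" "a \<in> K \<Longrightarrow> - a \<in> K" "a \<in> K \<Longrightarrow> inverse a \<in> K"
    and u_hom: "u 1 = \<one>\<^bsub>S\<^esub>" "u 0 = \<zero>\<^bsub>S\<^esub>" "a \<in> K \<Longrightarrow> b \<in> K \<Longrightarrow> u (a + b) = u a \<oplus>\<^bsub>S\<^esub> u b"
      "a \<in> K \<Longrightarrow> b \<in> K \<Longrightarrow> u (a * b) = u a \<otimes>\<^bsub>S\<^esub> u b"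
begin

sublocale T2: cring T2 by (rule T2)
lemmas F = ring_hom_memE[OF f] and H = ring_hom_memE[OF h] and SR = ring_hom_memE[OF shR] and ST = ring_hom_memE[OF sT]

lemma F0: "f \<zero>\<^bsub>R\<^esub> = \<zero>\<^bsub>T2\<^esub>" and H0: "h \<zero>\<^bsub>S\<^esub> = \<zero>\<^bsub>T2\<^esub>" and ST0: "sT \<zero>\<^bsub>T2\<^esub> = \<zero>\<^bsub>T2\<^esub>"
  using ring_hom_zero[OF f R.ring_axioms T2.ring_axioms] ring_hom_zero[OF h S.ring_axioms T2.ring_axioms]
    ring_hom_zero[OF sT T2.ring_axioms T2.ring_axioms] by auto

definition g :: "'r \<Rightarrow> 's \<Rightarrow> 't" where "g r s = f r \<otimes>\<^bsub>T2\<^esub> h s"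

abbreviation L where "L \<equiv> lin_comb T2 g"
abbreviation LK where "LK \<equiv> lin_comb S (\<lambda>a s. u a \<otimes>\<^bsub>S\<^esub> s)"
abbreviation LT where "LT \<equiv> lin_comb T t"

lemma g_closed: "r \<in> carrier R \<Longrightarrow> s \<in> carrier S \<Longrightarrow> g r s \<in> carrier T2" by (simp add: g_def F H)

lemma L_closed: "set rs \<subseteq> carrier R \<Longrightarrow> set ss \<subseteq> carrier S \<Longrightarrow> L rs ss \<in> carrier T2"
  by (rule lin_comb_closed[OF T2]) (auto simp: g_closed)

lemma LK_closed: "set as \<subseteq> K \<Longrightarrow> set ss \<subseteq> carrier S \<Longrightarrow> LK as ss \<in> carrier S"
  by (rule lin_comb_closed[OF S.is_cring]) (auto simp: u)

lemma map2_closed: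
  assumes "set xs \<subseteq> carrier R" "set ys \<subseteq> carrier R"
  shows "set (map2 (\<lambda>a b. a \<oplus>\<^bsub>R\<^esub> b) xs ys) \<subseteq> carrier R"
proof
  fix z assume "z \<in> set (map2 (\<lambda>a b. a \<oplus>\<^bsub>R\<^esub> b) xs ys)"
  then obtain a b where z: "(a, b) \<in> set (zip xs ys)" "z = a \<oplus>\<^bsub>R\<^esub> b" by auto
  then have "a \<in> carrier R" "b \<in> carrier R" using set_zip_leftD[OF z(1)] set_zip_rightD[OF z(1)] assms by auto
  then show "z \<in> carrier R" by (simp add: z)
qed

lemma LT_closed: "set rs \<subseteq> carrier R \<Longrightarrow> set ss \<subseteq> carrier S \<Longrightarrow> LT rs ss \<in> carrier T"
  by (rule lin_comb_closed[OF T.is_cring]) (auto simp: t_closed)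

lemma L_add:
  assumes "length rs = length rs'" "length rs' = length ss" "set rs \<subseteq> carrier R" "set rs' \<subseteq> carrier R" "set ss \<subseteq> carrier S"
  shows "L (map2 (\<lambda>a b. a \<oplus>\<^bsub>R\<^esub> b) rs rs') ss = L rs ss \<oplus>\<^bsub>T2\<^esub> L rs' ss"
  using assms
  by (induction rs rs' ss rule: list_induct3) (auto simp: g_def F H T2.l_distr L_closed T2.a_ac)

lemma L_mult:
  assumes "set rs \<subseteq> carrier R" "set ss \<subseteq> carrier S" "x \<in> carrier R" "length rs = length ss"
  shows "L (map (\<lambda>a. x \<otimes>\<^bsub>R\<^esub> a) rs) ss = f x \<otimes>\<^bsub>T2\<^esub> L rs ss"
  using assms(4,1,2,3)
  by (induction rs ss rule: list_induct2) (auto simp: g_def F H T2.r_distr L_closed T2.m_assoc)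

lemma L_shift:
  assumes "set rs \<subseteq> carrier R" "set ss \<subseteq> carrier S" "length rs = length ss"
  shows "L (map (shift R) rs) ss = sT (L rs ss)"
  using assms(3,1,2)
  by (induction rs ss rule: list_induct2) (auto simp: g_def F H ST ST0 sTf sTh L_closed)

lemma L_K:
  assumes "length as = length ss" "set as \<subseteq> K" "set ss \<subseteq> carrier S"
  shows "L (map c as) ss = h (LK as ss)"
  using assms
  by (induction as ss rule: list_induct2) (auto simp: g_def fh H H0 u LK_closed)

definition indep :: "'s list \<Rightarrow> bool" where
  "indep ss \<longleftrightarrow> set ss \<subseteq> carrier S \<and> (\<forall>as. length as = length ss \<longrightarrow> set as \<subseteq> K \<longrightarrow> LK as ss = \<zero>\<^bsub>S\<^esub> \<longrightarrow> set as \<subseteq> {0})"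

lemma indep_tl: "indep (s # ss) \<Longrightarrow> indep ss"
  unfolding indep_def
proof (intro conjI allI impI)
  fix as assume a: "set (s # ss) \<subseteq> carrier S \<and> (\<forall>as. length as = length (s # ss) \<longrightarrow> set as \<subseteq> K \<longrightarrow> LK as (s # ss) = \<zero>\<^bsub>S\<^esub> \<longrightarrow> set as \<subseteq> {0})"
    and as: "length as = length ss" "set as \<subseteq> K" "LK as ss = \<zero>\<^bsub>S\<^esub>"
  then have "set (0 # as) \<subseteq> {0}" using K(1) by (elim conjE allE[of _ "0 # as"]) (auto simp: u_hom)
  then show "set as \<subseteq> {0}" by simp
qed auto

text \<open>The classical argument for shortest relations: the possible first coefficients \<open>r\<close> in relations among the
  images of \<open>s # ss\<close> form a shift ideal \<open>N\<close> of \<open>R\<close>. If \<open>N\<close> contains \<open>\<one>\<close>, subtract a relation with first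
  coefficient \<open>\<one>\<close> from its shift; by induction the remaining coefficients are shift invariant, hence in \<open>K\<close>,
  against independence over \<open>K\<close>. So \<open>N\<close> is zero.\<close>
lemma indep_over_R:
  assumes "indep ss" "length rs = length ss" "set rs \<subseteq> carrier R" "L rs ss = \<zero>\<^bsub>T2\<^esub>"
  shows "set rs \<subseteq> {\<zero>\<^bsub>R\<^esub>}"
  using assms
proof (induction ss arbitrary: rs)
  case (Cons s ss)
  have i: "indep ss" by (rule indep_tl[OF Cons.prems(1)])
  have ss: "s \<in> carrier S" "set ss \<subseteq> carrier S" using Cons.prems(1) by (auto simp: indep_def)
  define N where "N = {r \<in> carrier R. \<exists>rs. length rs = length ss \<and> set rs \<subseteq> carrier R \<and> g r s \<oplus>\<^bsub>T2\<^esub> L rs ss = \<zero>\<^bsub>T2\<^esub>}"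
  have "ideal N R"
  proof (rule cring_idealI[OF R.is_cring])
    have "L (map (\<lambda>_. \<zero>\<^bsub>R\<^esub>) ss) ss = \<zero>\<^bsub>T2\<^esub>" using ss(2)
      by (induction ss) (auto simp: g_def F0 H)
    then show "\<zero>\<^bsub>R\<^esub> \<in> N" unfolding N_def using ss by (auto simp: g_def F0 H intro!: exI[of _ "map (\<lambda>_. \<zero>\<^bsub>R\<^esub>) ss"])
  next
    fix a b assume "a \<in> N" "b \<in> N"
    then obtain ra rb where r: "a \<in> carrier R" "length ra = length ss" "set ra \<subseteq> carrier R" "g a s \<oplus>\<^bsub>T2\<^esub> L ra ss = \<zero>\<^bsub>T2\<^esub>"
      "b \<in> carrier R" "length rb = length ss" "set rb \<subseteq> carrier R" "g b s \<oplus>\<^bsub>T2\<^esub> L rb ss = \<zero>\<^bsub>T2\<^esub>"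
      unfolding N_def by blast
    let ?r = "map2 (\<lambda>a b. a \<oplus>\<^bsub>R\<^esub> b) ra rb"
    have "g (a \<oplus>\<^bsub>R\<^esub> b) s \<oplus>\<^bsub>T2\<^esub> L ?r ss = (g a s \<oplus>\<^bsub>T2\<^esub> L ra ss) \<oplus>\<^bsub>T2\<^esub> (g b s \<oplus>\<^bsub>T2\<^esub> L rb ss)"
      using r(1-3,5-7) ss by (simp add: L_add L_closed g_closed T2.a_ac) (simp add: g_def F H T2.l_distr T2.a_ac L_closed)
    then have "g (a \<oplus>\<^bsub>R\<^esub> b) s \<oplus>\<^bsub>T2\<^esub> L ?r ss = \<zero>\<^bsub>T2\<^esub>" using r by simp
    moreover have "set ?r \<subseteq> carrier R" using r by (intro map2_closed) auto
    ultimately show "a \<oplus>\<^bsub>R\<^esub> b \<in> N" unfolding N_def using r by (auto intro!: exI[of _ ?r])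
  next
    fix a x assume "a \<in> N" and x: "x \<in> carrier R"
    then obtain ra where r: "a \<in> carrier R" "length ra = length ss" "set ra \<subseteq> carrier R" "g a s \<oplus>\<^bsub>T2\<^esub> L ra ss = \<zero>\<^bsub>T2\<^esub>"
      unfolding N_def by blast
    have "g (x \<otimes>\<^bsub>R\<^esub> a) s \<oplus>\<^bsub>T2\<^esub> L (map (\<lambda>a. x \<otimes>\<^bsub>R\<^esub> a) ra) ss = f x \<otimes>\<^bsub>T2\<^esub> (g a s \<oplus>\<^bsub>T2\<^esub> L ra ss)"
      using r(1-3) ss x by (simp add: L_mult L_closed g_def F H T2.r_distr T2.m_assoc)
    also have "\<dots> = \<zero>\<^bsub>T2\<^esub>" using r(4) x by (simp add: F)
    finally show "x \<otimes>\<^bsub>R\<^esub> a \<in> N" unfolding N_def using r x by (auto simp: F subset_iff intro!: exI[of _ "map (\<lambda>a. x \<otimes>\<^bsub>R\<^esub> a) ra"])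
  qed (auto simp: N_def)
  moreover have "shift R ` N \<subseteq> N"
  proof safe
    fix a assume "a \<in> N"
    then obtain ra where r: "a \<in> carrier R" "length ra = length ss" "set ra \<subseteq> carrier R" "g a s \<oplus>\<^bsub>T2\<^esub> L ra ss = \<zero>\<^bsub>T2\<^esub>"
      unfolding N_def by blast
    have "g (shift R a) s \<oplus>\<^bsub>T2\<^esub> L (map (shift R) ra) ss = sT (g a s \<oplus>\<^bsub>T2\<^esub> L ra ss)"
      using r(1-3) ss by (simp add: L_shift L_closed ST g_closed) (simp add: g_def ST F H sTf sTh)
    also have "\<dots> = \<zero>\<^bsub>T2\<^esub>" using r(4) by (simp add: ST0)
    finally show "shift R a \<in> N" unfolding N_def using r by (auto simp: SR ST0 subset_iff intro!: exI[of _ "map (shift R) ra"])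
  qed
  ultimately have alt: "N = {\<zero>\<^bsub>R\<^esub>} \<or> \<one>\<^bsub>R\<^esub> \<in> N" by (rule simple)
  have "\<one>\<^bsub>R\<^esub> \<notin> N"
  proof
    assume "\<one>\<^bsub>R\<^esub> \<in> N"
    then obtain rs where rs: "length rs = length ss" "set rs \<subseteq> carrier R" "g \<one>\<^bsub>R\<^esub> s \<oplus>\<^bsub>T2\<^esub> L rs ss = \<zero>\<^bsub>T2\<^esub>"
      unfolding N_def by blast
    then have eq: "h s \<oplus>\<^bsub>T2\<^esub> L rs ss = \<zero>\<^bsub>T2\<^esub>" using ss by (simp add: g_def F H)
    have "sT (h s \<oplus>\<^bsub>T2\<^esub> L rs ss) = \<zero>\<^bsub>T2\<^esub>" using eq ST0 by simp
    then have eq': "h s \<oplus>\<^bsub>T2\<^esub> L (map (shift R) rs) ss = \<zero>\<^bsub>T2\<^esub>"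
      using ss rs by (simp add: ST H L_closed sTh L_shift)
    let ?n = "map (\<lambda>a. (\<ominus>\<^bsub>R\<^esub> \<one>\<^bsub>R\<^esub>) \<otimes>\<^bsub>R\<^esub> a) rs"
    let ?d = "map2 (\<lambda>a b. a \<oplus>\<^bsub>R\<^esub> b) (map (shift R) rs) ?n"
    have sh: "set (map (shift R) rs) \<subseteq> carrier R" using rs(2) by (auto simp: SR subset_iff)
    have nn: "set ?n \<subseteq> carrier R" using rs(2) by (auto simp: subset_iff)
    have Lr: "L (map (shift R) rs) ss = L rs ss"
    proof -
      have "L (map (shift R) rs) ss = \<ominus>\<^bsub>T2\<^esub> h s" "L rs ss = \<ominus>\<^bsub>T2\<^esub> h s"
        using T2.minus_equality[of "L (map (shift R) rs) ss" "h s"] T2.minus_equality[of "L rs ss" "h s"]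
          eq eq' ss rs sh by (simp_all add: H L_closed T2.a_comm)
      then show ?thesis by simp
    qed
    have fm: "f (\<ominus>\<^bsub>R\<^esub> \<one>\<^bsub>R\<^esub>) = \<ominus>\<^bsub>T2\<^esub> \<one>\<^bsub>T2\<^esub>"
      using T2.minus_equality[of "f (\<ominus>\<^bsub>R\<^esub> \<one>\<^bsub>R\<^esub>)" "\<one>\<^bsub>T2\<^esub>"] F(3)[of "\<ominus>\<^bsub>R\<^esub> \<one>\<^bsub>R\<^esub>" "\<one>\<^bsub>R\<^esub>"] by (simp add: F(1,4) R.l_neg F0)
    have "L ?d ss = L (map (shift R) rs) ss \<oplus>\<^bsub>T2\<^esub> L ?n ss"
      by (rule L_add) (use rs sh nn ss in auto)
    also have "L ?n ss = f (\<ominus>\<^bsub>R\<^esub> \<one>\<^bsub>R\<^esub>) \<otimes>\<^bsub>T2\<^esub> L rs ss"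
      by (rule L_mult) (use rs ss in auto)
    also have "L (map (shift R) rs) ss \<oplus>\<^bsub>T2\<^esub> f (\<ominus>\<^bsub>R\<^esub> \<one>\<^bsub>R\<^esub>) \<otimes>\<^bsub>T2\<^esub> L rs ss = \<zero>\<^bsub>T2\<^esub>"
      using L_closed[OF rs(2) ss(2)] by (simp add: Lr fm T2.l_minus T2.r_neg)
    finally have "set ?d \<subseteq> {\<zero>\<^bsub>R\<^esub>}"
      using rs(1) by (intro Cons.IH[OF i] map2_closed sh nn) auto
    then have fixed: "shift R r = r" if r: "r \<in> set rs" for r
    proof -
      obtain k where k: "k < length rs" "r = rs ! k" using r by (metis in_set_conv_nth)
      have rc: "r \<in> carrier R" using r rs by blast
      have "?d ! k \<in> set ?d" by (rule nth_mem) (use k in simp)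
      then have "shift R r \<oplus>\<^bsub>R\<^esub> (\<ominus>\<^bsub>R\<^esub> \<one>\<^bsub>R\<^esub>) \<otimes>\<^bsub>R\<^esub> r = \<zero>\<^bsub>R\<^esub>" using k \<open>set ?d \<subseteq> {\<zero>\<^bsub>R\<^esub>}\<close> by auto
      then have "shift R r \<ominus>\<^bsub>R\<^esub> r = \<zero>\<^bsub>R\<^esub>" using rc by (simp add: R.l_minus R.minus_eq)
      then show ?thesis using rc SR(1)[OF rc] by (simp add: R.r_right_minus_eq)
    qed
    have "\<exists>a. a \<in> K \<and> r = c a" if "r \<in> set rs" for r
      using const[of r] fixed[OF that] rs(2) that by auto
    then have "\<forall>r\<in>set rs. \<exists>a. a \<in> K \<and> r = c a" by simp
    from bchoice[OF this] obtain ch where ch: "\<forall>r\<in>set rs. ch r \<in> K \<and> r = c (ch r)" ..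
    define as where "as = map ch rs"
    have as: "set as \<subseteq> K" "length as = length ss" using ch rs(1) by (auto simp: as_def)
    have asr: "rs = map c as" unfolding as_def map_map by (rule map_idI[symmetric]) (use ch in auto)
    have "h (LK (1 # as) (s # ss)) = \<zero>\<^bsub>T2\<^esub>"
      using eq as ss L_K[OF as(2,1) ss(2)] by (simp add: asr H LK_closed u_hom)
    then have "LK (1 # as) (s # ss) = \<zero>\<^bsub>S\<^esub>"
      using inj_onD[OF inj_h, of "LK (1 # as) (s # ss)" "\<zero>\<^bsub>S\<^esub>"] H0 LK_closed[of "1 # as" "s # ss"] as ss K(2) by simp
    then have "set (1 # as) \<subseteq> {0}" using Cons.prems(1) as K(2) unfolding indep_def
      by (elim conjE allE[of _ "1 # as"]) auto
    then show False by simp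
  qed
  then have N0: "N = {\<zero>\<^bsub>R\<^esub>}" using alt by blast
  obtain r rs' where r: "rs = r # rs'" "length rs' = length ss" using Cons.prems(2) by (cases rs) auto
  have "r \<in> N" unfolding N_def using Cons.prems r by auto
  then have r0: "r = \<zero>\<^bsub>R\<^esub>" using N0 by blast
  have "g r s = \<zero>\<^bsub>T2\<^esub>" using ss by (simp add: r0 g_def F0 H)
  then have "L rs' ss = \<zero>\<^bsub>T2\<^esub>" using Cons.prems r ss L_closed[of rs' ss] by simp
  then have "set rs' \<subseteq> {\<zero>\<^bsub>R\<^esub>}" using Cons.IH[OF i r(2)] Cons.prems r by auto
  then show ?case using r r0 by simp
qed auto

definition tspan :: "'s list \<Rightarrow> ('r \<times> 's \<Rightarrow>\<^sub>0 int) set set" where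
  "tspan ss = {LT rs ss | rs. length rs = length ss \<and> set rs \<subseteq> carrier R}"

lemma LT_add:
  assumes "length rs = length rs'" "length rs' = length ss" "set rs \<subseteq> carrier R" "set rs' \<subseteq> carrier R" "set ss \<subseteq> carrier S"
  shows "LT (map2 (\<lambda>a b. a \<oplus>\<^bsub>R\<^esub> b) rs rs') ss = LT rs ss \<oplus>\<^bsub>T\<^esub> LT rs' ss"
  using assms
  by (induction rs rs' ss rule: list_induct3) (auto simp: t_add1 LT_closed T.a_ac t_closed)

lemma tspan_add: "set ss \<subseteq> carrier S \<Longrightarrow> x \<in> tspan ss \<Longrightarrow> y \<in> tspan ss \<Longrightarrow> x \<oplus>\<^bsub>T\<^esub> y \<in> tspan ss"
proof -
  assume ss: "set ss \<subseteq> carrier S" and "x \<in> tspan ss" "y \<in> tspan ss"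
  then obtain rs rs' where r: "x = LT rs ss" "length rs = length ss" "set rs \<subseteq> carrier R"
    "y = LT rs' ss" "length rs' = length ss" "set rs' \<subseteq> carrier R" unfolding tspan_def by blast
  have "x \<oplus>\<^bsub>T\<^esub> y = LT (map2 (\<lambda>a b. a \<oplus>\<^bsub>R\<^esub> b) rs rs') ss" using r ss by (simp add: LT_add)
  moreover have "set (map2 (\<lambda>a b. a \<oplus>\<^bsub>R\<^esub> b) rs rs') \<subseteq> carrier R" using r by (intro map2_closed) auto
  ultimately show ?thesis unfolding tspan_def using r by (auto intro!: exI[of _ "map2 (\<lambda>a b. a \<oplus>\<^bsub>R\<^esub> b) rs rs'"])
qed

lemma LT_K:
  assumes "length as = length ss" "set as \<subseteq> K" "set ss \<subseteq> carrier S" "r \<in> carrier R"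
  shows "LT (map (\<lambda>a. c a \<otimes>\<^bsub>R\<^esub> r) as) ss = t r (LK as ss)"
  using assms
  by (induction as ss rule: list_induct2) (auto simp: t_balanced t_add2 LK_closed u t_zero2)

lemma LK_smult:
  assumes "length as = length ss" "set as \<subseteq> K" "set ss \<subseteq> carrier S" "b \<in> K"
  shows "LK (map (\<lambda>a. b * a) as) ss = u b \<otimes>\<^bsub>S\<^esub> LK as ss"
  using assms
  by (induction as ss rule: list_induct2) (auto simp: u_hom u LK_closed S.r_distr S.m_assoc)

lemma indep_extend:
  assumes i: "indep ss" and s: "s \<in> carrier S" and no: "\<nexists>as. length as = length ss \<and> set as \<subseteq> K \<and> s = LK as ss"
  shows "indep (s # ss)"
  unfolding indep_def
proof (intro conjI allI impI)
  have ss: "set ss \<subseteq> carrier S" using i by (simp add: indep_def)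
  then show "set (s # ss) \<subseteq> carrier S" using s by simp
  fix as assume as: "length as = length (s # ss)" "set as \<subseteq> K" "LK as (s # ss) = \<zero>\<^bsub>S\<^esub>"
  then obtain a bs where a: "as = a # bs" "length bs = length ss" "a \<in> K" "set bs \<subseteq> K" by (cases as) auto
  have eq: "u a \<otimes>\<^bsub>S\<^esub> s \<oplus>\<^bsub>S\<^esub> LK bs ss = \<zero>\<^bsub>S\<^esub>" using as a by simp
  have "a = 0"
  proof (rule ccontr)
    assume a0: "a \<noteq> 0"
    let ?e = "- inverse a"
    have eK: "?e \<in> K" by (rule K(5)[OF K(6)[OF a(3)]])
    have ea: "u ?e \<otimes>\<^bsub>S\<^esub> u a = u (- 1)" using u_hom(4)[OF eK a(3)] a0 by simp
    have "u ?e \<otimes>\<^bsub>S\<^esub> (u a \<otimes>\<^bsub>S\<^esub> s \<oplus>\<^bsub>S\<^esub> LK bs ss) = \<zero>\<^bsub>S\<^esub>" unfolding eq using u[OF eK] by simp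
    then have "(u ?e \<otimes>\<^bsub>S\<^esub> u a) \<otimes>\<^bsub>S\<^esub> s \<oplus>\<^bsub>S\<^esub> u ?e \<otimes>\<^bsub>S\<^esub> LK bs ss = \<zero>\<^bsub>S\<^esub>"
      using u[OF eK] u[OF a(3)] s LK_closed[OF a(4) ss] by (simp add: S.r_distr S.m_assoc)
    then have z: "u (- 1) \<otimes>\<^bsub>S\<^esub> s \<oplus>\<^bsub>S\<^esub> LK (map (\<lambda>a. ?e * a) bs) ss = \<zero>\<^bsub>S\<^esub>"
      unfolding ea using LK_smult[OF a(2,4) ss eK] by simp
    have m1: "- 1 \<in> K" by (rule K(5)[OF K(2)])
    have "u (- 1) \<oplus>\<^bsub>S\<^esub> \<one>\<^bsub>S\<^esub> = \<zero>\<^bsub>S\<^esub>" using u_hom(3)[OF m1 K(2)] u_hom(1,2) by simp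
    then have "u (- 1) = \<ominus>\<^bsub>S\<^esub> \<one>\<^bsub>S\<^esub>" using S.minus_equality[of "u (- 1)" "\<one>\<^bsub>S\<^esub>"] u[OF m1] by simp
    then have z2: "\<ominus>\<^bsub>S\<^esub> s \<oplus>\<^bsub>S\<^esub> LK (map (\<lambda>a. ?e * a) bs) ss = \<zero>\<^bsub>S\<^esub>" using z s by (simp add: S.l_minus)
    have eb: "set (map (\<lambda>a. ?e * a) bs) \<subseteq> K" 
    proof
      fix y assume "y \<in> set (map (\<lambda>a. ?e * a) bs)"
      then obtain b where "b \<in> set bs" "y = ?e * b" unfolding set_map by (rule imageE)
      then show "y \<in> K" using K(4)[OF eK, of b] a(4) by auto
    qed
    have "LK (map (\<lambda>a. ?e * a) bs) ss = s"
      using S.minus_equality[of "LK (map (\<lambda>a. ?e * a) bs) ss" "\<ominus>\<^bsub>S\<^esub> s"] z2 s LK_closed[OF eb ss]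
      by (simp add: S.a_comm)
    then have "length (map (\<lambda>a. ?e * a) bs) = length ss \<and> set (map (\<lambda>a. ?e * a) bs) \<subseteq> K \<and>
      s = LK (map (\<lambda>a. ?e * a) bs) ss" using eb a(2) by simp
    then show False using no by blast
  qed
  moreover from this have "LK bs ss = \<zero>\<^bsub>S\<^esub>" using eq s LK_closed[OF a(4) ss] by (simp add: u_hom)
  then have "set bs \<subseteq> {0}" using i a(2,4) unfolding indep_def by (elim conjE allE[of _ bs]) auto
  ultimately show "set as \<subseteq> {0}" using a by simp
qed

text \<open>Every tensor is a combination of pure tensors with right factors independent over \<open>K\<close>: add a right
  factor to the list unless it already depends on the list.\<close>
lemma tspan_exists:
  assumes "x \<in> carrier T" "indep ss"
  shows "\<exists>ss'. indep ss' \<and> tspan ss \<subseteq> tspan ss' \<and> x \<in> tspan ss'"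
  using assms
proof (induction arbitrary: ss rule: T_induct)
  case (pure r s)
  have ss: "set ss \<subseteq> carrier S" using pure by (simp add: indep_def)
  show ?case
  proof (cases "\<exists>as. length as = length ss \<and> set as \<subseteq> K \<and> s = LK as ss")
    case True
    then obtain as where as: "length as = length ss" "set as \<subseteq> K" "s = LK as ss" by blast
    have "t r s = LT (map (\<lambda>a. c a \<otimes>\<^bsub>R\<^esub> r) as) ss" using LT_K as ss pure by simp
    moreover have "set (map (\<lambda>a. c a \<otimes>\<^bsub>R\<^esub> r) as) \<subseteq> carrier R" using as(2) c pure by (auto simp: subset_iff)
    ultimately have "t r s \<in> tspan ss" unfolding tspan_def using as by (auto intro!: exI[of _ "map (\<lambda>a. c a \<otimes>\<^bsub>R\<^esub> r) as"])
    then show ?thesis using pure by blast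
  next
    case False
    then have i: "indep (s # ss)" by (intro indep_extend pure) auto
    have "tspan ss \<subseteq> tspan (s # ss)"
    proof
      fix y assume "y \<in> tspan ss"
      then obtain rs where rs: "y = LT rs ss" "length rs = length ss" "set rs \<subseteq> carrier R" unfolding tspan_def by blast
      then have "y = LT (\<zero>\<^bsub>R\<^esub> # rs) (s # ss)" using pure ss by (simp add: t_zero1 LT_closed)
      then show "y \<in> tspan (s # ss)" unfolding tspan_def using rs by (intro CollectI exI[of _ "\<zero>\<^bsub>R\<^esub> # rs"]) simp
    qed
    moreover have "t r s = LT (r # map (\<lambda>_. \<zero>\<^bsub>R\<^esub>) ss) (s # ss)"
    proof -
      have "LT (map (\<lambda>_. \<zero>\<^bsub>R\<^esub>) ss) ss = \<zero>\<^bsub>T\<^esub>" using ss by (induction ss) (auto simp: t_zero1)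
      then show ?thesis using pure by (simp add: t_closed)
    qed
    then have "t r s \<in> tspan (s # ss)" unfolding tspan_def using pure
      by (intro CollectI exI[of _ "r # map (\<lambda>_. \<zero>\<^bsub>R\<^esub>) ss"]) auto
    ultimately show ?thesis using i by blast
  qed
next
  case (add x y)
  obtain s1 where s1: "indep s1" "tspan ss \<subseteq> tspan s1" "x \<in> tspan s1" using add.IH(1)[OF add.prems] by blast
  obtain s2 where s2: "indep s2" "tspan s1 \<subseteq> tspan s2" "y \<in> tspan s2" using add.IH(2)[OF s1(1)] by blast
  have "x \<oplus>\<^bsub>T\<^esub> y \<in> tspan s2" using s1 s2 by (intro tspan_add) (auto simp: indep_def)
  then show ?case using s1 s2 by blast
qed

text \<open>Write an element of the kernel with independent right factors; all left factors vanish.\<close>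
theorem hom_injective:
  assumes Psi: "\<Psi> \<in> ring_hom T T2" "\<And>r s. r \<in> carrier R \<Longrightarrow> s \<in> carrier S \<Longrightarrow> \<Psi> (t r s) = f r \<otimes>\<^bsub>T2\<^esub> h s"
  shows "inj_on \<Psi> (carrier T)"
proof -
  interpret P: ring_hom_cring T T2 \<Psi> by unfold_locales (rule Psi)
  have "x = \<zero>\<^bsub>T\<^esub>" if x: "x \<in> carrier T" "\<Psi> x = \<zero>\<^bsub>T2\<^esub>" for x
  proof -
    have "indep []" by (simp add: indep_def)
    then obtain ss where ss: "indep ss" "x \<in> tspan ss" using tspan_exists[OF x(1)] by blast
    then obtain rs where rs: "x = LT rs ss" "length rs = length ss" "set rs \<subseteq> carrier R" unfolding tspan_def by blast
    have sc: "set ss \<subseteq> carrier S" using ss by (simp add: indep_def)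
    have "\<Psi> (LT rs ss) = L rs ss" using rs(2,3) sc
      by (induction rs ss rule: list_induct2) (auto simp: Psi(2) g_def LT_closed t_closed)
    then have z: "set rs \<subseteq> {\<zero>\<^bsub>R\<^esub>}" using indep_over_R[OF ss(1) rs(2,3)] x(2) rs(1) by simp
    have "LT rs ss = \<zero>\<^bsub>T\<^esub>" using rs(2) z sc by (induction rs ss rule: list_induct2) (auto simp: t_zero1)
    then show ?thesis using rs by simp
  qed
  note ker = this
  show ?thesis
  proof (rule inj_onI)
    fix x y assume xy: "x \<in> carrier T" "y \<in> carrier T" "\<Psi> x = \<Psi> y"
    then have "\<Psi> (x \<ominus>\<^bsub>T\<^esub> y) = \<zero>\<^bsub>T2\<^esub>" by (simp add: T.minus_eq T2.r_neg P.hom_a_inv)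
    then have "x \<ominus>\<^bsub>T\<^esub> y = \<zero>\<^bsub>T\<^esub>" using ker xy by simp
    then show "x = y" using xy by (simp add: T.r_right_minus_eq)
  qed
qed

end

section \<open>Homomorphisms from a ring type into a record\<close>

text \<open>Homomorphisms from a subring of a type to a ring record; through them matrix identities over polynomial
  rings are moved to records.\<close>
locale typed_hom =
  fixes C :: "'a::comm_ring_1 set" and S :: "('s, 'm) ring_scheme" and q :: "'a \<Rightarrow> 's"
  assumes C: "subring_set C" and S: "cring S"
    and closed: "a \<in> C \<Longrightarrow> q a \<in> carrier S"
    and add: "a \<in> C \<Longrightarrow> b \<in> C \<Longrightarrow> q (a + b) = q a \<oplus>\<^bsub>S\<^esub> q b"
    and mult: "a \<in> C \<Longrightarrow> b \<in> C \<Longrightarrow> q (a * b) = q a \<otimes>\<^bsub>S\<^esub> q b"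
    and one: "q 1 = \<one>\<^bsub>S\<^esub>"
begin

sublocale S: cring S by (rule S)

lemma zero: "q 0 = \<zero>\<^bsub>S\<^esub>"
  using add[of 0 0] closed[of 0] subring_setD(2)[OF C] by (simp add: S.add.l_cancel_one')

lemma uminus: "a \<in> C \<Longrightarrow> q (- a) = \<ominus>\<^bsub>S\<^esub> q a"
  using add[of "- a" a] closed[of "- a"] closed[of a] subring_setD(5)[OF C, of a] zero
  by (intro S.minus_equality[symmetric]) auto

lemma sum: "finite I \<Longrightarrow> (\<And>i. i \<in> I \<Longrightarrow> f i \<in> C) \<Longrightarrow> q (sum f I) = (\<Oplus>\<^bsub>S\<^esub>i\<in>I. q (f i))"
proof (induction I rule: finite_induct)
  case (insert x F)
  then have "q (sum f (insert x F)) = q (f x) \<oplus>\<^bsub>S\<^esub> q (sum f F)"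
    using subring_set_sum[OF C, of F f] by (simp add: add)
  then show ?case using insert by (subst S.finsum_insert) (auto simp: closed)
qed (simp add: zero)

definition qm :: "'a ^ 'n ^ 'n \<Rightarrow> 'n \<Rightarrow> 'n::finite \<Rightarrow> 's" where "qm M = (\<lambda>i j. q (M $ i $ j))"

lemma qm_closed: "(\<And>i j. M $ i $ j \<in> C) \<Longrightarrow> qm M \<in> carrier (mring S)"
  by (simp add: qm_def mring_simps closed)

lemma qm_mult:
  assumes "\<And>i j. M $ i $ j \<in> C" "\<And>i j. N $ i $ j \<in> C"
  shows "qm (M ** N) = qm M \<otimes>\<^bsub>mring S\<^esub> qm N"
proof (intro ext)
  fix i j
  have "q (\<Sum>k\<in>UNIV. M $ i $ k * N $ k $ j) = (\<Oplus>\<^bsub>S\<^esub>k\<in>UNIV. q (M $ i $ k * N $ k $ j))"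
    using assms by (intro sum) (auto intro: subring_setD(4)[OF C])
  also have "\<dots> = (\<Oplus>\<^bsub>S\<^esub>k\<in>UNIV. q (M $ i $ k) \<otimes>\<^bsub>S\<^esub> q (N $ k $ j))"
    using assms by (intro S.finsum_cong') (auto simp: mult closed)
  finally show "qm (M ** N) i j = (qm M \<otimes>\<^bsub>mring S\<^esub> qm N) i j"
    by (simp add: qm_def mring_simps matrix_matrix_mult_def)
qed

lemma qm_add:
  assumes "\<And>i j. M $ i $ j \<in> C" "\<And>i j. N $ i $ j \<in> C"
  shows "qm (M + N) = qm M \<oplus>\<^bsub>mring S\<^esub> qm N"
  using assms by (auto simp: qm_def mring_simps add fun_eq_iff)

end

section \<open>Linear functionals\<close>

text \<open>A maximal subspace containing \<open>W\<close> but not \<open>v\<close> is a hyperplane complementary to \<open>v\<close>, and \<open>l\<close> is the coordinate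
  along \<open>v\<close>. The action is a parameter because the scalars act through coefficients, through a structure map,
  or through an embedding of fields.\<close>
lemma exists_functional:
  fixes act :: "'f::field \<Rightarrow> 'v::ab_group_add \<Rightarrow> 'v"
  assumes K: "0 \<in> K" "1 \<in> K" "\<And>a b. a \<in> K \<Longrightarrow> b \<in> K \<Longrightarrow> a + b \<in> K" "\<And>a b. a \<in> K \<Longrightarrow> b \<in> K \<Longrightarrow> a * b \<in> K"
      "\<And>a. a \<in> K \<Longrightarrow> - a \<in> K" "\<And>a. a \<in> K \<Longrightarrow> inverse a \<in> K"
    and act: "\<And>a x y. a \<in> K \<Longrightarrow> act a (x + y) = act a x + act a y"
      "\<And>a b x. a \<in> K \<Longrightarrow> b \<in> K \<Longrightarrow> act (a + b) x = act a x + act b x"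
      "\<And>a b x. a \<in> K \<Longrightarrow> b \<in> K \<Longrightarrow> act (a * b) x = act a (act b x)" "\<And>x. act 1 x = x"
    and W: "0 \<in> W" "\<And>x y. x \<in> W \<Longrightarrow> y \<in> W \<Longrightarrow> x + y \<in> W" "\<And>a x. a \<in> K \<Longrightarrow> x \<in> W \<Longrightarrow> act a x \<in> W"
    and v: "v \<notin> W"
  obtains l where "\<And>x y. l (x + y) = l x + l y" "\<And>x. l x \<in> K" "\<And>a x. a \<in> K \<Longrightarrow> l (act a x) = a * l x"
    "l v = 1" "\<And>x. x \<in> W \<Longrightarrow> l x = (0::'f)"
proof -
  define sub where "sub V \<longleftrightarrow> 0 \<in> V \<and> (\<forall>x\<in>V. \<forall>y\<in>V. x + y \<in> V) \<and> (\<forall>a\<in>K. \<forall>x\<in>V. act a x \<in> V)" for V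
  define C where "C = {V. sub V \<and> W \<subseteq> V \<and> v \<notin> V}"
  have act0: "act 0 x = 0" for x using act(2)[of 0 0 x] K(1) by simp
  have actz: "act a 0 = 0" if "a \<in> K" for a using act(1)[OF that, of 0 0] by simp
  have actm: "act (- 1) x = - x" for x
    using act(2)[of "- 1" 1 x] K(2,5) act(4) act0 by (simp add: eq_neg_iff_add_eq_0)
  have "\<exists>M\<in>C. \<forall>V\<in>C. M \<subseteq> V \<longrightarrow> V = M"
  proof (rule subset_Zorn_nonempty)
    have "sub W" unfolding sub_def using W by blast
    then have "W \<in> C" using v by (simp add: C_def)
    then show "C \<noteq> {}" by blast
    fix \<C> assume ne: "\<C> \<noteq> {}" and ch: "subset.chain C \<C>"
    have s: "\<C> \<subseteq> C" using ch by (auto simp: subset.chain_def)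
    have "sub (\<Union>\<C>)" unfolding sub_def
    proof (intro conjI ballI)
      show "0 \<in> \<Union>\<C>" using ne s by (auto simp: C_def sub_def)
    next
      fix x y assume "x \<in> \<Union>\<C>" "y \<in> \<Union>\<C>"
      then obtain V1 V2 where V: "V1 \<in> \<C>" "V2 \<in> \<C>" "x \<in> V1" "y \<in> V2" by auto
      then have "V1 \<subseteq> V2 \<or> V2 \<subseteq> V1" using ch by (auto simp: subset.chain_def)
      then obtain V3 where V3: "V3 \<in> \<C>" "x \<in> V3" "y \<in> V3" using V by blast
      then have "x + y \<in> V3" using s by (auto simp: C_def sub_def)
      then show "x + y \<in> \<Union>\<C>" using V3 by blast
    next
      fix a x assume a: "a \<in> K" "x \<in> \<Union>\<C>"
      then obtain V1 where "V1 \<in> \<C>" "x \<in> V1" by auto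
      then show "act a x \<in> \<Union>\<C>" using s a by (intro UnionI[of V1]) (auto simp: C_def sub_def)
    qed
    moreover have "W \<subseteq> \<Union>\<C>" using ne s by (auto simp: C_def)
    moreover have "v \<notin> \<Union>\<C>" using s by (auto simp: C_def)
    ultimately show "\<Union>\<C> \<in> C" by (simp add: C_def)
  qed
  then obtain M where MC: "M \<in> C" and mx: "\<forall>V\<in>C. M \<subseteq> V \<longrightarrow> V = M" by blast
  have Ms: "0 \<in> M" "\<And>x y. x \<in> M \<Longrightarrow> y \<in> M \<Longrightarrow> x + y \<in> M" "\<And>a x. a \<in> K \<Longrightarrow> x \<in> M \<Longrightarrow> act a x \<in> M"
    and WM: "W \<subseteq> M" and vM: "v \<notin> M" using MC by (auto simp: C_def sub_def)
  have Mm: "- x \<in> M" if "x \<in> M" for x using Ms(3)[OF K(5)[OF K(2)] that] by (simp add: actm)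
  have actneg: "act a (- x) = - act a x" if "a \<in> K" for a x
    using act(1)[OF that, of "- x" x] actz[OF that] by (simp add: eq_neg_iff_add_eq_0)
  have ex: "\<exists>a\<in>K. x - act a v \<in> M" for x
  proof (cases "x \<in> M")
    case True
    then show ?thesis using K(1) act0 by (intro bexI[of _ 0]) auto
  next
    case False
    define V where "V = {m + act a x | m a. m \<in> M \<and> a \<in> K}"
    have MV: "M \<subseteq> V" unfolding V_def using K(1) act0 by force
    have xV: "x \<in> V" unfolding V_def
      by (rule CollectI, rule exI[of _ 0], rule exI[of _ 1]) (use K(2) act(4) Ms(1) in simp)
    have "sub V" unfolding sub_def
    proof (intro conjI ballI)
      show "0 \<in> V" using MV Ms(1) by blast
    next
      fix y z assume "y \<in> V" "z \<in> V"
      then obtain m a m' a' where e: "y = m + act a x" "z = m' + act a' x" "m \<in> M" "a \<in> K" "m' \<in> M" "a' \<in> K"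
        unfolding V_def by blast
      have "y + z = (m + m') + act (a + a') x" using e act(2) by (simp add: algebra_simps)
      moreover have "m + m' \<in> M" "a + a' \<in> K" using e Ms K by auto
      ultimately show "y + z \<in> V" unfolding V_def by blast
    next
      fix b y assume b: "b \<in> K" "y \<in> V"
      then obtain m a where e: "y = m + act a x" "m \<in> M" "a \<in> K" unfolding V_def by blast
      have "act b y = act b m + act (b * a) x" using e b act(1,3) by simp
      moreover have "act b m \<in> M" "b * a \<in> K" using e b Ms K by auto
      ultimately show "act b y \<in> V" unfolding V_def by blast
    qed
    then have "v \<in> V" using mx MV xV False WM unfolding C_def by blast
    then obtain m a where e: "v = m + act a x" "m \<in> M" "a \<in> K" unfolding V_def by blast
    have a0: "a \<noteq> 0" using e vM act0 by auto
    let ?b = "inverse a"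
    have bK: "?b \<in> K" by (rule K(6)[OF e(3)])
    have "act ?b v = act ?b m + x" using act(1)[OF bK, of m "act a x"] act(3)[OF bK e(3), of x] a0 act(4) e(1) by simp
    then have "x - act ?b v = - act ?b m" by simp
    also have "\<dots> \<in> M" by (intro Mm Ms(3) bK e(2))
    finally show ?thesis using bK by blast
  qed
  have uniq: "a = b" if "a \<in> K" "b \<in> K" "x - act a v \<in> M" "x - act b v \<in> M" for a b x
  proof (rule ccontr)
    assume ab: "a \<noteq> b"
    have d: "a + - b \<in> K" by (rule K(3)[OF that(1) K(5)[OF that(2)]])
    have nb: "act (- b) v = - act b v" using act(2)[OF that(2) K(5)[OF that(2)], of v] act0 by (simp add: eq_neg_iff_add_eq_0 add.commute)
    have "act (a + - b) v = (x - act b v) + - (x - act a v)" using act(2)[OF that(1) K(5)[OF that(2)], of v] nb by simp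
    also have "\<dots> \<in> M" by (intro Ms(2) Mm that)
    finally have dm: "act (a + - b) v \<in> M" .
    have "act (inverse (a + - b)) (act (a + - b) v) \<in> M" by (intro Ms(3) K(6) d dm)
    then have "act (inverse (a + - b) * (a + - b)) v \<in> M" by (simp only: act(3)[OF K(6)[OF d] d])
    moreover have "inverse (a + - b) * (a + - b) = 1" using ab by simp
    ultimately have "act 1 v \<in> M" by (simp only:)
    then show False using vM act(4) by simp
  qed
  define l where "l x = (THE a. a \<in> K \<and> x - act a v \<in> M)" for x
  have l: "l x \<in> K \<and> x - act (l x) v \<in> M" for x
    unfolding l_def
  proof (rule theI')
    show "\<exists>!a. a \<in> K \<and> x - act a v \<in> M" using ex[of x] uniq by blast
  qed
  have leq: "l x = a" if "a \<in> K" "x - act a v \<in> M" for x a using uniq[of "l x" a x] l[of x] that by blast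
  show ?thesis
  proof (rule that[of l])
    show "l (x + y) = l x + l y" for x y
    proof (rule leq)
      show "l x + l y \<in> K" by (intro K(3)) (use l in blast)+
      have e: "x + y - act (l x + l y) v = (x - act (l x) v) + (y - act (l y) v)" using act(2) l by simp
      show "x + y - act (l x + l y) v \<in> M" unfolding e by (intro Ms(2)) (use l in blast)+
    qed
    show "l x \<in> K" for x using l by blast
    show "l (act a x) = a * l x" if a: "a \<in> K" for a x
    proof (rule leq)
      show "a * l x \<in> K" by (intro K(4) a) (use l in blast)
      have e: "act a x - act (a * l x) v = act a (x - act (l x) v)"
        using act(3)[OF a] act(1)[OF a, of x "- act (l x) v"] actneg[OF a] l by simp
      show "act a x - act (a * l x) v \<in> M" unfolding e by (rule Ms(3)[OF a]) (use l in blast)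
    qed
    show "l v = 1" by (rule leq) (use K act Ms in auto)
    show "l x = 0" if "x \<in> W" for x by (rule leq) (use K act0 that WM in auto)
  qed
qed

section \<open>Injective codes for lists\<close>

lemma exists_inj_list:
  assumes inf: "infinite (UNIV :: 'a set)"
  shows "\<exists>j :: 'a list \<Rightarrow> 'a. inj j"
proof -
  have "|(UNIV :: 'a set) \<times> (UNIV :: 'a set)| =o |UNIV :: 'a set|" by (rule card_of_Times_same_infinite[OF inf])
  then obtain p :: "'a \<times> 'a \<Rightarrow> 'a" where "bij_betw p (UNIV \<times> UNIV) UNIV" unfolding card_of_ordIso[symmetric] by blast
  then have p: "inj p" by (simp add: bij_betw_def UNIV_Times_UNIV)
  obtain e :: "nat \<Rightarrow> 'a" where e: "inj e" using infinite_countable_subset[OF inf] by blast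
  define en where "en = rec_list (e 0) (\<lambda>x _ y. p (x, y))"
  have en: "en [] = e 0" "en (x # xs) = p (x, en xs)" for x xs by (simp_all add: en_def)
  have "xs = ys" if "length xs = length ys" "en xs = en ys" for xs ys
    using that by (induction xs ys rule: list_induct2) (auto simp: en dest: injD[OF p])
  then have "inj (\<lambda>xs. p (e (length xs), en xs))"
    by (intro injI) (auto dest!: injD[OF p] injD[OF e])
  then show ?thesis by blast
qed

lemma exists_inj_pair_list:
  assumes inf: "infinite (UNIV :: 'a set)"
  shows "\<exists>j :: ('a \<times> 'a) list \<Rightarrow> 'a. inj j"
proof -
  obtain j :: "'a list \<Rightarrow> 'a" where j: "inj j" using exists_inj_list[OF inf] by blast
  have "inj (\<lambda>ps. j (map j (map (\<lambda>(a, b). [a, b]) ps)))"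
  proof (rule injI)
    fix ps qs assume "j (map j (map (\<lambda>(a, b). [a, b]) ps)) = j (map j (map (\<lambda>(a, b). [a, b]) qs))"
    then have "map j (map (\<lambda>(a, b). [a, b]) ps) = map j (map (\<lambda>(a, b). [a, b]) qs)" by (rule injD[OF j])
    then have "map (\<lambda>(a, b). [a, b]) ps = map (\<lambda>(a, b). [a, b]) qs" using inj_mapI[OF j] by (meson injD)
    moreover have "inj (\<lambda>(a, b). [a, b :: 'a])" by (auto intro!: injI)
    ultimately show "ps = qs" using inj_mapI by (meson injD)
  qed
  then show ?thesis by blast
qed

lemma der_one: "diff_ring R \<Longrightarrow> der R \<one>\<^bsub>R\<^esub> = \<zero>\<^bsub>R\<^esub>"
proof -
  assume d: "diff_ring R"
  then interpret cring R by (simp add: diff_ring_def)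
  have c: "der R \<one>\<^bsub>R\<^esub> \<in> carrier R" using d by (auto simp: diff_ring_def)
  have "der R (a \<otimes>\<^bsub>R\<^esub> b) = der R a \<otimes>\<^bsub>R\<^esub> b \<oplus>\<^bsub>R\<^esub> a \<otimes>\<^bsub>R\<^esub> der R b" if "a \<in> carrier R" "b \<in> carrier R" for a b
    using d that by (auto simp: diff_ring_def)
  from this[of "\<one>\<^bsub>R\<^esub>" "\<one>\<^bsub>R\<^esub>"] show ?thesis using c by (simp add: add.l_cancel_one')
qed

section \<open>Structure of the Picard-Vessiot ring\<close>

context pv_data
begin

lemma R_diff: "diff_ring R"
  by (rule diff_ring_of_surj[OF F.pol_diff_ring, where q = pc]) (auto simp: gl_pol_dring_def pc_simps)

sublocale R: cring R using R_diff by (simp add: diff_ring_def)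

lemma pc_closed: "pc p \<in> carrier R" by (simp add: pc_simps(1))

sublocale pc: typed_hom UNIV R pc
  by unfold_locales (auto simp: subring_set_UNIV pc_closed pc_simps(2-4))

definition c :: "'f \<Rightarrow> ('f, 'n) gl_pol set set" where "c a = pc (mpol_const a)"

sublocale c: typed_hom UNIV R c
  by unfold_locales (auto simp: subring_set_UNIV c_def pc_closed pc_simps(2-4) const_add const_mult const_one)

lemma c_closed: "c a \<in> carrier R" by (simp add: c_def pc_closed)

lemma const_Pv: "mpol_const a \<in> Pv \<Longrightarrow> a = 0"
proof (rule ccontr)
  assume "mpol_const a \<in> Pv" "a \<noteq> 0"
  then have "mpol_const (inverse a) * mpol_const a \<in> Pv" by (intro Pv_mult)
  then show False using \<open>a \<noteq> 0\<close> Pv_one by (simp add: const_one flip: const_mult)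
qed

lemma c_inj: "c a = c b \<Longrightarrow> a = b"
proof -
  assume "c a = c b"
  then have "mpol_const a - mpol_const b \<in> Pv" by (simp add: c_def pc_simps(6))
  moreover have "mpol_const a - mpol_const b = (mpol_const (a - b) :: ('f, 'n) gl_pol)" by (simp add: mpol_const_def single_diff)
  ultimately show "a = b" using const_Pv[of "a - b"] by simp
qed

lemma der_c: "der R (c a) = c (\<delta> a)" and shift_c: "shift R (c a) = c (\<sigma> a)"
  by (simp_all add: c_def pc_simps(7,8) gl_deriv_const shift_const)

lemma shift_hom: "shift R \<in> ring_hom R R"
  by (rule ring_hom_memI) (auto simp: pc_simps S.mult S.add S.one simp del: pc_simps(6))

lemma shift_der: "x \<in> carrier R \<Longrightarrow> shift R (der R x) = der R (shift R x)"
proof -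
  assume "x \<in> carrier R"
  then obtain p where "x = pc p" by (auto simp: pc_simps(1))
  then show ?thesis using gl_rel_Pv[OF shift_deriv_commute[of p]] by (simp add: pc_simps(6-8))
qed

text \<open>This is \<open>Pv_maximal\<close> for preimages.\<close>
lemma R_simple:
  assumes J: "ideal J R" "shift R ` J \<subseteq> J"
  shows "J = {\<zero>\<^bsub>R\<^esub>} \<or> \<one>\<^bsub>R\<^esub> \<in> J"
proof (rule disjCI)
  assume one: "\<one>\<^bsub>R\<^esub> \<notin> J"
  interpret J: ideal J R by (rule J(1))
  have z: "pc 0 \<in> J" using J.zero_closed by (simp add: pc_simps(5))
  have "{p. pc p \<in> J} = Pv"
  proof (rule Pv_maximal)
    show "Pv \<subseteq> {p. pc p \<in> J}"
    proof
      fix p assume "p \<in> Pv"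
      then have "pc p = pc 0" by (simp add: pc_simps(6))
      then show "p \<in> {p. pc p \<in> J}" using z by simp
    qed
    show "1 \<notin> {p. pc p \<in> J}" using one by (simp add: pc_simps(4))
    show "p + q \<in> {p. pc p \<in> J}" if "p \<in> {p. pc p \<in> J}" "q \<in> {p. pc p \<in> J}" for p q
      using that J.a_closed by (auto simp flip: pc_simps(3))
    show "q * p \<in> {p. pc p \<in> J}" if "p \<in> {p. pc p \<in> J}" for p q
      using that J.I_l_closed[OF _ pc_closed] by (auto simp flip: pc_simps(2))
    show "\<Sigma> p \<in> {p. pc p \<in> J}" if "p \<in> {p. pc p \<in> J}" for p
      using that J(2) by (auto simp flip: pc_simps(8))
  qed
  then have iff: "pc p \<in> J \<longleftrightarrow> p \<in> Pv" for p by blast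
  show "J = {\<zero>\<^bsub>R\<^esub>}"
  proof
    show "J \<subseteq> {\<zero>\<^bsub>R\<^esub>}"
    proof
      fix x assume x: "x \<in> J"
      then obtain p where p: "x = pc p" using J.Icarr by (auto simp: pc_simps(1))
      then have "p \<in> Pv" using x iff by simp
      then have "pc p = pc 0" by (simp add: pc_simps(6))
      then show "x \<in> {\<zero>\<^bsub>R\<^esub>}" using p by (simp add: pc_simps(5))
    qed
    show "{\<zero>\<^bsub>R\<^esub>} \<subseteq> J" using J.zero_closed by simp
  qed
qed

lemma R_const:
  assumes "x \<in> carrier R" "shift R x = x" shows "\<exists>a\<in>K. x = c a"
proof -
  obtain p where p: "x = pc p" using assms by (auto simp: pc_simps(1))
  then have "\<Sigma> p - p \<in> Pv" using assms(2) by (simp add: pc_simps(6,8))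
  then obtain a where "a \<in> K" "p - mpol_const a \<in> Pv" using Pv_constants by blast
  then show ?thesis using p by (auto simp: c_def pc_simps(6))
qed

abbreviation Z :: "'n \<Rightarrow> 'n \<Rightarrow> ('f, 'n) gl_pol set set" where "Z i j \<equiv> pc (mpol_var (Entry i j 0))"
abbreviation Th where "Th \<equiv> pc (mpol_var InvDet)"
abbreviation Dt where "Dt \<equiv> pc (det gen_mat)"

text \<open>Surjectivity of the maps in \<open>psi_bij\<close> is checked on these generators.\<close>
lemma R_generated:
  assumes B: "\<And>a. c a \<in> B" "\<And>i j. Z i j \<in> B" "Th \<in> B"
    "\<And>x y. x \<in> B \<Longrightarrow> y \<in> B \<Longrightarrow> x \<in> carrier R \<Longrightarrow> y \<in> carrier R \<Longrightarrow> x \<oplus>\<^bsub>R\<^esub> y \<in> B"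
    "\<And>x y. x \<in> B \<Longrightarrow> y \<in> B \<Longrightarrow> x \<in> carrier R \<Longrightarrow> y \<in> carrier R \<Longrightarrow> x \<otimes>\<^bsub>R\<^esub> y \<in> B"
    "\<And>x. x \<in> B \<Longrightarrow> x \<in> carrier R \<Longrightarrow> der R x \<in> B"
  shows "carrier R \<subseteq> B"
proof -
  have e: "pc (mpol_var (Entry i j k)) \<in> B" for i j k
  proof (induction k)
    case (Suc k)
    then show ?case using B(6)[of "pc (mpol_var (Entry i j k))"] by (simp add: pc_closed pc_simps(7) gl_deriv_Entry)
  qed (rule B)
  have "pc p \<in> B" for p
  proof -
    have "p \<in> mpols_over UNIV" by simp
    then show ?thesis using subring_set_UNIV
    proof (induction rule: mpol_induct)
      case (const a) then show ?case using B(1) by (simp add: c_def)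
    next
      case (var v) then show ?case using e B(3) by (cases v) auto
    next
      case (add p q) then show ?case using B(4)[of "pc p" "pc q"] by (simp add: pc_closed pc_simps(3))
    next
      case (mult p q) then show ?case using B(5)[of "pc p" "pc q"] by (simp add: pc_closed pc_simps(2))
    qed
  qed
  then show ?thesis by (auto simp: pc_simps(1))
qed

lemma Th_Dt: "Th \<otimes>\<^bsub>R\<^esub> Dt = \<one>\<^bsub>R\<^esub>"
proof -
  have "gl_eq \<in> Pv" by (rule gl_rel_Pv) (auto simp: F.gl_rel_eq intro: exI[of _ 1])
  then show ?thesis by (simp add: pc_simps(2,4,6) gl_eq_def)
qed

text \<open>The inverse of the fundamental matrix.\<close>
definition W :: "'n \<Rightarrow> 'n \<Rightarrow> ('f, 'n) gl_pol set set" where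
  "W = (\<lambda>i j. pc (mpol_var InvDet * adjugate gen_mat $ i $ j))"

sublocale M: ring "mring R :: ('n \<Rightarrow> 'n \<Rightarrow> _) ring" by (rule ring_mring) (rule R.is_cring)

lemma Z_qm: "Z = pc.qm gen_mat" by (simp add: pc.qm_def gen_mat_nth)

lemma Z_closed: "Z \<in> carrier (mring R)" and W_closed: "W \<in> carrier (mring R)"
  by (simp_all add: mring_simps W_def pc_closed)

lemma pc_inv_diag: "pc (mpol_var InvDet * (if i = j then det gen_mat else 0)) = \<one>\<^bsub>mring R\<^esub> i j"
  using Th_Dt pc.zero by (simp add: mring_simps pc_simps(2))

lemma Z_W: "Z \<otimes>\<^bsub>mring R\<^esub> W = \<one>\<^bsub>mring R\<^esub>"
proof -
  let ?A = "(\<chi> i j. mpol_var InvDet * adjugate gen_mat $ i $ j) :: ('f, 'n) gl_pol ^ 'n ^ 'n"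
  have W: "W = pc.qm ?A" by (simp add: W_def pc.qm_def)
  have "(gen_mat ** ?A) $ i $ j = mpol_var InvDet * (gen_mat ** adjugate gen_mat) $ i $ j" for i j
    by (simp add: matrix_matrix_mult_def sum_distrib_left mult_ac)
  then have "(gen_mat ** ?A) $ i $ j = mpol_var InvDet * (if i = j then det gen_mat else 0)" for i j
    by (simp only: mult_adjugate)
  then have "pc.qm (gen_mat ** ?A) = \<one>\<^bsub>mring R\<^esub>" by (intro ext) (simp only: pc.qm_def pc_inv_diag)
  then show ?thesis unfolding Z_qm W by (simp add: pc.qm_mult)
qed

lemma W_Z: "W \<otimes>\<^bsub>mring R\<^esub> Z = \<one>\<^bsub>mring R\<^esub>"
proof -
  let ?A = "(\<chi> i j. mpol_var InvDet * transpose (adjugate (transpose gen_mat)) $ i $ j) :: ('f, 'n) gl_pol ^ 'n ^ 'n"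
  have cl: "pc.qm ?A \<in> carrier (mring R)" by (rule pc.qm_closed) simp
  have "(?A ** gen_mat) $ i $ j = mpol_var InvDet * (transpose (adjugate (transpose gen_mat)) ** gen_mat) $ i $ j" for i j
    by (simp add: matrix_matrix_mult_def sum_distrib_left mult_ac)
  then have "(?A ** gen_mat) $ i $ j = mpol_var InvDet * (if i = j then det gen_mat else 0)" for i j
    by (simp only: adjugate_mult)
  then have "pc.qm (?A ** gen_mat) = \<one>\<^bsub>mring R\<^esub>" by (intro ext) (simp only: pc.qm_def pc_inv_diag)
  then have l: "pc.qm ?A \<otimes>\<^bsub>mring R\<^esub> Z = \<one>\<^bsub>mring R\<^esub>" unfolding Z_qm by (simp add: pc.qm_mult)
  have "pc.qm ?A = pc.qm ?A \<otimes>\<^bsub>mring R\<^esub> (Z \<otimes>\<^bsub>mring R\<^esub> W)" using cl by (simp add: Z_W)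
  also have "\<dots> = W" using cl Z_closed W_closed l by (simp flip: M.m_assoc)
  finally show ?thesis using l by simp
qed

lemma shift_Z: "(\<lambda>i j. shift R (Z i j)) = c.qm A \<otimes>\<^bsub>mring R\<^esub> Z"
proof -
  have "(\<lambda>i j. shift R (Z i j)) = pc.qm (Ac ** gen_mat)" by (simp add: pc.qm_def pc_simps(8) shift_Entry)
  also have "\<dots> = pc.qm Ac \<otimes>\<^bsub>mring R\<^esub> Z" unfolding Z_qm by (rule pc.qm_mult) auto
  also have "pc.qm Ac = c.qm A" by (simp add: pc.qm_def c.qm_def c_def)
  finally show ?thesis .
qed

lemma shift_Th: "shift R Th = c (inverse (det A)) \<otimes>\<^bsub>R\<^esub> Th"
  by (simp add: pc_simps(2,8) shift_InvDet c_def)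

lemma shift_Dt: "shift R Dt = c (det A) \<otimes>\<^bsub>R\<^esub> Dt"
  by (simp add: pc_simps(2,8) shift_det c_def)

text \<open>A functional on representatives that vanishes on the ideal descends to \<open>R\<close>.\<close>
lemma R_functional:
  assumes "\<And>p q. l (p + q) = l p + l q" "\<And>p. p \<in> Pv \<Longrightarrow> l p = (0::'f)"
  obtains \<mu> where "\<And>p. \<mu> (pc p) = l p"
proof
  fix p
  have "pc (SOME q. pc q = pc p) = pc p" by (rule someI[of "\<lambda>q. pc q = pc p" p]) simp
  then have "(SOME q. pc q = pc p) - p \<in> Pv" by (simp add: pc_simps(6))
  then have "l ((SOME q. pc q = pc p) - p) = 0" by (rule assms(2))
  then show "l (SOME q. pc q = pc p) = l p" using assms(1)[of "(SOME q. pc q = pc p) - p" p] by simp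
qed

end

section \<open>Transport of structure\<close>

text \<open>The Galois group is tested on algebras carried by one fixed type, and so is differential closedness on
  extension fields; a ring on another type has to be moved there along an injection.\<close>
definition transport :: "('a \<Rightarrow> 'b) \<Rightarrow> ('a, 'm) dring_scheme \<Rightarrow> 'b dring" where
  "transport j R = (let i = inv_into (carrier R) j in
     \<lparr>carrier = j ` carrier R, mult = (\<lambda>x y. j (i x \<otimes>\<^bsub>R\<^esub> i y)), one = j \<one>\<^bsub>R\<^esub>, ring.zero = j \<zero>\<^bsub>R\<^esub>,
      add = (\<lambda>x y. j (i x \<oplus>\<^bsub>R\<^esub> i y)), der = (\<lambda>x. j (der R (i x)))\<rparr>)"

lemma transport_simps:
  assumes j: "inj_on j (carrier R)"
  shows "carrier (transport j R) = j ` carrier R" "\<one>\<^bsub>transport j R\<^esub> = j \<one>\<^bsub>R\<^esub>" "\<zero>\<^bsub>transport j R\<^esub> = j \<zero>\<^bsub>R\<^esub>"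
    "a \<in> carrier R \<Longrightarrow> b \<in> carrier R \<Longrightarrow> j a \<otimes>\<^bsub>transport j R\<^esub> j b = j (a \<otimes>\<^bsub>R\<^esub> b)"
    "a \<in> carrier R \<Longrightarrow> b \<in> carrier R \<Longrightarrow> j a \<oplus>\<^bsub>transport j R\<^esub> j b = j (a \<oplus>\<^bsub>R\<^esub> b)"
    "a \<in> carrier R \<Longrightarrow> der (transport j R) (j a) = j (der R a)"
  using j by (simp_all add: transport_def Let_def inv_into_f_f)

lemma transport_diff_ring:
  assumes j: "inj_on j (carrier R)" and R: "diff_ring R"
  shows "diff_ring (transport j R)"
  by (rule diff_ring_of_surj[OF R, where q = j]) (simp_all add: transport_simps[OF j])

lemma transport_inv_hom:
  assumes j: "inj_on j (carrier R)" and R: "diff_ring R"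
  shows "inv_into (carrier R) j \<in> dring_hom (transport j R) R" "j \<in> dring_hom R (transport j R)"
proof -
  interpret R: cring R using R by (simp add: diff_ring_def)
  have d: "a \<in> carrier R \<Longrightarrow> der R a \<in> carrier R" for a using R by (auto simp: diff_ring_def)
  show "inv_into (carrier R) j \<in> dring_hom (transport j R) R"
    unfolding dring_hom_def using j d
    by (auto intro!: ring_hom_memI simp: transport_simps[OF j] inv_into_f_f)
  show "j \<in> dring_hom R (transport j R)"
  proof -
    have "j \<in> ring_hom R (transport j R)"
      by (rule ring_hom_memI) (simp_all add: transport_simps[OF j])
    then show ?thesis by (simp add: dring_hom_def transport_simps[OF j])
  qed
qed

section \<open>The tensor square and its shift constants\<close>

context pv_data
begin

lemma der_R_closed: "x \<in> carrier R \<Longrightarrow> der R x \<in> carrier R" using R_diff by (auto simp: diff_ring_def)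

sublocale F2: tensor_prod R R "UNIV :: 'f set" c c
  by unfold_locales (use R_diff der_c c_closed in auto)

abbreviation T2 where "T2 \<equiv> tensor (UNIV :: 'f set) R c R c"
abbreviation t2 where "t2 \<equiv> pure_tensor (UNIV :: 'f set) R c R c"

definition f1 where "f1 r = t2 r \<one>\<^bsub>R\<^esub>"
definition f2 where "f2 r = t2 \<one>\<^bsub>R\<^esub> r"

lemma f1_hom: "f1 \<in> ring_hom R T2" and f2_hom: "f2 \<in> ring_hom R T2"
  unfolding f1_def f2_def
  by (rule ring_hom_memI; simp add: F2.t_closed F2.t_add1 F2.t_add2 F2.t_mult F2.t_one)+

lemma f12_c: "f1 (c a) = f2 (c a)"
  using F2.t_balanced[of a "\<one>\<^bsub>R\<^esub>" "\<one>\<^bsub>R\<^esub>"] c_closed by (simp add: f1_def f2_def)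

lemma t2_eq: "r \<in> carrier R \<Longrightarrow> r' \<in> carrier R \<Longrightarrow> t2 r r' = f1 r \<otimes>\<^bsub>T2\<^esub> f2 r'"
  by (simp add: f1_def f2_def F2.t_mult)

lemma der_f: "r \<in> carrier R \<Longrightarrow> der T2 (f1 r) = f1 (der R r)" "r \<in> carrier R \<Longrightarrow> der T2 (f2 r) = f2 (der R r)"
  using der_one[OF R_diff] by (simp_all add: f1_def f2_def F2.der_t F2.t_zero1 F2.t_zero2 F2.t_closed der_R_closed)

text \<open>The diagonal shift \<open>\<sigma> \<otimes> \<sigma>\<close>. The shift of the tensor record acts on the left factor only, which is not
  well defined over \<open>F\<close>.\<close>
definition s2 where "s2 = (SOME \<Phi>. \<Phi> \<in> ring_hom T2 T2 \<and> (\<forall>r\<in>carrier R. \<forall>r'\<in>carrier R. \<Phi> (t2 r r') = t2 (shift R r) (shift R r')))"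

lemma s2: "s2 \<in> ring_hom T2 T2" "r \<in> carrier R \<Longrightarrow> r' \<in> carrier R \<Longrightarrow> s2 (t2 r r') = t2 (shift R r) (shift R r')"
proof -
  note SH = ring_hom_memE[OF shift_hom] and F1 = ring_hom_memE[OF f1_hom] and F2h = ring_hom_memE[OF f2_hom]
  have h1: "(\<lambda>r. f1 (shift R r)) \<in> ring_hom R T2" and h2: "(\<lambda>r. f2 (shift R r)) \<in> ring_hom R T2"
    by (rule ring_hom_memI; simp add: SH F1 F2h)+
  have b: "f1 (shift R (c a)) = f2 (shift R (c a))" for a by (simp add: shift_c f12_c)
  obtain \<Phi> where "\<Phi> \<in> ring_hom T2 T2" "\<And>r s. r \<in> carrier R \<Longrightarrow> s \<in> carrier R \<Longrightarrow> \<Phi> (t2 r s) = f1 (shift R r) \<otimes>\<^bsub>T2\<^esub> f2 (shift R s)"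
    by (rule F2.universal_ring[OF F2.T.is_cring h1 h2 b]) blast
  then have "\<Phi> \<in> ring_hom T2 T2 \<and> (\<forall>r\<in>carrier R. \<forall>r'\<in>carrier R. \<Phi> (t2 r r') = t2 (shift R r) (shift R r'))"
    by (simp add: t2_eq SH)
  then have ex: "\<exists>\<Phi>. \<Phi> \<in> ring_hom T2 T2 \<and> (\<forall>r\<in>carrier R. \<forall>r'\<in>carrier R. \<Phi> (t2 r r') = t2 (shift R r) (shift R r'))" by (rule exI[of _ \<Phi>])
  have *: "s2 \<in> ring_hom T2 T2 \<and> (\<forall>r\<in>carrier R. \<forall>r'\<in>carrier R. s2 (t2 r r') = t2 (shift R r) (shift R r'))"
    unfolding s2_def by (rule someI_ex[OF ex])
  then show "s2 \<in> ring_hom T2 T2" "r \<in> carrier R \<Longrightarrow> r' \<in> carrier R \<Longrightarrow> s2 (t2 r r') = t2 (shift R r) (shift R r')"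
    by auto
qed

lemmas S2 = ring_hom_memE[OF s2(1)]

lemma s2_f: "r \<in> carrier R \<Longrightarrow> s2 (f1 r) = f1 (shift R r)" "r \<in> carrier R \<Longrightarrow> s2 (f2 r) = f2 (shift R r)"
  using ring_hom_memE(4)[OF shift_hom] by (simp_all add: f1_def f2_def s2)

lemma s2_zero: "s2 \<zero>\<^bsub>T2\<^esub> = \<zero>\<^bsub>T2\<^esub>"
  by (rule ring_hom_zero[OF s2(1) F2.T.ring_axioms F2.T.ring_axioms])

lemma s2_uminus: "x \<in> carrier T2 \<Longrightarrow> s2 (\<ominus>\<^bsub>T2\<^esub> x) = \<ominus>\<^bsub>T2\<^esub> s2 x"
  using S2(3)[of "\<ominus>\<^bsub>T2\<^esub> x" x] S2(1) by (intro F2.T.minus_equality[symmetric]) (auto simp: F2.T.l_neg s2_zero)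

lemma der_T2_closed: "x \<in> carrier T2 \<Longrightarrow> der T2 x \<in> carrier T2" by (rule F2.der_T_additive)

lemma s2_der: "x \<in> carrier T2 \<Longrightarrow> s2 (der T2 x) = der T2 (s2 x)"
proof (induction rule: F2.T_induct)
  case (pure r s)
  note SH = ring_hom_memE[OF shift_hom]
  show ?case using pure by (simp add: F2.der_t s2 S2 F2.t_closed der_R_closed SH shift_der)
next
  case (add x y)
  then show ?case by (simp add: F2.der_T_additive S2 der_T2_closed)
qed

definition S0 where "S0 = {x \<in> carrier T2. s2 x = x}"

lemma S0_diff: "diff_ring (T2\<lparr>carrier := S0\<rparr>)"
proof -
  have "subring S0 T2"
    by (rule F2.T.subringI) (auto simp: S0_def S2 s2_uminus)
  then have "subcring S0 T2" by (rule F2.T.subcringI')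
  then have "cring (T2\<lparr>carrier := S0\<rparr>)" using F2.T.subcring_iff[of S0] by (auto simp: S0_def)
  moreover have "der T2 x \<in> S0" if "x \<in> S0" for x using that s2_der der_T2_closed by (auto simp: S0_def)
  ultimately show ?thesis using F2.T_diff_ring by (auto simp: diff_ring_def S0_def)
qed

lemma infinite_Om: "infinite (UNIV :: ('f, 'n) gl_pol set)"
proof -
  have "inj (mpol_const :: 'f \<Rightarrow> ('f, 'n) gl_pol)" by (rule injI) (simp add: mpol_const_eq_iff)
  moreover have "infinite (UNIV :: 'f set)" by (rule infinite_UNIV_char_0)
  ultimately show ?thesis by (meson finite_imageD finite_subset subset_UNIV)
qed

text \<open>An element of the tensor square is described by finitely many pairs of polynomials, which gives an
  injection into the type of sets of sets of polynomials.\<close>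
definition val :: "(('f, 'n) gl_pol \<times> ('f, 'n) gl_pol) list \<Rightarrow> _" where
  "val ps = foldr (\<lambda>(p, q) x. t2 (pc p) (pc q) \<oplus>\<^bsub>T2\<^esub> x) ps \<zero>\<^bsub>T2\<^esub>"

lemma val_closed: "val ps \<in> carrier T2"
  by (induction ps) (auto simp: val_def F2.t_closed pc_closed)

lemma val_append: "val (ps @ qs) = val ps \<oplus>\<^bsub>T2\<^esub> val qs"
proof (induction ps)
  case (Cons p ps)
  have "t2 (pc (fst p)) (pc (snd p)) \<in> carrier T2" by (simp add: F2.t_closed pc_closed)
  then show ?case using Cons val_closed[of ps] val_closed[of qs]
    by (cases p) (simp add: val_def F2.T.a_assoc)
qed (use val_closed in \<open>simp add: val_def\<close>)

lemma val_surj: "x \<in> carrier T2 \<Longrightarrow> \<exists>ps. val ps = x"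
proof (induction rule: F2.T_induct)
  case (pure r s)
  then obtain p q where "r = pc p" "s = pc q" by (auto simp: pc_simps(1))
  then have "val [(p, q)] = t2 r s" by (simp add: val_def F2.t_closed pc_closed)
  then show ?case by blast
next
  case (add x y)
  then show ?case using val_append by metis
qed

lemma exists_T2_code: "\<exists>j :: _ \<Rightarrow> ('f, 'n) gl_pol set set. inj_on j (carrier T2)"
proof -
  obtain e :: "(('f, 'n) gl_pol \<times> ('f, 'n) gl_pol) list \<Rightarrow> ('f, 'n) gl_pol" where e: "inj e"
    using exists_inj_pair_list[OF infinite_Om] by blast
  define r where "r x = (SOME ps. val ps = x)" for x
  have r: "val (r x) = x" if "x \<in> carrier T2" for x
    unfolding r_def using val_surj[OF that] by (rule someI_ex)
  have "inj_on (\<lambda>x. {{e (r x)}}) (carrier T2)"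
  proof (rule inj_onI)
    fix x y assume xy: "x \<in> carrier T2" "y \<in> carrier T2" "{{e (r x)}} = {{e (r y)}}"
    then have "r x = r y" using injD[OF e] by auto
    then have "val (r x) = val (r y)" by simp
    then show "x = y" using r xy by simp
  qed
  then show ?thesis by blast
qed

definition jT where "jT = (SOME j :: _ \<Rightarrow> ('f, 'n) gl_pol set set. inj_on j (carrier T2))"

lemma jT: "inj_on jT (carrier T2)" unfolding jT_def using exists_T2_code by (rule someI_ex)

text \<open>The constants of \<open>R \<otimes>\<^sub>F R\<close> on the type over which the Galois group is tested; \<open>iT\<close> includes them back.\<close>
definition Sr :: "('f, 'n) gl_pol set set dring" where "Sr = transport jT (T2\<lparr>carrier := S0\<rparr>)"
definition iT where "iT = inv_into S0 jT"
definition uT where "uT a = jT (f1 (c a))"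

lemma jT0: "inj_on jT (carrier (T2\<lparr>carrier := S0\<rparr>))"
  by (rule inj_on_subset[OF jT]) (auto simp: S0_def)

lemma Sr_diff: "diff_ring Sr" unfolding Sr_def by (rule transport_diff_ring[OF jT0 S0_diff])

lemma Sr_carrier: "carrier Sr = jT ` S0" unfolding Sr_def by (simp add: transport_simps[OF jT0])

lemma iT_j: "x \<in> S0 \<Longrightarrow> iT (jT x) = x"
  unfolding iT_def using jT0 by (auto intro: inv_into_f_f)

lemma iT_S0: "s \<in> carrier Sr \<Longrightarrow> iT s \<in> S0" by (auto simp: Sr_carrier iT_j)

lemma iT_hom: "iT \<in> ring_hom Sr T2" "s \<in> carrier Sr \<Longrightarrow> iT (der Sr s) = der T2 (iT s)"
proof -
  have "iT \<in> dring_hom Sr (T2\<lparr>carrier := S0\<rparr>)"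
    unfolding Sr_def iT_def using transport_inv_hom(1)[OF jT0 S0_diff] by simp
  then show "iT \<in> ring_hom Sr T2" "s \<in> carrier Sr \<Longrightarrow> iT (der Sr s) = der T2 (iT s)"
    by (auto simp: dring_hom_def ring_hom_def S0_def)
qed

lemma iT_inj: "inj_on iT (carrier Sr)"
  by (rule inj_onI) (auto simp: Sr_carrier iT_j)

lemma f1_c_S0: "a \<in> K \<Longrightarrow> f1 (c a) \<in> S0"
  using ring_hom_memE(1)[OF f1_hom c_closed] by (auto simp: S0_def s2_f c_closed shift_c fixed_field_def)

lemma uT: "a \<in> K \<Longrightarrow> uT a \<in> carrier Sr" "a \<in> K \<Longrightarrow> iT (uT a) = f1 (c a)"
  by (simp_all add: uT_def Sr_carrier f1_c_S0 iT_j)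

lemma K_closed: "0 \<in> K" "1 \<in> K" "a \<in> K \<Longrightarrow> b \<in> K \<Longrightarrow> a + b \<in> K" "a \<in> K \<Longrightarrow> b \<in> K \<Longrightarrow> a * b \<in> K"
   "a \<in> K \<Longrightarrow> - a \<in> K" "a \<in> K \<Longrightarrow> inverse a \<in> K" "a \<in> K \<Longrightarrow> \<delta> a \<in> K"
proof -
  show "0 \<in> K" "1 \<in> K" "a \<in> K \<Longrightarrow> b \<in> K \<Longrightarrow> a + b \<in> K" "a \<in> K \<Longrightarrow> b \<in> K \<Longrightarrow> a * b \<in> K"
   "a \<in> K \<Longrightarrow> - a \<in> K" using s.zero s.one s.add s.mult s.uminus by (auto simp: fixed_field_def)
  show "a \<in> K \<Longrightarrow> \<delta> a \<in> K" using commute by (auto simp: fixed_field_def)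
  assume a: "a \<in> K"
  show "inverse a \<in> K"
  proof (cases "a = 0")
    case False
    then have "\<sigma> (inverse a) * a = 1" using s.mult[of "inverse a" a] s.one a by (simp add: fixed_field_def)
    then show ?thesis using False by (simp add: fixed_field_def field_simps)
  qed (use a in simp)
qed

lemma uT_hom: "uT 1 = \<one>\<^bsub>Sr\<^esub>" "uT 0 = \<zero>\<^bsub>Sr\<^esub>" "a \<in> K \<Longrightarrow> b \<in> K \<Longrightarrow> uT (a + b) = uT a \<oplus>\<^bsub>Sr\<^esub> uT b"
  "a \<in> K \<Longrightarrow> b \<in> K \<Longrightarrow> uT (a * b) = uT a \<otimes>\<^bsub>Sr\<^esub> uT b" "a \<in> K \<Longrightarrow> der Sr (uT a) = uT (\<delta> a)"
proof -
  note F1 = ring_hom_memE[OF f1_hom]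
  note tr = transport_simps[OF jT0, folded Sr_def, simplified]
  show "uT 1 = \<one>\<^bsub>Sr\<^esub>" by (simp add: uT_def c.one F1 tr)
  show "uT 0 = \<zero>\<^bsub>Sr\<^esub>" using ring_hom_zero[OF f1_hom R.ring_axioms F2.T.ring_axioms] by (simp add: uT_def c.zero tr)
  show "a \<in> K \<Longrightarrow> b \<in> K \<Longrightarrow> uT (a + b) = uT a \<oplus>\<^bsub>Sr\<^esub> uT b"
    "a \<in> K \<Longrightarrow> b \<in> K \<Longrightarrow> uT (a * b) = uT a \<otimes>\<^bsub>Sr\<^esub> uT b"
    by (simp_all add: uT_def c.add c.mult c_closed F1 f1_c_S0 tr)
  show "a \<in> K \<Longrightarrow> der Sr (uT a) = uT (\<delta> a)"
    using tr(6)[OF f1_c_S0, of a] by (simp add: uT_def der_f c_closed der_c)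
qed

lemma Sr_algebra: "d_algebra (dring_on K \<delta>) Sr uT"
  unfolding d_algebra_def dring_hom_def using Sr_diff uT uT_hom
  by (auto intro!: ring_hom_memI)

sublocale KS: tensor_prod R Sr K c uT
  by unfold_locales (use R_diff Sr_diff c_closed uT uT_hom der_c K_closed in auto)

abbreviation TS where "TS \<equiv> tensor K R c Sr uT"
abbreviation tS where "tS \<equiv> pure_tensor K R c Sr uT"

lemma TS_shift: "shift TS \<in> ring_hom TS TS" "r \<in> carrier R \<Longrightarrow> s \<in> carrier Sr \<Longrightarrow> shift TS (tS r s) = tS (shift R r) s"
  using KS.shift_T[OF shift_hom] by (auto simp: shift_c fixed_field_def)

lemma shift_W_A: "(\<lambda>i j. shift R (W i j)) \<otimes>\<^bsub>mring R\<^esub> c.qm A = W"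
proof -
  let ?W = "\<lambda>i j. shift R (W i j)"
  have cl: "?W \<in> carrier (mring R)" "c.qm A \<in> carrier (mring R)"
    using W_closed ring_hom_memE(1)[OF shift_hom] c.qm_closed[of A] by (auto simp: mring_simps)
  have "?W \<otimes>\<^bsub>mring R\<^esub> (\<lambda>i j. shift R (Z i j)) = \<one>\<^bsub>mring R\<^esub>"
  proof -
    have "(\<lambda>i j. shift R ((W \<otimes>\<^bsub>mring R\<^esub> Z) i j)) = ?W \<otimes>\<^bsub>mring R\<^esub> (\<lambda>i j. shift R (Z i j))"
      by (rule hom_mring_mult[OF R.is_cring R.is_cring shift_hom W_closed Z_closed])
    moreover have "(\<lambda>i j. shift R (\<one>\<^bsub>mring R\<^esub> i j)) = \<one>\<^bsub>mring R\<^esub>"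
      by (rule hom_mring_one[OF R.is_cring R.is_cring shift_hom])
    ultimately show ?thesis unfolding W_Z by metis
  qed
  then have "(?W \<otimes>\<^bsub>mring R\<^esub> c.qm A) \<otimes>\<^bsub>mring R\<^esub> Z = \<one>\<^bsub>mring R\<^esub>"
    unfolding shift_Z using cl Z_closed by (simp add: M.m_assoc)
  then have "((?W \<otimes>\<^bsub>mring R\<^esub> c.qm A) \<otimes>\<^bsub>mring R\<^esub> Z) \<otimes>\<^bsub>mring R\<^esub> W = W" using W_closed by simp
  then show ?thesis using cl Z_closed W_closed M.m_closed[OF cl] by (simp add: M.m_assoc Z_W)
qed

text \<open>The roles of \<open>fa\<close> and \<open>fb\<close> are played by the two embeddings of \<open>R\<close>, in either order. Injectivity is linear
  disjointness. For surjectivity, \<open>G = fa (Z\<^sup>-\<^sup>1) fb Z\<close> is shift invariant, so \<open>fb Z = fa Z G\<close> lies in the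
  image; the same holds for the inverse determinant, and these generate \<open>fb R\<close>.\<close>
lemma psi_bij:
  assumes fa: "fa \<in> ring_hom R T2" and fb: "fb \<in> ring_hom R T2"
    and da: "\<And>r. r \<in> carrier R \<Longrightarrow> der T2 (fa r) = fa (der R r)" and db: "\<And>r. r \<in> carrier R \<Longrightarrow> der T2 (fb r) = fb (der R r)"
    and sa: "\<And>r. r \<in> carrier R \<Longrightarrow> s2 (fa r) = fa (shift R r)" and sb: "\<And>r. r \<in> carrier R \<Longrightarrow> s2 (fb r) = fb (shift R r)"
    and ca: "\<And>a. fa (c a) = f1 (c a)" and cb: "\<And>a. fb (c a) = f1 (c a)"
    and gen: "\<And>r r'. r \<in> carrier R \<Longrightarrow> r' \<in> carrier R \<Longrightarrow> \<exists>x\<in>carrier R. \<exists>y\<in>carrier R. t2 r r' = fa x \<otimes>\<^bsub>T2\<^esub> fb y"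
  obtains \<Psi> where "\<Psi> \<in> ring_hom TS T2" "\<And>r s. r \<in> carrier R \<Longrightarrow> s \<in> carrier Sr \<Longrightarrow> \<Psi> (tS r s) = fa r \<otimes>\<^bsub>T2\<^esub> iT s"
    "bij_betw \<Psi> (carrier TS) (carrier T2)" "\<And>x. x \<in> carrier TS \<Longrightarrow> \<Psi> (der TS x) = der T2 (\<Psi> x)"
    "\<And>x. x \<in> carrier TS \<Longrightarrow> \<Psi> (shift TS x) = s2 (\<Psi> x)"
proof -
  note A = ring_hom_memE[OF fa] and B = ring_hom_memE[OF fb] and SH = ring_hom_memE[OF shift_hom]
    and IH = ring_hom_memE[OF iT_hom(1)]
  interpret D: disjoint_tensor R Sr K c uT T2 fa iT s2
    by unfold_locales
      (use F2.T.is_cring fa iT_hom iT_inj uT ca s2 sa shift_hom R_simple R_const K_closed c.one c.zero uT_hom iT_S0 in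
        \<open>auto simp: S0_def\<close>)
  obtain \<Psi> where P: "\<Psi> \<in> ring_hom TS T2" "\<And>r s. r \<in> carrier R \<Longrightarrow> s \<in> carrier Sr \<Longrightarrow> \<Psi> (tS r s) = fa r \<otimes>\<^bsub>T2\<^esub> iT s"
    using KS.universal_ring[OF F2.T.is_cring fa iT_hom(1)] uT(2) ca by metis
  note PH = ring_hom_memE[OF P(1)]
  have inj: "inj_on \<Psi> (carrier TS)" by (rule D.hom_injective[OF P])
  have der: "\<Psi> (der TS x) = der T2 (\<Psi> x)" if "x \<in> carrier TS" for x
    using that
  proof (induction rule: KS.T_induct)
    case (pure r s)
    have "der T2 (fa r \<otimes>\<^bsub>T2\<^esub> iT s) = der T2 (fa r) \<otimes>\<^bsub>T2\<^esub> iT s \<oplus>\<^bsub>T2\<^esub> fa r \<otimes>\<^bsub>T2\<^esub> der T2 (iT s)"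
      using F2.T_diff_ring A(1)[OF pure(1)] IH(1)[OF pure(2)] by (auto simp: diff_ring_def)
    then show ?case using pure by (simp add: KS.der_t P PH(3) KS.t_closed der_R_closed KS.der_closed da iT_hom)
  next
    case (add x y)
    then show ?case by (simp add: KS.der_T_additive PH F2.der_T_additive)
  qed
  have sh: "\<Psi> (shift TS x) = s2 (\<Psi> x)" if "x \<in> carrier TS" for x
    using that
  proof (induction rule: KS.T_induct)
    case (pure r s)
    have "s2 (iT s) = iT s" using iT_S0[OF pure(2)] by (simp add: S0_def)
    then show ?case using pure by (simp add: TS_shift P SH S2 A IH sa)
  next
    case (add x y)
    then show ?case by (simp add: ring_hom_memE[OF TS_shift(1)] PH S2)
  qed
  let ?H = "\<Psi> ` carrier TS"
  have Hsub: "?H \<subseteq> carrier T2" using PH(1) by auto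
  have Hadd: "x \<oplus>\<^bsub>T2\<^esub> y \<in> ?H" if xy: "x \<in> ?H" "y \<in> ?H" for x y
  proof -
    obtain x' y' where "x' \<in> carrier TS" "y' \<in> carrier TS" "x = \<Psi> x'" "y = \<Psi> y'" using xy by auto
    then show ?thesis by (intro image_eqI[of _ _ "x' \<oplus>\<^bsub>TS\<^esub> y'"]) (auto simp: PH)
  qed
  have Hmult: "x \<otimes>\<^bsub>T2\<^esub> y \<in> ?H" if xy: "x \<in> ?H" "y \<in> ?H" for x y
  proof -
    obtain x' y' where "x' \<in> carrier TS" "y' \<in> carrier TS" "x = \<Psi> x'" "y = \<Psi> y'" using xy by auto
    then show ?thesis by (intro image_eqI[of _ _ "x' \<otimes>\<^bsub>TS\<^esub> y'"]) (auto simp: PH)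
  qed
  have Hder: "der T2 x \<in> ?H" if x: "x \<in> ?H" for x
  proof -
    obtain x' where "x' \<in> carrier TS" "x = \<Psi> x'" using x by auto
    then show ?thesis by (intro image_eqI[of _ _ "der TS x'"]) (auto simp: der KS.der_T_additive)
  qed
  have Ha: "fa r \<in> ?H" if "r \<in> carrier R" for r
    by (rule image_eqI[of _ _ "tS r \<one>\<^bsub>Sr\<^esub>"]) (use that in \<open>simp_all add: P KS.t_closed IH A\<close>)
  have HS: "x \<in> ?H" if "x \<in> S0" for x
    by (rule image_eqI[of _ _ "tS \<one>\<^bsub>R\<^esub> (jT x)"])
      (use that in \<open>simp_all add: P KS.t_closed Sr_carrier iT_j A, simp add: S0_def\<close>)
  have Hfin: "(\<Oplus>\<^bsub>T2\<^esub>k\<in>N. f k) \<in> ?H" if "finite N" "\<And>k. f k \<in> ?H" for f :: "'n \<Rightarrow> _" and N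
    using that
  proof (induction N rule: finite_induct)
    case empty
    have "fa \<zero>\<^bsub>R\<^esub> = \<zero>\<^bsub>T2\<^esub>" by (rule ring_hom_zero[OF fa R.ring_axioms F2.T.ring_axioms])
    then show ?case using Ha[of "\<zero>\<^bsub>R\<^esub>"] by simp
  next
    case (insert k N)
    have fk: "f k \<in> carrier T2" for k using insert.prems[of k] Hsub by blast
    have "(\<Oplus>\<^bsub>T2\<^esub>k\<in>insert k N. f k) = f k \<oplus>\<^bsub>T2\<^esub> (\<Oplus>\<^bsub>T2\<^esub>k\<in>N. f k)"
      using insert.hyps fk by (intro F2.T.finsum_insert) auto
    then show ?case using Hadd[OF insert.prems[of k] insert.IH[OF insert.prems]] by simp
  qed
  interpret M2: ring "mring T2 :: ('n \<Rightarrow> 'n \<Rightarrow> _) ring" by (rule ring_mring) (rule F2.T.is_cring)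
  define aW where "aW = (\<lambda>i j. fa (W i j))"
  define aZ where "aZ = (\<lambda>i j. fa (Z i j))"
  define bZ where "bZ = (\<lambda>i j. fb (Z i j))"
  define G where "G = aW \<otimes>\<^bsub>mring T2\<^esub> bZ"
  have cl: "aW \<in> carrier (mring T2)" "aZ \<in> carrier (mring T2)" "bZ \<in> carrier (mring T2)"
    using W_closed Z_closed A(1) B(1) by (auto simp: mring_simps aW_def aZ_def bZ_def)
  have "aZ \<otimes>\<^bsub>mring T2\<^esub> aW = \<one>\<^bsub>mring T2\<^esub>"
  proof -
    have "(\<lambda>i j. fa ((Z \<otimes>\<^bsub>mring R\<^esub> W) i j)) = aZ \<otimes>\<^bsub>mring T2\<^esub> aW"
      unfolding aZ_def aW_def by (rule hom_mring_mult[OF R.is_cring F2.T.is_cring fa Z_closed W_closed])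
    moreover have "(\<lambda>i j. fa (\<one>\<^bsub>mring R\<^esub> i j)) = \<one>\<^bsub>mring T2\<^esub>"
      by (rule hom_mring_one[OF R.is_cring F2.T.is_cring fa])
    ultimately show ?thesis unfolding Z_W by metis
  qed
  then have bZ: "bZ = aZ \<otimes>\<^bsub>mring T2\<^esub> G" unfolding G_def using cl by (simp flip: M2.m_assoc)
  have Gc: "G \<in> carrier (mring T2)" unfolding G_def using cl by simp
  \<comment> \<open>The factors \<open>A\<^sup>-\<^sup>1\<close> and \<open>A\<close> produced by the shift cancel, because both embeddings agree on \<open>F\<close>.\<close>
  have Gs: "(\<lambda>i j. s2 (G i j)) = G"
  proof -
    let ?sW = "\<lambda>i j. shift R (W i j)"
    have sWc: "?sW \<in> carrier (mring R)" "c.qm A \<in> carrier (mring R)"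
      using W_closed SH(1) c.qm_closed[of A] by (auto simp: mring_simps)
    have "(\<lambda>i j. s2 (G i j)) = (\<lambda>i j. s2 (aW i j)) \<otimes>\<^bsub>mring T2\<^esub> (\<lambda>i j. s2 (bZ i j))"
      unfolding G_def by (rule hom_mring_mult[OF F2.T.is_cring F2.T.is_cring s2(1) cl(1,3)])
    also have "(\<lambda>i j. s2 (aW i j)) = (\<lambda>i j. fa (?sW i j))" using W_closed by (simp add: aW_def sa mring_simps)
    also have "(\<lambda>i j. s2 (bZ i j)) = (\<lambda>i j. fb ((c.qm A \<otimes>\<^bsub>mring R\<^esub> Z) i j))"
      unfolding bZ_def shift_Z[symmetric] using Z_closed by (simp add: sb mring_simps)
    also have "\<dots> = (\<lambda>i j. fb (c.qm A i j)) \<otimes>\<^bsub>mring T2\<^esub> bZ"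
      unfolding bZ_def by (rule hom_mring_mult[OF R.is_cring F2.T.is_cring fb sWc(2) Z_closed])
    also have "(\<lambda>i j. fb (c.qm A i j)) = (\<lambda>i j. fa (c.qm A i j))" by (simp add: c.qm_def ca cb)
    also have "(\<lambda>i j. fa (?sW i j)) \<otimes>\<^bsub>mring T2\<^esub> ((\<lambda>i j. fa (c.qm A i j)) \<otimes>\<^bsub>mring T2\<^esub> bZ) =
      ((\<lambda>i j. fa (?sW i j)) \<otimes>\<^bsub>mring T2\<^esub> (\<lambda>i j. fa (c.qm A i j))) \<otimes>\<^bsub>mring T2\<^esub> bZ"
      using sWc A(1) cl by (intro M2.m_assoc[symmetric]) (auto simp: mring_simps)
    also have "(\<lambda>i j. fa (?sW i j)) \<otimes>\<^bsub>mring T2\<^esub> (\<lambda>i j. fa (c.qm A i j)) = aW"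
      using hom_mring_mult[OF R.is_cring F2.T.is_cring fa sWc] unfolding shift_W_A aW_def by simp
    finally show ?thesis by (simp add: G_def)
  qed
  have GS0: "G i j \<in> S0" for i j
    using fun_cong[OF fun_cong[OF Gs, of i], of j] Gc by (auto simp: S0_def mring_simps)
  have "carrier R \<subseteq> {r \<in> carrier R. fb r \<in> ?H}"
  proof (rule R_generated)
    show "c a \<in> {r \<in> carrier R. fb r \<in> ?H}" for a
      using Ha[OF c_closed, of a] by (simp add: c_closed ca cb)
    show "Z i j \<in> {r \<in> carrier R. fb r \<in> ?H}" for i j
    proof -
      have "fb (Z i j) = (\<Oplus>\<^bsub>T2\<^esub>k\<in>UNIV. aZ i k \<otimes>\<^bsub>T2\<^esub> G k j)"
        using fun_cong[OF fun_cong[OF bZ, of i], of j] by (simp add: bZ_def mring_simps)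
      moreover have "aZ i k \<otimes>\<^bsub>T2\<^esub> G k j \<in> ?H" for k
        unfolding aZ_def by (intro Hmult Ha HS GS0 pc_closed)
      ultimately have "fb (Z i j) \<in> ?H" using Hfin[of UNIV "\<lambda>k. aZ i k \<otimes>\<^bsub>T2\<^esub> G k j"] by simp
      then show ?thesis by (simp add: pc_closed)
    qed
    show "Th \<in> {r \<in> carrier R. fb r \<in> ?H}"
    proof -
      have d: "fa Dt \<otimes>\<^bsub>T2\<^esub> fb Th \<in> S0"
      proof -
        have cc: "fa (c (det A)) \<otimes>\<^bsub>T2\<^esub> fb (c (inverse (det A))) = \<one>\<^bsub>T2\<^esub>"
        proof -
          have "fa (c (det A)) \<otimes>\<^bsub>T2\<^esub> fa (c (inverse (det A))) = fa (c (det A * inverse (det A)))"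
            by (simp add: c.mult A c_closed)
          then show ?thesis using detA by (simp add: ca cb c.one) (simp add: ca[symmetric] A)
        qed
        have m: "fa (c (det A)) \<in> carrier T2" "fb (c (inverse (det A))) \<in> carrier T2" "fa Dt \<in> carrier T2" "fb Th \<in> carrier T2"
          using A(1) B(1) c_closed pc_closed by auto
        have "s2 (fa Dt \<otimes>\<^bsub>T2\<^esub> fb Th) = (fa (c (det A)) \<otimes>\<^bsub>T2\<^esub> fa Dt) \<otimes>\<^bsub>T2\<^esub> (fb (c (inverse (det A))) \<otimes>\<^bsub>T2\<^esub> fb Th)"
          using m by (simp add: S2 sa sb pc_closed shift_Dt shift_Th A B c_closed)
        also have "\<dots> = (fa (c (det A)) \<otimes>\<^bsub>T2\<^esub> fb (c (inverse (det A)))) \<otimes>\<^bsub>T2\<^esub> (fa Dt \<otimes>\<^bsub>T2\<^esub> fb Th)"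
          using m by (simp add: F2.T.m_ac)
        finally show ?thesis using m by (simp add: S0_def cc)
      qed
      have "fa Th \<otimes>\<^bsub>T2\<^esub> fa Dt = \<one>\<^bsub>T2\<^esub>" using A(2)[OF pc_closed pc_closed, of "mpol_var InvDet" "det gen_mat"] by (simp add: Th_Dt A(4))
      then have "fb Th = fa Th \<otimes>\<^bsub>T2\<^esub> (fa Dt \<otimes>\<^bsub>T2\<^esub> fb Th)"
        using A(1) B(1) pc_closed by (simp flip: F2.T.m_assoc)
      also have "\<dots> \<in> ?H" by (intro Hmult Ha HS d pc_closed)
      finally show ?thesis by (simp add: pc_closed)
    qed
    show "x \<oplus>\<^bsub>R\<^esub> y \<in> {r \<in> carrier R. fb r \<in> ?H}" if "x \<in> {r \<in> carrier R. fb r \<in> ?H}" "y \<in> {r \<in> carrier R. fb r \<in> ?H}" for x y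
      using that Hadd[of "fb x" "fb y"] by (simp add: B)
    show "x \<otimes>\<^bsub>R\<^esub> y \<in> {r \<in> carrier R. fb r \<in> ?H}" if "x \<in> {r \<in> carrier R. fb r \<in> ?H}" "y \<in> {r \<in> carrier R. fb r \<in> ?H}" for x y
      using that Hmult[of "fb x" "fb y"] by (simp add: B)
    show "der R x \<in> {r \<in> carrier R. fb r \<in> ?H}" if "x \<in> {r \<in> carrier R. fb r \<in> ?H}" for x
      using that Hder[of "fb x"] by (simp add: db der_R_closed)
  qed
  then have Hb: "fb r \<in> ?H" if "r \<in> carrier R" for r using that by blast
  have "x \<in> ?H" if "x \<in> carrier T2" for x
    using that
  proof (induction rule: F2.T_induct)
    case (pure r s)
    obtain y z where yz: "y \<in> carrier R" "z \<in> carrier R" "t2 r s = fa y \<otimes>\<^bsub>T2\<^esub> fb z" using gen[OF pure] by blast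
    show ?case unfolding yz(3) by (intro Hmult Ha Hb yz)
  qed (rule Hadd)
  then have "bij_betw \<Psi> (carrier TS) (carrier T2)" using inj Hsub by (auto simp: bij_betw_def)
  then show ?thesis using that[OF P _ der sh] by blast
qed

lemma pv_aut_eq:
  "pv_aut \<sigma> \<delta> A I S u = {\<phi> \<in> ring_iso (tensor K R c S u) (tensor K R c S u) \<inter> extensional (carrier (tensor K R c S u)).
     (\<forall>a\<in>carrier (tensor K R c S u). \<phi> (der (tensor K R c S u) a) = der (tensor K R c S u) (\<phi> a) \<and>
        \<phi> (shift (tensor K R c S u) a) = shift (tensor K R c S u) (\<phi> a)) \<and>
     (\<forall>a. \<forall>s\<in>carrier S. \<phi> (pure_tensor K R c S u (c a) s) = pure_tensor K R c S u (c a) s)}"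
proof -
  have c: "(\<lambda>a. pv_class \<sigma> \<delta> A I (mpol_const a)) = c" by (simp add: fun_eq_iff c_def pc_def)
  show ?thesis unfolding pv_aut_def Let_def c R_def[symmetric] by (simp add: c_def pc_def)
qed

lemma pv_matrix_eq:
  "pv_matrix \<sigma> \<delta> A I S u \<phi> g \<longleftrightarrow> (\<forall>i j. \<phi> (pure_tensor K R c S u (Z i j) \<one>\<^bsub>S\<^esub>) =
     (\<Oplus>\<^bsub>tensor K R c S u\<^esub>k\<in>UNIV. pure_tensor K R c S u (Z i k) \<one>\<^bsub>S\<^esub> \<otimes>\<^bsub>tensor K R c S u\<^esub> pure_tensor K R c S u \<one>\<^bsub>R\<^esub> (g $ k $ j)))"
  unfolding pv_matrix_def Let_def R_def[symmetric] pc_def[symmetric] c_def[symmetric] ..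

text \<open>Compose the isomorphism given by the second embedding with the inverse of the one given by the first.\<close>
theorem pv_aut_exists:
  obtains \<phi> \<Psi> where "\<phi> \<in> pv_aut \<sigma> \<delta> A I Sr uT" "\<Psi> \<in> ring_hom TS T2"
    "\<And>r s. r \<in> carrier R \<Longrightarrow> s \<in> carrier Sr \<Longrightarrow> \<Psi> (tS r s) = f1 r \<otimes>\<^bsub>T2\<^esub> iT s"
    "\<And>r. r \<in> carrier R \<Longrightarrow> \<Psi> (\<phi> (tS r \<one>\<^bsub>Sr\<^esub>)) = f2 r"
proof -
  note F1 = ring_hom_memE[OF f1_hom] and F2h = ring_hom_memE[OF f2_hom] and IH = ring_hom_memE[OF iT_hom(1)]
  have g1: "\<exists>x\<in>carrier R. \<exists>y\<in>carrier R. t2 r r' = f1 x \<otimes>\<^bsub>T2\<^esub> f2 y" if "r \<in> carrier R" "r' \<in> carrier R" for r r'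
    using that t2_eq by blast
  have g2: "\<exists>x\<in>carrier R. \<exists>y\<in>carrier R. t2 r r' = f2 x \<otimes>\<^bsub>T2\<^esub> f1 y" if "r \<in> carrier R" "r' \<in> carrier R" for r r'
    using that t2_eq[OF that] F1(1) F2h(1) by (intro bexI[of _ r'] bexI[of _ r]) (auto simp: F2.T.m_comm)
  obtain P1 where P1: "P1 \<in> ring_hom TS T2" "\<And>r s. r \<in> carrier R \<Longrightarrow> s \<in> carrier Sr \<Longrightarrow> P1 (tS r s) = f1 r \<otimes>\<^bsub>T2\<^esub> iT s"
    "bij_betw P1 (carrier TS) (carrier T2)" "\<And>x. x \<in> carrier TS \<Longrightarrow> P1 (der TS x) = der T2 (P1 x)"
    "\<And>x. x \<in> carrier TS \<Longrightarrow> P1 (shift TS x) = s2 (P1 x)"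
    by (rule psi_bij[OF f1_hom f2_hom der_f s2_f refl f12_c[symmetric] g1]) (assumption, assumption, assumption, assumption, assumption, assumption, blast)
  obtain P2 where P2: "P2 \<in> ring_hom TS T2" "\<And>r s. r \<in> carrier R \<Longrightarrow> s \<in> carrier Sr \<Longrightarrow> P2 (tS r s) = f2 r \<otimes>\<^bsub>T2\<^esub> iT s"
    "bij_betw P2 (carrier TS) (carrier T2)" "\<And>x. x \<in> carrier TS \<Longrightarrow> P2 (der TS x) = der T2 (P2 x)"
    "\<And>x. x \<in> carrier TS \<Longrightarrow> P2 (shift TS x) = s2 (P2 x)"
    by (rule psi_bij[OF f2_hom f1_hom der_f(2,1) s2_f(2,1) f12_c[symmetric] refl g2]) (assumption, assumption, assumption, assumption, assumption, assumption, blast)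
  note H1 = ring_hom_memE[OF P1(1)] and H2 = ring_hom_memE[OF P2(1)]
  define \<phi> where "\<phi> = restrict (\<lambda>x. inv_into (carrier TS) P1 (P2 x)) (carrier TS)"
  have im: "P1 ` carrier TS = carrier T2" "inj_on P1 (carrier TS)" using P1(3) by (auto simp: bij_betw_def)
  have ph: "P1 (\<phi> x) = P2 x" "\<phi> x \<in> carrier TS" if "x \<in> carrier TS" for x
    using that H2(1)[OF that] im by (auto simp: \<phi>_def f_inv_into_f inv_into_into)
  have eqI: "x = y" if "x \<in> carrier TS" "y \<in> carrier TS" "P1 x = P1 y" for x y using im(2) that by (auto dest: inj_onD)
  note TSh = ring_hom_memE[OF TS_shift(1)]
  have "\<phi> \<in> ring_hom TS TS"
  proof (rule ring_hom_memI)
    fix x y assume xy: "x \<in> carrier TS" "y \<in> carrier TS"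
    show "\<phi> (x \<otimes>\<^bsub>TS\<^esub> y) = \<phi> x \<otimes>\<^bsub>TS\<^esub> \<phi> y" by (rule eqI) (use xy in \<open>auto simp: ph H1 H2\<close>)
    show "\<phi> (x \<oplus>\<^bsub>TS\<^esub> y) = \<phi> x \<oplus>\<^bsub>TS\<^esub> \<phi> y" by (rule eqI) (use xy in \<open>auto simp: ph H1 H2\<close>)
  next
    show "\<phi> \<one>\<^bsub>TS\<^esub> = \<one>\<^bsub>TS\<^esub>" by (rule eqI) (auto simp: ph H1 H2)
  qed (rule ph)
  moreover have "bij_betw \<phi> (carrier TS) (carrier TS)"
  proof -
    have "bij_betw (inv_into (carrier TS) P1 \<circ> P2) (carrier TS) (carrier TS)"
      by (rule bij_betw_trans[OF P2(3) bij_betw_inv_into[OF P1(3)]])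
    then show ?thesis by (rule bij_betw_cong[THEN iffD1, rotated]) (simp add: \<phi>_def)
  qed
  moreover have "\<phi> (der TS x) = der TS (\<phi> x)" "\<phi> (shift TS x) = shift TS (\<phi> x)" if "x \<in> carrier TS" for x
    by (rule eqI; use that in \<open>simp add: ph P1 P2 KS.der_T_additive TSh\<close>)+
  moreover have "\<phi> (tS (c a) s) = tS (c a) s" if "s \<in> carrier Sr" for a s
    by (rule eqI) (use that in \<open>auto simp: ph P1 P2 KS.t_closed c_closed f12_c\<close>)
  ultimately have "\<phi> \<in> pv_aut \<sigma> \<delta> A I Sr uT" unfolding pv_aut_eq by (auto simp: ring_iso_def \<phi>_def)
  moreover have "P1 (\<phi> (tS r \<one>\<^bsub>Sr\<^esub>)) = f2 r" if "r \<in> carrier R" for r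
    using that F2h(1) by (simp add: ph KS.t_closed P2 IH)
  ultimately show ?thesis using that P1(1,2) by blast
qed

end

section \<open>Gauge relations and integrability\<close>

text \<open>The matrix \<open>X' + C X - X C\<close>. Its entries vanish at \<open>g\<close> iff \<open>g\<close> satisfies \<open>g' = g C - C g\<close>, which for
  \<open>C = P\<^sup>-\<^sup>1 P'\<close> means that \<open>P g P\<^sup>-\<^sup>1\<close> is constant.\<close>
definition gauge_rel :: "('a::comm_ring_1 \<Rightarrow> 'a) \<Rightarrow> 'a ^ 'n ^ 'n \<Rightarrow> ('a, 'n::finite) gl_pol ^ 'n ^ 'n" where
  "gauge_rel d C = map_matrix (gl_deriv d) gen_mat + map_matrix mpol_const C ** gen_mat - gen_mat ** map_matrix mpol_const C"

text \<open>Differentiate \<open>z1 g\<close> when \<open>z1' = b z1 + z1 u\<close>. If \<open>g' + u g = g u\<close>, the product \<open>z1 g\<close> satisfies the same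
  equation as \<open>z1\<close>.\<close>
lemma (in ring) gauge_transfer:
  assumes c: "z1 \<in> carrier R" "g \<in> carrier R" "b \<in> carrier R" "u \<in> carrier R" "dg \<in> carrier R"
    and z1: "dz1 = b \<otimes> z1 \<oplus> z1 \<otimes> u" and dz2: "dz2 = dz1 \<otimes> g \<oplus> z1 \<otimes> dg"
  shows "dz2 = b \<otimes> (z1 \<otimes> g) \<oplus> z1 \<otimes> (dg \<oplus> u \<otimes> g)"
  unfolding dz2 z1 using c by (simp add: l_distr r_distr m_assoc a_ac)

lemma (in ring) cancel_right_inverse:
  assumes "x \<in> carrier R" "y \<in> carrier R" "z \<in> carrier R" "w \<in> carrier R" "z \<otimes> w = \<one>" "x \<otimes> z = y \<otimes> z"
  shows "x = y"
proof -
  have "(x \<otimes> z) \<otimes> w = (y \<otimes> z) \<otimes> w" by (simp add: assms(6))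
  then show ?thesis using assms(1-5) by (simp add: m_assoc)
qed

lemma (in ring) cancel_left_inverse:
  assumes "x \<in> carrier R" "y \<in> carrier R" "z \<in> carrier R" "w \<in> carrier R" "w \<otimes> z = \<one>" "z \<otimes> x = z \<otimes> y"
  shows "x = y"
proof -
  have "w \<otimes> (z \<otimes> x) = w \<otimes> (z \<otimes> y)" by (simp add: assms(6))
  then show ?thesis using assms(1-5) by (simp flip: m_assoc)
qed

lemma (in ring) cancel_left_summand:
  assumes "a \<in> carrier R" "x \<in> carrier R" "y \<in> carrier R" "a \<oplus> x = a \<oplus> y" shows "x = y"
  using add.m_assoc[of "\<ominus> a" a x] add.m_assoc[of "\<ominus> a" a y] assms by (simp add: l_neg)

lemma (in ring) cancel_right_summand:
  assumes "a \<in> carrier R" "x \<in> carrier R" "y \<in> carrier R" "x \<oplus> a = y \<oplus> a" shows "x = y"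
  using assms cancel_left_summand[of a x y] by (simp add: a_comm)

lemma matrix_inv_invertible:
  fixes A :: "'a::semiring_1 ^ 'n::finite ^ 'n"
  assumes "invertible A" shows "A ** matrix_inv A = mat 1" "matrix_inv A ** A = mat 1"
  using someI_ex[of "\<lambda>A'. A ** A' = mat 1 \<and> A' ** A = mat 1"] assms by (auto simp: invertible_def matrix_inv_def)

lemma gauge_rel_iff:
  fixes q :: "('a::comm_ring_1, 'n::finite) gl_pol \<Rightarrow> 's"
  assumes g: "gl_setup d C" and t: "typed_hom (mpols_over C) S q"
    and d: "\<And>p. p \<in> mpols_over C \<Longrightarrow> q (gl_deriv d p) = der S (q p)" and M: "\<And>i j. M $ i $ j \<in> C"
  defines "G \<equiv> \<lambda>i j. q (mpol_var (Entry i j 0))" and "U \<equiv> \<lambda>i j. q (mpol_const (M $ i $ j))"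
  shows "q (gauge_rel d M $ i $ j) = \<zero>\<^bsub>S\<^esub> \<longleftrightarrow>
    ((\<lambda>i j. der S (G i j)) \<oplus>\<^bsub>mring S\<^esub> U \<otimes>\<^bsub>mring S\<^esub> G) i j = (G \<otimes>\<^bsub>mring S\<^esub> U) i j"
proof -
  interpret gl_setup d C by fact
  interpret t: typed_hom "mpols_over C" S q by fact
  interpret S: cring S by (rule t.S)
  note sd = subring_setD[OF t.C]
  let ?c = "map_matrix mpol_const M :: ('a, 'n) gl_pol ^ 'n ^ 'n"
  have v: "(gen_mat $ i $ j :: ('a, 'n) gl_pol) \<in> mpols_over C" for i j by (rule gen_mat_closed[OF C])
  have vd: "map_matrix (gl_deriv d) gen_mat $ i $ j \<in> (mpols_over C :: ('a, 'n) gl_pol set)" for i j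
    using gl_deriv_closed[OF v] by (simp add: map_matrix_def)
  have vc: "?c $ i $ j \<in> mpols_over C" for i j using M mpol_const_closed[OF C, of "M $ i $ j"] by (simp add: map_matrix_def)
  have cg: "(?c ** gen_mat) $ i $ j \<in> mpols_over C" "(gen_mat ** ?c) $ i $ j \<in> mpols_over C" for i j
    using v vc by (auto simp: matrix_matrix_mult_def intro!: subring_set_sum[OF t.C] sd)
  have qG: "t.qm gen_mat = G" by (simp add: t.qm_def G_def gen_mat_nth)
  have qU: "t.qm ?c = U" by (simp add: t.qm_def U_def map_matrix_def)
  have qD: "t.qm (map_matrix (gl_deriv d) gen_mat) = (\<lambda>i j. der S (G i j))"
    using d v by (simp add: t.qm_def G_def map_matrix_def gen_mat_nth)
  let ?a = "map_matrix (gl_deriv d) gen_mat + ?c ** gen_mat"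
  have a: "?a $ i $ j \<in> mpols_over C" for i j using vd cg sd by simp
  have "t.qm ?a = (\<lambda>i j. der S (G i j)) \<oplus>\<^bsub>mring S\<^esub> U \<otimes>\<^bsub>mring S\<^esub> G"
    by (subst t.qm_add[OF vd cg(1)], subst t.qm_mult[OF vc v]) (simp add: qG qU qD)
  moreover have "t.qm (gen_mat ** ?c) = G \<otimes>\<^bsub>mring S\<^esub> U"
    by (subst t.qm_mult[OF v vc]) (simp add: qG qU)
  moreover have "q (gauge_rel d M $ i $ j) = q (?a $ i $ j) \<oplus>\<^bsub>S\<^esub> (\<ominus>\<^bsub>S\<^esub> q ((gen_mat ** ?c) $ i $ j))"
  proof -
    have "gauge_rel d M $ i $ j = ?a $ i $ j + - ((gen_mat ** ?c) $ i $ j)" by (simp add: gauge_rel_def)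
    then show ?thesis using t.add[OF a sd(5)[OF cg(2)], of i j i j] t.uminus[OF cg(2), of i j] by simp
  qed
  moreover have "t.qm N i j = q (N $ i $ j)" for N by (simp add: t.qm_def)
  moreover have "q (?a $ i $ j) \<in> carrier S" "q ((gen_mat ** ?c) $ i $ j) \<in> carrier S"
    using a cg t.closed by auto
  then have "q (?a $ i $ j) \<oplus>\<^bsub>S\<^esub> (\<ominus>\<^bsub>S\<^esub> q ((gen_mat ** ?c) $ i $ j)) = \<zero>\<^bsub>S\<^esub> \<longleftrightarrow> q (?a $ i $ j) = q ((gen_mat ** ?c) $ i $ j)"
    using t.S.r_neg t.S.minus_equality by (metis t.S.a_inv_closed t.S.minus_minus)
  ultimately show ?thesis by metis
qed

lemma gauge_rel_closed:
  assumes "gl_setup d C" and M: "\<And>i j. M $ i $ j \<in> C"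
  shows "gauge_rel d M $ i $ j \<in> mpols_over C"
proof -
  interpret gl_setup d C by fact
  note R = subring_mpols_over[OF C]
  have v: "(gen_mat $ i $ j :: ('a, 'b) gl_pol) \<in> mpols_over C" for i j by (rule gen_mat_closed[OF C])
  show ?thesis unfolding gauge_rel_def using v M
    by (auto simp: matrix_matrix_mult_def map_matrix_def intro!: subring_set_sum[OF R] subring_setD[OF R] gl_deriv_closed mpol_const_closed[OF C])
qed

context pv_data
begin

abbreviation "der_mat S G \<equiv> (\<lambda>i j. der S (G i j))"

lemma Z_matrix_closed: "der_mat R Z \<in> carrier (mring R)" "c.qm (N :: 'f ^ 'n ^ 'n) \<in> carrier (mring R)"
  using pc_closed der_R_closed c_closed by (auto simp: mring_simps c.qm_def)

text \<open>The derivative of \<open>A Z\<close> computed by the Leibniz rule and as the shift of \<open>Z'\<close>.\<close>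
lemma shift_relation:
  assumes b: "b \<in> carrier (mring R)" "v \<in> carrier (mring R)" and e: "der_mat R Z = b \<otimes>\<^bsub>mring R\<^esub> Z \<oplus>\<^bsub>mring R\<^esub> Z \<otimes>\<^bsub>mring R\<^esub> v"
  shows "(c.qm (map_matrix \<delta> A) \<oplus>\<^bsub>mring R\<^esub> c.qm A \<otimes>\<^bsub>mring R\<^esub> b) \<otimes>\<^bsub>mring R\<^esub> Z \<oplus>\<^bsub>mring R\<^esub> c.qm A \<otimes>\<^bsub>mring R\<^esub> (Z \<otimes>\<^bsub>mring R\<^esub> v) =
    ((\<lambda>i j. shift R (b i j)) \<otimes>\<^bsub>mring R\<^esub> c.qm A) \<otimes>\<^bsub>mring R\<^esub> Z \<oplus>\<^bsub>mring R\<^esub> c.qm A \<otimes>\<^bsub>mring R\<^esub> (Z \<otimes>\<^bsub>mring R\<^esub> (\<lambda>i j. shift R (v i j)))"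
proof -
  let ?s = "\<lambda>N i j. shift R (N i j)"
  note SH = ring_hom_memE[OF shift_hom]
  have cl: "?s b \<in> carrier (mring R)" "?s v \<in> carrier (mring R)" "?s Z \<in> carrier (mring R)"
    using b Z_closed SH(1) by (auto simp: mring_simps)
  note cl = cl b Z_matrix_closed Z_closed
  have e': "der R (Z i j) = (b \<otimes>\<^bsub>mring R\<^esub> Z \<oplus>\<^bsub>mring R\<^esub> Z \<otimes>\<^bsub>mring R\<^esub> v) i j" for i j
    by (rule fun_cong[OF fun_cong[OF e]])
  have "?s (der_mat R Z) = ?s (b \<otimes>\<^bsub>mring R\<^esub> Z) \<oplus>\<^bsub>mring R\<^esub> ?s (Z \<otimes>\<^bsub>mring R\<^esub> v)"
    unfolding e' by (rule hom_mring_add[OF shift_hom]) (use cl in \<open>auto simp: M.m_closed\<close>)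
  also have "?s (b \<otimes>\<^bsub>mring R\<^esub> Z) = ?s b \<otimes>\<^bsub>mring R\<^esub> (c.qm A \<otimes>\<^bsub>mring R\<^esub> Z)"
    unfolding shift_Z[symmetric] by (rule hom_mring_mult[OF R.is_cring R.is_cring shift_hom]) (use cl in auto)
  also have "?s (Z \<otimes>\<^bsub>mring R\<^esub> v) = (c.qm A \<otimes>\<^bsub>mring R\<^esub> Z) \<otimes>\<^bsub>mring R\<^esub> ?s v"
    unfolding shift_Z[symmetric] by (rule hom_mring_mult[OF R.is_cring R.is_cring shift_hom]) (use cl in auto)
  finally have 1: "?s (der_mat R Z) = (?s b \<otimes>\<^bsub>mring R\<^esub> c.qm A) \<otimes>\<^bsub>mring R\<^esub> Z \<oplus>\<^bsub>mring R\<^esub> c.qm A \<otimes>\<^bsub>mring R\<^esub> (Z \<otimes>\<^bsub>mring R\<^esub> ?s v)"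
    using cl by (simp add: M.m_assoc)
  have "?s (der_mat R Z) = der_mat R (c.qm A \<otimes>\<^bsub>mring R\<^esub> Z)"
    unfolding shift_Z[symmetric] by (simp add: shift_der pc_closed)
  also have "\<dots> = der_mat R (c.qm A) \<otimes>\<^bsub>mring R\<^esub> Z \<oplus>\<^bsub>mring R\<^esub> c.qm A \<otimes>\<^bsub>mring R\<^esub> der_mat R Z"
    by (rule der_mring_mult[OF R_diff]) (use cl in auto)
  also have "der_mat R (c.qm A) = c.qm (map_matrix \<delta> A)" by (simp add: c.qm_def der_c map_matrix_def)
  also have "c.qm A \<otimes>\<^bsub>mring R\<^esub> der_mat R Z = c.qm A \<otimes>\<^bsub>mring R\<^esub> b \<otimes>\<^bsub>mring R\<^esub> Z \<oplus>\<^bsub>mring R\<^esub> c.qm A \<otimes>\<^bsub>mring R\<^esub> (Z \<otimes>\<^bsub>mring R\<^esub> v)"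
    unfolding e using cl by (simp add: M.r_distr M.m_assoc)
  finally show ?thesis using 1 cl by (simp add: M.l_distr M.a_assoc)
qed

definition Kq :: "('f, 'n) gl_pol \<Rightarrow> _" where "Kq = gl_class K \<delta>"

lemma Kq: "typed_hom (mpols_over K) (gl_dring K \<delta>) Kq"
  and Kq_der: "p \<in> mpols_over K \<Longrightarrow> Kq (gl_deriv \<delta> p) = der (gl_dring K \<delta>) (Kq p)"
  and Kq_carrier: "carrier (gl_dring K \<delta>) = Kq ` mpols_over K"
proof -
  show "typed_hom (mpols_over K) (gl_dring K \<delta>) Kq"
    unfolding Kq_def by (rule typed_hom.intro) (simp_all add: Kg.gl_class_simps(1-5) Kg.Q.S subring_mpols_over[OF Kg.C])
  show "p \<in> mpols_over K \<Longrightarrow> Kq (gl_deriv \<delta> p) = der (gl_dring K \<delta>) (Kq p)"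
    unfolding Kq_def by (simp add: Kg.der_gl_class)
  show "carrier (gl_dring K \<delta>) = Kq ` mpols_over K" unfolding Kq_def by (rule Kg.gl_class_simps)
qed

lemma K_gl: "gl_setup \<delta> K" by unfold_locales

lemma typed_hom_comp:
  assumes "h \<in> dring_hom (gl_dring K \<delta>) S" "cring S"
  shows "typed_hom (mpols_over K) S (\<lambda>p. h (Kq p))"
    "p \<in> mpols_over K \<Longrightarrow> h (Kq (gl_deriv \<delta> p)) = der S (h (Kq p))"
proof -
  interpret q: typed_hom "mpols_over K" "gl_dring K \<delta>" Kq by (rule Kq)
  have h: "h \<in> ring_hom (gl_dring K \<delta>) S" using assms by (simp add: dring_hom_def)
  note H = ring_hom_memE[OF h]
  show "typed_hom (mpols_over K) S (\<lambda>p. h (Kq p))"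
    by (rule typed_hom.intro) (use assms q.C H q.closed q.add q.mult q.one in auto)
  show "p \<in> mpols_over K \<Longrightarrow> h (Kq (gl_deriv \<delta> p)) = der S (h (Kq p))"
    using assms q.closed Kq_der by (simp add: dring_hom_def)
qed

text \<open>Used with \<open>F\<close> the whole field and with \<open>F\<close> the shift constants: in both cases a linear retraction of the
  structure map into \<open>R\<close>.\<close>
lemma K_functional:
  assumes F: "0 \<in> F" "1 \<in> F" "\<And>a b. a \<in> F \<Longrightarrow> b \<in> F \<Longrightarrow> a + b \<in> F" "\<And>a b. a \<in> F \<Longrightarrow> b \<in> F \<Longrightarrow> a * b \<in> F"
      "\<And>a. a \<in> F \<Longrightarrow> - a \<in> F" "\<And>a. a \<in> F \<Longrightarrow> inverse a \<in> F"
  obtains \<mu> where "\<And>r. r \<in> carrier R \<Longrightarrow> \<mu> r \<in> F"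
    "\<And>r s. r \<in> carrier R \<Longrightarrow> s \<in> carrier R \<Longrightarrow> \<mu> (r \<oplus>\<^bsub>R\<^esub> s) = \<mu> r + \<mu> s"
    "\<And>a r. a \<in> F \<Longrightarrow> r \<in> carrier R \<Longrightarrow> \<mu> (c a \<otimes>\<^bsub>R\<^esub> r) = a * \<mu> r" "\<mu> \<one>\<^bsub>R\<^esub> = (1::'f)"
proof -
  obtain l where l: "\<And>p q. l (p + q) = l p + l q" "\<And>p. l p \<in> F" "\<And>a p. a \<in> F \<Longrightarrow> l (mpol_const a * p) = a * l p"
    "l 1 = (1::'f)" "\<And>p. p \<in> Pv \<Longrightarrow> l p = 0"
    by (rule exists_functional[OF F, where act = "\<lambda>a p. mpol_const a * p" and W = Pv and v = 1])
      (auto simp: distrib_left distrib_right const_add const_mult const_one mult.assoc Pv_zero Pv_add Pv_mult Pv_one)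
  obtain \<mu> where m: "\<And>p. \<mu> (pc p) = l p" using R_functional[OF l(1,5)] by blast
  show ?thesis
  proof (rule that[of \<mu>])
    show "\<mu> r \<in> F" if "r \<in> carrier R" for r using that by (auto simp: pc_simps(1) m l)
    show "\<mu> (r \<oplus>\<^bsub>R\<^esub> s) = \<mu> r + \<mu> s" if "r \<in> carrier R" "s \<in> carrier R" for r s
      using that by (auto simp: pc_simps(1,3) m l)
    show "\<mu> (c a \<otimes>\<^bsub>R\<^esub> r) = a * \<mu> r" if "a \<in> F" "r \<in> carrier R" for a r
      using that by (auto simp: pc_simps(1,2) m l c_def)
    show "\<mu> \<one>\<^bsub>R\<^esub> = 1" by (simp add: pc_simps(4) m l)
  qed
qed

text \<open>Apply an \<open>F\<close>-linear retraction \<open>\<mu>\<close> to the left factor of \<open>1 \<otimes> r = r \<otimes> 1\<close>: the result is \<open>r = \<mu> r\<close>.\<close>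
lemma equal_in_both_factors:
  assumes r: "r \<in> carrier R" and e: "f1 r = f2 r"
  obtains a where "r = c a"
proof -
  obtain \<mu> where m: "\<And>r s. r \<in> carrier R \<Longrightarrow> s \<in> carrier R \<Longrightarrow> \<mu> (r \<oplus>\<^bsub>R\<^esub> s) = \<mu> r + \<mu> s"
    "\<And>a r. r \<in> carrier R \<Longrightarrow> \<mu> (c a \<otimes>\<^bsub>R\<^esub> r) = a * \<mu> r" "\<mu> \<one>\<^bsub>R\<^esub> = (1::'f)"
    by (rule K_functional[of UNIV]) auto
  have "c (\<mu> r) \<otimes>\<^bsub>R\<^esub> \<one>\<^bsub>R\<^esub> = c (\<mu> \<one>\<^bsub>R\<^esub>) \<otimes>\<^bsub>R\<^esub> r"
    by (rule F2.inj_right[where lam = "\<lambda>r. c (\<mu> r)"])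
      (use r e in \<open>auto simp: m c.add c.mult c_closed f1_def f2_def\<close>)
  then have "r = c (\<mu> r)" using r c_closed by (simp add: m c.one)
  then show ?thesis by (rule that)
qed

lemma const_matrix:
  assumes "\<And>i j. N i j \<in> range c" obtains B where "N = c.qm B"
proof -
  have "\<exists>a. N i j = c a" for i j using assms[of i j] by auto
  then obtain b where "N i j = c (b i j)" for i j by metis
  then have "N = c.qm (\<chi> i j. b i j)" by (simp add: c.qm_def fun_eq_iff)
  then show ?thesis by (rule that)
qed

lemma c_qm_inj: "c.qm N = c.qm N' \<Longrightarrow> N = N'"
  using c_inj by (auto simp: c.qm_def fun_eq_iff vec_eq_iff)

lemma gauge_hom_image:
  assumes T: "cring T" and f: "f \<in> ring_hom R T" and df: "\<And>r. r \<in> carrier R \<Longrightarrow> der T (f r) = f (der R r)"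
    and bc: "b \<in> carrier (mring R)" and Vc: "V \<in> carrier (mring R)"
    and e: "der_mat R Z = b \<otimes>\<^bsub>mring R\<^esub> Z \<oplus>\<^bsub>mring R\<^esub> Z \<otimes>\<^bsub>mring R\<^esub> V"
  shows "der_mat T (\<lambda>i j. f (Z i j)) = (\<lambda>i j. f (b i j)) \<otimes>\<^bsub>mring T\<^esub> (\<lambda>i j. f (Z i j)) \<oplus>\<^bsub>mring T\<^esub>
      (\<lambda>i j. f (Z i j)) \<otimes>\<^bsub>mring T\<^esub> (\<lambda>i j. f (V i j))"
proof -
  have e': "der R (Z i j) = (b \<otimes>\<^bsub>mring R\<^esub> Z \<oplus>\<^bsub>mring R\<^esub> Z \<otimes>\<^bsub>mring R\<^esub> V) i j" for i j
    by (rule fun_cong[OF fun_cong[OF e]])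
  have "der_mat T (\<lambda>i j. f (Z i j)) = (\<lambda>i j. f ((b \<otimes>\<^bsub>mring R\<^esub> Z \<oplus>\<^bsub>mring R\<^esub> Z \<otimes>\<^bsub>mring R\<^esub> V) i j))"
    unfolding e'[symmetric] using df pc_closed by simp
  also have "\<dots> = (\<lambda>i j. f ((b \<otimes>\<^bsub>mring R\<^esub> Z) i j)) \<oplus>\<^bsub>mring T\<^esub> (\<lambda>i j. f ((Z \<otimes>\<^bsub>mring R\<^esub> V) i j))"
    by (rule hom_mring_add[OF f]) (use bc Z_closed Vc in auto)
  also have "(\<lambda>i j. f ((b \<otimes>\<^bsub>mring R\<^esub> Z) i j)) = (\<lambda>i j. f (b i j)) \<otimes>\<^bsub>mring T\<^esub> (\<lambda>i j. f (Z i j))"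
    by (rule hom_mring_mult[OF R.is_cring T f bc Z_closed])
  also have "(\<lambda>i j. f ((Z \<otimes>\<^bsub>mring R\<^esub> V) i j)) = (\<lambda>i j. f (Z i j)) \<otimes>\<^bsub>mring T\<^esub> (\<lambda>i j. f (V i j))"
    by (rule hom_mring_mult[OF R.is_cring T f Z_closed Vc])
  finally show ?thesis .
qed

text \<open>The automorphism carrying \<open>Z \<otimes> 1\<close> to \<open>1 \<otimes> Z\<close> gives a point \<open>g\<close> of the group with \<open>1 \<otimes> Z = (Z \<otimes> 1) g\<close>. As \<open>g\<close> satisfies the
  relation for \<open>C\<close>, the matrix \<open>1 \<otimes> Z\<close> satisfies the differential equation of \<open>Z \<otimes> 1\<close>, and comparison with its
  own equation shows that \<open>b = (Z' - Z C) Z\<^sup>-\<^sup>1\<close> is the same in both factors.\<close>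
theorem integrable_if_gauge_constant:
  assumes J: "galois_group_ideal \<sigma> \<delta> A I J" and C: "\<And>i j. C $ i $ j \<in> K" and CJ: "\<And>i j. Kq (gauge_rel \<delta> C $ i $ j) \<in> J"
  obtains B where "map_matrix \<sigma> B ** A = map_matrix \<delta> A + A ** B"
proof -
  obtain \<phi> \<Psi> where P: "\<phi> \<in> pv_aut \<sigma> \<delta> A I Sr uT" "\<Psi> \<in> ring_hom TS T2"
    "\<And>r s. r \<in> carrier R \<Longrightarrow> s \<in> carrier Sr \<Longrightarrow> \<Psi> (tS r s) = f1 r \<otimes>\<^bsub>T2\<^esub> iT s"
    "\<And>r. r \<in> carrier R \<Longrightarrow> \<Psi> (\<phi> (tS r \<one>\<^bsub>Sr\<^esub>)) = f2 r" by (rule pv_aut_exists) blast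
  obtain g where g: "g \<in> gl_points K \<delta> J Sr uT" "pv_matrix \<sigma> \<delta> A I Sr uT \<phi> g"
    using J[unfolded galois_group_ideal_def Let_def] Sr_algebra P(1) by metis
  then obtain h where h: "g = (\<chi> i j. h (Kq (mpol_var (Entry i j 0))))" "h \<in> dring_hom (gl_dring K \<delta>) Sr"
    "\<And>a. a \<in> K \<Longrightarrow> h (Kq (mpol_const a)) = uT a" "\<And>a. a \<in> J \<Longrightarrow> h a = \<zero>\<^bsub>Sr\<^esub>"
    unfolding gl_points_def Kq_def[symmetric] by blast
  define q where "q p = iT (h (Kq p))" for p
  note IH = ring_hom_memE[OF iT_hom(1)]
  interpret hq: typed_hom "mpols_over K" Sr "\<lambda>p. h (Kq p)" by (rule typed_hom_comp[OF h(2) KS.S.is_cring])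
  interpret q: typed_hom "mpols_over K" T2 q
    by (rule typed_hom.intro) (auto simp: q_def IH hq.closed hq.add hq.mult hq.one hq.C F2.T.is_cring)
  have qd: "q (gl_deriv \<delta> p) = der T2 (q p)" if p: "p \<in> mpols_over K" for p
    unfolding q_def typed_hom_comp(2)[OF h(2) KS.S.is_cring p] by (rule iT_hom(2)[OF hq.closed[OF p]])
  define G where "G = (\<lambda>i j. q (mpol_var (Entry i j 0)))"
  define U where "U = (\<lambda>i j. q (mpol_const (C $ i $ j)))"
  have q0: "q (gauge_rel \<delta> C $ i $ j) = \<zero>\<^bsub>T2\<^esub>" for i j
    using ring_hom_zero[OF iT_hom(1) KS.S.ring_axioms F2.T.ring_axioms] by (simp add: q_def h(4)[OF CJ])
  \<comment> \<open>The matrix of the automorphism is a point of the group, so it satisfies the relation for \<open>C\<close>.\<close>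
  have GU: "der_mat T2 G \<oplus>\<^bsub>mring T2\<^esub> U \<otimes>\<^bsub>mring T2\<^esub> G = G \<otimes>\<^bsub>mring T2\<^esub> U"
    using gauge_rel_iff[OF K_gl q.typed_hom_axioms qd C] q0 unfolding G_def U_def by (intro ext) blast
  define Z1 where "Z1 = (\<lambda>i j. f1 (Z i j))"
  define Z2 where "Z2 = (\<lambda>i j. f2 (Z i j))"
  define V where "V = c.qm C"
  note F1 = ring_hom_memE[OF f1_hom] and F2h = ring_hom_memE[OF f2_hom]
  have U1: "U = (\<lambda>i j. f1 (V i j))" and U2: "U = (\<lambda>i j. f2 (V i j))"
    using C by (auto simp: U_def q_def h(3) uT V_def c.qm_def f12_c)
  interpret M2: ring "mring T2 :: ('n \<Rightarrow> 'n \<Rightarrow> _) ring" by (rule ring_mring) (rule F2.T.is_cring)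
  have gc: "h (Kq (mpol_var (Entry i j 0))) \<in> carrier Sr" for i j by (rule hq.closed[OF mpol_var_closed[OF Kg.C]])
  have Gc: "G \<in> carrier (mring T2)" using q.closed[OF mpol_var_closed[OF Kg.C]] by (simp add: G_def mring_simps)
  have Vc: "V \<in> carrier (mring R)" using c_closed by (simp add: V_def c.qm_def mring_simps)
  have Uc: "U \<in> carrier (mring T2)" using Vc F1(1) by (simp add: U1 mring_simps)
  have Zc: "Z1 \<in> carrier (mring T2)" "Z2 \<in> carrier (mring T2)"
    using F1(1) F2h(1) pc_closed by (simp_all add: Z1_def Z2_def mring_simps)
  have dGc: "der_mat T2 G \<in> carrier (mring T2)" using Gc der_T2_closed by (simp add: mring_simps)
  interpret PH: ring_hom_cring TS T2 \<Psi> by unfold_locales (rule P(2))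
  have Z21: "Z2 = Z1 \<otimes>\<^bsub>mring T2\<^esub> G"
  proof (intro ext)
    fix i j
    have "f2 (Z i j) = \<Psi> (\<phi> (tS (Z i j) \<one>\<^bsub>Sr\<^esub>))" by (simp add: P(4) pc_closed)
    also have "\<phi> (tS (Z i j) \<one>\<^bsub>Sr\<^esub>) = (\<Oplus>\<^bsub>TS\<^esub>k\<in>UNIV. tS (Z i k) \<one>\<^bsub>Sr\<^esub> \<otimes>\<^bsub>TS\<^esub> tS \<one>\<^bsub>R\<^esub> (g $ k $ j))"
      using g(2) unfolding pv_matrix_eq by blast
    also have "\<dots> = (\<Oplus>\<^bsub>TS\<^esub>k\<in>UNIV. tS (Z i k) (g $ k $ j))"
      by (intro KS.T.finsum_cong') (use gc in \<open>auto simp: KS.t_mult KS.t_closed pc_closed h(1)\<close>)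
    also have "\<Psi> \<dots> = (\<Oplus>\<^bsub>T2\<^esub>k\<in>UNIV. \<Psi> (tS (Z i k) (g $ k $ j)))"
      by (rule PH.hom_finsum[unfolded comp_def]) (use gc in \<open>auto simp: KS.t_closed pc_closed h(1)\<close>)
    also have "\<dots> = (\<Oplus>\<^bsub>T2\<^esub>k\<in>UNIV. Z1 i k \<otimes>\<^bsub>T2\<^esub> G k j)"
      by (intro F2.T.finsum_cong') (use gc F1(1) IH(1) in \<open>auto simp: P(3) pc_closed h(1) Z1_def G_def q_def\<close>)
    finally show "Z2 i j = (Z1 \<otimes>\<^bsub>mring T2\<^esub> G) i j" by (simp add: Z2_def mring_simps)
  qed
  define E where "E = der_mat R Z \<oplus>\<^bsub>mring R\<^esub> (\<ominus>\<^bsub>mring R\<^esub> (Z \<otimes>\<^bsub>mring R\<^esub> V))"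
  define b where "b = E \<otimes>\<^bsub>mring R\<^esub> W"
  have bc: "b \<in> carrier (mring R)" "E \<in> carrier (mring R)"
    unfolding b_def E_def using Z_matrix_closed Z_closed Vc W_closed by auto
  have e: "der_mat R Z = b \<otimes>\<^bsub>mring R\<^esub> Z \<oplus>\<^bsub>mring R\<^esub> Z \<otimes>\<^bsub>mring R\<^esub> V"
  proof -
    have "b \<otimes>\<^bsub>mring R\<^esub> Z = E" unfolding b_def using bc(2) Z_closed W_closed by (simp add: M.m_assoc W_Z)
    then show ?thesis unfolding E_def using Z_matrix_closed Z_closed Vc by (simp add: M.a_assoc M.l_neg)
  qed
  note im = gauge_hom_image[OF F2.T.is_cring _ _ bc(1) Vc e]
  define b1 where "b1 = (\<lambda>i j. f1 (b i j))"
  define b2 where "b2 = (\<lambda>i j. f2 (b i j))"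
  have b12c: "b1 \<in> carrier (mring T2)" "b2 \<in> carrier (mring T2)"
    using bc(1) F1(1) F2h(1) by (simp_all add: b1_def b2_def mring_simps)
  have d1: "der_mat T2 Z1 = b1 \<otimes>\<^bsub>mring T2\<^esub> Z1 \<oplus>\<^bsub>mring T2\<^esub> Z1 \<otimes>\<^bsub>mring T2\<^esub> U"
    unfolding Z1_def b1_def U1 by (rule im[OF f1_hom der_f(1)])
  have d2: "der_mat T2 Z2 = b2 \<otimes>\<^bsub>mring T2\<^esub> Z2 \<oplus>\<^bsub>mring T2\<^esub> Z2 \<otimes>\<^bsub>mring T2\<^esub> U"
    unfolding Z2_def b2_def U2 by (rule im[OF f2_hom der_f(2)])
  have d21: "der_mat T2 Z2 = der_mat T2 Z1 \<otimes>\<^bsub>mring T2\<^esub> G \<oplus>\<^bsub>mring T2\<^esub> Z1 \<otimes>\<^bsub>mring T2\<^esub> der_mat T2 G"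
    unfolding Z21 by (rule der_mring_mult[OF F2.T_diff_ring Zc(1) Gc])
  have "der_mat T2 Z2 = b1 \<otimes>\<^bsub>mring T2\<^esub> (Z1 \<otimes>\<^bsub>mring T2\<^esub> G) \<oplus>\<^bsub>mring T2\<^esub> Z1 \<otimes>\<^bsub>mring T2\<^esub> (der_mat T2 G \<oplus>\<^bsub>mring T2\<^esub> U \<otimes>\<^bsub>mring T2\<^esub> G)"
    by (rule M2.gauge_transfer[OF Zc(1) Gc b12c(1) Uc dGc d1 d21])
  then have "der_mat T2 Z2 = b1 \<otimes>\<^bsub>mring T2\<^esub> Z2 \<oplus>\<^bsub>mring T2\<^esub> Z2 \<otimes>\<^bsub>mring T2\<^esub> U"
    unfolding GU using Zc Gc Uc by (simp add: Z21 M2.m_assoc)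
  then have "b2 \<otimes>\<^bsub>mring T2\<^esub> Z2 = b1 \<otimes>\<^bsub>mring T2\<^esub> Z2" unfolding d2 using b12c Zc Uc by simp
  moreover have "Z2 \<otimes>\<^bsub>mring T2\<^esub> (\<lambda>i j. f2 (W i j)) = \<one>\<^bsub>mring T2\<^esub>"
  proof -
    have "(\<lambda>i j. f2 ((Z \<otimes>\<^bsub>mring R\<^esub> W) i j)) = Z2 \<otimes>\<^bsub>mring T2\<^esub> (\<lambda>i j. f2 (W i j))"
      unfolding Z2_def by (rule hom_mring_mult[OF R.is_cring F2.T.is_cring f2_hom Z_closed W_closed])
    moreover have "(\<lambda>i j. f2 (\<one>\<^bsub>mring R\<^esub> i j)) = \<one>\<^bsub>mring T2\<^esub>"
      by (rule hom_mring_one[OF R.is_cring F2.T.is_cring f2_hom])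
    ultimately show ?thesis unfolding Z_W by metis
  qed
  moreover have "(\<lambda>i j. f2 (W i j)) \<in> carrier (mring T2)" using W_closed F2h(1) by (simp add: mring_simps)
  ultimately have "b2 = b1" using M2.cancel_right_inverse[OF b12c(2,1) Zc(2)] by blast
  then have "f1 (b i j) = f2 (b i j)" for i j by (simp add: b1_def b2_def fun_eq_iff)
  then have "b i j \<in> range c" for i j
    by (rule equal_in_both_factors[rotated]) (use bc(1) in \<open>auto simp: mring_simps\<close>)
  then obtain B where B: "b = c.qm B" by (rule const_matrix)
  have sV: "(\<lambda>i j. shift R (V i j)) = V" using C by (simp add: V_def c.qm_def shift_c fixed_field_def)
  have sb: "(\<lambda>i j. shift R (b i j)) = c.qm (map_matrix \<sigma> B)" by (simp add: B c.qm_def shift_c map_matrix_def)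
  let ?x = "c.qm (map_matrix \<delta> A) \<oplus>\<^bsub>mring R\<^esub> c.qm A \<otimes>\<^bsub>mring R\<^esub> c.qm B" and ?y = "c.qm (map_matrix \<sigma> B) \<otimes>\<^bsub>mring R\<^esub> c.qm A"
  have xy: "?x \<in> carrier (mring R)" "?y \<in> carrier (mring R)" using Z_matrix_closed by auto
  have "?x \<otimes>\<^bsub>mring R\<^esub> Z = ?y \<otimes>\<^bsub>mring R\<^esub> Z"
    by (rule M.cancel_right_summand[OF _ _ _ shift_relation[OF bc(1) Vc e, unfolded sV sb, unfolded B]])
      (use xy Z_closed Vc Z_matrix_closed(2)[of A] in simp_all)
  then have "?x = ?y" by (rule M.cancel_right_inverse[OF xy Z_closed W_closed Z_W])
  moreover have "?x = c.qm (map_matrix \<delta> A + A ** B)" by (simp add: c.qm_add c.qm_mult)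
  moreover have "?y = c.qm (map_matrix \<sigma> B ** A)" by (simp add: c.qm_mult)
  ultimately have "c.qm (map_matrix \<sigma> B ** A) = c.qm (map_matrix \<delta> A + A ** B)" by simp
  then show ?thesis using that c_qm_inj by blast
qed

text \<open>The relation is tested on the universal point, the class of \<open>X\<close> in \<open>K{X, 1/det X}/J\<close>, where an
  equation between group elements is a statement about membership in \<open>J\<close>. It is derived in the tensor product
  with \<open>R\<close>, into which this ring embeds.\<close>
theorem gauge_constant_if_integrable:
  assumes J: "galois_group_ideal \<sigma> \<delta> A I J" and B: "map_matrix \<sigma> B ** A = map_matrix \<delta> A + A ** B"
  obtains C where "\<And>i j. C $ i $ j \<in> K" "\<And>i j. Kq (gauge_rel \<delta> C $ i $ j) \<in> J"
proof -
  define b where "b = c.qm B"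
  define E where "E = der_mat R Z \<oplus>\<^bsub>mring R\<^esub> (\<ominus>\<^bsub>mring R\<^esub> (b \<otimes>\<^bsub>mring R\<^esub> Z))"
  define V where "V = W \<otimes>\<^bsub>mring R\<^esub> E"
  have bc: "b \<in> carrier (mring R)" unfolding b_def by (rule Z_matrix_closed)
  have Ec: "E \<in> carrier (mring R)" unfolding E_def using Z_matrix_closed Z_closed bc by auto
  have Vc: "V \<in> carrier (mring R)" unfolding V_def using Ec W_closed by auto
  have e: "der_mat R Z = b \<otimes>\<^bsub>mring R\<^esub> Z \<oplus>\<^bsub>mring R\<^esub> Z \<otimes>\<^bsub>mring R\<^esub> V"
  proof -
    have "Z \<otimes>\<^bsub>mring R\<^esub> V = E" unfolding V_def using Ec Z_closed W_closed by (simp add: Z_W flip: M.m_assoc)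
    then show ?thesis unfolding E_def using Z_matrix_closed(1) Z_closed bc by (simp add: M.a_ac M.r_neg)
  qed
  let ?sV = "\<lambda>i j. shift R (V i j)"
  have sVc: "?sV \<in> carrier (mring R)" using Vc ring_hom_memE(1)[OF shift_hom] by (simp add: mring_simps)
  let ?x = "c.qm (map_matrix \<delta> A) \<oplus>\<^bsub>mring R\<^esub> c.qm A \<otimes>\<^bsub>mring R\<^esub> b"
  note Ac = Z_matrix_closed(2)[of A] Z_matrix_closed(2)[of "matrix_inv A"]
  have xc: "?x \<in> carrier (mring R)" using Ac Z_matrix_closed(2)[of "map_matrix \<delta> A"] bc by simp
  have "?x = c.qm (map_matrix \<delta> A + A ** B)" by (simp add: c.qm_add c.qm_mult b_def)
  moreover have "(\<lambda>i j. shift R (b i j)) \<otimes>\<^bsub>mring R\<^esub> c.qm A = c.qm (map_matrix \<sigma> B ** A)"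
    by (simp add: c.qm_mult) (simp add: b_def c.qm_def shift_c map_matrix_def)
  ultimately have x: "(\<lambda>i j. shift R (b i j)) \<otimes>\<^bsub>mring R\<^esub> c.qm A = ?x" by (simp add: B)
  have "c.qm A \<otimes>\<^bsub>mring R\<^esub> (Z \<otimes>\<^bsub>mring R\<^esub> V) = c.qm A \<otimes>\<^bsub>mring R\<^esub> (Z \<otimes>\<^bsub>mring R\<^esub> ?sV)"
    by (rule M.cancel_left_summand[OF _ _ _ shift_relation[OF bc Vc e, unfolded x]])
      (use xc Z_closed Vc sVc Ac(1) in simp_all)
  moreover have "c.qm (matrix_inv A) \<otimes>\<^bsub>mring R\<^esub> c.qm A = \<one>\<^bsub>mring R\<^esub>"
  proof -
    have "matrix_inv A ** A = mat 1" using detA invertible_det_nz[of A] matrix_inv_invertible(2) by blast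
    then have "c.qm (matrix_inv A) \<otimes>\<^bsub>mring R\<^esub> c.qm A = c.qm (mat 1)" by (simp add: c.qm_mult[symmetric])
    also have "\<dots> = \<one>\<^bsub>mring R\<^esub>" by (auto simp: c.qm_def mat_def fun_eq_iff mring_simps c.one c.zero)
    finally show ?thesis .
  qed
  ultimately have "Z \<otimes>\<^bsub>mring R\<^esub> V = Z \<otimes>\<^bsub>mring R\<^esub> ?sV"
    using M.cancel_left_inverse[OF _ _ Ac, of "Z \<otimes>\<^bsub>mring R\<^esub> V" "Z \<otimes>\<^bsub>mring R\<^esub> ?sV"] Z_closed Vc sVc by simp
  then have "V = ?sV" by (rule M.cancel_left_inverse[OF Vc sVc Z_closed W_closed W_Z])
  then have "shift R (V i j) = V i j" for i j by (simp add: fun_eq_iff)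
  then have VK: "\<exists>a\<in>K. V i j = c a" for i j using R_const[of "V i j"] Vc by (simp add: mring_simps)
  then have "V i j \<in> range c" for i j by blast
  then obtain C where C: "V = c.qm C" by (rule const_matrix)
  have CK: "C $ i $ j \<in> K" for i j using VK[of i j] c_inj by (auto simp: C c.qm_def)
  interpret Gd: cring "gl_dring K \<delta> :: ('f, 'n) gl_pol set dring" by (rule Kg.Q.S)
  have Ji: "ideal J (gl_dring K \<delta>)" and Jd: "der (gl_dring K \<delta>) ` J \<subseteq> J"
    using J by (auto simp: galois_group_ideal_def Let_def)
  define S where "S = d_quot (gl_dring K \<delta>) J"
  define h where "h a = J +>\<^bsub>gl_dring K \<delta>\<^esub> a" for a
  interpret Q: quot_hom "gl_dring K \<delta> :: ('f, 'n) gl_pol set dring" S h J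
    unfolding S_def h_def by (rule quot_hom_d_quot[OF Gd.is_cring Ji])
  have hder: "a \<in> carrier (gl_dring K \<delta>) \<Longrightarrow> h (der (gl_dring K \<delta>) a) = der S (h a)" for a
    unfolding S_def h_def by (rule der_d_quot[OF Kg.gl_diff_ring Ji Jd, symmetric])
  have hh: "h \<in> dring_hom (gl_dring K \<delta>) S"
    unfolding dring_hom_def by (auto intro!: ring_hom_memI simp: Q.q_closed Q.q_mult Q.q_add Q.q_one hder)
  have Sd: "diff_ring S"
    by (rule diff_ring_of_surj[OF Kg.gl_diff_ring Q.carr Q.q_mult Q.q_add Q.q_one Q.q_zero hder])
  define q where "q p = h (Kq p)" for p
  interpret q: typed_hom "mpols_over K" S q unfolding q_def by (rule typed_hom_comp(1)[OF hh Q.S])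
  have qd: "q (gl_deriv \<delta> p) = der S (q p)" if "p \<in> mpols_over K" for p
    unfolding q_def by (rule typed_hom_comp(2)[OF hh Q.S that])
  define u where "u a = q (mpol_const a)" for a
  note cK = mpol_const_closed[OF Kg.C]
  have uc: "u a \<in> carrier S" if "a \<in> K" for a unfolding u_def using that by (intro q.closed cK)
  have u: "u (a + b) = u a \<oplus>\<^bsub>S\<^esub> u b" "u (a * b) = u a \<otimes>\<^bsub>S\<^esub> u b" if "a \<in> K" "b \<in> K" for a b
    using that by (simp_all add: u_def const_add const_mult q.add q.mult cK)
  have u1: "u 1 = \<one>\<^bsub>S\<^esub>" by (simp add: u_def const_one q.one)
  have du: "der S (u a) = u (\<delta> a)" if "a \<in> K" for a
    using qd[OF cK[OF that]] by (simp add: u_def gl_deriv_const)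
  have alg: "d_algebra (dring_on K \<delta>) S u"
    unfolding d_algebra_def dring_hom_def using Sd uc u u1 du by (auto intro!: ring_hom_memI)
  define g where "g = (\<chi> i j. q (mpol_var (Entry i j 0)))"
  have "g \<in> gl_points K \<delta> J S u"
    unfolding gl_points_def Kq_def[symmetric]
  proof (rule CollectI, rule exI[of _ h], intro conjI ballI)
    show "g = (\<chi> i j. h (Kq (mpol_var (Entry i j 0))))" by (simp add: g_def q_def)
    show "h \<in> dring_hom (gl_dring K \<delta>) S" by (rule hh)
    show "h (Kq (mpol_const a)) = u a" if "a \<in> K" for a by (simp add: u_def q_def)
    show "h a = \<zero>\<^bsub>S\<^esub>" if "a \<in> J" for a using Q.q_eq_zero[of a] that ideal.Icarr[OF Ji that] by simp
  qed
  then obtain \<phi> where ph: "\<phi> \<in> pv_aut \<sigma> \<delta> A I S u" "pv_matrix \<sigma> \<delta> A I S u \<phi> g"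
    using J[unfolded galois_group_ideal_def Let_def] alg by metis
  interpret TP: tensor_prod R S K c u
    by (rule tensor_prod.intro) (use R_diff Sd c_closed uc du der_c K_closed in auto)
  let ?T = "tensor K R c S u" and ?t = "pure_tensor K R c S u"
  have phi: "\<phi> \<in> ring_hom ?T ?T" "\<And>x. x \<in> carrier ?T \<Longrightarrow> \<phi> (der ?T x) = der ?T (\<phi> x)"
    "\<And>a s. s \<in> carrier S \<Longrightarrow> \<phi> (?t (c a) s) = ?t (c a) s"
    using ph(1) unfolding pv_aut_eq by (auto simp: ring_iso_def)
  note PH = ring_hom_memE[OF phi(1)]
  define e1 where "e1 r = ?t r \<one>\<^bsub>S\<^esub>" for r
  define e2 where "e2 s = ?t \<one>\<^bsub>R\<^esub> s" for s
  have e1h: "e1 \<in> ring_hom R ?T" and e2h: "e2 \<in> ring_hom S ?T"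
    unfolding e1_def e2_def
    by (rule ring_hom_memI; simp add: TP.t_closed TP.t_add1 TP.t_add2 TP.t_mult TP.t_one)+
  note E1 = ring_hom_memE[OF e1h] and E2 = ring_hom_memE[OF e2h]
  have dS: "s \<in> carrier S \<Longrightarrow> der S s \<in> carrier S" for s using Sd by (auto simp: diff_ring_def)
  have de: "r \<in> carrier R \<Longrightarrow> der ?T (e1 r) = e1 (der R r)" "s \<in> carrier S \<Longrightarrow> der ?T (e2 s) = e2 (der S s)" for r s
    using der_one[OF R_diff] der_one[OF Sd]
    by (simp_all add: e1_def e2_def TP.der_t TP.t_zero1 TP.t_zero2 TP.t_closed der_R_closed dS)
  have e12: "e1 (c a) = e2 (u a)" if "a \<in> K" for a
    using TP.t_balanced[OF that, of "\<one>\<^bsub>R\<^esub>" "\<one>\<^bsub>S\<^esub>"] that c_closed uc by (simp add: e1_def e2_def)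
  define pe where "pe r = \<phi> (e1 r)" for r
  have peh: "pe \<in> ring_hom R ?T" unfolding pe_def by (rule ring_hom_memI) (simp_all add: E1 PH)
  have dpe: "r \<in> carrier R \<Longrightarrow> der ?T (pe r) = pe (der R r)" for r
    by (simp add: pe_def phi(2)[symmetric] E1 de)
  have pec: "pe (c a) = e1 (c a)" for a by (simp add: pe_def e1_def phi(3))
  interpret MT: ring "mring ?T :: ('n \<Rightarrow> 'n \<Rightarrow> _) ring" by (rule ring_mring) (rule TP.T.is_cring)
  define G where "G = (\<lambda>i j. e2 (g $ i $ j))"
  define Z1 where "Z1 = (\<lambda>i j. e1 (Z i j))"
  define Z2 where "Z2 = (\<lambda>i j. pe (Z i j))"
  define b1 where "b1 = (\<lambda>i j. e1 (b i j))"
  define U where "U = (\<lambda>i j. e1 (V i j))"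
  have gc: "g $ i $ j \<in> carrier S" for i j by (simp add: g_def q.closed mpol_var_closed[OF Kg.C])
  have Gc: "G \<in> carrier (mring ?T)" using gc E2(1) by (simp add: G_def mring_simps)
  have Zc: "Z1 \<in> carrier (mring ?T)" "Z2 \<in> carrier (mring ?T)" "b1 \<in> carrier (mring ?T)" "U \<in> carrier (mring ?T)"
    using E1(1) ring_hom_memE(1)[OF peh] pc_closed bc Vc by (simp_all add: Z1_def Z2_def b1_def U_def mring_simps)
  have dGc: "der_mat ?T G \<in> carrier (mring ?T)" using Gc TP.der_T_additive by (simp add: mring_simps)
  have Z21: "Z2 = Z1 \<otimes>\<^bsub>mring ?T\<^esub> G"
  proof (intro ext)
    fix i j
    have "\<phi> (?t (Z i j) \<one>\<^bsub>S\<^esub>) = (\<Oplus>\<^bsub>?T\<^esub>k\<in>UNIV. ?t (Z i k) \<one>\<^bsub>S\<^esub> \<otimes>\<^bsub>?T\<^esub> ?t \<one>\<^bsub>R\<^esub> (g $ k $ j))"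
      using ph(2) unfolding pv_matrix_eq by blast
    then show "Z2 i j = (Z1 \<otimes>\<^bsub>mring ?T\<^esub> G) i j"
      by (simp add: Z2_def pe_def e1_def mring_simps Z1_def G_def e2_def)
  qed
  have im: "der_mat ?T (\<lambda>i j. f (Z i j)) = (\<lambda>i j. f (b i j)) \<otimes>\<^bsub>mring ?T\<^esub> (\<lambda>i j. f (Z i j)) \<oplus>\<^bsub>mring ?T\<^esub>
      (\<lambda>i j. f (Z i j)) \<otimes>\<^bsub>mring ?T\<^esub> (\<lambda>i j. f (V i j))"
    if f: "f \<in> ring_hom R ?T" and df: "\<And>r. r \<in> carrier R \<Longrightarrow> der ?T (f r) = f (der R r)" for f
    by (rule gauge_hom_image[OF TP.T.is_cring f df bc Vc e])
  have d1: "der_mat ?T Z1 = b1 \<otimes>\<^bsub>mring ?T\<^esub> Z1 \<oplus>\<^bsub>mring ?T\<^esub> Z1 \<otimes>\<^bsub>mring ?T\<^esub> U"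
    unfolding Z1_def b1_def U_def by (rule im[OF e1h de(1)])
  have d2: "der_mat ?T Z2 = b1 \<otimes>\<^bsub>mring ?T\<^esub> Z2 \<oplus>\<^bsub>mring ?T\<^esub> Z2 \<otimes>\<^bsub>mring ?T\<^esub> U"
    using im[OF peh dpe] by (simp add: Z2_def b1_def U_def b_def C c.qm_def pec)
  have d21: "der_mat ?T Z2 = der_mat ?T Z1 \<otimes>\<^bsub>mring ?T\<^esub> G \<oplus>\<^bsub>mring ?T\<^esub> Z1 \<otimes>\<^bsub>mring ?T\<^esub> der_mat ?T G"
    unfolding Z21 by (rule der_mring_mult[OF TP.T_diff_ring Zc(1) Gc])
  have "der_mat ?T Z2 = b1 \<otimes>\<^bsub>mring ?T\<^esub> Z2 \<oplus>\<^bsub>mring ?T\<^esub> Z1 \<otimes>\<^bsub>mring ?T\<^esub> (der_mat ?T G \<oplus>\<^bsub>mring ?T\<^esub> U \<otimes>\<^bsub>mring ?T\<^esub> G)"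
    using MT.gauge_transfer[OF Zc(1) Gc Zc(3,4) dGc d1 d21] unfolding Z21[symmetric] .
  from trans[OF this[symmetric] d2]
  have "Z1 \<otimes>\<^bsub>mring ?T\<^esub> (der_mat ?T G \<oplus>\<^bsub>mring ?T\<^esub> U \<otimes>\<^bsub>mring ?T\<^esub> G) = Z2 \<otimes>\<^bsub>mring ?T\<^esub> U"
    by (rule MT.cancel_left_summand[rotated 3]) (use Zc Gc dGc in simp_all)
  then have "Z1 \<otimes>\<^bsub>mring ?T\<^esub> (der_mat ?T G \<oplus>\<^bsub>mring ?T\<^esub> U \<otimes>\<^bsub>mring ?T\<^esub> G) = Z1 \<otimes>\<^bsub>mring ?T\<^esub> (G \<otimes>\<^bsub>mring ?T\<^esub> U)"
    unfolding Z21 using Zc Gc by (simp add: MT.m_assoc)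
  moreover have "(\<lambda>i j. e1 (W i j)) \<otimes>\<^bsub>mring ?T\<^esub> Z1 = \<one>\<^bsub>mring ?T\<^esub>"
  proof -
    have "(\<lambda>i j. e1 ((W \<otimes>\<^bsub>mring R\<^esub> Z) i j)) = (\<lambda>i j. e1 (W i j)) \<otimes>\<^bsub>mring ?T\<^esub> Z1"
      unfolding Z1_def by (rule hom_mring_mult[OF R.is_cring TP.T.is_cring e1h W_closed Z_closed])
    moreover have "(\<lambda>i j. e1 (\<one>\<^bsub>mring R\<^esub> i j)) = \<one>\<^bsub>mring ?T\<^esub>"
      by (rule hom_mring_one[OF R.is_cring TP.T.is_cring e1h])
    ultimately show ?thesis unfolding W_Z by metis
  qed
  moreover have "(\<lambda>i j. e1 (W i j)) \<in> carrier (mring ?T)" using W_closed E1(1) by (simp add: mring_simps)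
  ultimately have GT: "der_mat ?T G \<oplus>\<^bsub>mring ?T\<^esub> U \<otimes>\<^bsub>mring ?T\<^esub> G = G \<otimes>\<^bsub>mring ?T\<^esub> U"
    using MT.cancel_left_inverse[of "der_mat ?T G \<oplus>\<^bsub>mring ?T\<^esub> U \<otimes>\<^bsub>mring ?T\<^esub> G" "G \<otimes>\<^bsub>mring ?T\<^esub> U" Z1 "\<lambda>i j. e1 (W i j)"]
      Zc(1,4) Gc dGc by simp
  have U2: "U = (\<lambda>i j. e2 (u (C $ i $ j)))" by (simp add: U_def C c.qm_def e12 CK)
  interpret Tq: typed_hom "mpols_over K" ?T "\<lambda>p. e2 (q p)"
    by (rule typed_hom.intro) (auto simp: E2 q.closed q.add q.mult q.one q.C TP.T.is_cring)
  have e2c: "e2 (q (gauge_rel \<delta> C $ i $ j)) = \<zero>\<^bsub>?T\<^esub>" for i j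
  proof -
    have "e2 (q (gl_deriv \<delta> p)) = der ?T (e2 (q p))" if "p \<in> mpols_over K" for p
      using that by (simp add: qd de q.closed)
    then show ?thesis using gauge_rel_iff[OF K_gl Tq.typed_hom_axioms _ CK, of i j] GT
      by (simp add: G_def g_def U2 u_def)
  qed
  obtain \<mu> where m: "\<And>r. r \<in> carrier R \<Longrightarrow> \<mu> r \<in> K" "\<And>r s. r \<in> carrier R \<Longrightarrow> s \<in> carrier R \<Longrightarrow> \<mu> (r \<oplus>\<^bsub>R\<^esub> s) = \<mu> r + \<mu> s"
    "\<And>a r. a \<in> K \<Longrightarrow> r \<in> carrier R \<Longrightarrow> \<mu> (c a \<otimes>\<^bsub>R\<^esub> r) = a * \<mu> r" "\<mu> \<one>\<^bsub>R\<^esub> = (1::'f)"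
    using K_functional[OF K_closed(1-6)] by blast
  have e2_zero: "s = \<zero>\<^bsub>S\<^esub>" if s: "s \<in> carrier S" "e2 s = \<zero>\<^bsub>?T\<^esub>" for s
  proof -
    have "u (\<mu> \<one>\<^bsub>R\<^esub>) \<otimes>\<^bsub>S\<^esub> s = u (\<mu> \<one>\<^bsub>R\<^esub>) \<otimes>\<^bsub>S\<^esub> \<zero>\<^bsub>S\<^esub>"
      by (rule TP.inj_right[where lam = "\<lambda>r. u (\<mu> r)"])
        (use s TP.t_zero2 in \<open>auto simp: m u uc e2_def\<close>)
    then show ?thesis using s by (simp add: m u1)
  qed
  have crc: "gauge_rel \<delta> C $ i $ j \<in> mpols_over K" for i j by (rule gauge_rel_closed[OF K_gl CK])
  have "Kq (gauge_rel \<delta> C $ i $ j) \<in> J" for i j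
  proof -
    have "q (gauge_rel \<delta> C $ i $ j) = \<zero>\<^bsub>S\<^esub>" by (rule e2_zero[OF q.closed[OF crc] e2c])
    then show ?thesis using Q.q_eq_zero[of "Kq (gauge_rel \<delta> C $ i $ j)"] crc by (simp add: q_def Kq_carrier)
  qed
  then show ?thesis using that CK by blast
qed

end

section \<open>Extension of scalars and conjugation\<close>

lemma gauge_rel_nth:
  "gauge_rel d C $ i $ j = gl_deriv d (mpol_var (Entry i j 0)) + (\<Sum>k\<in>UNIV. mpol_const (C $ i $ k) * mpol_var (Entry k j 0))
    - (\<Sum>k\<in>UNIV. mpol_var (Entry i k 0) * mpol_const (C $ k $ j))"
  by (simp add: gauge_rel_def map_matrix_def matrix_matrix_mult_def gen_mat_nth)

lemma mm_distribs:
  fixes M N L :: "'a::comm_ring_1 ^ 'n::finite ^ 'n"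
  shows "M ** (N + L) = M ** N + M ** L" "(N + L) ** M = N ** M + L ** M"
    "M ** (N - L) = M ** N - M ** L" "(N - L) ** M = N ** M - L ** M" "M ** (- N) = - (M ** N)" "(- N) ** M = - (N ** M)"
  by (simp_all add: vec_eq_iff matrix_matrix_mult_def algebra_simps sum.distrib sum_subtractf sum_negf)

text \<open>The embedding \<open>\<iota>\<close> is a homomorphism on \<open>K\<close> only. Ideals are handled through the polynomials that
  represent their elements.\<close>
locale scalar_extension =
  Kg: gl_setup \<delta> K + d': derivation \<delta>' + i: ring_map_on K \<iota>
  for \<delta> :: "'f::field \<Rightarrow> 'f" and K :: "'f set" and \<delta>' :: "'k::field \<Rightarrow> 'k" and \<iota> :: "'f \<Rightarrow> 'k" +
  fixes J :: "('f, 'n::finite) gl_pol set set"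
  assumes J: "ideal J (gl_dring K \<delta>)"
begin

sublocale F': gl_setup \<delta>' UNIV by unfold_locales (simp_all add: subring_set_UNIV)

abbreviation m :: "('f, 'n) gl_pol \<Rightarrow> ('k, 'n) gl_pol" where "m \<equiv> Poly_Mapping.map \<iota>"
abbreviation cl :: "('k, 'n) gl_pol \<Rightarrow> ('k, 'n) gl_pol set" where "cl \<equiv> gl_class UNIV \<delta>'"
abbreviation KP :: "('f, 'n) gl_pol set" where "KP \<equiv> mpols_over K"

sublocale m: ring_map_on KP m by (rule i.coeff_map)

definition Jt :: "('f, 'n) gl_pol set" where "Jt = {p \<in> KP. gl_class K \<delta> p \<in> J}"
definition E :: "('k, 'n) gl_pol set" where "E = {q. cl q \<in> extend_scalars \<delta>' \<iota> J}"

declare mpols_over_UNIV [simp]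

lemma cl_simps:
  "carrier (gl_dring UNIV \<delta>') = range cl" "cl p \<otimes>\<^bsub>gl_dring UNIV \<delta>'\<^esub> cl q = cl (p * q)"
  "cl p \<oplus>\<^bsub>gl_dring UNIV \<delta>'\<^esub> cl q = cl (p + q)" "\<zero>\<^bsub>gl_dring UNIV \<delta>'\<^esub> = cl 0"
  "cl p = cl q \<longleftrightarrow> p - q \<in> gl_rel UNIV \<delta>'"
  by (simp_all add: F'.gl_class_simps)

lemma gl_rel': "gl_rel UNIV \<delta>' = range (\<lambda>x. x * (gl_eq :: ('k, 'n) gl_pol))"
  by (auto simp: F'.gl_rel_eq)

lemma m_gen: "m gl_eq = gl_eq"
proof -
  have "map_matrix m gen_mat = gen_mat" by (simp add: map_matrix_def gen_mat_nth i.map_var vec_eq_iff)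
  moreover have "m (det gen_mat) = det (map_matrix m gen_mat)" by (rule m.det) (rule gen_mat_closed[OF i.C])
  ultimately show ?thesis
    by (simp add: gl_eq_def m.diff m.mult m.one i.map_var subring_setD[OF m.C] mpol_var_closed[OF i.C] det_gen_mat_closed[OF i.C])
qed

lemma m_rel: "m ` gl_rel K \<delta> \<subseteq> gl_rel UNIV \<delta>'"
proof
  fix q assume "q \<in> m ` gl_rel K \<delta>"
  then obtain x where "x \<in> KP" "q = m (x * gl_eq)" by (auto simp: Kg.gl_rel_eq)
  then have "q = m x * gl_eq" by (simp add: m.mult gl_eq_closed[OF i.C] m_gen)
  then show "q \<in> gl_rel UNIV \<delta>'" by (simp add: gl_rel')
qed

lemma quot_m:
  assumes "p \<in> KP"
  shows "quot_map (gl_pol_dring UNIV \<delta>') (gl_rel UNIV \<delta>') m (gl_class K \<delta> p) = cl (m p)"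
proof -
  interpret R: cring "gl_pol_dring K \<delta> :: ('f, 'n) gl_pol dring" by (rule Kg.pol_cring)
  interpret S: cring "gl_pol_dring UNIV \<delta>' :: ('k, 'n) gl_pol dring" by (rule F'.pol_cring)
  show ?thesis unfolding gl_class_def
    by (rule quot_map_coset[OF R.ring_axioms S.ring_axioms Kg.gl_rel_ideal F'.gl_rel_ideal _ _ m_rel])
      (use assms in \<open>auto simp: gl_pol_dring_def m.add\<close>)
qed

lemma Jt_ideal: "p \<in> Jt \<Longrightarrow> q \<in> Jt \<Longrightarrow> p + q \<in> Jt" "p \<in> Jt \<Longrightarrow> x \<in> KP \<Longrightarrow> x * p \<in> Jt" "gl_eq \<in> Jt" "0 \<in> Jt"
proof -
  interpret J: ideal J "gl_dring K \<delta>" by (rule J)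
  note P = subring_setD[OF m.C]
  note G = Kg.gl_class_simps
  show "p \<in> Jt \<Longrightarrow> q \<in> Jt \<Longrightarrow> p + q \<in> Jt" by (simp add: Jt_def P flip: G(3))
  show m: "p \<in> Jt \<Longrightarrow> x \<in> KP \<Longrightarrow> x * p \<in> Jt" for p x
    by (simp add: Jt_def P G(1) J.I_l_closed flip: G(2))
  have z: "gl_class K \<delta> 0 \<in> J"
    using additive_subgroup.zero_closed[OF ideal.axioms(1)[OF J]] unfolding G(5) .
  then show "0 \<in> Jt" by (simp add: Jt_def P)
  have "(gl_eq :: ('f, 'n) gl_pol) \<in> gl_rel K \<delta>" unfolding Kg.gl_rel_eq using P(1,3) by (auto intro!: exI[of _ 1])
  then have "gl_class K \<delta> gl_eq = gl_class K \<delta> (0 :: ('f, 'n) gl_pol)" by (subst G(6)) (simp_all add: P gl_eq_closed[OF i.C])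
  then show "gl_eq \<in> Jt" using z gl_eq_closed[OF i.C] by (simp add: Jt_def)
qed

lemma E_gens: "p \<in> Jt \<Longrightarrow> m p \<in> E"
  and E_add: "p' \<in> E \<Longrightarrow> q' \<in> E \<Longrightarrow> p' + q' \<in> E" and E_mult: "p' \<in> E \<Longrightarrow> x' * p' \<in> E"
proof -
  interpret G: cring "gl_dring UNIV \<delta>' :: ('k, 'n) gl_pol set dring" by (rule F'.Q.S)
  let ?g = "quot_map (gl_pol_dring UNIV \<delta>') (gl_rel UNIV \<delta>') m ` J"
  have Jc: "J \<subseteq> gl_class K \<delta> ` KP" using ideal.Icarr[OF J] by (auto simp: Kg.gl_class_simps(1))
  have g: "?g \<subseteq> carrier (gl_dring UNIV \<delta>')"
  proof (rule image_subsetI)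
    fix a assume "a \<in> J"
    then obtain p where "p \<in> KP" "a = gl_class K \<delta> p" using Jc by blast
    then show "quot_map (gl_pol_dring UNIV \<delta>') (gl_rel UNIV \<delta>') m a \<in> carrier (gl_dring UNIV \<delta>')"
      by (simp add: quot_m cl_simps(1))
  qed
  interpret I: ideal "extend_scalars \<delta>' \<iota> J" "gl_dring UNIV \<delta>'"
    unfolding extend_scalars_def by (rule G.genideal_ideal[OF g])
  show "p' \<in> E \<Longrightarrow> q' \<in> E \<Longrightarrow> p' + q' \<in> E" using I.a_closed[of "cl p'" "cl q'"] by (simp add: E_def cl_simps)
  show "p' \<in> E \<Longrightarrow> x' * p' \<in> E" using I.I_l_closed[of "cl p'" "cl x'"] by (simp add: E_def cl_simps(1-3))
  show "p \<in> Jt \<Longrightarrow> m p \<in> E"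
    using G.genideal_self[OF g] quot_m[of p] by (auto simp: E_def Jt_def extend_scalars_def)
qed

text \<open>The extended ideal is generated by the image of \<open>J\<close>, so an ideal of polynomials that contains the image
  of \<open>Jt\<close> (and with it the defining relation of the localization) contains all representatives.\<close>
lemma E_least:
  assumes g: "\<And>p. p \<in> Jt \<Longrightarrow> m p \<in> E0" and a: "\<And>p q. p \<in> E0 \<Longrightarrow> q \<in> E0 \<Longrightarrow> p + q \<in> E0" and mu: "\<And>p x. p \<in> E0 \<Longrightarrow> x * p \<in> E0"
  shows "E \<subseteq> E0"
proof
  interpret G: cring "gl_dring UNIV \<delta>' :: ('k, 'n) gl_pol set dring" by (rule F'.Q.S)
  let ?g = "quot_map (gl_pol_dring UNIV \<delta>') (gl_rel UNIV \<delta>') m ` J"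
  have Jc: "J \<subseteq> gl_class K \<delta> ` KP" using ideal.Icarr[OF J] by (auto simp: Kg.gl_class_simps(1))
  have z: "0 \<in> E0" using g[OF Jt_ideal(4)] m.zero by simp
  have eq: "gl_eq \<in> E0" using g[OF Jt_ideal(3)] by (simp add: m_gen)
  have I0: "ideal (cl ` E0) (gl_dring UNIV \<delta>')"
    by (rule cring_idealI[OF G.is_cring]) (use a mu z in \<open>auto simp: cl_simps\<close>)
  have "?g \<subseteq> cl ` E0"
  proof
    fix y assume "y \<in> ?g"
    then obtain j where j: "j \<in> J" "y = quot_map (gl_pol_dring UNIV \<delta>') (gl_rel UNIV \<delta>') m j" by blast
    then obtain p where p: "p \<in> KP" "j = gl_class K \<delta> p" using Jc by blast
    then have "p \<in> Jt" using j by (simp add: Jt_def)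
    then show "y \<in> cl ` E0" using g quot_m[OF p(1)] by (auto simp: j p)
  qed
  then have sub: "extend_scalars \<delta>' \<iota> J \<subseteq> cl ` E0" unfolding extend_scalars_def by (rule G.genideal_minimal[OF I0])
  fix q assume "q \<in> E"
  then obtain q0 where q0: "q0 \<in> E0" "cl q = cl q0" using sub by (auto simp: E_def)
  then obtain x where x: "q - q0 = x * gl_eq" by (auto simp: cl_simps(5) gl_rel')
  have "q0 + x * gl_eq \<in> E0" by (intro a mu q0 eq)
  then show "q \<in> E0" using x by (simp add: algebra_simps flip: x)
qed

lemma E_gl_eq: "gl_eq \<in> E" using E_gens[OF Jt_ideal(3)] by (simp add: m_gen)

text \<open>Applying the retraction \<open>l\<close> to coefficients is linear over polynomials with coefficients in \<open>K\<close>; hence the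
  polynomials all of whose multiples are mapped into \<open>Jt\<close> form an ideal containing the generators. The
  coefficients of the derivative and of the products in the relation are \<open>1\<close> and entries of \<open>C\<close>, so \<open>l\<close> just
  replaces \<open>C\<close> by \<open>l C\<close>.\<close>
lemma descend:
  fixes l :: "'k \<Rightarrow> 'f"
  assumes l: "\<And>x y. l (x + y) = l x + l y" "\<And>x. l x \<in> K" "\<And>a x. a \<in> K \<Longrightarrow> l (\<iota> a * x) = a * l x" "l 1 = 1"
    and C: "\<And>i j. gauge_rel \<delta>' C $ i $ j \<in> E"
  shows "gauge_rel \<delta> (map_matrix l C) $ i $ j \<in> Jt"
proof -
  let ?l = "Poly_Mapping.map l :: ('k, 'n) gl_pol \<Rightarrow> ('f, 'n) gl_pol"
  have l0: "l 0 = 0" using l(1)[of 0 0] by (metis add_0_right add_left_imp_eq)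
  have add: "?l (p + q) = ?l p + ?l q" for p q
    by (rule poly_mapping_eqI) (auto simp: map.rep_eq lookup_add l0 when_def simp flip: l(1))
  have lK: "?l p \<in> KP" for p by (auto simp: mpols_over_def map.rep_eq when_def l(2) subring_setD[OF i.C])
  have lmult: "?l (m p * q) = p * ?l q" if "p \<in> KP" for p q
    using that i.C
  proof (induction rule: mpols_over_induct)
    case (single \<alpha> a)
    have "q \<in> mpols_over UNIV" by simp
    then show ?case using subring_set_UNIV
    proof (induction rule: mpols_over_induct)
      case (single \<beta> b)
      then show ?case using \<open>a \<in> K\<close> by (simp add: mult_single l l0 i.zero)
    next
      case (add q1 q2)
      then show ?case by (simp add: distrib_left \<open>\<And>p q. ?l (p + q) = ?l p + ?l q\<close>)
    qed
  next
    case (add p1 p2)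
    then show ?case by (simp add: distrib_right m.add \<open>\<And>p q. ?l (p + q) = ?l p + ?l q\<close>)
  qed
  have "E \<subseteq> {q. \<forall>y. ?l (y * q) \<in> Jt}"
  proof (rule E_least)
    show "m p \<in> {q. \<forall>y. ?l (y * q) \<in> Jt}" if p: "p \<in> Jt" for p
    proof -
      have "?l (y * m p) = ?l y * p" for y using lmult[of p y] p by (simp add: Jt_def mult.commute)
      then show ?thesis using Jt_ideal(2)[OF p lK] by simp
    qed
    show "p + q \<in> {q. \<forall>y. ?l (y * q) \<in> Jt}" if "p \<in> {q. \<forall>y. ?l (y * q) \<in> Jt}" "q \<in> {q. \<forall>y. ?l (y * q) \<in> Jt}" for p q
      using that by (simp add: distrib_left add Jt_ideal(1))
    show "x * p \<in> {q. \<forall>y. ?l (y * q) \<in> Jt}" if "p \<in> {q. \<forall>y. ?l (y * q) \<in> Jt}" for p x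
      using that by (simp flip: mult.assoc)
  qed
  then have "?l (1 * gauge_rel \<delta>' C $ i $ j) \<in> Jt" using C[of i j] by blast
  moreover have "?l (gauge_rel \<delta>' C $ i $ j) = gauge_rel \<delta> (map_matrix l C) $ i $ j"
  proof -
    have lv: "?l (mpol_var v) = mpol_var v" for v by (simp add: mpol_var_def l0 l)
    have lc: "?l (mpol_const a * mpol_var v) = mpol_const (l a) * mpol_var v" "?l (mpol_var v * mpol_const a) = mpol_var v * mpol_const (l a)" for a v
      by (simp_all add: mpol_var_def mpol_const_def mult_single l0)
    have z: "?l 0 = 0" using add[of 0 0] by simp
    have lsum: "?l (sum f S) = (\<Sum>k\<in>S. ?l (f k))" for f and S :: "'n set"
      by (induction S rule: infinite_finite_induct) (simp_all add: z add)
    have ld: "?l (p - q) = ?l p - ?l q" for p q using add[of "p - q" q] by simp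
    show ?thesis
      unfolding gauge_rel_nth ld add lsum lc d'.gl_deriv_Entry Kg.gl_deriv_Entry lv by (simp add: map_matrix_def)
  qed
  ultimately show ?thesis by simp
qed

lemma ascend:
  assumes C: "\<And>i j. C $ i $ j \<in> K" and J: "\<And>i j. gauge_rel \<delta> C $ i $ j \<in> Jt"
  shows "gauge_rel \<delta>' (map_matrix \<iota> C) $ i $ j \<in> E"
proof -
  note P = subring_setD(1,3-)[OF m.C] mpol_var_closed[OF i.C] mpol_const_closed[OF i.C]
  have s: "(\<Sum>k\<in>UNIV. mpol_const (C $ i $ k) * mpol_var (Entry k j 0)) \<in> KP" "(\<Sum>k\<in>UNIV. mpol_var (Entry i k 0) * mpol_const (C $ k $ j)) \<in> KP"
    using C by (auto intro!: subring_set_sum[OF m.C] P)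
  have "m (gauge_rel \<delta> C $ i $ j) = gauge_rel \<delta>' (map_matrix \<iota> C) $ i $ j"
    unfolding gauge_rel_nth d'.gl_deriv_Entry Kg.gl_deriv_Entry
    using C s by (simp add: m.diff m.add m.sum m.mult i.map_var i.map_const map_matrix_def P)
  then show ?thesis using E_gens[OF J[of i j]] by simp
qed

text \<open>The derivative of \<open>P X P\<^sup>-\<^sup>1\<close> is \<open>P (X' + C X - X C) P\<^sup>-\<^sup>1\<close> with \<open>C = P\<^sup>-\<^sup>1 P'\<close>, and multiplication by the
  matrices \<open>P\<close> and \<open>P\<^sup>-\<^sup>1\<close> does not affect membership in an ideal.\<close>
lemma conj_constant_iff:
  assumes P: "invertible P"
  shows "constant_dgroup \<delta>' (conj_ideal \<delta>' P (extend_scalars \<delta>' \<iota> J)) \<longleftrightarrow>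
    (\<forall>i j. gauge_rel \<delta>' (matrix_inv P ** map_matrix \<delta>' P) $ i $ j \<in> E)"
proof -
  let ?c = "map_matrix mpol_const :: 'k ^ 'n ^ 'n \<Rightarrow> ('k, 'n) gl_pol ^ 'n ^ 'n"
  let ?X = "gen_mat :: ('k, 'n) gl_pol ^ 'n ^ 'n"
  let ?D = "gl_deriv \<delta>' :: ('k, 'n) gl_pol \<Rightarrow> _"
  let ?Q = "matrix_inv P"
  let ?Y = "?c P ** ?X ** ?c ?Q"
  interpret cc: ring_map_on UNIV "mpol_const :: 'k \<Rightarrow> ('k, 'n) gl_pol" by (rule mpol_const_map)
  have cm: "?c (M ** N) = ?c M ** ?c N" for M N
    by (simp add: vec_eq_iff map_matrix_def matrix_matrix_mult_def cc.sum cc.mult)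
  have c1: "?c (mat 1) = mat 1" by (simp add: vec_eq_iff map_matrix_def mat_def cc.one cc.zero)
  have PQ: "?c P ** ?c ?Q = mat 1" "?c ?Q ** ?c P = mat 1"
    using matrix_inv_invertible[OF P] by (simp_all add: c1 flip: cm)
  let ?h = "gl_conj \<delta>' P"
  interpret h: ring_map_on "UNIV :: ('k, 'n) gl_pol set" ?h
    unfolding gl_conj_def using cc.subst_map by simp
  have hv: "?h (mpol_var (Entry i j k)) = (?D ^^ k) (?Y $ i $ j)" "?h (mpol_var InvDet) = mpol_var InvDet" for i j k
    unfolding gl_conj_def by (simp_all add: cc.subst_var)
  have hX: "map_matrix ?h ?X = ?Y" by (simp add: vec_eq_iff map_matrix_def gen_mat_nth hv)
  have "det ?Y = det ?X"
  proof -
    have "det (?c P) * det (?c ?Q) = 1" using PQ(1) det_mul[of "?c P" "?c ?Q"] by simp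
    then show ?thesis by (simp add: det_mul algebra_simps)
  qed
  then have heq: "?h gl_eq = gl_eq" using h.det[of ?X] by (simp add: gl_eq_def h.diff h.mult h.one hv hX)
  have hrel: "?h ` gl_rel UNIV \<delta>' \<subseteq> gl_rel UNIV \<delta>'" by (auto simp: gl_rel' h.mult heq)
  interpret R: cring "gl_pol_dring UNIV \<delta>' :: ('k, 'n) gl_pol dring" by (rule F'.pol_cring)
  have qh: "quot_map (gl_pol_dring UNIV \<delta>') (gl_rel UNIV \<delta>') ?h (cl p) = cl (?h p)" for p
    unfolding gl_class_def
    by (rule quot_map_coset[OF R.ring_axioms R.ring_axioms F'.gl_rel_ideal F'.gl_rel_ideal _ _ hrel]) (auto simp: gl_pol_dring_def h.add)
  have E_sum: "sum f S \<in> E" if "\<And>k. f k \<in> E" for f and S :: "'n set"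
    using that E_mult[OF E_gl_eq, of 0] by (induction S rule: infinite_finite_induct) (auto simp: E_add)
  have E_mat: "(M ** N ** L) $ i $ j \<in> E" if N: "\<And>i j. N $ i $ j \<in> E" for M N L :: "('k, 'n) gl_pol ^ 'n ^ 'n" and i j
    unfolding matrix_matrix_mult_def vec_lambda_beta by (intro E_sum, subst mult.commute, intro E_mult E_sum N)
  have "constant_dgroup \<delta>' (conj_ideal \<delta>' P (extend_scalars \<delta>' \<iota> J)) \<longleftrightarrow> (\<forall>i j. ?D (?Y $ i $ j) \<in> E)"
    unfolding constant_dgroup_def conj_ideal_def
    by (simp add: F'.der_gl_class d'.gl_deriv_Entry qh hv E_def cl_simps(1))
  also have "\<dots> \<longleftrightarrow> (\<forall>i j. map_matrix ?D ?Y $ i $ j \<in> E)" by (simp add: map_matrix_def)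
  also have "map_matrix ?D ?Y = ?c P ** gauge_rel \<delta>' (?Q ** map_matrix \<delta>' P) ** ?c ?Q"
  proof -
    interpret D: derivation ?D by (rule d'.gl_derivation)
    have dc: "map_matrix ?D (?c M) = ?c (map_matrix \<delta>' M)" for M
      by (simp add: map_matrix_def vec_eq_iff d'.gl_deriv_const)
    have "map_matrix ?D (?c P ** ?c ?Q) = map_matrix ?D (?c P) ** ?c ?Q + ?c P ** map_matrix ?D (?c ?Q)" by (rule D.matrix_mult)
    then have z: "map_matrix ?D (?c P) ** ?c ?Q + ?c P ** map_matrix ?D (?c ?Q) = 0" by (simp add: PQ D.matrix_one)
    have "?c ?Q ** (map_matrix ?D (?c P) ** ?c ?Q + ?c P ** map_matrix ?D (?c ?Q)) = ?c ?Q ** map_matrix ?D (?c P) ** ?c ?Q + (?c ?Q ** ?c P) ** map_matrix ?D (?c ?Q)"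
      by (simp add: matrix_add_ldistrib matrix_mul_assoc)
    then have dQ: "map_matrix ?D (?c ?Q) = - (?c ?Q ** map_matrix ?D (?c P) ** ?c ?Q)"
      unfolding z by (simp add: PQ eq_neg_iff_add_eq_0 add.commute)
    have "map_matrix ?D ?Y = (map_matrix ?D (?c P) ** ?X + ?c P ** map_matrix ?D ?X) ** ?c ?Q + ?c P ** ?X ** map_matrix ?D (?c ?Q)"
      by (simp add: D.matrix_mult)
    also have "\<dots> = ?c P ** (map_matrix ?D ?X + (?c ?Q ** map_matrix ?D (?c P)) ** ?X - ?X ** (?c ?Q ** map_matrix ?D (?c P))) ** ?c ?Q"
    proof -
      have "?c P ** ((?c ?Q ** map_matrix ?D (?c P)) ** ?X) = map_matrix ?D (?c P) ** ?X"
        using PQ(1) by (simp add: matrix_mul_assoc)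
      then show ?thesis unfolding dQ
        by (simp add: mm_distribs matrix_mul_assoc algebra_simps)
    qed
    also have "\<dots> = ?c P ** gauge_rel \<delta>' (?Q ** map_matrix \<delta>' P) ** ?c ?Q" by (simp add: gauge_rel_def cm dc)
    finally show ?thesis .
  qed
  also have "(\<forall>i j. (?c P ** gauge_rel \<delta>' (?Q ** map_matrix \<delta>' P) ** ?c ?Q) $ i $ j \<in> E) \<longleftrightarrow> (\<forall>i j. gauge_rel \<delta>' (?Q ** map_matrix \<delta>' P) $ i $ j \<in> E)" (is "?l \<longleftrightarrow> ?r")
  proof
    assume ?r then show ?l by (auto intro: E_mat)
  next
    assume ?l
    then have 0: "(?c P ** gauge_rel \<delta>' (?Q ** map_matrix \<delta>' P) ** ?c ?Q) $ i $ j \<in> E" for i j by blast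
    have 1: "(?c ?Q ** (?c P ** gauge_rel \<delta>' (?Q ** map_matrix \<delta>' P) ** ?c ?Q) ** ?c P) $ i $ j \<in> E" for i j by (rule E_mat[OF 0])
    have 2: "?c ?Q ** (?c P ** N ** ?c ?Q) ** ?c P = (?c ?Q ** ?c P) ** N ** (?c ?Q ** ?c P)" for N
      by (simp only: matrix_mul_assoc)
    show ?r using 1 unfolding 2 by (simp add: PQ)
  qed
  finally show ?thesis .
qed

end

section \<open>Derivations of fraction fields\<close>

definition fract_deriv :: "('a::idom \<Rightarrow> 'a) \<Rightarrow> 'a fract \<Rightarrow> 'a fract" where
  "fract_deriv d q = (SOME r. \<exists>a b. b \<noteq> 0 \<and> q = Fract a b \<and> r = Fract (d a * b - a * d b) (b * b))"

text \<open>The quotient rule does not depend on the fraction: \<open>x\<close>, \<open>y\<close>, \<open>x'\<close>, \<open>y'\<close> stand for the derivatives of \<open>a\<close>,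
  \<open>b\<close>, \<open>a'\<close>, \<open>b'\<close>, so that the second assumption is the derivative of the first.\<close>
lemma quotient_rule_well_defined:
  fixes a b a' b' x y x' y' :: "'a::comm_ring_1"
  assumes "a * b' = a' * b" "x * b' + a * y' = x' * b + a' * y"
  shows "(x' * b' - a' * y') * (b * b) = (x * b - a * y) * (b' * b')"
proof -
  have "(x' * b' - a' * y') * (b * b) - (x * b - a * y) * (b' * b') =
    - (b * b') * ((x * b' + a * y') - (x' * b + a' * y)) + (y' * b + y * b') * (a * b' - a' * b)"
    by (simp add: algebra_simps)
  then show ?thesis using assms by simp
qed

lemma fract_deriv_Fract:
  fixes d :: "'a::idom \<Rightarrow> 'a"
  assumes d: "derivation d" and b: "b \<noteq> 0"
  shows "fract_deriv d (Fract a b) = Fract (d a * b - a * d b) (b * b)"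
proof -
  interpret derivation d by fact
  have "Fract (d a' * b' - a' * d b') (b' * b') = Fract (d a * b - a * d b) (b * b)"
    if ab: "b' \<noteq> 0" "Fract a b = Fract a' b'" for a' b'
  proof -
    have e: "a * b' = a' * b" using ab b by (simp add: eq_fract)
    then have "d (a * b') = d (a' * b)" by simp
    then have de: "d a * b' + a * d b' = d a' * b + a' * d b" by (simp add: mult)
    have "(d a' * b' - a' * d b') * (b * b) = (d a * b - a * d b) * (b' * b')"
      by (rule quotient_rule_well_defined[OF e de])
    then show ?thesis using b ab by (simp add: eq_fract)
  qed
  note 1 = this
  have "\<exists>r a' b'. b' \<noteq> 0 \<and> Fract a b = Fract a' b' \<and> r = Fract (d a' * b' - a' * d b') (b' * b')"
    using b by blast
  from someI_ex[OF this] obtain a' b' where "b' \<noteq> 0" "Fract a b = Fract a' b'"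
    "fract_deriv d (Fract a b) = Fract (d a' * b' - a' * d b') (b' * b')"
    unfolding fract_deriv_def by blast
  then show ?thesis using 1 by simp
qed

lemma fract_derivation:
  fixes d :: "'a::idom \<Rightarrow> 'a"
  assumes d: "derivation d" shows "derivation (fract_deriv d)"
proof
  interpret derivation d by fact
  fix p q :: "'a fract"
  obtain a b where p: "p = Fract a b" "b \<noteq> 0" by (cases p)
  obtain a' b' where q: "q = Fract a' b'" "b' \<noteq> 0" by (cases q)
  show "fract_deriv d (p + q) = fract_deriv d p + fract_deriv d q"
    using p(2) q(2) by (simp add: p(1) q(1) fract_deriv_Fract[OF d] eq_fract add mult) (simp add: algebra_simps)
  show "fract_deriv d (p * q) = fract_deriv d p * q + p * fract_deriv d q"
    using p(2) q(2) by (simp add: p(1) q(1) fract_deriv_Fract[OF d] eq_fract mult) (simp add: algebra_simps)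
qed

section \<open>Injective codes for rational functions\<close>

text \<open>Lists of lists describe polynomials: a list of length one is a constant, other lists encode a variable by
  their length. Concatenation of descriptions multiplies monomials and adds polynomials.\<close>
definition tok :: "'k::field list \<Rightarrow> (nat, 'k) mpol" where
  "tok zs = (if length zs = 1 then mpol_const (hd zs) else mpol_var (length zs - 2))"

definition mon :: "'k::field list list \<Rightarrow> (nat, 'k) mpol" where "mon ms = prod_list (map tok ms)"
definition pol :: "'k::field list list list \<Rightarrow> (nat, 'k) mpol" where "pol ps = sum_list (map mon ps)"

lemma pol_surj: "\<exists>ps. pol ps = p"
proof -
  have mm: "mon ms * mon ns \<in> range mon" for ms ns :: "'a list list" by (rule range_eqI[of _ _ "ms @ ns"]) (simp add: mon_def)
  have mmr: "p * q \<in> range (mon :: 'a list list \<Rightarrow> _)" if "p \<in> range mon" "q \<in> range mon" for p q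
    using that by (elim rangeE) (simp add: mm)
  have m1: "1 \<in> range (mon :: 'a list list \<Rightarrow> _)" by (rule range_eqI[of _ _ "[]"]) (simp add: mon_def)
  have mv: "mpol_var v \<in> range (mon :: 'a list list \<Rightarrow> _)" for v
    by (rule range_eqI[of _ _ "[replicate (v + 2) 0]"]) (simp add: mon_def tok_def)
  have mc: "mpol_const a \<in> range (mon :: 'a list list \<Rightarrow> _)" for a
    by (rule range_eqI[of _ _ "[[a]]"]) (simp add: mon_def tok_def)
  have mw: "mpol_var v ^ k \<in> range (mon :: 'a list list \<Rightarrow> _)" for v k
    by (induction k) (simp_all add: m1 mv mmr)
  have mp: "(\<Prod>v\<in>S. mpol_var v ^ g v) \<in> range (mon :: 'a list list \<Rightarrow> _)" for S and g :: "nat \<Rightarrow> nat"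
    by (induction S rule: infinite_finite_induct) (simp_all add: m1 mw mmr)
  have "p \<in> mpols_over UNIV" by (simp add: mpols_over_def)
  then show ?thesis using subring_set_UNIV
  proof (induction rule: mpols_over_induct)
    case (single \<alpha> a)
    have "Poly_Mapping.single \<alpha> a \<in> range mon" unfolding single_eq_const_times_vars by (intro mmr mc mp)
    then obtain ms where "mon ms = Poly_Mapping.single \<alpha> a" by auto
    then have "pol [ms] = Poly_Mapping.single \<alpha> a" by (simp add: pol_def)
    then show ?case by blast
  next
    case (add p q)
    then obtain ps qs where "pol ps = p" "pol qs = q" by blast
    then have "pol (ps @ qs) = p + q" by (simp add: pol_def)
    then show ?case by blast
  qed
qed

lemma exists_fract_code:
  assumes "infinite (UNIV :: 'k::field set)" shows "\<exists>j :: (nat, 'k) mpol fract \<Rightarrow> 'k. inj j"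
proof -
  obtain s :: "'k list \<Rightarrow> 'k" where s: "inj s" using exists_inj_list[OF assms] by blast
  let ?cc = "\<lambda>ps. s (map (\<lambda>ms. s (map s ms)) ps)"
  have ci: "inj ?cc"
  proof -
    have "inj (\<lambda>ms. s (map s ms))" using inj_compose[OF s inj_mapI[OF s]] by (simp add: comp_def)
    from inj_compose[OF s inj_mapI[OF this]] show ?thesis by (simp add: comp_def)
  qed
  obtain r where r: "pol (r p) = p" for p :: "(nat, 'k) mpol" using pol_surj by metis
  have "\<exists>ab. (\<lambda>(a, b). q = Fract a b) ab" for q :: "(nat, 'k) mpol fract" by (cases q) auto
  then obtain f where f: "(\<lambda>(a, b). q = Fract a b) (f q)" for q :: "(nat, 'k) mpol fract" by metis
  have "inj (\<lambda>q. s [?cc (r (fst (f q))), ?cc (r (snd (f q)))])"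
  proof (rule injI)
    fix q q' assume "s [?cc (r (fst (f q))), ?cc (r (snd (f q)))] = s [?cc (r (fst (f q'))), ?cc (r (snd (f q')))]"
    then have "?cc (r (fst (f q))) = ?cc (r (fst (f q')))" "?cc (r (snd (f q))) = ?cc (r (snd (f q')))" using injD[OF s] by blast+
    then have "r (fst (f q)) = r (fst (f q'))" "r (snd (f q)) = r (snd (f q'))" using injD[OF ci] by blast+
    then have "f q = f q'" using r by (metis prod.expand)
    then show "q = q'" using f[of q] f[of q'] by auto
  qed
  then show ?thesis by blast
qed

section \<open>Linear systems over a differentially closed field\<close>

lemma finsum_dring_on:
  assumes "subring_set C" "finite A" "\<And>x. x \<in> A \<Longrightarrow> f x \<in> C" shows "(\<Oplus>\<^bsub>dring_on C d\<^esub>x\<in>A. f x) = sum f A"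
proof -
  interpret cring "dring_on C d" by (rule cring_dring_on) fact
  show ?thesis using assms(2,3) by (induction A rule: finite_induct) (auto simp: finsum_insert Pi_def)
qed

lemma finprod_dring_on:
  assumes "subring_set C" "finite A" "\<And>x. x \<in> A \<Longrightarrow> f x \<in> C" shows "(\<Otimes>\<^bsub>dring_on C d\<^esub>x\<in>A. f x) = prod f A"
proof -
  interpret cring "dring_on C d" by (rule cring_dring_on) fact
  show ?thesis using assms(2,3) by (induction A rule: finite_induct) (auto simp: finprod_insert Pi_def)
qed

lemma dpoly_eval_typed:
  fixes p :: "(nat \<times> nat, 'k::comm_ring_1) mpol"
  shows "dpoly_eval (dring_on UNIV d) (dring_on UNIV d') h y (Poly_Mapping.lookup p) = mpol_subst h (\<lambda>w. (d' ^^ snd w) (y (fst w))) p"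
proof -
  have "{\<alpha>. Poly_Mapping.lookup p \<alpha> \<noteq> 0} = Poly_Mapping.keys p" by (auto simp: in_keys_iff)
  then show ?thesis unfolding dpoly_eval_def mpol_subst_def
    by (simp add: finsum_dring_on subring_set_UNIV finprod_dring_on nat_pow_dring_on)
qed

text \<open>Moves a solution from a fraction field to the type over which differential closedness is tested.\<close>
lemma dpoly_eval_hom:
  assumes L: "diff_ring L" and L': "cring L'" and f: "f \<in> ring_hom L L'" and df: "\<And>a. a \<in> carrier L \<Longrightarrow> f (der L a) = der L' (f a)"
    and h: "\<And>a. a \<in> carrier M \<Longrightarrow> h a \<in> carrier L" and p: "p \<in> dpolys M m" and y: "\<And>v. v < m \<Longrightarrow> y v \<in> carrier L"
  shows "f (dpoly_eval M L h y p) = dpoly_eval M L' (\<lambda>a. f (h a)) (\<lambda>v. f (y v)) p"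
proof -
  interpret L: cring L using L by (simp add: diff_ring_def)
  interpret L': cring L' by (rule L')
  interpret f: ring_hom_cring L L' f by unfold_locales (rule f)
  have d: "der L a \<in> carrier L" if "a \<in> carrier L" for a using that L by (auto simp: diff_ring_def)
  have it: "(der L ^^ k) a \<in> carrier L \<and> f ((der L ^^ k) a) = (der L' ^^ k) (f a)" if "a \<in> carrier L" for a k
    using that by (induction k) (auto simp: d df)
  have pw: "f (a [^]\<^bsub>L\<^esub> (k::nat)) = f a [^]\<^bsub>L'\<^esub> k" if "a \<in> carrier L" for a k
    using that by (induction k) auto
  let ?S = "{\<alpha>. p \<alpha> \<noteq> \<zero>\<^bsub>M\<^esub>}"
  have p0: "p \<alpha> \<in> carrier M" for \<alpha> using p by (auto simp: dpolys_def)
  have p1: "y (fst w) \<in> carrier L" if "\<alpha> \<in> ?S" "w \<in> Poly_Mapping.keys \<alpha>" for \<alpha> w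
  proof -
    have "Poly_Mapping.keys \<alpha> \<subseteq> {..<m} \<times> UNIV" using p that(1) by (simp add: dpolys_def)
    then show ?thesis using that(2) by (intro y) auto
  qed
  have wc: "(der L ^^ snd w) (y (fst w)) [^]\<^bsub>L\<^esub> (k::nat) \<in> carrier L" if "\<alpha> \<in> ?S" "w \<in> Poly_Mapping.keys \<alpha>" for \<alpha> w k
    using it[OF p1[OF that]] by simp
  have mc: "(\<Otimes>\<^bsub>L\<^esub>w\<in>Poly_Mapping.keys \<alpha>. (der L ^^ snd w) (y (fst w)) [^]\<^bsub>L\<^esub> Poly_Mapping.lookup \<alpha> w) \<in> carrier L" if "\<alpha> \<in> ?S" for \<alpha>
    by (rule L.finprod_closed) (use wc that in auto)
  have "f (dpoly_eval M L h y p) = (\<Oplus>\<^bsub>L'\<^esub>\<alpha>\<in>?S. f (h (p \<alpha>) \<otimes>\<^bsub>L\<^esub>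
     (\<Otimes>\<^bsub>L\<^esub>w\<in>Poly_Mapping.keys \<alpha>. (der L ^^ snd w) (y (fst w)) [^]\<^bsub>L\<^esub> Poly_Mapping.lookup \<alpha> w)))"
    unfolding dpoly_eval_def
    by (subst f.hom_finsum) (use mc h p0 in \<open>simp_all add: comp_def Pi_def\<close>)
  also have "\<dots> = dpoly_eval M L' (\<lambda>a. f (h a)) (\<lambda>v. f (y v)) p"
    unfolding dpoly_eval_def
  proof (rule L'.finsum_cong')
    fix \<alpha> assume a: "\<alpha> \<in> ?S"
    have "f (\<Otimes>\<^bsub>L\<^esub>w\<in>Poly_Mapping.keys \<alpha>. (der L ^^ snd w) (y (fst w)) [^]\<^bsub>L\<^esub> Poly_Mapping.lookup \<alpha> w) =
      (\<Otimes>\<^bsub>L'\<^esub>w\<in>Poly_Mapping.keys \<alpha>. f ((der L ^^ snd w) (y (fst w)) [^]\<^bsub>L\<^esub> Poly_Mapping.lookup \<alpha> w))"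
      by (subst f.hom_finprod) (use wc a in \<open>auto simp: comp_def\<close>)
    also have "\<dots> = (\<Otimes>\<^bsub>L'\<^esub>w\<in>Poly_Mapping.keys \<alpha>. (der L' ^^ snd w) (f (y (fst w))) [^]\<^bsub>L'\<^esub> Poly_Mapping.lookup \<alpha> w)"
    proof (rule L'.finprod_cong')
      fix w assume w: "w \<in> Poly_Mapping.keys \<alpha>"
      note yc = p1[OF a w]
      show "f ((der L ^^ snd w) (y (fst w)) [^]\<^bsub>L\<^esub> Poly_Mapping.lookup \<alpha> w) = (der L' ^^ snd w) (f (y (fst w))) [^]\<^bsub>L'\<^esub> Poly_Mapping.lookup \<alpha> w"
        using it[OF yc] by (simp add: pw)
    next
      show "(\<lambda>w. (der L' ^^ snd w) (f (y (fst w))) [^]\<^bsub>L'\<^esub> Poly_Mapping.lookup \<alpha> w) \<in> Poly_Mapping.keys \<alpha> \<rightarrow> carrier L'"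
      proof
        fix w assume w: "w \<in> Poly_Mapping.keys \<alpha>"
        have "(der L' ^^ snd w) (f (y (fst w))) \<in> carrier L'" using it[OF p1[OF a w], of "snd w"] f.hom_closed by metis
        then show "(der L' ^^ snd w) (f (y (fst w))) [^]\<^bsub>L'\<^esub> Poly_Mapping.lookup \<alpha> w \<in> carrier L'" by simp
      qed
    qed simp
    finally show "f (h (p \<alpha>) \<otimes>\<^bsub>L\<^esub> (\<Otimes>\<^bsub>L\<^esub>w\<in>Poly_Mapping.keys \<alpha>. (der L ^^ snd w) (y (fst w)) [^]\<^bsub>L\<^esub> Poly_Mapping.lookup \<alpha> w)) =
      f (h (p \<alpha>)) \<otimes>\<^bsub>L'\<^esub> (\<Otimes>\<^bsub>L'\<^esub>w\<in>Poly_Mapping.keys \<alpha>. (der L' ^^ snd w) (f (y (fst w))) [^]\<^bsub>L'\<^esub> Poly_Mapping.lookup \<alpha> w)"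
      using mc[OF a] h[OF p0[of \<alpha>]] by simp
  next
    show "(\<lambda>\<alpha>. f (h (p \<alpha>)) \<otimes>\<^bsub>L'\<^esub> (\<Otimes>\<^bsub>L'\<^esub>w\<in>Poly_Mapping.keys \<alpha>. (der L' ^^ snd w) (f (y (fst w))) [^]\<^bsub>L'\<^esub> Poly_Mapping.lookup \<alpha> w)) \<in> ?S \<rightarrow> carrier L'"
    proof (intro Pi_I L'.m_closed f.hom_closed h p0 L'.finprod_closed)
      fix \<alpha> w assume a: "\<alpha> \<in> ?S" and w: "w \<in> Poly_Mapping.keys \<alpha>"
      have "(der L' ^^ snd w) (f (y (fst w))) \<in> carrier L'" using it[OF p1[OF a w], of "snd w"] f.hom_closed by metis
      then show "(der L' ^^ snd w) (f (y (fst w))) [^]\<^bsub>L'\<^esub> Poly_Mapping.lookup \<alpha> w \<in> carrier L'" by simp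
    qed
  qed simp
  finally show ?thesis .
qed

lemma dpolys_typed:
  "subring_set {p :: (nat \<times> nat, 'k::comm_ring_1) mpol. Poly_Mapping.lookup p \<in> dpolys (dring_on UNIV d) m}"
  "Poly_Mapping.lookup (mpol_const a :: (nat \<times> nat, 'k) mpol) \<in> dpolys (dring_on UNIV d) m"
  "v < m \<Longrightarrow> Poly_Mapping.lookup (mpol_var (v, k) :: (nat \<times> nat, 'k) mpol) \<in> dpolys (dring_on UNIV d) m"
proof -
  have eq: "Poly_Mapping.lookup p \<in> dpolys (dring_on UNIV d) m \<longleftrightarrow> (\<forall>\<alpha>\<in>Poly_Mapping.keys p. Poly_Mapping.keys \<alpha> \<subseteq> {..<m} \<times> UNIV)"
    for p :: "(nat \<times> nat, 'k) mpol"
  proof -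
    have "{\<alpha>. Poly_Mapping.lookup p \<alpha> \<noteq> 0} = Poly_Mapping.keys p" by (auto simp: in_keys_iff)
    then show ?thesis by (auto simp: dpolys_def in_keys_iff)
  qed
  have ks: "Poly_Mapping.keys (\<alpha> + \<beta>) \<subseteq> {..<m} \<times> UNIV" if "Poly_Mapping.keys \<alpha> \<subseteq> {..<m} \<times> UNIV" "Poly_Mapping.keys \<beta> \<subseteq> {..<m} \<times> UNIV"
    for \<alpha> \<beta> :: "nat \<times> nat \<Rightarrow>\<^sub>0 nat" using that Poly_Mapping.keys_add[of \<alpha> \<beta>] by blast
  show "Poly_Mapping.lookup (mpol_const a :: (nat \<times> nat, 'k) mpol) \<in> dpolys (dring_on UNIV d) m"
    unfolding eq by (auto simp: mpol_const_def)
  show "v < m \<Longrightarrow> Poly_Mapping.lookup (mpol_var (v, k) :: (nat \<times> nat, 'k) mpol) \<in> dpolys (dring_on UNIV d) m"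
    unfolding eq by (auto simp: mpol_var_def)
  show "subring_set {p :: (nat \<times> nat, 'k::comm_ring_1) mpol. Poly_Mapping.lookup p \<in> dpolys (dring_on UNIV d) m}"
    unfolding eq subring_set_def
  proof (intro conjI ballI)
    fix p q :: "(nat \<times> nat, 'k) mpol"
    assume p: "p \<in> {p. \<forall>\<alpha>\<in>Poly_Mapping.keys p. Poly_Mapping.keys \<alpha> \<subseteq> {..<m} \<times> UNIV}" and q: "q \<in> {p. \<forall>\<alpha>\<in>Poly_Mapping.keys p. Poly_Mapping.keys \<alpha> \<subseteq> {..<m} \<times> UNIV}"
    show "p - q \<in> {p. \<forall>\<alpha>\<in>Poly_Mapping.keys p. Poly_Mapping.keys \<alpha> \<subseteq> {..<m} \<times> UNIV}"
      using p q Poly_Mapping.keys_add[of p "- q"] by (simp add: subset_iff) blast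
    show "p * q \<in> {p. \<forall>\<alpha>\<in>Poly_Mapping.keys p. Poly_Mapping.keys \<alpha> \<subseteq> {..<m} \<times> UNIV}"
      using p q Poly_Mapping.keys_mult[of p q] ks by (simp add: subset_iff) blast
  qed simp
qed

text \<open>Adjoin independent variables \<open>Y\<close> to the field and extend the derivation by \<open>Y' = Y M\<close>: the fraction field
  contains a solution with nonzero determinant. The equations for the entries and the inequation for the
  determinant form a finite system, so closedness gives a solution in the field itself.\<close>
theorem linear_system_solvable:
  fixes M :: "'k::field ^ 'n::finite ^ 'n"
  assumes dc: "diff_closed (dring_on UNIV \<delta>)" and inf: "infinite (UNIV :: 'k set)"
  obtains P :: "'k ^ 'n ^ 'n" where "invertible P" "map_matrix \<delta> P = P ** M"
proof -
  have "diff_ring (dring_on UNIV \<delta>)" using dc by (simp add: diff_closed_def diff_field_def)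
  then interpret derivation \<delta> by unfold_locales (simp_all add: diff_ring_def)
  obtain e :: "'n \<times> 'n \<Rightarrow> nat" where "bij_betw e UNIV {0..<card (UNIV :: ('n \<times> 'n) set)}"
    using ex_bij_betw_finite_nat[of "UNIV :: ('n \<times> 'n) set"] by auto
  define N where "N = card (UNIV :: ('n \<times> 'n) set)"
  have e: "inj e" "e w < N" for w using \<open>bij_betw e _ _\<close> by (auto simp: bij_betw_def N_def)
  let ?var = "mpol_var :: nat \<Rightarrow> (nat, 'k) mpol"
  \<comment> \<open>The variable numbered \<open>e (i, l)\<close> is the entry \<open>(i, l)\<close> of \<open>Y\<close>, and \<open>dv\<close> encodes \<open>Y' = Y M\<close>.\<close>
  define dv where "dv v = (\<Sum>k\<in>UNIV. ?var (e (fst (inv_into UNIV e v), k)) * mpol_const (M $ k $ snd (inv_into UNIV e v)))" for v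
  define dm where "dm = mpol_deriv \<delta> dv"
  have dm: "derivation dm" unfolding dm_def by (rule mpol_derivation)
  define dF where "dF = fract_deriv dm"
  interpret dF: derivation dF unfolding dF_def by (rule fract_derivation[OF dm])
  interpret dm: derivation dm by (rule dm)
  define fr :: "(nat, 'k) mpol \<Rightarrow> (nat, 'k) mpol fract" where "fr p = Fract p 1" for p
  interpret fr: ring_map_on UNIV fr
    by unfold_locales (simp_all add: subring_set_UNIV fr_def One_fract_def)
  have dfr: "dF (fr p) = fr (dm p)" for p by (simp add: fr_def dF_def fract_deriv_Fract[OF dm] dm.one)
  interpret cc: ring_map_on UNIV "mpol_const :: 'k \<Rightarrow> (nat, 'k) mpol" by (rule mpol_const_map)
  let ?ci = "\<lambda>a. fr (mpol_const a)" and ?Y = "\<lambda>v. fr (?var v)"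
  interpret ci: ring_map_on UNIV ?ci
    by unfold_locales (simp_all add: subring_set_UNIV cc.add cc.mult cc.one fr.add fr.mult fr.one)
  let ?FF = "dring_on UNIV dF :: (nat, 'k) mpol fract dring" and ?M = "dring_on UNIV \<delta> :: 'k dring"
  have FF: "diff_ring ?FF" by (rule diff_ring_dring_on[OF subring_set_UNIV dF.derivation_axioms]) simp
  obtain j :: "(nat, 'k) mpol fract \<Rightarrow> 'k" where j: "inj j" using exists_fract_code[OF inf] by blast
  have j': "inj_on j (carrier ?FF)" using j by simp
  define L where "L = transport j ?FF"
  note tr = transport_simps[OF j', folded L_def, simplified]
  have Ld: "diff_ring L" unfolding L_def by (rule transport_diff_ring[OF j' FF])
  interpret L: cring L using Ld by (simp add: diff_ring_def)
  have "field L"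
  proof (rule L.cring_fieldI2)
    show "\<zero>\<^bsub>L\<^esub> \<noteq> \<one>\<^bsub>L\<^esub>" using j by (simp add: tr inj_eq)
    fix a assume "a \<in> carrier L" "a \<noteq> \<zero>\<^bsub>L\<^esub>"
    then obtain x where "a = j x" "x \<noteq> 0" by (auto simp: tr)
    then show "\<exists>b\<in>carrier L. a \<otimes>\<^bsub>L\<^esub> b = \<one>\<^bsub>L\<^esub>"
      by (intro bexI[of _ "j (inverse x)"]) (simp_all add: tr)
  qed
  then have Lf: "diff_field L" using Ld by (simp add: diff_field_def)
  have jh: "j \<in> ring_hom ?FF L" and jd: "j (dF x) = der L (j x)" for x
    using transport_inv_hom(2)[OF j' FF] by (simp_all add: L_def dring_hom_def)
  have hL: "(\<lambda>a. j (?ci a)) \<in> dring_hom ?M L"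
    unfolding dring_hom_def
    by (auto intro!: ring_hom_memI simp: tr ci.add[symmetric] ci.mult[symmetric] ci.one jd[symmetric] dfr dm_def mpol_deriv_const simp del: fr.add fr.mult)
  let ?v = "\<lambda>w. mpol_var w :: (nat \<times> nat, 'k) mpol"
  define eqn where "eqn i l = ?v (e (i, l), 1) - (\<Sum>k\<in>UNIV. ?v (e (i, k), 0) * mpol_const (M $ k $ l))" for i l
  define Q where "Q = det (\<chi> i l. ?v (e (i, l), 0))"
  note dp = dpolys_typed[where ?'k = 'k and d = \<delta> and m = N]
  have eqd: "Poly_Mapping.lookup (eqn i l) \<in> dpolys ?M N" for i l
  proof -
    have "eqn i l \<in> {p. Poly_Mapping.lookup p \<in> dpolys ?M N}"
      unfolding eqn_def by (intro subring_setD(3,4)[OF dp(1)] subring_set_sum[OF dp(1)]) (simp_all add: dp(2,3) e)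
    then show ?thesis by simp
  qed
  have Qd: "Poly_Mapping.lookup Q \<in> dpolys ?M N"
  proof -
    have "Q \<in> {p. Poly_Mapping.lookup p \<in> dpolys ?M N}"
      unfolding Q_def by (rule subring_set_det[OF dp(1)]) (simp add: dp(3) e)
    then show ?thesis by simp
  qed
  have ev: "mpol_subst h (\<lambda>w. (d ^^ snd w) (y (fst w))) (eqn i l) = d (y (e (i, l))) - (\<Sum>k\<in>UNIV. y (e (i, k)) * h (M $ k $ l))"
    "mpol_subst h (\<lambda>w. (d ^^ snd w) (y (fst w))) Q = det (\<chi> i l. y (e (i, l)))"
    if h: "ring_map_on UNIV h" for h :: "'k \<Rightarrow> 'x::comm_ring_1" and d y i l
  proof -
    interpret h: ring_map_on UNIV h by (rule h)
    let ?s = "mpol_subst h (\<lambda>w. (d ^^ snd w) (y (fst w)))"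
    interpret s: ring_map_on "mpols_over UNIV :: (nat \<times> nat, 'k) mpol set" ?s by (rule h.subst_map)
    have U: "p \<in> mpols_over UNIV" for p :: "(nat \<times> nat, 'k) mpol" by (simp add: mpols_over_def)
    show "?s (eqn i l) = d (y (e (i, l))) - (\<Sum>k\<in>UNIV. y (e (i, k)) * h (M $ k $ l))"
      unfolding eqn_def by (simp add: s.diff s.sum s.mult U h.subst_var h.subst_const)
    show "?s Q = det (\<chi> i l. y (e (i, l)))"
      unfolding Q_def by (subst s.det) (simp_all add: U map_matrix_def h.subst_var)
  qed
  have jev: "dpoly_eval ?M L (\<lambda>a. j (?ci a)) (\<lambda>v. j (?Y v)) (Poly_Mapping.lookup p) = j (mpol_subst ?ci (\<lambda>w. (dF ^^ snd w) (?Y (fst w))) p)"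
    if "Poly_Mapping.lookup p \<in> dpolys ?M N" for p
  proof -
    have t: "dpoly_eval ?M ?FF ?ci ?Y (Poly_Mapping.lookup p) = mpol_subst ?ci (\<lambda>w. (dF ^^ snd w) (?Y (fst w))) p"
      by (rule dpoly_eval_typed)
    show ?thesis unfolding t[symmetric]
      by (rule dpoly_eval_hom[OF FF L.is_cring jh _ _ that, symmetric]) (simp_all add: jd)
  qed
  have "j 0 = \<zero>\<^bsub>L\<^esub>" by (simp add: tr)
  have dYv: "dF (?Y (e (i, l))) - (\<Sum>k\<in>UNIV. ?Y (e (i, k)) * ?ci (M $ k $ l)) = 0" for i l
    by (simp add: dfr dm_def mpol_deriv_var dv_def e(1) fr.sum fr.mult)
  have Qn: "det (\<chi> i l. ?Y (e (i, l))) \<noteq> 0"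
  proof -
    let ?G = "(\<chi> i l. ?var (e (i, l))) :: (nat, 'k) mpol ^ 'n ^ 'n"
    interpret u: ring_map_on UNIV "\<lambda>a :: 'k. a" by unfold_locales (simp_all add: subring_set_UNIV)
    \<comment> \<open>Specializing \<open>Y\<close> to the identity matrix shows that its determinant is nonzero.\<close>
    let ?s = "mpol_subst (\<lambda>a :: 'k. a) (\<lambda>v. if fst (inv_into UNIV e v) = snd (inv_into UNIV e v) then 1 else 0)"
    interpret s: ring_map_on "mpols_over UNIV :: (nat, 'k) mpol set" ?s by (rule u.subst_map)
    have "map_matrix ?s ?G = mat 1" by (simp add: vec_eq_iff map_matrix_def u.subst_var e(1) mat_def)
    then have "?s (det ?G) = 1" by (subst s.det) (simp_all add: mpols_over_def)
    then have "det ?G \<noteq> 0" using s.zero by auto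
    then have "fr (det ?G) \<noteq> 0" by (simp add: fr_def Zero_fract_def eq_fract)
    moreover have "map_matrix fr ?G = (\<chi> i l. ?Y (e (i, l)))" by (simp add: vec_eq_iff map_matrix_def)
    ultimately show ?thesis using fr.det[of ?G] by simp
  qed
  let ?E = "(\<lambda>(i, l). Poly_Mapping.lookup (eqn i l)) ` UNIV"
  have sol: "\<exists>(L :: 'k dring) h y. diff_field L \<and> h \<in> dring_hom ?M L \<and> y \<in> {..<N} \<rightarrow> carrier L \<and>
      (\<forall>p\<in>?E. dpoly_eval ?M L h y p = \<zero>\<^bsub>L\<^esub>) \<and> dpoly_eval ?M L h y (Poly_Mapping.lookup Q) \<noteq> \<zero>\<^bsub>L\<^esub>"
  proof (intro exI conjI)
    show "diff_field L" by (rule Lf)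
    show "(\<lambda>a. j (?ci a)) \<in> dring_hom ?M L" by (rule hL)
    show "(\<lambda>v. j (?Y v)) \<in> {..<N} \<rightarrow> carrier L" by (simp add: tr)
    show "\<forall>p\<in>?E. dpoly_eval ?M L (\<lambda>a. j (?ci a)) (\<lambda>v. j (?Y v)) p = \<zero>\<^bsub>L\<^esub>"
      using ev(1)[OF ci.ring_map_on_axioms, of dF ?Y] by (auto simp: jev[OF eqd] dYv tr)
    show "dpoly_eval ?M L (\<lambda>a. j (?ci a)) (\<lambda>v. j (?Y v)) (Poly_Mapping.lookup Q) \<noteq> \<zero>\<^bsub>L\<^esub>"
      using ev(2)[OF ci.ring_map_on_axioms, of dF ?Y] Qn j by (simp add: jev[OF Qd] tr inj_eq)
  qed
  have Ed: "finite ?E" "?E \<subseteq> dpolys ?M N" using eqd by auto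
  obtain y where y: "\<forall>p\<in>?E. dpoly_eval ?M ?M id y p = \<zero>\<^bsub>?M\<^esub>" "dpoly_eval ?M ?M id y (Poly_Mapping.lookup Q) \<noteq> \<zero>\<^bsub>?M\<^esub>"
    using dc[unfolded diff_closed_def, THEN conjunct2, rule_format, OF Ed Qd sol] by blast
  have idm: "ring_map_on UNIV (id :: 'k \<Rightarrow> 'k)" by unfold_locales (simp_all add: subring_set_UNIV)
  let ?P = "(\<chi> i l. y (e (i, l))) :: 'k ^ 'n ^ 'n"
  have "\<delta> (y (e (i, l))) = (\<Sum>k\<in>UNIV. y (e (i, k)) * M $ k $ l)" for i l
  proof -
    have "dpoly_eval ?M ?M id y (Poly_Mapping.lookup (eqn i l)) = \<zero>\<^bsub>?M\<^esub>"
      by (rule bspec[OF y(1)]) (rule range_eqI[of _ _ "(i, l)"], simp)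
    then show ?thesis unfolding dpoly_eval_typed ev(1)[OF idm, of \<delta> y] by simp
  qed
  then have "map_matrix \<delta> ?P = ?P ** M" by (simp add: vec_eq_iff map_matrix_def matrix_matrix_mult_def)
  moreover have "invertible ?P" using y(2) unfolding dpoly_eval_typed ev(2)[OF idm, of \<delta> y] by (simp add: invertible_det_nz)
  ultimately show ?thesis by (rule that[rotated])
qed

section \<open>Constant groups and integrable systems\<close>

theorem corollary1p26:
  fixes \<sigma> \<delta> :: "'f::field_char_0 \<Rightarrow> 'f"
    and n :: nat and x :: "nat \<Rightarrow> 'f"
    and \<delta>' :: "'k::field \<Rightarrow> 'k" and \<iota> :: "'f \<Rightarrow> 'k"
    and A :: "'f ^ 'n::finite ^ 'n"
    and I :: "nat \<Rightarrow> ('f, 'n) gl_pol set set"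
    and J :: "('f, 'n) gl_pol set set"
  assumes "bij \<sigma>"
    and "\<And>a b. \<sigma> (a + b) = \<sigma> a + \<sigma> b"
    and "\<And>a b. \<sigma> (a * b) = \<sigma> a * \<sigma> b"
    and "\<And>a b. \<delta> (a + b) = \<delta> a + \<delta> b"
    and "\<And>a b. \<delta> (a * b) = \<delta> a * b + a * \<delta> b"
    and "\<And>a. \<sigma> (\<delta> a) = \<delta> (\<sigma> a)"
    and "algebraically_closed (dring_on (fixed_field \<sigma>) \<delta>)"
    and "algebraically_independent_over (fixed_field \<sigma>) n x"
    and "adjoin (fixed_field \<sigma>) (x ` {..<n}) = UNIV"
    and "\<And>i. i < n \<Longrightarrow> \<sigma> ` adjoin (fixed_field \<sigma>) {x i} = adjoin (fixed_field \<sigma>) {x i}"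
    and "diff_closure (dring_on (fixed_field \<sigma>) \<delta>) \<iota> (dring_on UNIV \<delta>')"
    and "invertible A"
    and "pv_ideals \<sigma> \<delta> A I"
    and "galois_group_ideal \<sigma> \<delta> A I J"
  shows "(\<exists>P :: 'k ^ 'n ^ 'n. invertible P \<and>
            constant_dgroup \<delta>' (conj_ideal \<delta>' P (extend_scalars \<delta>' \<iota> J))) \<longleftrightarrow>
         (\<exists>B :: 'f ^ 'n ^ 'n.
            map_matrix \<sigma> B = A ** B ** matrix_inv A + map_matrix \<delta> A ** matrix_inv A)"
proof -
  have "\<sigma> 1 = 1"
  proof -
    have "\<sigma> 0 = 0" using assms(2)[of 0 0] by simp
    then have "\<sigma> 1 \<noteq> 0" using bij_is_inj[OF assms(1)] by (metis injD zero_neq_one)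
    then show ?thesis using assms(3)[of 1 1] by simp
  qed
  then have s: "ring_map \<sigma>" by unfold_locales (simp_all add: assms(2,3))
  have d: "derivation \<delta>" by unfold_locales (simp_all add: assms(4,5))
  have "sd_field \<sigma> \<delta> A"
    by (intro sd_field.intro sd_field_axioms.intro d s) (use assms(6,12) invertible_det_nz[of A] in auto)
  then interpret pv_data \<sigma> \<delta> A I
    by (intro pv_data.intro pv_data_axioms.intro assms(7,13))
  have dc: "diff_closed (dring_on UNIV \<delta>')" and hom: "\<iota> \<in> dring_hom (dring_on K \<delta>) (dring_on UNIV \<delta>')"
    using assms(11) by (auto simp: diff_closure_def)
  have "diff_ring (dring_on UNIV \<delta>')" using dc by (simp add: diff_closed_def diff_field_def)
  then interpret d': derivation \<delta>' by unfold_locales (simp_all add: diff_ring_def)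
  have hom': "\<iota> \<in> ring_hom (dring_on K \<delta>) (dring_on UNIV \<delta>')" using hom by (simp add: dring_hom_def)
  interpret i: ring_map_on K \<iota>
    using ring_hom_memE[OF hom'] Kg.C by unfold_locales auto
  interpret E: scalar_extension \<delta> K \<delta>' \<iota> J
    by (intro scalar_extension.intro scalar_extension_axioms.intro K_gl d'.derivation_axioms i.ring_map_on_axioms)
      (use assms(14) in \<open>simp add: galois_group_ideal_def Let_def\<close>)
  have inv: "matrix_inv A ** A = mat 1" "A ** matrix_inv A = mat 1"
    using matrix_inv_invertible[OF assms(12)] by auto
  have integrable_iff: "map_matrix \<sigma> B = A ** B ** matrix_inv A + map_matrix \<delta> A ** matrix_inv A \<longleftrightarrow>
      map_matrix \<sigma> B ** A = map_matrix \<delta> A + A ** B" for B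
  proof
    assume "map_matrix \<sigma> B = A ** B ** matrix_inv A + map_matrix \<delta> A ** matrix_inv A"
    then show "map_matrix \<sigma> B ** A = map_matrix \<delta> A + A ** B"
      by (simp add: mm_distribs inv add.commute flip: matrix_mul_assoc)
  next
    assume "map_matrix \<sigma> B ** A = map_matrix \<delta> A + A ** B"
    then have "map_matrix \<sigma> B ** A ** matrix_inv A = A ** B ** matrix_inv A + map_matrix \<delta> A ** matrix_inv A"
      by (simp add: mm_distribs add.commute)
    then show "map_matrix \<sigma> B = A ** B ** matrix_inv A + map_matrix \<delta> A ** matrix_inv A"
      by (simp add: inv flip: matrix_mul_assoc)
  qed
  have Jt: "Kq p \<in> J" if "p \<in> E.Jt" for p using that by (simp add: E.Jt_def Kq_def)
  show ?thesis unfolding integrable_iff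
  proof
    assume "\<exists>P :: 'k ^ 'n ^ 'n. invertible P \<and> constant_dgroup \<delta>' (conj_ideal \<delta>' P (extend_scalars \<delta>' \<iota> J))"
    then obtain P where P: "invertible P" "constant_dgroup \<delta>' (conj_ideal \<delta>' P (extend_scalars \<delta>' \<iota> J))" by blast
    \<comment> \<open>A \<open>K\<close>-linear retraction of the differential closure onto \<open>K\<close>.\<close>
    obtain l where l: "\<And>y z. l (y + z) = l y + l z" "\<And>y. l y \<in> K" "\<And>a y. a \<in> K \<Longrightarrow> l (\<iota> a * y) = a * l y" "l 1 = (1 :: 'f)"
      by (rule exists_functional[OF K_closed(1-6), where act = "\<lambda>a y. \<iota> a * y" and W = "{0}" and v = "1 :: 'k"])
        (auto simp: i.add i.mult i.one distrib_left distrib_right mult.assoc)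
    have "\<And>i j. gauge_rel \<delta>' (matrix_inv P ** map_matrix \<delta>' P) $ i $ j \<in> E.E"
      using P(2) unfolding E.conj_constant_iff[OF P(1)] by blast
    then have J': "Kq (gauge_rel \<delta> (map_matrix l (matrix_inv P ** map_matrix \<delta>' P)) $ i $ j) \<in> J" for i j
      by (intro Jt E.descend[OF l])
    have K': "map_matrix l (matrix_inv P ** map_matrix \<delta>' P) $ i $ j \<in> K" for i j by (simp add: map_matrix_def l(2))
    show "\<exists>B. map_matrix \<sigma> B ** A = map_matrix \<delta> A + A ** B"
      by (rule integrable_if_gauge_constant[OF assms(14) K' J']) (rule exI)
  next
    assume "\<exists>B. map_matrix \<sigma> B ** A = map_matrix \<delta> A + A ** B"
    then obtain B where B: "map_matrix \<sigma> B ** A = map_matrix \<delta> A + A ** B" by blast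
    obtain C where C: "\<And>i j. C $ i $ j \<in> K" "\<And>i j. Kq (gauge_rel \<delta> C $ i $ j) \<in> J"
      using gauge_constant_if_integrable[OF assms(14) B] by blast
    have "gauge_rel \<delta> C $ i $ j \<in> E.Jt" for i j
      using C gauge_rel_closed[OF K_gl C(1)] by (simp add: E.Jt_def Kq_def)
    then have CE: "gauge_rel \<delta>' (map_matrix \<iota> C) $ i $ j \<in> E.E" for i j by (rule E.ascend[OF C(1)])
    have "inj_on \<iota> K"
    proof (rule inj_onI)
      fix a b assume ab: "a \<in> K" "b \<in> K" "\<iota> a = \<iota> b"
      then have d: "a - b \<in> K" "\<iota> (a - b) = 0" using i.diff subring_setD(3)[OF Kg.C] by auto
      then have "\<iota> ((a - b) * inverse (a - b)) = 0" using K_closed(6) i.mult by simp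
      then show "a = b" using i.one by (cases "a - b = 0") auto
    qed
    then have inf: "infinite (UNIV :: 'k set)" using infinite_K by (meson finite_imageD finite_subset subset_UNIV)
    obtain P :: "'k ^ 'n ^ 'n" where P: "invertible P" "map_matrix \<delta>' P = P ** map_matrix \<iota> C"
      by (rule linear_system_solvable[OF dc inf])
    have "matrix_inv P ** map_matrix \<delta>' P = map_matrix \<iota> C"
      unfolding P(2) by (simp add: matrix_mul_assoc matrix_inv_invertible[OF P(1)])
    then show "\<exists>P :: 'k ^ 'n ^ 'n. invertible P \<and> constant_dgroup \<delta>' (conj_ideal \<delta>' P (extend_scalars \<delta>' \<iota> J))"
      using E.conj_constant_iff[OF P(1)] CE P(1) by auto
  qed
qed

end
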